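(* Consider the linear network model with latent agents, observed through the data $\{(p_O^{(t)},y_O^{(t)})\}_{t\in[n]}$, and suppose that the design is regular with respect to $(s_n,r_{1n})$ (in particular $H^{-1}$ admits an $(s_n,r_{1n})$-sparse approximation). Let $(\hat v,\hat W)$, $\hat\Psi$, $(\check v,\check W)$, $\check W^\mu$ and $\lambda$ be as defined in the context. (a) With probability at least $1-o(1)$ the debiased estimator satisfies $$\max_{k,j\in V_O}|(\check W-H^{-1})_{kj}|\le C_1\sqrt{\frac{\log|V_O|}{n}}\quad\text{and}\quad\max_{k\in V_O}|\check v_k-v_k|\le C_1\sqrt{\frac{\log|V_O|}{n}}$$ for some constant $C_1>0$. (b) Suppose moreover that $r_{1n}=o(1/\log n)$, and choose the thresholds $$\mu_{kj}=2\Big(1+\frac1{\log n}\Big)\hat\sigma_{kj}\lambda,\qquad \hat\sigma_{kj}^2=\frac1n\sum_{t=1}^n\big\{\hat\Psi_{j,\cdot}(1;p_O^{(t)})\,\big(y_k^{(t)}-(\hat v_k-\hat W_{k,\cdot}p_O^{(t)})\big)\big\}^2,\quad k,j\in V_O .$$ Then with probability at least $1-o(1)$, $$C_2\sqrt{\log|V_O|/n}\ \ge\ \mu_{kj}\ \ge\ 2|(\check W-H^{-1})_{kj}|\quad\text{simultaneously over }k,j\in V_O,$$ for some constant $C_2>0$. (c) Under the conditions of (b), with probability $1-o(1)$ the thresholded estimator based on these thresholds satisfies $$\max_{k,j\in V_O}|(\check W^\mu-H^{-1})_{kj}|\le C_3\sqrt{\frac{\log|V_O|}{n}},$$ $$\|\check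 W^\mu-H^{-1}\|_\infty\le s_nC_3\sqrt{\frac{\log|V_O|}{n}}+3r_{1n}\quad\text{and}\quad\|\check W^\mu-H^{-1}\|_1\le s_nC_3\sqrt{\frac{\log|V_O|}{n}}+3r_{1n}$$ for some constant $C_3>0$.
   Context: **Asymptotics.** $n$ is the number of periods, $[n]=\{1,\dots,n\}$; limits are as $n\to\infty$. The network, its sizes, all model parameters, the data distribution, $s_n,r_{1n},M_\varepsilon,M_\Psi$ may depend on $n$. A "constant" is a number not depending on $n$ or on the network sizes. **Model.** $V=V_O\sqcup V_L$ is a finite set of agents (observable and latent), $G\in\mathbb R^{V\times V}$ the weights, $\Lambda=\mathrm{diag}(\lambda_i)_{i\in V}$, $M=\Lambda-G$. Outcomes in period $t$ are $y^{(t)}=M^{-1}(a+\xi^{(t)}-p^{(t)})$, with intercepts $a\in\mathbb R^V$, covariates $p^{(t)}\in\mathbb R^V$ and zero-mean shocks $\xi^{(t)}$, independent over $t$ (possibly correlated across agents). Latent covariates are fixed: $p^{(t)}_i=p_0$ for $i\in V_L$. Subscripts $O,L$ denote sub-vectors/blocks for $V_O,V_L$. Put $S_{OL}=M_{OL}M_{LL}^{-1}$, $H=M_{OO}-M_{OL}M_{LL}^{-1}M_{LO}$, $v_O=H^{-1}a_O-H^{-1}S_{OL}(a_L-p_L)$, $\varepsilon_O^{(t)}=H^{-1}\xi_O^{(t)}-H^{-1}S_{OL}\xi_L^{(t)}$, so that $$y_O^{(t)}=v_O-H^{-1}p_O^{(t)}+\varepsilon_O^{(t)}.\qquad( * )$$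 Standing assumptions: $M,M_{LL},H$ are invertible; $\|M^{-1}\|_1$ and $\|M^{-1}\|_\infty$ are bounded by a constant; $|a_i|\le\bar a$, $|\lambda_i|\le\bar\lambda$, $|p_i^{(t)}|\le\bar p$ for all $i,t$ with constants $\bar a,\bar\lambda,\bar p$. Only $\{(p_O^{(t)},y_O^{(t)})\}$ is observed. **Norms and indices.** $\|A\|_1,\|A\|_\infty$ are the maximum absolute column and row sums; $A_{k,\cdot}$ and $A_{\cdot,k}$ the $k$th row and column. $\bar V_O=\{0\}\cup V_O$; $(1;p_O^{(t)})\in\mathbb R^{\bar V_O}$ has $0$th entry $1$ and $j$th entry $p_j^{(t)}$. $\mathbf 1_{kj}=1$ if $k=j$, else $0$. $\Phi$ is the standard normal CDF. **Sparse approximation.** A matrix is $s$-sparse if each row and each column has at most $s$ nonzero entries. $H^{-1}$ admits an $(s,r_1)$-sparse approximation if there is an $s$-sparse $\bar W$ with $\max\{\|H^{-1}-\bar W\|_1,\|H^{-1}-\bar W\|_\infty\}\le r_1$. **Regular design.** The design is regular with respect to $(s_n,r_{1n})$ if $H^{-1}$ admits an $(s_n,r_{1n})$-sparse approximation and, for constants $0<c<C$, $C'>0$ and parameters $M_\varepsilon,M_\Psi\ge1$: 1. the data $(p_O^{(t)},y_O^{(t)})$, $t\in[n]$, are i.i.d. and satisfy $( * )$, and $E[\varepsilon_O^{(t)}\mid p_O^{(t)}]=0$; 2. for all $t$: $\min_{j\in V_O}E[(\varepsilon_j^{(t)})^2\mid p_O^{(t)}]\ge c$, $\max_{j\in V_O}E[|\varepsilon_j^{(t)}|^4\mid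 p_O^{(t)}]\le C$, and $E[\max_{t\in[n],j\in V_O}|\varepsilon_j^{(t)}|^4\mid\{p_O^{(t)}\}]\le M_\varepsilon$; 3. $\bar\Psi:=E[(1;p_O^{(t)})(1;p_O^{(t)})^T]^{-1}$ satisfies $\min_{k,j\in\bar V_O}E[\{\bar\Psi_{k,\cdot}(1;p_O^{(t)})(1;p_O^{(t)})_j-\mathbf 1_{kj}\}^2]\ge c$, $\max_{k,j\in\bar V_O}E[|\bar\Psi_{k,\cdot}(1;p_O^{(t)})(1;p_O^{(t)})_j|^4]\le C$, $E[\max_{t\in[n];j,k\in\bar V_O}|\bar\Psi_{k,\cdot}(1;p_O^{(t)})(1;p_O^{(t)})_j|^4]\le M_\Psi$, and the eigenvalues of $\bar\Psi$ are bounded above by a constant; 4. $s_n^2(\log|V_O|)(\log n)^3=o(n)$, $M_\varepsilon M_\Psi\log|V_O|=o(n)$, $C'\log|V_O|\ge\log n$. **Estimators.** Put $M_n^2=1\vee\max_{k\in V_O}\frac1n\sum_t(p_k^{(t)})^4$, $\tau=\frac1{4M_n}$, $\lambda=\frac1{\sqrt n}\Phi^{-1}\big(1-\frac1{3n|V_O|^2}\big)$, $\hat\Sigma=\frac1n\sum_t(1;p_O^{(t)})(1;p_O^{(t)})^T$. Step 1: $(\hat W,\hat v,\hat z)$ minimizes $\sum_{k\in V_O}\big(\|(\tilde v_k,\tilde W_{k,\cdot})\|_1+\tau z_k\big)$ over $(\tilde W,\tilde v,z)$ subject to, for all $k\in V_O$, $j\in\bar V_O$: $\big|\frac1n\sum_t\{y_k^{(t)}-(\tilde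 v_k-\tilde W_{k,\cdot}p_O^{(t)})\}(1;p_O^{(t)})_j\big|\le\lambda z_k$ and $\big\{\frac1n\sum_t\{y_k^{(t)}-(\tilde v_k-\tilde W_{k,\cdot}p_O^{(t)})\}^2(1;p_O^{(t)})_j^2\big\}^{1/2}\le z_k$. Step 2: $\hat\Psi\in\mathbb R^{\bar V_O\times\bar V_O}$ is the $\Psi$-part of a minimizer of $\sum_{k\in\bar V_O}\big\{\big(\frac1n\sum_t|\Psi_{k,\cdot}(1;p_O^{(t)})|^4\big)^{1/4}+z_k\big\}$ over $(z,\Psi)$ subject to, for all $k,j\in\bar V_O$: $|\Psi_{k,\cdot}\hat\Sigma_{\cdot,j}-\mathbf 1_{kj}|\le\lambda z_k$ and $\big\{\frac1n\sum_t\{\Psi_{k,\cdot}(1;p_O^{(t)})(1;p_O^{(t)})_j-\mathbf 1_{kj}\}^2\big\}^{1/2}\le z_k$. Step 3 (debiased estimator): $(-\check v^T;\check W^T)=(-\hat v^T;\hat W^T)-\hat\Psi\big\{\frac1n\sum_t(1;p_O^{(t)})\{y_O^{(t)}-(\hat v-\hat Wp_O^{(t)})\}^T\big\}$. Step 4 (thresholded estimator, for thresholds $\mu_{kj}$): $\check W^\mu_{kj}=\check W_{kj}\,1\{|\check W_{kj}|>\mu_{kj}\}$, $k,j\in V_O$. *)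

theory Defs
  imports "HOL-Probability.Probability" "HOL-Library.Landau_Symbols"
begin

text \<open>
  Index sets vary with the number of periods, so vectors and matrices are functions used only on
  explicit finite index sets.
\<close>

definition delta :: "'i \<Rightarrow> 'i \<Rightarrow> real" where
  "delta i j = (if i = j then 1 else 0)"

definition mat_mult :: "'i set \<Rightarrow> ('i \<Rightarrow> 'i \<Rightarrow> real) \<Rightarrow> ('i \<Rightarrow> 'i \<Rightarrow> real) \<Rightarrow> 'i \<Rightarrow> 'i \<Rightarrow> real" where
  "mat_mult K A B i j = (\<Sum>k\<in>K. A i k * B k j)"

definition is_inverse_on :: "'i set \<Rightarrow> ('i \<Rightarrow> 'i \<Rightarrow> real) \<Rightarrow> ('i \<Rightarrow> 'i \<Rightarrow> real) \<Rightarrow> bool" where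
  "is_inverse_on K A B \<longleftrightarrow>
     (\<forall>i\<in>K. \<forall>j\<in>K. mat_mult K A B i j = delta i j \<and> mat_mult K B A i j = delta i j)"

definition invertible_on :: "'i set \<Rightarrow> ('i \<Rightarrow> 'i \<Rightarrow> real) \<Rightarrow> bool" where
  "invertible_on K A \<longleftrightarrow> (\<exists>B. is_inverse_on K A B)"

text \<open>For an invertible \<open>A\<close>, the entries of \<open>mat_inv K A\<close> indexed by \<open>K\<close> are uniquely determined;
  the others are never used.\<close>
definition mat_inv :: "'i set \<Rightarrow> ('i \<Rightarrow> 'i \<Rightarrow> real) \<Rightarrow> 'i \<Rightarrow> 'i \<Rightarrow> real" where
  "mat_inv K A = (SOME B. is_inverse_on K A B)"

definition norm_one :: "'i set \<Rightarrow> ('i \<Rightarrow> 'i \<Rightarrow> real) \<Rightarrow> real" where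
  "norm_one K A = (MAX j\<in>K. \<Sum>i\<in>K. \<bar>A i j\<bar>)"

definition norm_inf :: "'i set \<Rightarrow> ('i \<Rightarrow> 'i \<Rightarrow> real) \<Rightarrow> real" where
  "norm_inf K A = (MAX i\<in>K. \<Sum>j\<in>K. \<bar>A i j\<bar>)"

definition eigenvalue_on :: "'i set \<Rightarrow> ('i \<Rightarrow> 'i \<Rightarrow> real) \<Rightarrow> real \<Rightarrow> bool" where
  "eigenvalue_on K A e \<longleftrightarrow>
     (\<exists>x. (\<exists>i\<in>K. x i \<noteq> 0) \<and> (\<forall>i\<in>K. (\<Sum>j\<in>K. A i j * x j) = e * x i))"

definition sparse_on :: "'i set \<Rightarrow> nat \<Rightarrow> ('i \<Rightarrow> 'i \<Rightarrow> real) \<Rightarrow> bool" where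
  "sparse_on K s A \<longleftrightarrow>
     (\<forall>i\<in>K. card {j\<in>K. A i j \<noteq> 0} \<le> s) \<and> (\<forall>j\<in>K. card {i\<in>K. A i j \<noteq> 0} \<le> s)"

definition sparse_approx_on :: "'i set \<Rightarrow> nat \<Rightarrow> real \<Rightarrow> ('i \<Rightarrow> 'i \<Rightarrow> real) \<Rightarrow> bool" where
  "sparse_approx_on K s r A \<longleftrightarrow>
     (\<exists>W. sparse_on K s W \<and>
          max (norm_one K (\<lambda>i j. A i j - W i j)) (norm_inf K (\<lambda>i j. A i j - W i j)) \<le> r)"

text \<open>The index set \<open>{0} \<union> V\<^sub>O\<close> is rendered with \<open>None\<close> for the index 0; \<open>aug p\<close> is \<open>(1; p)\<close>.\<close>

definition aug_set :: "'a set \<Rightarrow> 'a option set" where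
  "aug_set V = insert None (Some ` V)"

definition aug :: "('a \<Rightarrow> real) \<Rightarrow> 'a option \<Rightarrow> real" where
  "aug p k = (case k of None \<Rightarrow> 1 | Some j \<Rightarrow> p j)"


section \<open>The linear network model with latent agents\<close>

text \<open>\<open>weight\<close> is \<open>G\<close>, \<open>slope\<close> the diagonal of \<open>\<Lambda>\<close>, \<open>icpt\<close> is \<open>a\<close>, \<open>lat_cov\<close> is \<open>p\<^sub>0\<close>; \<open>cov t\<close> and
  \<open>shock t\<close> are the random vectors \<open>p\<close> and \<open>\<xi>\<close> of period \<open>t\<close>.\<close>
record ('a, 'w) network =
  obs :: "'a set"
  lat :: "'a set"
  weight :: "'a \<Rightarrow> 'a \<Rightarrow> real"
  slope :: "'a \<Rightarrow> real"
  icpt :: "'a \<Rightarrow> real"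
  lat_cov :: real
  sample :: "'w measure"
  cov :: "nat \<Rightarrow> 'w \<Rightarrow> 'a \<Rightarrow> real"
  shock :: "nat \<Rightarrow> 'w \<Rightarrow> 'a \<Rightarrow> real"

definition agents :: "('a, 'w) network \<Rightarrow> 'a set" where
  "agents N = obs N \<union> lat N"

definition netM :: "('a, 'w) network \<Rightarrow> 'a \<Rightarrow> 'a \<Rightarrow> real" where
  "netM N i j = (if i = j then slope N i else 0) - weight N i j"

definition netMinv :: "('a, 'w) network \<Rightarrow> 'a \<Rightarrow> 'a \<Rightarrow> real" where
  "netMinv N = mat_inv (agents N) (netM N)"

definition outcome :: "('a, 'w) network \<Rightarrow> nat \<Rightarrow> 'w \<Rightarrow> 'a \<Rightarrow> real" where
  "outcome N t \<omega> i = (\<Sum>j\<in>agents N. netMinv N i j * (icpt N j + shock N t \<omega> j - cov N t \<omega> j))"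

definition netS :: "('a, 'w) network \<Rightarrow> 'a \<Rightarrow> 'a \<Rightarrow> real" where
  "netS N = mat_mult (lat N) (netM N) (mat_inv (lat N) (netM N))"

definition netH :: "('a, 'w) network \<Rightarrow> 'a \<Rightarrow> 'a \<Rightarrow> real" where
  "netH N i j = netM N i j - mat_mult (lat N) (netS N) (netM N) i j"

definition netHinv :: "('a, 'w) network \<Rightarrow> 'a \<Rightarrow> 'a \<Rightarrow> real" where
  "netHinv N = mat_inv (obs N) (netH N)"

definition red_v :: "('a, 'w) network \<Rightarrow> 'a \<Rightarrow> real" where
  "red_v N k =
     (\<Sum>j\<in>obs N. netHinv N k j * icpt N j)
     - (\<Sum>j\<in>obs N. netHinv N k j * (\<Sum>l\<in>lat N. netS N j l * (icpt N l - lat_cov N)))"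

definition red_eps :: "('a, 'w) network \<Rightarrow> nat \<Rightarrow> 'w \<Rightarrow> 'a \<Rightarrow> real" where
  "red_eps N t \<omega> k =
     (\<Sum>j\<in>obs N. netHinv N k j * shock N t \<omega> j)
     - (\<Sum>j\<in>obs N. netHinv N k j * (\<Sum>l\<in>lat N. netS N j l * shock N t \<omega> l))"

definition standing_assms ::
  "real \<Rightarrow> real \<Rightarrow> real \<Rightarrow> real \<Rightarrow> nat \<Rightarrow> ('a, 'w) network \<Rightarrow> bool" where
  "standing_assms B abar lbar pbar n N \<longleftrightarrow>
     finite (obs N) \<and> finite (lat N) \<and> obs N \<noteq> {} \<and> obs N \<inter> lat N = {} \<and>
     invertible_on (agents N) (netM N) \<and> invertible_on (lat N) (netM N) \<and>
     invertible_on (obs N) (netH N) \<and>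
     norm_one (agents N) (netMinv N) \<le> B \<and> norm_inf (agents N) (netMinv N) \<le> B \<and>
     (\<forall>i\<in>agents N. \<bar>icpt N i\<bar> \<le> abar \<and> \<bar>slope N i\<bar> \<le> lbar) \<and>
     prob_space (sample N) \<and>
     (\<forall>t\<in>{1..n}. \<forall>i\<in>agents N.
        (\<lambda>\<omega>. cov N t \<omega> i) \<in> borel_measurable (sample N) \<and>
        (AE \<omega> in sample N. \<bar>cov N t \<omega> i\<bar> \<le> pbar)) \<and>
     (\<forall>t\<in>{1..n}. \<forall>i\<in>lat N. \<forall>\<omega>\<in>space (sample N). cov N t \<omega> i = lat_cov N) \<and>
     (\<forall>t\<in>{1..n}. \<forall>i\<in>agents N.
        integrable (sample N) (\<lambda>\<omega>. shock N t \<omega> i) \<and>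
        integral\<^sup>L (sample N) (\<lambda>\<omega>. shock N t \<omega> i) = 0) \<and>
     prob_space.indep_vars (sample N) (\<lambda>_. PiM (agents N) (\<lambda>_. borel))
       (\<lambda>t \<omega>. restrict (shock N t \<omega>) (agents N)) {1..n}"


section \<open>Regular designs\<close>

definition obs_cov :: "('a, 'w) network \<Rightarrow> nat \<Rightarrow> 'w \<Rightarrow> 'a \<Rightarrow> real" where
  "obs_cov N t \<omega> = restrict (cov N t \<omega>) (obs N)"

definition obs_data :: "('a, 'w) network \<Rightarrow> nat \<Rightarrow> 'w \<Rightarrow> ('a \<Rightarrow> real) \<times> ('a \<Rightarrow> real)" where
  "obs_data N t \<omega> = (restrict (cov N t \<omega>) (obs N), restrict (outcome N t \<omega>) (obs N))"

definition data_space :: "('a, 'w) network \<Rightarrow> (('a \<Rightarrow> real) \<times> ('a \<Rightarrow> real)) measure" where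
  "data_space N = PiM (obs N) (\<lambda>_. borel) \<Otimes>\<^sub>M PiM (obs N) (\<lambda>_. borel)"

text \<open>The sigma-algebras generated by the observed covariates of period \<open>t\<close>, and of all periods.\<close>

definition sigma_cov :: "('a, 'w) network \<Rightarrow> nat \<Rightarrow> 'w measure" where
  "sigma_cov N t = vimage_algebra (space (sample N)) (obs_cov N t) (PiM (obs N) (\<lambda>_. borel))"

definition sigma_cov_all :: "nat \<Rightarrow> ('a, 'w) network \<Rightarrow> 'w measure" where
  "sigma_cov_all n N =
     vimage_algebra (space (sample N)) (\<lambda>\<omega>. \<lambda>t\<in>{1..n}. obs_cov N t \<omega>)
       (PiM {1..n} (\<lambda>_. PiM (obs N) (\<lambda>_. borel)))"

text \<open>\<open>\<Psi>\<close>-bar is computed from period 1: in a regular design all periods have the same law.\<close>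

definition gram :: "('a, 'w) network \<Rightarrow> 'a option \<Rightarrow> 'a option \<Rightarrow> real" where
  "gram N k j = integral\<^sup>L (sample N) (\<lambda>\<omega>. aug (cov N 1 \<omega>) k * aug (cov N 1 \<omega>) j)"

definition Psi_bar :: "('a, 'w) network \<Rightarrow> 'a option \<Rightarrow> 'a option \<Rightarrow> real" where
  "Psi_bar N = mat_inv (aug_set (obs N)) (gram N)"

definition row_aug :: "'a set \<Rightarrow> ('a option \<Rightarrow> 'a option \<Rightarrow> real) \<Rightarrow> 'a option \<Rightarrow> ('a \<Rightarrow> real) \<Rightarrow> real" where
  "row_aug V Psi k p = (\<Sum>l\<in>aug_set V. Psi k l * aug p l)"

definition regular_data :: "nat \<Rightarrow> ('a, 'w) network \<Rightarrow> bool" where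
  "regular_data n N \<longleftrightarrow>
     prob_space.indep_vars (sample N) (\<lambda>_. data_space N) (obs_data N) {1..n} \<and>
     (\<forall>t\<in>{1..n}. distr (sample N) (data_space N) (obs_data N t)
               = distr (sample N) (data_space N) (obs_data N 1)) \<and>
     (\<forall>t\<in>{1..n}. \<forall>\<omega>\<in>space (sample N). \<forall>k\<in>obs N.
        outcome N t \<omega> k =
          red_v N k - (\<Sum>j\<in>obs N. netHinv N k j * cov N t \<omega> j) + red_eps N t \<omega> k) \<and>
     (\<forall>t\<in>{1..n}. \<forall>k\<in>obs N. AE \<omega> in sample N.
        real_cond_exp (sample N) (sigma_cov N t) (\<lambda>\<omega>. red_eps N t \<omega> k) \<omega> = 0)"

text \<open>Integrability of the fourth powers is stated because \<open>real_cond_exp\<close> is meaningful only for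
  integrable arguments; it is implied by the bound on the fourth conditional moments.\<close>
definition regular_noise :: "real \<Rightarrow> real \<Rightarrow> real \<Rightarrow> nat \<Rightarrow> ('a, 'w) network \<Rightarrow> bool" where
  "regular_noise c C Meps n N \<longleftrightarrow>
     (\<forall>t\<in>{1..n}. \<forall>j\<in>obs N. integrable (sample N) (\<lambda>\<omega>. \<bar>red_eps N t \<omega> j\<bar> ^ 4)) \<and>
     (\<forall>t\<in>{1..n}. AE \<omega> in sample N.
        (MIN j\<in>obs N. real_cond_exp (sample N) (sigma_cov N t) (\<lambda>\<omega>. (red_eps N t \<omega> j)\<^sup>2) \<omega>) \<ge> c) \<and>
     (\<forall>t\<in>{1..n}. AE \<omega> in sample N.
        (MAX j\<in>obs N. real_cond_exp (sample N) (sigma_cov N t) (\<lambda>\<omega>. \<bar>red_eps N t \<omega> j\<bar> ^ 4) \<omega>) \<le> C) \<and>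
     (AE \<omega> in sample N.
        real_cond_exp (sample N) (sigma_cov_all n N)
          (\<lambda>\<omega>. MAX (t, j)\<in>{1..n} \<times> obs N. \<bar>red_eps N t \<omega> j\<bar> ^ 4) \<omega> \<le> Meps)"

definition regular_covariates ::
  "real \<Rightarrow> real \<Rightarrow> real \<Rightarrow> real \<Rightarrow> nat \<Rightarrow> ('a, 'w) network \<Rightarrow> bool" where
  "regular_covariates c C kappa MPsi n N \<longleftrightarrow>
     (let I = aug_set (obs N);
          q = (\<lambda>t \<omega> k j. row_aug (obs N) (Psi_bar N) k (cov N t \<omega>) * aug (cov N t \<omega>) j)
      in invertible_on I (gram N) \<and>
         (\<forall>t\<in>{1..n}. (MIN (k, j)\<in>I \<times> I. integral\<^sup>L (sample N) (\<lambda>\<omega>. (q t \<omega> k j - delta k j)\<^sup>2)) \<ge> c) \<and>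
         (\<forall>t\<in>{1..n}. (MAX (k, j)\<in>I \<times> I. integral\<^sup>L (sample N) (\<lambda>\<omega>. \<bar>q t \<omega> k j\<bar> ^ 4)) \<le> C) \<and>
         integral\<^sup>L (sample N) (\<lambda>\<omega>. MAX (t, k, j)\<in>{1..n} \<times> I \<times> I. \<bar>q t \<omega> k j\<bar> ^ 4) \<le> MPsi \<and>
         (\<forall>e. eigenvalue_on I (Psi_bar N) e \<longrightarrow> e \<le> kappa))"

text \<open>All real parameters before the sequence \<open>N\<close> are constants: \<open>B\<close> bounds the two norms of the
  inverse of \<open>M\<close>, and \<open>kappa\<close> bounds the eigenvalues of \<open>\<Psi>\<close>-bar.\<close>
definition regular_design ::
  "real \<Rightarrow> real \<Rightarrow> real \<Rightarrow> real \<Rightarrow> real \<Rightarrow> real \<Rightarrow> real \<Rightarrow> real \<Rightarrow>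
   (nat \<Rightarrow> ('a, 'w) network) \<Rightarrow> (nat \<Rightarrow> nat) \<Rightarrow> (nat \<Rightarrow> real) \<Rightarrow> (nat \<Rightarrow> real) \<Rightarrow> (nat \<Rightarrow> real) \<Rightarrow> bool" where
  "regular_design B abar lbar pbar c C C' kappa N s r1 Meps MPsi \<longleftrightarrow>
     (\<forall>n\<ge>1. standing_assms B abar lbar pbar n (N n) \<and>
        s n \<ge> 1 \<and> sparse_approx_on (obs (N n)) (s n) (r1 n) (netHinv (N n)) \<and>
        Meps n \<ge> 1 \<and> MPsi n \<ge> 1 \<and>
        regular_data n (N n) \<and>
        regular_noise c C (Meps n) n (N n) \<and>
        regular_covariates c C kappa (MPsi n) n (N n) \<and>
        C' * ln (card (obs (N n))) \<ge> ln n) \<and>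
     (\<lambda>n. (real (s n))\<^sup>2 * ln (card (obs (N n))) * (ln (real n)) ^ 3) \<in> o(\<lambda>n. real n) \<and>
     (\<lambda>n. Meps n * MPsi n * ln (card (obs (N n)))) \<in> o(\<lambda>n. real n)"


section \<open>The estimators\<close>

text \<open>\<open>V\<close> is the set of observable agents, and \<open>p t\<close>, \<open>y t\<close> are the realised covariates and outcomes
  of period \<open>t\<close>.\<close>

definition Phi :: "real \<Rightarrow> real" where
  "Phi = cdf std_normal_distribution"

definition avg :: "nat \<Rightarrow> (nat \<Rightarrow> real) \<Rightarrow> real" where
  "avg n f = (\<Sum>t=1..n. f t) / real n"

definition moment_bound :: "nat \<Rightarrow> 'a set \<Rightarrow> (nat \<Rightarrow> 'a \<Rightarrow> real) \<Rightarrow> real" where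
  "moment_bound n V p = sqrt (max 1 (MAX k\<in>V. avg n (\<lambda>t. (p t k) ^ 4)))"

definition tau :: "nat \<Rightarrow> 'a set \<Rightarrow> (nat \<Rightarrow> 'a \<Rightarrow> real) \<Rightarrow> real" where
  "tau n V p = 1 / (4 * moment_bound n V p)"

definition pen :: "nat \<Rightarrow> 'a set \<Rightarrow> real" where
  "pen n V = (1 / sqrt (real n)) * inv Phi (1 - 1 / (3 * real n * (real (card V))\<^sup>2))"

definition Sigma_hat :: "nat \<Rightarrow> (nat \<Rightarrow> 'a \<Rightarrow> real) \<Rightarrow> 'a option \<Rightarrow> 'a option \<Rightarrow> real" where
  "Sigma_hat n p k j = avg n (\<lambda>t. aug (p t) k * aug (p t) j)"

definition resid ::
  "'a set \<Rightarrow> (nat \<Rightarrow> 'a \<Rightarrow> real) \<Rightarrow> (nat \<Rightarrow> 'a \<Rightarrow> real) \<Rightarrow> ('a \<Rightarrow> 'a \<Rightarrow> real) \<Rightarrow> ('a \<Rightarrow> real) \<Rightarrow> nat \<Rightarrow> 'a \<Rightarrow> real" where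
  "resid V p y W v t k = y t k - (v k - (\<Sum>j\<in>V. W k j * p t j))"

definition step1_feasible ::
  "nat \<Rightarrow> 'a set \<Rightarrow> (nat \<Rightarrow> 'a \<Rightarrow> real) \<Rightarrow> (nat \<Rightarrow> 'a \<Rightarrow> real) \<Rightarrow>
   ('a \<Rightarrow> 'a \<Rightarrow> real) \<times> ('a \<Rightarrow> real) \<times> ('a \<Rightarrow> real) \<Rightarrow> bool" where
  "step1_feasible n V p y = (\<lambda>(W, v, z). \<forall>k\<in>V. \<forall>j\<in>aug_set V.
     \<bar>avg n (\<lambda>t. resid V p y W v t k * aug (p t) j)\<bar> \<le> pen n V * z k \<and>
     sqrt (avg n (\<lambda>t. (resid V p y W v t k)\<^sup>2 * (aug (p t) j)\<^sup>2)) \<le> z k)"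

definition step1_objective ::
  "nat \<Rightarrow> 'a set \<Rightarrow> (nat \<Rightarrow> 'a \<Rightarrow> real) \<Rightarrow>
   ('a \<Rightarrow> 'a \<Rightarrow> real) \<times> ('a \<Rightarrow> real) \<times> ('a \<Rightarrow> real) \<Rightarrow> real" where
  "step1_objective n V p = (\<lambda>(W, v, z). \<Sum>k\<in>V. (\<bar>v k\<bar> + (\<Sum>j\<in>V. \<bar>W k j\<bar>)) + tau n V p * z k)"

definition step1_estimator ::
  "nat \<Rightarrow> 'a set \<Rightarrow> (nat \<Rightarrow> 'a \<Rightarrow> real) \<Rightarrow> (nat \<Rightarrow> 'a \<Rightarrow> real) \<Rightarrow> ('a \<Rightarrow> 'a \<Rightarrow> real) \<Rightarrow> ('a \<Rightarrow> real) \<Rightarrow> bool" where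
  "step1_estimator n V p y W v \<longleftrightarrow>
     (\<exists>z. is_arg_min (step1_objective n V p) (step1_feasible n V p y) (W, v, z))"

definition step2_feasible ::
  "nat \<Rightarrow> 'a set \<Rightarrow> (nat \<Rightarrow> 'a \<Rightarrow> real) \<Rightarrow>
   ('a option \<Rightarrow> real) \<times> ('a option \<Rightarrow> 'a option \<Rightarrow> real) \<Rightarrow> bool" where
  "step2_feasible n V p = (\<lambda>(z, Psi). \<forall>k\<in>aug_set V. \<forall>j\<in>aug_set V.
     \<bar>mat_mult (aug_set V) Psi (Sigma_hat n p) k j - delta k j\<bar> \<le> pen n V * z k \<and>
     sqrt (avg n (\<lambda>t. (row_aug V Psi k (p t) * aug (p t) j - delta k j)\<^sup>2)) \<le> z k)"

definition step2_objective ::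
  "nat \<Rightarrow> 'a set \<Rightarrow> (nat \<Rightarrow> 'a \<Rightarrow> real) \<Rightarrow>
   ('a option \<Rightarrow> real) \<times> ('a option \<Rightarrow> 'a option \<Rightarrow> real) \<Rightarrow> real" where
  "step2_objective n V p = (\<lambda>(z, Psi). \<Sum>k\<in>aug_set V.
     root 4 (avg n (\<lambda>t. \<bar>row_aug V Psi k (p t)\<bar> ^ 4)) + z k)"

definition step2_estimator ::
  "nat \<Rightarrow> 'a set \<Rightarrow> (nat \<Rightarrow> 'a \<Rightarrow> real) \<Rightarrow> ('a option \<Rightarrow> 'a option \<Rightarrow> real) \<Rightarrow> bool" where
  "step2_estimator n V p Psi \<longleftrightarrow>
     (\<exists>z. is_arg_min (step2_objective n V p) (step2_feasible n V p) (z, Psi))"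

text \<open>The stacked matrix \<open>(-v\<^sup>T; W\<^sup>T)\<close>, with rows indexed by \<open>aug_set V\<close> and columns by \<open>V\<close>.\<close>
definition stack :: "('a \<Rightarrow> 'a \<Rightarrow> real) \<Rightarrow> ('a \<Rightarrow> real) \<Rightarrow> 'a option \<Rightarrow> 'a \<Rightarrow> real" where
  "stack W v i k = (case i of None \<Rightarrow> - v k | Some j \<Rightarrow> W k j)"

definition debiased_stack ::
  "nat \<Rightarrow> 'a set \<Rightarrow> (nat \<Rightarrow> 'a \<Rightarrow> real) \<Rightarrow> (nat \<Rightarrow> 'a \<Rightarrow> real) \<Rightarrow> ('a \<Rightarrow> 'a \<Rightarrow> real) \<Rightarrow> ('a \<Rightarrow> real) \<Rightarrow>
   ('a option \<Rightarrow> 'a option \<Rightarrow> real) \<Rightarrow> 'a option \<Rightarrow> 'a \<Rightarrow> real" where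
  "debiased_stack n V p y W v Psi i k =
     stack W v i k
     - (\<Sum>l\<in>aug_set V. Psi i l * avg n (\<lambda>t. aug (p t) l * resid V p y W v t k))"

definition debiased_W ::
  "nat \<Rightarrow> 'a set \<Rightarrow> (nat \<Rightarrow> 'a \<Rightarrow> real) \<Rightarrow> (nat \<Rightarrow> 'a \<Rightarrow> real) \<Rightarrow> ('a \<Rightarrow> 'a \<Rightarrow> real) \<Rightarrow> ('a \<Rightarrow> real) \<Rightarrow>
   ('a option \<Rightarrow> 'a option \<Rightarrow> real) \<Rightarrow> 'a \<Rightarrow> 'a \<Rightarrow> real" where
  "debiased_W n V p y W v Psi k j = debiased_stack n V p y W v Psi (Some j) k"

definition debiased_v ::
  "nat \<Rightarrow> 'a set \<Rightarrow> (nat \<Rightarrow> 'a \<Rightarrow> real) \<Rightarrow> (nat \<Rightarrow> 'a \<Rightarrow> real) \<Rightarrow> ('a \<Rightarrow> 'a \<Rightarrow> real) \<Rightarrow> ('a \<Rightarrow> real) \<Rightarrow>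
   ('a option \<Rightarrow> 'a option \<Rightarrow> real) \<Rightarrow> 'a \<Rightarrow> real" where
  "debiased_v n V p y W v Psi k = - debiased_stack n V p y W v Psi None k"

definition thresholded :: "('a \<Rightarrow> 'a \<Rightarrow> real) \<Rightarrow> ('a \<Rightarrow> 'a \<Rightarrow> real) \<Rightarrow> 'a \<Rightarrow> 'a \<Rightarrow> real" where
  "thresholded mu W k j = (if \<bar>W k j\<bar> > mu k j then W k j else 0)"

definition sigma_hat ::
  "nat \<Rightarrow> 'a set \<Rightarrow> (nat \<Rightarrow> 'a \<Rightarrow> real) \<Rightarrow> (nat \<Rightarrow> 'a \<Rightarrow> real) \<Rightarrow> ('a \<Rightarrow> 'a \<Rightarrow> real) \<Rightarrow> ('a \<Rightarrow> real) \<Rightarrow>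
   ('a option \<Rightarrow> 'a option \<Rightarrow> real) \<Rightarrow> 'a \<Rightarrow> 'a \<Rightarrow> real" where
  "sigma_hat n V p y W v Psi k j =
     sqrt (avg n (\<lambda>t. (row_aug V Psi (Some j) (p t) * resid V p y W v t k)\<^sup>2))"

definition threshold_level ::
  "nat \<Rightarrow> 'a set \<Rightarrow> (nat \<Rightarrow> 'a \<Rightarrow> real) \<Rightarrow> (nat \<Rightarrow> 'a \<Rightarrow> real) \<Rightarrow> ('a \<Rightarrow> 'a \<Rightarrow> real) \<Rightarrow> ('a \<Rightarrow> real) \<Rightarrow>
   ('a option \<Rightarrow> 'a option \<Rightarrow> real) \<Rightarrow> 'a \<Rightarrow> 'a \<Rightarrow> real" where
  "threshold_level n V p y W v Psi k j =
     2 * (1 + 1 / ln (real n)) * sigma_hat n V p y W v Psi k j * pen n V"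

text \<open>
  An event has probability at least \<open>1 - o(1)\<close>. The minimizers need not be unique, and a selection
  of them need not be measurable, so this is read as inner probability tending to 1; for measurable
  \<open>E n\<close> it says exactly that the probability of \<open>E n\<close> tends to 1.
\<close>
definition whp :: "(nat \<Rightarrow> 'w measure) \<Rightarrow> (nat \<Rightarrow> 'w \<Rightarrow> bool) \<Rightarrow> bool" where
  "whp P E \<longleftrightarrow>
     (\<exists>A. (\<forall>n. A n \<in> sets (P n)) \<and> (\<forall>n. \<forall>\<omega>\<in>A n. E n \<omega>) \<and>
          (\<lambda>n. measure (P n) (A n)) \<longlonglongrightarrow> 1)"

end

theory Submission
  imports Defs
begin

text \<open>
  Entrywise, the debiased estimator errs by \<open>(1 - \<Psi> \<Sigma>) \<Delta>\<close> minus the average over the periods of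
  \<open>w\<^sub>i t * \<epsilon>\<^sub>k t\<close>, where \<open>\<Psi>\<close> and \<open>\<Sigma>\<close> are the estimates of the second step, \<open>w\<^sub>i t\<close> is the product of
  row \<open>i\<close> of \<open>\<Psi>\<close> with \<open>(1; p t)\<close>, and \<open>\<Delta>\<close> is the error of the first step. The constraint of the second
  step and the \<open>\<ell>\<^sub>1\<close>-rate of the first, which follows from the cone argument and the eigenvalue bound,
  make the first term small.

  The second term is a self-normalised sum. A minimiser of the second step depends on the covariates
  only, and by strict convexity of the fourth-power norm its row of weights is unique up to a positive
  factor; normalised weights are therefore measurable functions of the covariates, and the noise is
  centred given these. With \<open>S\<close> the weighted noise sum, \<open>V\<^sup>2\<close> the sum of its squared terms and
  \<open>Q\<close> the sum of the \<open>\<bar>w t\<bar>\<^sup>3\<close>, the inequality \<open>exp (u - u\<^sup>2 / 2) \<le> 1 + u + 8 * \<bar>u\<bar>\<^sup>3\<close>,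
  iterated over the periods, gives \<open>E exp (b * S - b\<^sup>2 * V\<^sup>2 / 2 - K * \<bar>b\<bar>\<^sup>3 * Q) \<le> 1\<close>. Choosing \<open>b\<close> from a
  grid of values of \<open>V\<close> yields the Gaussian tail of \<open>S / V\<close> with a sharp exponent. Here \<open>sqrt n * \<lambda>\<close>
  is the normal quantile at level \<open>1 - 1 / (3 n |V|\<^sup>2)\<close>, so the noise stays below \<open>\<lambda>\<close> times its
  empirical standard deviation in all entries at once, and the factor \<open>1 + 1 / ln n\<close> in the threshold
  absorbs the first term and the error in estimating that standard deviation.
\<close>

section \<open>Elementary inequalities and Gaussian tails\<close>

text \<open>Minimisers may be selected in any way, even non-measurably, so no probability is ever
  computed for them. All probabilities concern a measurable event about covariates and noise
  (\<open>good_set\<close>), on which deterministic arguments apply to every choice of minimisers;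
  \<open>unit_min\<close> makes it possible to mention the weights of the second step in that event.
  The best \<open>b\<close> would be of order \<open>x / V\<close>, but \<open>V\<close> depends on
  the noise. A grid of relative mesh n^(-1/4) loses only a relative n^(-1/2) in the exponent,
  because the exponent is flat at its optimum, and costs about n^(1/4) union terms. The factor 1/n
  in the level of the quantile pays for them: the total is of order n^(1/4) * x / n, with x at most
  of order sqrt n. A finite grid needs \<open>V\<close> to be bounded away from 0; a second
  exponential moment, fed by the lower bound \<open>c\<close> on the conditional variance, secures
  this. The fourth-power norm in the second step also controls \<open>Q\<close> and bounds
  \<open>V\<close> from above. All constants depend only on the parameters common to the whole
  sequence, so they can be fixed before the networks.\<close>

lemma exp_quadratic_le_cubic:
  fixes u :: real
  shows "exp (u - u\<^sup>2 / 2) \<le> 1 + u + 8 * \<bar>u\<bar> ^ 3"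
proof (cases "\<bar>u\<bar> \<le> 1")
  case True
  \<comment> \<open>The exponent is made for the quadratic terms to cancel:
    \<open>v + v^2 / 2 = u - u^3 / 2 + u^4 / 8\<close>. The Lagrange remainder adds at most
    \<open>81/16 * |u|^3\<close>, and 1/2 + 1/8 + 81/16 stays below 8.\<close>
  define v where "v = u - u\<^sup>2 / 2"
  have u2: "u\<^sup>2 \<le> \<bar>u\<bar>"
    using mult_left_mono[OF True, of "\<bar>u\<bar>"] by (simp add: power2_eq_square flip: abs_mult)
  have v: "\<bar>v\<bar> \<le> 3/2 * \<bar>u\<bar>" unfolding v_def using u2 zero_le_power2[of u] by linarith
  obtain t where t: "\<bar>t\<bar> \<le> \<bar>v\<bar>" "exp v = (\<Sum>m<3. v ^ m / fact m) + exp t / fact 3 * v ^ 3"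
    using Maclaurin_exp_le[of v 3] by blast
  have "exp t \<le> exp (2::real)" using t(1) v True by simp
  also have "\<dots> = exp 1 * exp 1" by (simp flip: exp_add)
  also have "\<dots> \<le> 3 * (3::real)" by (intro mult_mono exp_le) auto
  finally have et: "exp t \<le> 9" by simp
  have v3: "\<bar>v\<bar> ^ 3 \<le> (3/2) ^ 3 * \<bar>u\<bar> ^ 3"
    using power_mono[OF v, of 3] unfolding power_mult_distrib by simp
  have "exp t / fact 3 * v ^ 3 \<le> exp t / fact 3 * \<bar>v\<bar> ^ 3"
    by (intro mult_left_mono) (auto simp flip: power_abs)
  also have "\<dots> \<le> 9 / 6 * ((3/2) ^ 3 * \<bar>u\<bar> ^ 3)"
    using et v3 by (intro mult_mono) (auto simp: fact_numeral)
  finally have r: "exp t / fact 3 * v ^ 3 \<le> 81/16 * \<bar>u\<bar> ^ 3" by (simp add: power3_eq_cube)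
  have s: "(\<Sum>m<3. v ^ m / fact m) = 1 + v + v\<^sup>2 / 2"
    by (simp add: numeral_3_eq_3 power2_eq_square)
  have vv: "v + v\<^sup>2 / 2 = u - u ^ 3 / 2 + u ^ 4 / 8"
    unfolding v_def by (simp add: field_simps power2_eq_square power3_eq_cube power4_eq_xxxx)
  have u4: "u ^ 4 \<le> \<bar>u\<bar> ^ 3"
  proof -
    have "u ^ 4 = \<bar>u\<bar> ^ 3 * \<bar>u\<bar>" by (simp add: power4_eq_xxxx power3_eq_cube abs_if)
    also have "\<dots> \<le> \<bar>u\<bar> ^ 3 * 1" using True by (intro mult_left_mono) auto
    finally show ?thesis by simp
  qed
  have u3: "- (u ^ 3) \<le> \<bar>u\<bar> ^ 3" by (metis abs_ge_minus_self power_abs)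
  have "0 \<le> \<bar>u\<bar> ^ 3" by simp
  then show ?thesis using t(2) s vv u4 u3 r unfolding v_def by linarith
next
  case False
  \<comment> \<open>Beyond 1 the left side is at most \<open>exp 1\<close>, while the right side is
    at least \<open>1 + 7 * |u|^3\<close>.\<close>
  have e: "u - u\<^sup>2 / 2 \<le> 1" using zero_le_power2[of "u - 1"] by (simp add: power2_eq_square algebra_simps)
  then have "exp (u - u\<^sup>2 / 2) \<le> exp 1" by simp
  also have "\<dots> \<le> 3" by (rule exp_le)
  finally have 1: "exp (u - u\<^sup>2 / 2) \<le> 3" .
  have "\<bar>u\<bar> \<le> \<bar>u\<bar> ^ 3" "1 \<le> \<bar>u\<bar> ^ 3" using False self_le_power[of "\<bar>u\<bar>" 3] by auto
  then show ?thesis using 1 by linarith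
qed

lemma exp_neg_le_quadratic:
  fixes u :: real assumes "0 \<le> u" shows "exp (- u) \<le> 1 - u + u\<^sup>2 / 2"
proof -
  have "(\<lambda>u. 1 - u + u\<^sup>2 / 2 - exp (- u)) 0 \<le> (\<lambda>u. 1 - u + u\<^sup>2 / 2 - exp (- u)) u"
  proof (rule DERIV_nonneg_imp_nondecreasing[OF assms])
    fix x :: real
    have "((\<lambda>u. 1 - u + u\<^sup>2 / 2 - exp (- u)) has_real_derivative - 1 + x + exp (- x)) (at x)"
      by (auto intro!: derivative_eq_intros)
    moreover have "0 \<le> - 1 + x + exp (- x)" using exp_ge_add_one_self[of "- x"] by simp
    ultimately show "\<exists>y. ((\<lambda>u. 1 - u + u\<^sup>2 / 2 - exp (- u)) has_real_derivative y) (at x) \<and> 0 \<le> y"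
      by blast
  qed
  then show ?thesis by simp
qed

lemma exp_le_affine:
  fixes u :: real assumes "0 \<le> u" "u \<le> 1" shows "exp u \<le> 1 + 2 * u"
proof -
  have "u\<^sup>2 \<le> u" using mult_left_mono[OF assms(2,1)] by (simp add: power2_eq_square)
  then show ?thesis using exp_bound[OF assms] by linarith
qed

lemma Phi_conv: "Phi x = measure std_normal_distribution {..x}"
  by (simp add: Phi_def cdf_def2)

interpretation std_normal: real_distribution std_normal_distribution
  by (rule real_dist_normal_dist)

lemma one_minus_Phi: "ennreal (1 - Phi x) = (\<integral>\<^sup>+t. ennreal (std_normal_density t) * indicator {x<..} t \<partial>lborel)"
proof -
  have "1 - Phi x = measure std_normal_distribution (space std_normal_distribution - {..x})"
    unfolding Phi_conv by (subst std_normal.prob_compl) auto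
  also have "space std_normal_distribution - {..x} = {x<..}" by auto
  finally have "ennreal (1 - Phi x) = emeasure std_normal_distribution {x<..}"
    by (simp add: std_normal.emeasure_eq_measure)
  then show ?thesis by (simp add: emeasure_density)
qed

text \<open>For \<open>t > x\<close> and \<open>x \<ge> 0\<close> one has
  \<open>t^2 \<ge> x^2 + (t - x)^2\<close>. Hence the density beyond \<open>x\<close> is at most
  \<open>exp (- x^2 / 2)\<close> times the density shifted to \<open>x\<close>, which has total mass
  1.\<close>

lemma one_minus_Phi_le:
  assumes "0 \<le> x" shows "1 - Phi x \<le> exp (- x\<^sup>2 / 2)"
proof -
  have "(\<integral>\<^sup>+t. ennreal (std_normal_density t) * indicator {x<..} t \<partial>lborel)
      \<le> (\<integral>\<^sup>+t. ennreal (exp (- x\<^sup>2 / 2)) * ennreal (std_normal_density (t - x)) \<partial>lborel)"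
  proof (rule nn_integral_mono)
    fix t
    show "ennreal (std_normal_density t) * indicator {x<..} t
      \<le> ennreal (exp (- x\<^sup>2 / 2)) * ennreal (std_normal_density (t - x))"
    proof (cases "x < t")
      case True
      have "x * x \<le> t * x" using True assms by (intro mult_right_mono) auto
      then have "- t\<^sup>2 / 2 \<le> - x\<^sup>2 / 2 - (t - x)\<^sup>2 / 2"
        by (simp add: field_simps power2_eq_square)
      then have "exp (- t\<^sup>2 / 2) \<le> exp (- x\<^sup>2 / 2) * exp (- (t - x)\<^sup>2 / 2)"
        by (simp flip: exp_add)
      then have "std_normal_density t \<le> exp (- x\<^sup>2 / 2) * std_normal_density (t - x)"
        by (simp add: std_normal_density_def divide_right_mono)
      then show ?thesis using True by (simp add: ennreal_leI flip: ennreal_mult)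
    qed auto
  qed
  also have "\<dots> = ennreal (exp (- x\<^sup>2 / 2)) * (\<integral>\<^sup>+t. ennreal (std_normal_density (t - x)) \<partial>lborel)"
    by (rule nn_integral_cmult) auto
  also have "(\<integral>\<^sup>+t. ennreal (std_normal_density (t - x)) \<partial>lborel) = (\<integral>\<^sup>+t. ennreal (std_normal_density t) \<partial>lborel)"
    by (subst nn_integral_real_affine[of _ 1 x]) auto
  also have "\<dots> = 1"
    using std_normal.emeasure_space_1 by (simp add: emeasure_density)
  finally have "ennreal (1 - Phi x) \<le> ennreal (exp (- x\<^sup>2 / 2))" by (simp add: one_minus_Phi)
  then show ?thesis by (simp add: ennreal_le_iff)
qed

text \<open>A Mills-type bound: only the interval from \<open>x\<close> to \<open>x + 1 / x\<close>
  is kept, over which the exponent drops by at most 3/2. The factor 12 is 8/3 times 9/2, bounds for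
  \<open>sqrt (2 * pi)\<close> and \<open>exp (3/2)\<close>. It converts the level of a quantile
  into a bound on \<open>exp (- x^2 / 2)\<close>, the quantity in which the noise tails are
  expressed.\<close>

lemma one_minus_Phi_ge:
  assumes "1 \<le> x" shows "exp (- x\<^sup>2 / 2) \<le> 12 * x * (1 - Phi x)"
proof -
  let ?r = "1 / x"
  have [simp]: "0 < x" using assms by simp
  have "emeasure lborel {x<..x + ?r} = ennreal ?r" using assms by (subst emeasure_lborel_Ioc) auto
  then have "ennreal (std_normal_density (x + ?r)) * ennreal ?r = (\<integral>\<^sup>+t. ennreal (std_normal_density (x + ?r)) * indicator {x<..x + ?r} t \<partial>lborel)"
    by (subst nn_integral_cmult) auto
  also have "\<dots> \<le> (\<integral>\<^sup>+t. ennreal (std_normal_density t) * indicator {x<..} t \<partial>lborel)"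
  proof (intro nn_integral_mono)
    fix t
    show "ennreal (std_normal_density (x + ?r)) * indicator {x<..x + ?r} t
        \<le> ennreal (std_normal_density t) * indicator {x<..} t"
    proof (cases "t \<in> {x<..x + ?r}")
      case True
      then have "t\<^sup>2 \<le> (x + ?r)\<^sup>2" using assms by (intro power_mono) auto
      then show ?thesis using True by (auto simp: std_normal_density_def intro!: ennreal_leI divide_right_mono)
    qed auto
  qed
  finally have "ennreal (std_normal_density (x + ?r) * ?r) \<le> ennreal (1 - Phi x)"
    unfolding one_minus_Phi[symmetric] using assms by (subst ennreal_mult) auto
  then have 1: "std_normal_density (x + ?r) * ?r \<le> 1 - Phi x"
    by (subst (asm) ennreal_le_iff) (auto simp: Phi_def std_normal.cdf_bounded_prob)
  have r1: "?r\<^sup>2 \<le> 1" using assms by (simp add: power_le_one)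
  have "(x + ?r)\<^sup>2 = x\<^sup>2 + 2 + ?r\<^sup>2" using assms by (simp add: field_simps power2_eq_square)
  then have "- (x + ?r)\<^sup>2 / 2 \<ge> - x\<^sup>2 / 2 - 3/2" using r1 by linarith
  then have "exp (- x\<^sup>2 / 2) * exp (- 3/2) \<le> exp (- (x + ?r)\<^sup>2 / 2)" by (simp flip: exp_add)
  also have "\<dots> = sqrt (2 * pi) * std_normal_density (x + ?r)"
    by (simp add: std_normal_density_def)
  also have "\<dots> \<le> sqrt (2 * pi) * (x * (1 - Phi x))"
    using mult_left_mono[OF 1, of x] assms by (intro mult_left_mono) auto
  finally have 2: "exp (- x\<^sup>2 / 2) * exp (- 3/2) \<le> sqrt (2 * pi) * (x * (1 - Phi x))" .
  have s: "sqrt (2 * pi) \<le> 8/3"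
    using pi_approx by (intro real_le_lsqrt) (auto simp: power2_eq_square)
  have "exp (3/2::real) ^ 2 = exp 1 ^ 3" by (simp flip: exp_of_nat_mult)
  also have "\<dots> \<le> (272/100) ^ 3"
  proof (intro power_mono)
    show "exp 1 \<le> (272/100::real)" using e_approx_32[THEN abs_le_D1] by simp
  qed auto
  also have "\<dots> \<le> (9/2::real)\<^sup>2" by (simp add: power2_eq_square power3_eq_cube)
  finally have e: "exp (3/2::real) \<le> 9/2" by (rule power2_le_imp_le) auto
  have n: "0 \<le> x * (1 - Phi x)" using assms by (auto simp: Phi_def std_normal.cdf_bounded_prob intro!: mult_nonneg_nonneg)
  have "exp (- x\<^sup>2 / 2) = exp (- x\<^sup>2 / 2) * exp (- 3/2) * exp (3/2)" by (simp flip: exp_add)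
  also have "\<dots> \<le> 8/3 * (x * (1 - Phi x)) * (9/2)"
    by (rule mult_mono[OF order_trans[OF 2 mult_right_mono[OF s n]] e]) (use n in auto)
  finally show ?thesis by simp
qed

text \<open>\<open>inv\<close> selects some preimage, so it is enough that each level strictly
  between 0 and 1 is attained. The normal law has no atoms, hence \<open>Phi\<close> is continuous,
  and the intermediate value theorem applies between its limits.\<close>

lemma Phi_inv:
  assumes "0 < y" "y < 1" shows "Phi (inv Phi y) = y"
proof -
  have cont: "continuous_on UNIV Phi"
    unfolding Phi_def continuous_on_eq_continuous_at[OF open_UNIV]
  proof safe
    fix x :: real
    have "AE t in lborel. t \<noteq> x" by (rule AE_lborel_singleton)
    then have "AE t in lborel. ennreal (std_normal_density t) * indicator {x} t = 0" by eventually_elim simp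
    then have "emeasure std_normal_distribution {x} = 0"
      by (simp add: emeasure_density nn_integral_0_iff_AE)
    then show "isCont (cdf std_normal_distribution) x"
      by (simp add: std_normal.isCont_cdf measure_def)
  qed
  have "eventually (\<lambda>x. Phi x > y) at_top"
    using order_tendstoD(1)[OF std_normal.cdf_lim_at_top_prob assms(2)] by (simp add: Phi_def)
  then obtain b where b: "Phi b > y" by (auto simp: eventually_at_top_linorder)
  have "eventually (\<lambda>x. Phi x < y) at_bot"
    using order_tendstoD(2)[OF std_normal.cdf_lim_at_bot assms(1)] by (simp add: Phi_def)
  then obtain a where a: "Phi a < y" by (auto simp: eventually_at_bot_linorder)
  have "a \<le> b" using a b std_normal.cdf_nondecreasing[of b a] unfolding Phi_def by (smt (verit))
  then obtain x where "Phi x = y"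
    using IVT'[of Phi a y b] a b continuous_on_subset[OF cont] by auto
  then show ?thesis by (metis f_inv_into_f rangeI)
qed

text \<open>Quantitative strict convexity of the fourth power. Expanding around the mean
  \<open>m\<close>, the gap is \<open>s * (1 - s) * d^2\<close> times the sum of a square and
  \<open>(1/3 - s * (1 - s) / 3) * d^2\<close>; as \<open>s * (1 - s) \<le> 1/4\<close>, the last
  coefficient is at least 1/4.\<close>

lemma quartic_convexity_gap:
  fixes x y s :: real
  assumes "0 \<le> s" "s \<le> 1"
  shows "(s * x + (1 - s) * y) ^ 4 + s * (1 - s) * (x - y) ^ 4 / 4 \<le> s * x ^ 4 + (1 - s) * y ^ 4"
proof -
  define m d where "m = s * x + (1 - s) * y" and "d = x - y"
  have xy: "x = m + (1 - s) * d" "y = m - s * d" by (simp_all add: m_def d_def algebra_simps)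
  have sp: "0 \<le> s * (1 - s)" using assms by simp
  have id: "s * x ^ 4 + (1 - s) * y ^ 4 - m ^ 4
     = s * (1 - s) * d\<^sup>2 * (6 * (m + (1 - 2 * s) * d / 3)\<^sup>2 + (1/3 - s * (1 - s) / 3) * d\<^sup>2)"
    unfolding xy by (simp add: power2_eq_square power4_eq_xxxx field_simps)
  have "s * (1 - s) \<le> 1/4" using zero_le_power2[of "s - 1/2"] by (simp add: power2_eq_square algebra_simps)
  then have "(1/4) * d\<^sup>2 \<le> 6 * (m + (1 - 2 * s) * d / 3)\<^sup>2 + (1/3 - s * (1 - s) / 3) * d\<^sup>2"
    by (intro order_trans[OF mult_right_mono[of "1/4" "1/3 - s * (1 - s) / 3"]]) auto
  then have "s * (1 - s) * d\<^sup>2 * ((1/4) * d\<^sup>2) \<le> s * x ^ 4 + (1 - s) * y ^ 4 - m ^ 4"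
    unfolding id using sp by (intro mult_left_mono) auto
  moreover have "s * (1 - s) * d\<^sup>2 * ((1/4) * d\<^sup>2) = s * (1 - s) * (x - y) ^ 4 / 4"
    by (simp add: d_def power2_eq_square power4_eq_xxxx)
  ultimately show ?thesis unfolding m_def by linarith
qed

section \<open>Schur complements and quadratic forms\<close>

lemma is_inverse_on_mat_inv: "invertible_on K A \<Longrightarrow> is_inverse_on K A (mat_inv K A)"
  using someI_ex[of "is_inverse_on K A"] by (simp add: invertible_on_def mat_inv_def)

lemma sum_delta_left:
  assumes "finite K" "i \<in> K" shows "(\<Sum>k\<in>K. delta i k * f k) = f i"
  using assms by (simp add: delta_def if_distrib[of "\<lambda>x. x * _"] cong: if_cong)

lemma sum_delta_right:
  assumes "finite K" "j \<in> K" shows "(\<Sum>k\<in>K. f k * delta k j) = f j"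
  using assms by (simp add: delta_def if_distrib[of "\<lambda>x. _ * x"] cong: if_cong)

lemma is_inverse_on_left:
  assumes "is_inverse_on K A B" "i \<in> K" "j \<in> K"
  shows "(\<Sum>k\<in>K. A i k * B k j) = delta i j"
  using assms by (auto simp: is_inverse_on_def mat_mult_def)

lemma is_inverse_on_right:
  assumes "is_inverse_on K A B" "i \<in> K" "j \<in> K"
  shows "(\<Sum>k\<in>K. B i k * A k j) = delta i j"
  using assms by (auto simp: is_inverse_on_def mat_mult_def)

lemma sum_mult_swap:
  fixes f :: "'a \<Rightarrow> real"
  shows "(\<Sum>i\<in>I. f i * (\<Sum>j\<in>J. g i j * h j)) = (\<Sum>j\<in>J. (\<Sum>i\<in>I. f i * g i j) * h j)"
  by (simp add: sum_distrib_left sum_distrib_right sum.swap[of _ J I] mult.assoc)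

context
  fixes K L :: "'i set" and M N Li S H Hi :: "'i \<Rightarrow> 'i \<Rightarrow> real"
  assumes fin: "finite K" "finite L" and disj: "K \<inter> L = {}"
    and N: "is_inverse_on (K \<union> L) M N" and Li: "is_inverse_on L M Li"
    and S: "S = mat_mult L M Li" and H: "\<And>i j. H i j = M i j - mat_mult L S M i j"
    and Hi: "is_inverse_on K H Hi"
begin

text \<open>Block elimination: \<open>S\<close> times the \<open>L\<close>-rows of the identity
  \<open>M N = 1\<close> is subtracted from its \<open>K\<close>-rows. By the choice of
  \<open>S\<close>, the coefficients of the \<open>L\<close>-rows of \<open>N\<close>
  cancel.\<close>

lemma schur_mult_block:
  assumes i: "i \<in> K" and c: "c \<in> K \<union> L"
  shows "(\<Sum>j\<in>K. H i j * N j c) = delta i c - (\<Sum>l\<in>L. S i l * delta l c)"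
proof -
  have SM: "(\<Sum>l'\<in>L. S i l' * M l' l) = M i l" if "l \<in> L" for l
  proof -
    have "(\<Sum>l'\<in>L. S i l' * M l' l) = (\<Sum>m\<in>L. M i m * (\<Sum>l'\<in>L. Li m l' * M l' l))"
      unfolding S mat_mult_def by (rule sum_mult_swap[symmetric])
    also have "\<dots> = (\<Sum>m\<in>L. M i m * delta m l)"
      using is_inverse_on_right[OF Li _ that] by (intro sum.cong) auto
    finally show ?thesis using sum_delta_right[OF fin(2) that] by simp
  qed
  have col: "(\<Sum>j\<in>K. M a j * N j c) + (\<Sum>l\<in>L. M a l * N l c) = delta a c" if "a \<in> K \<union> L" for a
    using is_inverse_on_left[OF N that c] fin disj by (simp add: sum.union_disjoint)
  have "(\<Sum>l\<in>L. S i l * delta l c)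
      = (\<Sum>l'\<in>L. S i l' * (\<Sum>j\<in>K. M l' j * N j c)) + (\<Sum>l'\<in>L. S i l' * (\<Sum>l\<in>L. M l' l * N l c))"
    unfolding sum.distrib[symmetric] distrib_left[symmetric] using col by (intro sum.cong) auto
  also have "(\<Sum>l'\<in>L. S i l' * (\<Sum>l\<in>L. M l' l * N l c)) = (\<Sum>l\<in>L. M i l * N l c)"
    unfolding sum_mult_swap using SM by simp
  finally have 1: "(\<Sum>l\<in>L. S i l * delta l c)
      = (\<Sum>j\<in>K. (\<Sum>l'\<in>L. S i l' * M l' j) * N j c) + (\<Sum>l\<in>L. M i l * N l c)"
    unfolding sum_mult_swap .
  have "(\<Sum>j\<in>K. H i j * N j c) = (\<Sum>j\<in>K. M i j * N j c) - (\<Sum>j\<in>K. (\<Sum>l'\<in>L. S i l' * M l' j) * N j c)"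
    by (simp add: H mat_mult_def left_diff_distrib sum_subtractf)
  then show ?thesis using 1 col[of i] i by simp
qed

lemma schur_inverse_mult:
  assumes k: "k \<in> K" and c: "c \<in> K \<union> L"
  shows "N k c = (\<Sum>i\<in>K. Hi k i * (delta i c - (\<Sum>l\<in>L. S i l * delta l c)))"
proof -
  have "N k c = (\<Sum>j\<in>K. (\<Sum>i\<in>K. Hi k i * H i j) * N j c)"
    using is_inverse_on_right[OF Hi k] sum_delta_left[OF fin(1) k, of "\<lambda>j. N j c"] by simp
  also have "\<dots> = (\<Sum>i\<in>K. Hi k i * (\<Sum>j\<in>K. H i j * N j c))" by (rule sum_mult_swap[symmetric])
  also have "\<dots> = (\<Sum>i\<in>K. Hi k i * (delta i c - (\<Sum>l\<in>L. S i l * delta l c)))"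
    using schur_mult_block[OF _ c] by simp
  finally show ?thesis .
qed

text \<open>Together with the next lemma: \<open>Hi\<close> and \<open>- Hi S\<close> are blocks of
  the full inverse \<open>N\<close>. In this way the norm bound on the inverse of \<open>M\<close>
  reaches the coefficients of the reduced form.\<close>

lemma schur_inverse_eq_block:
  assumes "k \<in> K" "c \<in> K" shows "Hi k c = N k c"
proof -
  have "(\<Sum>l\<in>L. S i l * delta l c) = 0" for i
    using assms disj by (intro sum.neutral) (auto simp: delta_def)
  then show ?thesis using schur_inverse_mult[of k c] assms sum_delta_right[OF fin(1) assms(2), of "Hi k"] by simp
qed

lemma schur_inverse_mult_eq_block:
  assumes "k \<in> K" "c \<in> L" shows "(\<Sum>i\<in>K. Hi k i * S i c) = - N k c"
proof -
  have "delta i c = 0" if "i \<in> K" for i using that assms disj by (auto simp: delta_def)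
  then show ?thesis using schur_inverse_mult[of k c] assms sum_delta_right[OF fin(2) assms(2)]
    by (simp add: sum_negf)
qed

end

section \<open>Rayleigh quotients and eigenvalues of the inverse\<close>

lemma quadratic_nonneg_imp_linear_zero:
  fixes a b :: real
  assumes "\<And>t. 0 \<le> 2 * t * a + t\<^sup>2 * b" shows "a = 0"
proof (rule ccontr)
  assume a: "a \<noteq> 0"
  define d where "d = \<bar>b\<bar> + 1"
  have d: "d > 0" "b < d" by (auto simp: d_def)
  have "0 \<le> 2 * (- a / d) * a + (- a / d)\<^sup>2 * b" by (rule assms)
  also have "\<dots> = - (a\<^sup>2 * (2 * d - b)) / d\<^sup>2" using d by (simp add: field_simps power2_eq_square)
  also have "\<dots> < 0" using a d by (intro divide_neg_pos) auto
  finally show False by simp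
qed

definition quad_form :: "'i set \<Rightarrow> ('i \<Rightarrow> 'i \<Rightarrow> real) \<Rightarrow> ('i \<Rightarrow> real) \<Rightarrow> real" where
  "quad_form I G x = (\<Sum>i\<in>I. x i * (\<Sum>j\<in>I. G i j * x j))"

text \<open>The minimum \<open>m\<close> of the form on the unit sphere is an eigenvalue of
  \<open>G\<close>: varying the minimiser along each coordinate gives the eigenvector equation.
  Invertibility excludes \<open>m = 0\<close>, so \<open>1 / m\<close> is an eigenvalue of
  \<open>Q\<close> and therefore at most \<open>\<kappa>\<close>.\<close>

lemma rayleigh_inverse_bound:
  fixes G Q :: "'i \<Rightarrow> 'i \<Rightarrow> real"
  assumes fin: "finite I" and ne: "I \<noteq> {}"
    and sym: "\<And>i j. G i j = G j i" and psd: "\<And>x. 0 \<le> quad_form I G x"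
    and inv: "is_inverse_on I G Q" and eig: "\<And>e. eigenvalue_on I Q e \<Longrightarrow> e \<le> \<kappa>"
  shows "0 < \<kappa>" "(\<Sum>i\<in>I. (x i)\<^sup>2) \<le> \<kappa> * quad_form I G x"
proof -
  let ?q = "quad_form I G"
  \<comment> \<open>Vectors are functions on the whole index type; fixing them to 0 off
    \<open>I\<close> makes the cube, and with it the sphere \<open>Y\<close>, compact in the product
    topology.\<close>
  define X :: "('i \<Rightarrow> real) set" where "X = (\<Pi>\<^sub>E i\<in>UNIV. if i \<in> I then {-1..1} else {0})"
  define Y where "Y = X \<inter> {x. (\<Sum>i\<in>I. (x i)\<^sup>2) = 1}"
  have "compactin (product_topology (\<lambda>i::'i. euclidean :: real topology) UNIV) X"
    unfolding X_def compactin_PiE by auto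
  then have "compact X" by (simp add: euclidean_product_topology)
  moreover have "closed {x::'i \<Rightarrow> real. (\<Sum>i\<in>I. (x i)\<^sup>2) = 1}"
    by (intro closed_Collect_eq continuous_intros continuous_on_product_coordinates)
  ultimately have cY: "compact Y" unfolding Y_def by (rule compact_Int_closed)
  obtain i0 where i0: "i0 \<in> I" using ne by auto
  have "(\<lambda>i. if i = i0 then 1 else 0) \<in> Y"
    using i0 fin by (auto simp: Y_def X_def if_distrib[of "\<lambda>x. x\<^sup>2"] cong: if_cong)
  then have neY: "Y \<noteq> {}" by blast
  have cq: "continuous_on Y ?q" unfolding quad_form_def
    by (intro continuous_intros continuous_on_product_coordinates[THEN continuous_on_subset]) auto
  obtain u where u: "u \<in> Y" and umin: "\<And>y. y \<in> Y \<Longrightarrow> ?q u \<le> ?q y"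
    using continuous_attains_inf[OF cY neY cq] by blast
  define m where "m = ?q u"
  have u1: "(\<Sum>i\<in>I. (u i)\<^sup>2) = 1" using u by (simp add: Y_def)
  have scale: "?q (\<lambda>i. a * x i) = a\<^sup>2 * ?q x" for a x
    by (simp add: quad_form_def sum_distrib_left power2_eq_square mult_ac)
  have qm: "m * (\<Sum>i\<in>I. (x i)\<^sup>2) \<le> ?q x" for x
  proof (cases "(\<Sum>i\<in>I. (x i)\<^sup>2) = 0")
    case True then show ?thesis using psd by simp
  next
    case False
    define r where "r = sqrt (\<Sum>i\<in>I. (x i)\<^sup>2)"
    have r2: "r\<^sup>2 = (\<Sum>i\<in>I. (x i)\<^sup>2)" by (simp add: r_def sum_nonneg)
    have r0: "r > 0" using False by (simp add: r_def sum_nonneg order.strict_iff_order)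
    define y where "y = (\<lambda>i. if i \<in> I then x i / r else 0)"
    have y1: "(\<Sum>i\<in>I. (y i)\<^sup>2) = 1"
      using r0 by (simp add: y_def power_divide r2 flip: sum_divide_distrib) (simp flip: r2)
    have "y i \<in> {-1..1}" if "i \<in> I" for i
    proof -
      have "(y i)\<^sup>2 \<le> 1" unfolding y1[symmetric] by (rule member_le_sum[OF that _ fin]) simp
      then show ?thesis by (simp add: abs_square_le_1 abs_le_iff)
    qed
    then have "y \<in> Y" using y1 by (auto simp: Y_def X_def y_def PiE_iff)
    then have "m \<le> ?q y" unfolding m_def by (rule umin)
    also have "?q y = ?q (\<lambda>i. (1 / r) * x i)" by (simp add: quad_form_def y_def)
    also have "\<dots> = ?q x / r\<^sup>2" unfolding scale by (simp add: power_divide)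
    finally show ?thesis using r0 unfolding r2[symmetric] by (simp add: field_simps)
  qed
  have Gu: "(\<Sum>j\<in>I. G i j * u j) = m * u i" if i: "i \<in> I" for i
  proof -
    define a b where "a = (\<Sum>j\<in>I. G i j * u j) - m * u i" and "b = G i i - m"
    have "0 \<le> 2 * t * a + t\<^sup>2 * b" for t
    proof -
      define y where "y = (\<lambda>j. u j + t * delta i j)"
      have e: "(\<Sum>j\<in>I. f j * delta i j) = f i" for f :: "'i \<Rightarrow> real"
        using sum_delta_left[OF fin i, of f] by (simp add: mult.commute)
      have row: "(\<Sum>j\<in>I. G k j * y j) = (\<Sum>j\<in>I. G k j * u j) + t * G k i" for k
      proof -
        have "(\<Sum>j\<in>I. G k j * y j) = (\<Sum>j\<in>I. G k j * u j) + t * (\<Sum>j\<in>I. G k j * delta i j)"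
          by (simp add: y_def sum.distrib sum_distrib_left algebra_simps)
        then show ?thesis by (simp add: e)
      qed
      have "?q y = (\<Sum>k\<in>I. u k * (\<Sum>j\<in>I. G k j * u j)) + t * (\<Sum>k\<in>I. u k * G k i)
         + t * (\<Sum>k\<in>I. ((\<Sum>j\<in>I. G k j * u j) + t * G k i) * delta i k)"
        unfolding quad_form_def row by (simp add: y_def sum.distrib sum_distrib_left algebra_simps)
      also have "\<dots> = m + 2 * t * (\<Sum>j\<in>I. G i j * u j) + t\<^sup>2 * G i i"
        unfolding e using sym by (simp add: m_def quad_form_def mult.commute power2_eq_square algebra_simps)
      finally have q: "?q y = m + 2 * t * (\<Sum>j\<in>I. G i j * u j) + t\<^sup>2 * G i i" .
      have "(\<Sum>k\<in>I. (y k)\<^sup>2) = (\<Sum>k\<in>I. (u k)\<^sup>2) + (\<Sum>k\<in>I. (2 * t * u k + t\<^sup>2 * delta i k) * delta i k)"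
        by (simp add: y_def power2_sum sum.distrib power2_eq_square algebra_simps)
      also have "\<dots> = 1 + 2 * t * u i + t\<^sup>2" unfolding e u1 by (simp add: delta_def)
      finally have n: "(\<Sum>k\<in>I. (y k)\<^sup>2) = 1 + 2 * t * u i + t\<^sup>2" .
      show ?thesis using qm[of y] unfolding q n a_def b_def by (simp add: algebra_simps)
    qed
    then have "a = 0" by (rule quadratic_nonneg_imp_linear_zero)
    then show ?thesis by (simp add: a_def)
  qed
  have Qu: "m * (\<Sum>j\<in>I. Q i j * u j) = u i" if "i \<in> I" for i
  proof -
    have "m * (\<Sum>j\<in>I. Q i j * u j) = (\<Sum>j\<in>I. Q i j * (\<Sum>k\<in>I. G j k * u k))"
      using Gu by (simp add: sum_distrib_left mult_ac)
    also have "\<dots> = (\<Sum>k\<in>I. delta i k * u k)"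
      unfolding sum_mult_swap using is_inverse_on_right[OF inv that] by simp
    finally show ?thesis using sum_delta_left[OF fin that] by simp
  qed
  obtain k where k: "k \<in> I" "u k \<noteq> 0"
    using u1 by (metis (mono_tags, lifting) power_zero_numeral sum.neutral zero_neq_one)
  have "m \<noteq> 0" using Qu[OF k(1)] k(2) by auto
  moreover have "0 \<le> m" using psd by (simp add: m_def)
  ultimately have m: "m > 0" by simp
  have "eigenvalue_on I Q (1 / m)"
    unfolding eigenvalue_on_def using k Qu m by (intro exI[of _ u]) (auto simp: field_simps)
  then have km: "1 / m \<le> \<kappa>" by (rule eig)
  then show k0: "0 < \<kappa>" using m by (meson divide_pos_pos less_le_trans zero_less_one)
  have "1 \<le> \<kappa> * m" using km m by (simp add: field_simps)
  then have "1 * (\<Sum>i\<in>I. (x i)\<^sup>2) \<le> \<kappa> * m * (\<Sum>i\<in>I. (x i)\<^sup>2)"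
    by (rule mult_right_mono) (simp add: sum_nonneg)
  also have "\<dots> \<le> \<kappa> * ?q x" using qm k0 by (simp add: mult.assoc)
  finally show "(\<Sum>i\<in>I. (x i)\<^sup>2) \<le> \<kappa> * ?q x" by simp
qed

section \<open>Empirical averages and the first step\<close>

text \<open>The L2 norm of the empirical measure on the periods; Minkowski's and the Cauchy-Schwarz
  inequality are inherited from \<open>L2_set\<close>.\<close>

definition rms :: "nat \<Rightarrow> (nat \<Rightarrow> real) \<Rightarrow> real" where
  "rms n f = sqrt (avg n (\<lambda>t. (f t)\<^sup>2))"

definition lin :: "'a set \<Rightarrow> ('a option \<Rightarrow> real) \<Rightarrow> ('a \<Rightarrow> real) \<Rightarrow> real" where
  "lin V d x = (\<Sum>l\<in>aug_set V. d l * aug x l)"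

definition l1 :: "'a set \<Rightarrow> ('a option \<Rightarrow> real) \<Rightarrow> real" where
  "l1 V d = (\<Sum>l\<in>aug_set V. \<bar>d l\<bar>)"

lemma row_aug_eq_lin: "row_aug V Psi k x = lin V (Psi k) x"
  by (simp add: row_aug_def lin_def)

lemma finite_aug_set [simp]: "finite (aug_set V) \<longleftrightarrow> finite V"
  by (auto simp: aug_set_def dest: finite_imageD)

lemma aug_set_ne [simp]: "aug_set V \<noteq> {}" and None_in_aug_set [simp]: "None \<in> aug_set V"
  and Some_in_aug_set [simp]: "Some j \<in> aug_set V \<longleftrightarrow> j \<in> V"
  by (auto simp: aug_set_def)

lemma aug_simps [simp]: "aug x None = 1" "aug x (Some j) = x j"
  by (simp_all add: aug_def)

lemma sum_aug_set: "finite V \<Longrightarrow> (\<Sum>l\<in>aug_set V. f l) = f None + (\<Sum>j\<in>V. f (Some j))"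
  by (simp add: aug_set_def sum.reindex)

lemma card_aug_set: "finite V \<Longrightarrow> card (aug_set V) = Suc (card V)"
  by (simp add: aug_set_def card_image)

lemma avg_mono: "(\<And>t. t \<in> {1..n} \<Longrightarrow> f t \<le> g t) \<Longrightarrow> avg n f \<le> avg n g"
  unfolding avg_def by (intro divide_right_mono sum_mono) auto

lemma avg_cong: "(\<And>t. t \<in> {1..n} \<Longrightarrow> f t = g t) \<Longrightarrow> avg n f = avg n g"
  unfolding avg_def by (intro arg_cong2[of _ _ _ _ "(/)"] sum.cong) auto

lemma avg_nonneg: "(\<And>t. t \<in> {1..n} \<Longrightarrow> 0 \<le> f t) \<Longrightarrow> 0 \<le> avg n f"
  unfolding avg_def by (intro divide_nonneg_nonneg sum_nonneg) auto

lemma avg_add: "avg n (\<lambda>t. f t + g t) = avg n f + avg n g"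
  by (simp add: avg_def sum.distrib add_divide_distrib)

lemma avg_diff: "avg n (\<lambda>t. f t - g t) = avg n f - avg n g"
  by (simp add: avg_def sum_subtractf diff_divide_distrib)

lemma avg_cmult: "avg n (\<lambda>t. a * f t) = a * avg n f"
  by (simp add: avg_def sum_distrib_left)

lemma avg_sum: "avg n (\<lambda>t. \<Sum>l\<in>I. f l t) = (\<Sum>l\<in>I. avg n (f l))"
  by (simp add: avg_def sum.swap[of _ I] sum_divide_distrib)

lemma avg_const: "1 \<le> n \<Longrightarrow> avg n (\<lambda>_. a) = a"
  by (simp add: avg_def)

lemma avg_bound_const:
  assumes "1 \<le> n" "\<And>t. t \<in> {1..n} \<Longrightarrow> f t \<le> a" shows "avg n f \<le> a"
  using avg_mono[of n f "\<lambda>_. a"] assms by (simp add: avg_const)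

lemma rms_eq_L2_set: "rms n f = L2_set f {1..n} / sqrt (real n)"
  by (simp add: rms_def avg_def L2_set_def real_sqrt_divide)

lemma rms_nonneg [simp]: "0 \<le> rms n f"
  by (simp add: rms_eq_L2_set)

lemma rms_sq: "(rms n f)\<^sup>2 = avg n (\<lambda>t. (f t)\<^sup>2)"
  by (simp add: rms_def avg_nonneg)

lemma rms_triangle: "rms n (\<lambda>t. f t + g t) \<le> rms n f + rms n g"
  unfolding rms_eq_L2_set add_divide_distrib[symmetric]
  by (intro divide_right_mono L2_set_triangle_ineq) auto

lemma rms_cmult: "rms n (\<lambda>t. a * f t) = \<bar>a\<bar> * rms n f"
  by (simp add: rms_def power_mult_distrib avg_cmult real_sqrt_mult)

lemma rms_minus: "rms n (\<lambda>t. - f t) = rms n f"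
  by (simp add: rms_def)

lemma rms_diff: "rms n f - rms n g \<le> rms n (\<lambda>t. f t + g t)"
  using rms_triangle[of n "\<lambda>t. f t + g t" "\<lambda>t. - g t"] by (simp add: rms_minus)

lemma rms_mono: "(\<And>t. t \<in> {1..n} \<Longrightarrow> \<bar>f t\<bar> \<le> \<bar>g t\<bar>) \<Longrightarrow> rms n f \<le> rms n g"
  unfolding rms_def by (intro real_sqrt_le_mono avg_mono) (auto simp: abs_le_square_iff)

lemma rms_cong: "(\<And>t. t \<in> {1..n} \<Longrightarrow> f t = g t) \<Longrightarrow> rms n f = rms n g"
  unfolding rms_def by (intro arg_cong[of _ _ sqrt] avg_cong) auto

lemma rms_sum: "finite I \<Longrightarrow> rms n (\<lambda>t. \<Sum>l\<in>I. f l t) \<le> (\<Sum>l\<in>I. rms n (f l))"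
proof (induction I rule: finite_induct)
  case empty then show ?case by (simp add: rms_def avg_def)
next
  case (insert x F)
  then show ?case using rms_triangle[of n "f x" "\<lambda>t. \<Sum>l\<in>F. f l t"] by simp
qed

lemma avg_cauchy_schwarz: "\<bar>avg n (\<lambda>t. f t * g t)\<bar> \<le> rms n f * rms n g"
proof -
  have "\<bar>avg n (\<lambda>t. f t * g t)\<bar> \<le> (\<Sum>t=1..n. \<bar>f t\<bar> * \<bar>g t\<bar>) / real n"
    unfolding avg_def abs_divide by (simp add: divide_right_mono order_trans[OF sum_abs] abs_mult)
  also have "\<dots> \<le> (L2_set f {1..n} * L2_set g {1..n}) / real n"
    by (intro divide_right_mono L2_set_mult_ineq) auto
  also have "\<dots> = rms n f * rms n g" by (simp add: rms_eq_L2_set)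
  finally show ?thesis .
qed

lemma rms_le_avg4:
  assumes "1 \<le> n" "avg n (\<lambda>t. (f t) ^ 4) \<le> K" shows "(avg n (\<lambda>t. (f t)\<^sup>2))\<^sup>2 \<le> K"
proof -
  have "\<bar>avg n (\<lambda>t. (f t)\<^sup>2 * 1)\<bar> \<le> rms n (\<lambda>t. (f t)\<^sup>2) * rms n (\<lambda>_. 1)"
    by (rule avg_cauchy_schwarz)
  then have "(\<bar>avg n (\<lambda>t. (f t)\<^sup>2)\<bar>)\<^sup>2 \<le> (rms n (\<lambda>t. (f t)\<^sup>2))\<^sup>2"
    using assms(1) by (intro power_mono) (auto simp: rms_def avg_const)
  then show ?thesis using assms(2) by (simp add: rms_sq flip: power_mult)
qed

lemma avg_prod_sq_le:
  assumes "avg n (\<lambda>t. (f t) ^ 4) \<le> K1" "avg n (\<lambda>t. (g t) ^ 4) \<le> K2"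
  shows "(avg n (\<lambda>t. (f t)\<^sup>2 * (g t)\<^sup>2))\<^sup>2 \<le> K1 * K2"
proof -
  have "\<bar>avg n (\<lambda>t. (f t)\<^sup>2 * (g t)\<^sup>2)\<bar>\<^sup>2 \<le> (rms n (\<lambda>t. (f t)\<^sup>2) * rms n (\<lambda>t. (g t)\<^sup>2))\<^sup>2"
    by (intro power_mono avg_cauchy_schwarz) auto
  also have "\<dots> = avg n (\<lambda>t. (f t) ^ 4) * avg n (\<lambda>t. (g t) ^ 4)"
    by (simp add: power_mult_distrib rms_sq flip: power_mult)
  also have "\<dots> \<le> K1 * K2" using assms by (intro mult_mono order_trans[OF avg_nonneg assms(1)]) (auto intro: avg_nonneg)
  finally show ?thesis by simp
qed

lemma l1_nonneg [simp]: "0 \<le> l1 V d" by (simp add: l1_def sum_nonneg)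

lemma l1_triangle_diff: "l1 V (\<lambda>l. f l - g l) \<le> l1 V f + l1 V g"
  unfolding l1_def sum.distrib[symmetric] by (intro sum_mono) auto

lemma moment_bound_ge_1: "1 \<le> moment_bound n V p"
  by (simp add: moment_bound_def)

lemma avg4_le_moment_bound:
  assumes "1 \<le> n" "finite V" "l \<in> aug_set V"
  shows "avg n (\<lambda>t. (aug (p t) l) ^ 4) \<le> (moment_bound n V p)\<^sup>2"
proof (cases l)
  case None
  then show ?thesis using assms moment_bound_ge_1[of n V p] by (simp add: avg_const)
next
  case (Some j)
  then have "j \<in> V" using assms by simp
  then show ?thesis using Some assms(2) by (auto simp: moment_bound_def le_max_iff_disj intro!: Max_ge)
qed

lemma rms_aug_prod_le:
  assumes "1 \<le> n" "finite V" "l \<in> aug_set V" "j \<in> aug_set V"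
  shows "rms n (\<lambda>t. aug (p t) l * aug (p t) j) \<le> moment_bound n V p"
proof -
  have "avg n (\<lambda>t. (aug (p t) l * aug (p t) j)\<^sup>2)
      \<le> avg n (\<lambda>t. (1/2) * ((aug (p t) l) ^ 4 + (aug (p t) j) ^ 4))"
  proof (rule avg_mono)
    fix t
    show "(aug (p t) l * aug (p t) j)\<^sup>2 \<le> (1/2) * ((aug (p t) l) ^ 4 + (aug (p t) j) ^ 4)"
      using zero_le_power2[of "(aug (p t) l)\<^sup>2 - (aug (p t) j)\<^sup>2"]
      by (simp add: power2_diff power_mult_distrib flip: power_mult)
  qed
  also have "\<dots> \<le> (moment_bound n V p)\<^sup>2"
    unfolding avg_cmult avg_add
    using add_mono[OF avg4_le_moment_bound[OF assms(1-3), of p] avg4_le_moment_bound[OF assms(1,2,4), of p]]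
    by simp
  finally show ?thesis unfolding rms_def using moment_bound_ge_1[of n V p]
    by (intro real_le_lsqrt) auto
qed

text \<open>The scale in the second constraint of the first step is thus Lipschitz in the row, for
  the l1 norm and with constant \<open>moment_bound\<close>. The weight \<open>tau\<close> is a
  quarter of the reciprocal of this constant.\<close>

lemma rms_lin_aug_le:
  assumes "1 \<le> n" "finite V" "j \<in> aug_set V"
  shows "rms n (\<lambda>t. lin V d (p t) * aug (p t) j) \<le> moment_bound n V p * l1 V d"
proof -
  have "rms n (\<lambda>t. lin V d (p t) * aug (p t) j) = rms n (\<lambda>t. \<Sum>l\<in>aug_set V. d l * (aug (p t) l * aug (p t) j))"
    by (simp add: lin_def sum_distrib_right mult.assoc)
  also have "\<dots> \<le> (\<Sum>l\<in>aug_set V. \<bar>d l\<bar> * rms n (\<lambda>t. aug (p t) l * aug (p t) j))"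
    using rms_sum[of "aug_set V" n "\<lambda>l t. d l * (aug (p t) l * aug (p t) j)"] assms by (simp add: rms_cmult)
  also have "\<dots> \<le> (\<Sum>l\<in>aug_set V. \<bar>d l\<bar> * moment_bound n V p)"
    using assms by (intro sum_mono mult_left_mono rms_aug_prod_le) auto
  finally show ?thesis by (simp add: l1_def sum_distrib_left mult.commute)
qed

text \<open>One row of the first step: \<open>e\<close> is the noise, \<open>b\<close> the true row and \<open>d\<close> the error of the
  minimiser; \<open>Z\<close> is the smallest admissible noise level and \<open>(1 + \<eta>) Z\<close> the one used for the truth.\<close>

locale step1_row =
  fixes n :: nat and V :: "'a set" and p :: "nat \<Rightarrow> 'a \<Rightarrow> real"
    and e :: "nat \<Rightarrow> real" and b d :: "'a option \<Rightarrow> real" and zh Z \<eta> lam :: real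
  assumes n: "1 \<le> n" and fin: "finite V" and lam: "0 \<le> lam" and eta: "0 \<le> \<eta>" "\<eta> \<le> 1"
    and Z: "\<exists>j\<in>aug_set V. Z = rms n (\<lambda>t. e t * aug (p t) j)"
    and truth: "\<And>j. j \<in> aug_set V \<Longrightarrow> \<bar>avg n (\<lambda>t. e t * aug (p t) j)\<bar> \<le> lam * ((1 + \<eta>) * Z)"
    and feas1: "\<And>j. j \<in> aug_set V \<Longrightarrow> \<bar>avg n (\<lambda>t. (e t + lin V d (p t)) * aug (p t) j)\<bar> \<le> lam * zh"
    and feas2: "\<And>j. j \<in> aug_set V \<Longrightarrow> rms n (\<lambda>t. (e t + lin V d (p t)) * aug (p t) j) \<le> zh"
    and opt: "l1 V (\<lambda>l. b l + d l) + tau n V p * zh \<le> l1 V b + tau n V p * ((1 + \<eta>) * Z)"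
begin

abbreviation "T4 \<equiv> moment_bound n V p"

lemma tau_pos: "0 < tau n V p" and tau_le: "tau n V p \<le> 1/4"
  and tau_moment: "tau n V p * T4 = 1/4"
  using moment_bound_ge_1[of n V p] by (auto simp: tau_def field_simps)

lemma Z_nonneg: "0 \<le> Z" using Z by auto

lemma zh_nonneg: "0 \<le> zh" 
  by (rule order_trans[OF rms_nonneg feas2[OF None_in_aug_set]])

text \<open>Read off from optimality: the term of \<open>zh\<close> is nonnegative and dropped, and
  \<open>tau \<le> 1/4\<close> with \<open>1 + \<eta> \<le> 2\<close> leaves
  \<open>Z / 2\<close>.\<close>

lemma l1_error_le: "l1 V d \<le> 2 * l1 V b + Z / 2"
proof -
  have "l1 V d \<le> l1 V (\<lambda>l. b l + d l) + l1 V b"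
    using l1_triangle_diff[of V "\<lambda>l. b l + d l" b] by simp
  moreover have "0 \<le> tau n V p * zh" using tau_pos zh_nonneg by simp
  moreover have "tau n V p * ((1 + \<eta>) * Z) \<le> (1/4) * (2 * Z)"
    using tau_le tau_pos eta Z_nonneg by (intro mult_mono mult_right_mono) auto
  ultimately show ?thesis using opt by linarith
qed

lemma zh_le: "zh \<le> 4 * T4 * l1 V b + 2 * Z"
proof -
  have "tau n V p * zh \<le> l1 V b + tau n V p * ((1 + \<eta>) * Z)" 
    using opt l1_nonneg[of V "\<lambda>l. b l + d l"] by linarith
  then have "T4 * (tau n V p * zh) \<le> T4 * (l1 V b + tau n V p * ((1 + \<eta>) * Z))"
    using moment_bound_ge_1[of n V p] by (intro mult_left_mono) auto
  also have "\<dots> = T4 * l1 V b + (tau n V p * T4) * ((1 + \<eta>) * Z)" by (simp add: algebra_simps)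
  also have "T4 * (tau n V p * zh) = (tau n V p * T4) * zh" by simp
  finally have "zh \<le> 4 * T4 * l1 V b + (1 + \<eta>) * Z" unfolding tau_moment by linarith
  moreover have "(1 + \<eta>) * Z \<le> 2 * Z" using eta Z_nonneg by (intro mult_right_mono) auto
  ultimately show ?thesis by linarith
qed

text \<open>The minimiser can undercut the noise level \<open>Z\<close> only by moving the row, and
  then by at most \<open>T4 * l1 V d\<close>. Since \<open>tau * T4 = 1/4\<close>, the gain in the
  objective is at most a quarter of \<open>l1 V d\<close>, apart from the inflation by
  \<open>\<eta>\<close>.\<close>

lemma Z_minus_zh: "tau n V p * ((1 + \<eta>) * Z - zh) \<le> \<eta> * Z / 4 + l1 V d / 4"
proof -
  obtain j where j: "j \<in> aug_set V" "Z = rms n (\<lambda>t. e t * aug (p t) j)" using Z by blast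
  have "Z - rms n (\<lambda>t. lin V d (p t) * aug (p t) j) \<le> rms n (\<lambda>t. e t * aug (p t) j + lin V d (p t) * aug (p t) j)"
    unfolding j(2) by (rule rms_diff)
  also have "\<dots> \<le> zh" using feas2[OF j(1)] by (simp add: distrib_right)
  finally have "(1 + \<eta>) * Z - zh \<le> \<eta> * Z + T4 * l1 V d"
    using rms_lin_aug_le[OF n fin j(1), of d p] by (simp add: algebra_simps)
  then have "tau n V p * ((1 + \<eta>) * Z - zh) \<le> tau n V p * (\<eta> * Z) + (tau n V p * T4) * l1 V d"
    unfolding mult.assoc distrib_left[symmetric] by (rule mult_left_mono) (simp add: tau_pos less_imp_le)
  also have "tau n V p * (\<eta> * Z) \<le> (1/4) * (\<eta> * Z)"
    using tau_le eta Z_nonneg by (intro mult_right_mono) auto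
  finally show ?thesis unfolding tau_moment by simp
qed

text \<open>Splitting optimality over \<open>T\<close> and its complement gives that 3/4 of
  \<open>l1 V d\<close> is at most twice the mass of \<open>d\<close> on \<open>T\<close>, plus
  \<open>2 * r + \<eta> * Z / 4\<close>; the quarter conceded to the noise level by
  \<open>Z_minus_zh\<close> has been moved to the left. Dividing by 3/4 and rounding up yields the
  constants.\<close>

lemma cone:
  assumes T: "T \<subseteq> aug_set V" and r: "(\<Sum>l\<in>aug_set V - T. \<bar>b l\<bar>) \<le> r"
  shows "l1 V d \<le> 3 * (\<Sum>l\<in>T. \<bar>d l\<bar>) + (3 * r + \<eta> * Z)"
proof -
  have split: "l1 V f = (\<Sum>l\<in>T. \<bar>f l\<bar>) + (\<Sum>l\<in>aug_set V - T. \<bar>f l\<bar>)" for f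
    unfolding l1_def using T fin by (subst sum.subset_diff[OF T]) auto
  have "(\<Sum>l\<in>T. \<bar>b l\<bar>) \<le> (\<Sum>l\<in>T. \<bar>b l + d l\<bar>) + (\<Sum>l\<in>T. \<bar>d l\<bar>)"
    unfolding sum.distrib[symmetric] by (intro sum_mono) auto
  moreover have "(\<Sum>l\<in>aug_set V - T. \<bar>d l\<bar>) \<le> (\<Sum>l\<in>aug_set V - T. \<bar>b l + d l\<bar>) + (\<Sum>l\<in>aug_set V - T. \<bar>b l\<bar>)"
    unfolding sum.distrib[symmetric] by (intro sum_mono) auto
  moreover have "0 \<le> \<eta> * Z" "0 \<le> (\<Sum>l\<in>T. \<bar>d l\<bar>)" "0 \<le> (\<Sum>l\<in>aug_set V - T. \<bar>b l\<bar>)"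
    using eta Z_nonneg by (auto intro: sum_nonneg)
  ultimately show ?thesis
    using opt Z_minus_zh[unfolded right_diff_distrib] r split[of b] split[of d] split[of "\<lambda>l. b l + d l"]
    by linarith
qed

text \<open>Both the truth and the minimiser nearly annihilate the correlations with the regressors,
  so by difference the fitted error does too. Pairing these correlations with \<open>d\<close> is
  Hoelder's inequality for the maximum norm and the l1 norm.\<close>

lemma quad_form_error:
  "avg n (\<lambda>t. (lin V d (p t))\<^sup>2) \<le> l1 V d * (lam * (4 * T4 * l1 V b + 4 * Z))"
proof -
  let ?a = "lam * (4 * T4 * l1 V b + 4 * Z)"
  have 1: "\<bar>avg n (\<lambda>t. lin V d (p t) * aug (p t) j)\<bar> \<le> ?a" if "j \<in> aug_set V" for j
  proof -
    have "avg n (\<lambda>t. (e t + lin V d (p t)) * aug (p t) j)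
        = avg n (\<lambda>t. e t * aug (p t) j) + avg n (\<lambda>t. lin V d (p t) * aug (p t) j)"
      by (simp add: distrib_right avg_add)
    then have "\<bar>avg n (\<lambda>t. lin V d (p t) * aug (p t) j)\<bar> \<le> lam * zh + lam * ((1 + \<eta>) * Z)"
      using feas1[OF that] truth[OF that] by linarith
    also have "\<dots> \<le> lam * (4 * T4 * l1 V b + 2 * Z) + lam * (2 * Z)"
      using zh_le lam eta Z_nonneg by (intro add_mono mult_left_mono mult_right_mono) auto
    finally show ?thesis by (simp add: algebra_simps)
  qed
  have "avg n (\<lambda>t. (lin V d (p t))\<^sup>2) = avg n (\<lambda>t. \<Sum>l\<in>aug_set V. d l * (lin V d (p t) * aug (p t) l))"
  proof (rule avg_cong)
    fix t
    have "(lin V d (p t))\<^sup>2 = lin V d (p t) * (\<Sum>l\<in>aug_set V. d l * aug (p t) l)"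
      by (simp add: power2_eq_square lin_def)
    then show "(lin V d (p t))\<^sup>2 = (\<Sum>l\<in>aug_set V. d l * (lin V d (p t) * aug (p t) l))"
      by (simp add: sum_distrib_left mult.left_commute)
  qed
  also have "\<dots> = (\<Sum>l\<in>aug_set V. d l * avg n (\<lambda>t. lin V d (p t) * aug (p t) l))"
    by (simp add: avg_sum avg_cmult)
  also have "\<dots> \<le> (\<Sum>l\<in>aug_set V. \<bar>d l\<bar> * ?a)"
  proof (intro sum_mono)
    fix l assume l: "l \<in> aug_set V"
    have "d l * avg n (\<lambda>t. lin V d (p t) * aug (p t) l) \<le> \<bar>d l\<bar> * \<bar>avg n (\<lambda>t. lin V d (p t) * aug (p t) l)\<bar>"
      by (simp flip: abs_mult)
    also have "\<dots> \<le> \<bar>d l\<bar> * ?a" using 1[OF l] by (intro mult_left_mono) auto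
    finally show "d l * avg n (\<lambda>t. lin V d (p t) * aug (p t) l) \<le> \<bar>d l\<bar> * ?a" .
  qed
  finally show ?thesis by (simp add: l1_def sum_distrib_right)
qed

end

section \<open>Separation of the first-step program into rows\<close>

lemma resid_eq:
  assumes "finite V" "y t k = v k - (\<Sum>j\<in>V. A k j * p t j) + eps t k"
  shows "resid V p y W vh t k = eps t k + lin V (\<lambda>l. stack W vh l k - stack A v l k) (p t)"
  using assms by (simp add: resid_def lin_def sum_aug_set stack_def sum_subtractf algebra_simps)

lemma l1_stack: "finite V \<Longrightarrow> l1 V (\<lambda>l. stack W v l k) = \<bar>v k\<bar> + (\<Sum>j\<in>V. \<bar>W k j\<bar>)"
  by (simp add: l1_def sum_aug_set stack_def)

text \<open>Objective and constraints decouple over the rows, so the competitor differs from the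
  minimiser in row \<open>k\<close> only, where it is the truth. Its noise level is inflated by
  \<open>1 + \<eta>\<close> because the self-normalised bound for the noise holds only up to this
  factor.\<close>

lemma step1_estimator_row:
  fixes Z :: "'a \<Rightarrow> real"
  assumes est: "step1_estimator n V p y W vh"
    and n: "1 \<le> n" and fin: "finite V" and pen: "0 \<le> pen n V" and eta: "0 \<le> \<eta>" "\<eta> \<le> 1"
    and model: "\<And>t k. t \<in> {1..n} \<Longrightarrow> k \<in> V \<Longrightarrow> y t k = v k - (\<Sum>j\<in>V. A k j * p t j) + eps t k"
    and Z: "\<And>k. Z k = (MAX j\<in>aug_set V. rms n (\<lambda>t. eps t k * aug (p t) j))"
    and truth: "\<And>k j. k \<in> V \<Longrightarrow> j \<in> aug_set V \<Longrightarrow> \<bar>avg n (\<lambda>t. eps t k * aug (p t) j)\<bar> \<le> pen n V * ((1 + \<eta>) * Z k)"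
    and k: "k \<in> V"
  shows "\<exists>zh. step1_row n V p (\<lambda>t. eps t k) (\<lambda>l. stack A v l k)
    (\<lambda>l. stack W vh l k - stack A v l k) zh (Z k) \<eta> (pen n V)"
proof -
  obtain z where z: "is_arg_min (step1_objective n V p) (step1_feasible n V p y) (W, vh, z)"
    using est by (auto simp: step1_estimator_def)
  let ?D = "\<lambda>l. stack W vh l k - stack A v l k"
  have feas: "step1_feasible n V p y (W, vh, z)" using z by (simp add: is_arg_min_def)
  have Zle: "rms n (\<lambda>t. eps t k * aug (p t) j) \<le> Z k" if "j \<in> aug_set V" for j
    unfolding Z using that fin by (intro Max_ge) auto
  have "Z k \<in> (\<lambda>j. rms n (\<lambda>t. eps t k * aug (p t) j)) ` aug_set V"
    unfolding Z using fin by (intro Max_in) auto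
  then have Zex: "\<exists>j\<in>aug_set V. Z k = rms n (\<lambda>t. eps t k * aug (p t) j)" by (auto simp: image_iff)
  then have Z0: "0 \<le> Z k" by auto
  define W' v' z' where "W' = W(k := A k)" and "v' = vh(k := v k)" and "z' = z(k := (1 + \<eta>) * Z k)"
  have "step1_feasible n V p y (W', v', z')"
    unfolding step1_feasible_def prod.case
  proof (intro ballI)
    fix k' j assume kj: "k' \<in> V" "j \<in> aug_set V"
    show "\<bar>avg n (\<lambda>t. resid V p y W' v' t k' * aug (p t) j)\<bar> \<le> pen n V * z' k' \<and>
         sqrt (avg n (\<lambda>t. (resid V p y W' v' t k')\<^sup>2 * (aug (p t) j)\<^sup>2)) \<le> z' k'"
    proof (cases "k' = k")
      case False
      then have "resid V p y W' v' t k' = resid V p y W vh t k'" for t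
        by (simp add: resid_def W'_def v'_def)
      then show ?thesis using feas kj False by (simp add: step1_feasible_def z'_def)
    next
      case True
      have r: "resid V p y W' v' t k = eps t k" if "t \<in> {1..n}" for t
        using model[OF that k] by (simp add: resid_def W'_def v'_def)
      have 1: "avg n (\<lambda>t. resid V p y W' v' t k * aug (p t) j) = avg n (\<lambda>t. eps t k * aug (p t) j)"
        by (rule avg_cong) (simp add: r)
      have 2: "avg n (\<lambda>t. (resid V p y W' v' t k)\<^sup>2 * (aug (p t) j)\<^sup>2) = avg n (\<lambda>t. (eps t k * aug (p t) j)\<^sup>2)"
        by (rule avg_cong) (simp add: r power_mult_distrib)
      have "rms n (\<lambda>t. eps t k * aug (p t) j) \<le> (1 + \<eta>) * Z k"
        using Zle[OF kj(2)] mult_right_mono[of 1 "1 + \<eta>" "Z k"] eta Z0 by simp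
      then show ?thesis using truth[OF k kj(2)] True 1 2 by (simp add: z'_def rms_def)
    qed
  qed
  then have "step1_objective n V p (W, vh, z) \<le> step1_objective n V p (W', v', z')"
    using z unfolding is_arg_min_def by (meson not_le)
  moreover have "step1_objective n V p (W, vh, z) = (l1 V (\<lambda>l. stack W vh l k) + tau n V p * z k)
      + (\<Sum>k\<in>V - {k}. (\<bar>vh k\<bar> + (\<Sum>j\<in>V. \<bar>W k j\<bar>)) + tau n V p * z k)"
    using fin k by (simp add: step1_objective_def sum.remove[of V k] l1_stack)
  moreover have "step1_objective n V p (W', v', z') = (l1 V (\<lambda>l. stack A v l k) + tau n V p * ((1 + \<eta>) * Z k))
      + (\<Sum>k\<in>V - {k}. (\<bar>vh k\<bar> + (\<Sum>j\<in>V. \<bar>W k j\<bar>)) + tau n V p * z k)"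
    using fin k by (simp add: step1_objective_def sum.remove[of V k] l1_stack W'_def v'_def z'_def)
  ultimately have opt: "l1 V (\<lambda>l. stack W vh l k) + tau n V p * z k \<le> l1 V (\<lambda>l. stack A v l k) + tau n V p * ((1 + \<eta>) * Z k)"
    by linarith
  have r: "resid V p y W vh t k = eps t k + lin V ?D (p t)" if "t \<in> {1..n}" for t
    by (rule resid_eq[where A=A and v=v and eps=eps]) (use fin model[OF that k] in auto)
  have f: "\<bar>avg n (\<lambda>t. resid V p y W vh t k * aug (p t) j)\<bar> \<le> pen n V * z k \<and>
         sqrt (avg n (\<lambda>t. (resid V p y W vh t k)\<^sup>2 * (aug (p t) j)\<^sup>2)) \<le> z k" if "j \<in> aug_set V" for j
    using feas k that by (auto simp: step1_feasible_def)
  have a1: "avg n (\<lambda>t. resid V p y W vh t k * aug (p t) j) = avg n (\<lambda>t. (eps t k + lin V ?D (p t)) * aug (p t) j)" for j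
    by (rule avg_cong) (simp add: r)
  have a2: "avg n (\<lambda>t. (resid V p y W vh t k)\<^sup>2 * (aug (p t) j)\<^sup>2) = avg n (\<lambda>t. ((eps t k + lin V ?D (p t)) * aug (p t) j)\<^sup>2)" for j
    by (rule avg_cong) (simp add: r power_mult_distrib)
  have "step1_row n V p (\<lambda>t. eps t k) (\<lambda>l. stack A v l k) ?D (z k) (Z k) \<eta> (pen n V)"
    using n fin pen eta Zex truth[OF k] f opt unfolding a1 a2 by unfold_locales (auto simp: rms_def)
  then show ?thesis by blast
qed

section \<open>The second step\<close>

definition norm4 :: "nat \<Rightarrow> (nat \<Rightarrow> real) \<Rightarrow> real" where
  "norm4 n f = root 4 (avg n (\<lambda>t. \<bar>f t\<bar> ^ 4))"

text \<open>\<open>slack2\<close> is the least feasible \<open>z k\<close> for a given row of \<open>\<Psi>\<close>, so that the second step minimises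
  \<open>cost2\<close> separately over the rows.\<close>

definition slack2 :: "nat \<Rightarrow> 'a set \<Rightarrow> (nat \<Rightarrow> 'a \<Rightarrow> real) \<Rightarrow> 'a option \<Rightarrow> ('a option \<Rightarrow> real) \<Rightarrow> real" where
  "slack2 n V p k \<psi> = (MAX j\<in>aug_set V. max (\<bar>avg n (\<lambda>t. lin V \<psi> (p t) * aug (p t) j) - delta k j\<bar> / pen n V)
      (rms n (\<lambda>t. lin V \<psi> (p t) * aug (p t) j - delta k j)))"

definition cost2 :: "nat \<Rightarrow> 'a set \<Rightarrow> (nat \<Rightarrow> 'a \<Rightarrow> real) \<Rightarrow> 'a option \<Rightarrow> ('a option \<Rightarrow> real) \<Rightarrow> real" where
  "cost2 n V p k \<psi> = norm4 n (\<lambda>t. lin V \<psi> (p t)) + slack2 n V p k \<psi>"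

lemma norm4_nonneg [simp]: "0 \<le> norm4 n f"
  by (simp add: norm4_def avg_nonneg)

lemma norm4_power: "(norm4 n f) ^ 4 = avg n (\<lambda>t. (f t) ^ 4)"
  by (simp add: norm4_def avg_nonneg)

lemma norm4_cmult: "norm4 n (\<lambda>t. a * f t) = \<bar>a\<bar> * norm4 n f"
proof (rule power_eq_imp_eq_base)
  show "norm4 n (\<lambda>t. a * f t) ^ 4 = (\<bar>a\<bar> * norm4 n f) ^ 4"
    by (simp add: norm4_power power_mult_distrib avg_cmult)
qed auto

lemma rms_le_norm4: assumes "1 \<le> n" shows "rms n f \<le> norm4 n f"
proof -
  have "(rms n f) ^ 4 = ((rms n f)\<^sup>2)\<^sup>2" by (simp flip: power_mult)
  also have "\<dots> \<le> avg n (\<lambda>t. (f t) ^ 4)" unfolding rms_sq by (rule rms_le_avg4[OF assms order_refl])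
  finally show ?thesis unfolding norm4_power[symmetric]
    by (rule power_mono_iff[THEN iffD1, rotated -1]) auto
qed

lemma mat_mult_Sigma_hat:
  "mat_mult (aug_set V) Psi (Sigma_hat n p) k j = avg n (\<lambda>t. lin V (Psi k) (p t) * aug (p t) j)"
  by (simp add: mat_mult_def Sigma_hat_def lin_def sum_distrib_right avg_sum mult.assoc avg_cmult)

lemma slack2_le_iff:
  assumes "finite V" "0 < pen n V"
  shows "slack2 n V p k \<psi> \<le> z \<longleftrightarrow> (\<forall>j\<in>aug_set V. \<bar>avg n (\<lambda>t. lin V \<psi> (p t) * aug (p t) j) - delta k j\<bar> \<le> pen n V * z
     \<and> rms n (\<lambda>t. lin V \<psi> (p t) * aug (p t) j - delta k j) \<le> z)"
  using assms by (auto simp: slack2_def pos_divide_le_eq mult.commute)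

lemma slack2_nonneg: "finite V \<Longrightarrow> 0 < pen n V \<Longrightarrow> 0 \<le> slack2 n V p k \<psi>"
  using slack2_le_iff[of V n p k \<psi> "slack2 n V p k \<psi>"] rms_nonneg None_in_aug_set order_trans by blast

lemma step2_estimator_row:
  assumes est: "step2_estimator n V p Psi" and fin: "finite V" and pen: "0 < pen n V" and k: "k \<in> aug_set V"
  shows "cost2 n V p k (Psi k) \<le> cost2 n V p k \<psi>"
proof -
  obtain z where z: "is_arg_min (step2_objective n V p) (step2_feasible n V p) (z, Psi)"
    using est by (auto simp: step2_estimator_def)
  have feas: "step2_feasible n V p (z, Psi) \<longleftrightarrow> (\<forall>k\<in>aug_set V. slack2 n V p k (Psi k) \<le> z k)" for z Psi
    unfolding step2_feasible_def prod.case slack2_le_iff[OF fin pen] mat_mult_Sigma_hat row_aug_eq_lin rms_def ..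
  have zf: "\<forall>k\<in>aug_set V. slack2 n V p k (Psi k) \<le> z k" using z feas by (simp add: is_arg_min_def)
  define P' z' where "P' = Psi(k := \<psi>)" and "z' = z(k := slack2 n V p k \<psi>)"
  have "step2_feasible n V p (z', P')" unfolding feas using zf by (simp add: P'_def z'_def)
  then have "step2_objective n V p (z, Psi) \<le> step2_objective n V p (z', P')"
    using z unfolding is_arg_min_def by (meson not_le)
  moreover have "step2_objective n V p (z, Psi) = (norm4 n (\<lambda>t. lin V (Psi k) (p t)) + z k)
      + (\<Sum>k\<in>aug_set V - {k}. root 4 (avg n (\<lambda>t. \<bar>lin V (Psi k) (p t)\<bar> ^ 4)) + z k)"
    using fin k by (simp add: step2_objective_def sum.remove[of "aug_set V" k] norm4_def row_aug_eq_lin)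
  moreover have "step2_objective n V p (z', P') = (norm4 n (\<lambda>t. lin V \<psi> (p t)) + slack2 n V p k \<psi>)
      + (\<Sum>k\<in>aug_set V - {k}. root 4 (avg n (\<lambda>t. \<bar>lin V (Psi k) (p t)\<bar> ^ 4)) + z k)"
    using fin k by (simp add: step2_objective_def sum.remove[of "aug_set V" k] norm4_def row_aug_eq_lin P'_def z'_def)
  ultimately have "norm4 n (\<lambda>t. lin V (Psi k) (p t)) + z k \<le> cost2 n V p k \<psi>" by (simp add: cost2_def)
  then show ?thesis using zf k by (force simp: cost2_def)
qed

lemma lin_add: "lin V (\<lambda>l. f l + g l) x = lin V f x + lin V g x"
  by (simp add: lin_def distrib_right sum.distrib)

lemma lin_cmult: "lin V (\<lambda>l. a * f l) x = a * lin V f x"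
  by (simp add: lin_def sum_distrib_left mult.assoc)

text \<open>Both constraints are seminorms of affine functions of the row, hence convex; midpoints
  are all that the comparison of two near-minimisers uses.\<close>

lemma slack2_midpoint:
  assumes "finite V" "0 < pen n V"
  shows "slack2 n V p k (\<lambda>l. 1/2 * (f l + g l)) \<le> (slack2 n V p k f + slack2 n V p k g) / 2"
proof (subst slack2_le_iff[OF assms], intro ballI)
  fix j assume j: "j \<in> aug_set V"
  let ?z = "\<lambda>h. slack2 n V p k h"
  let ?a = "\<lambda>h. avg n (\<lambda>t. lin V h (p t) * aug (p t) j)"
  let ?r = "\<lambda>h t. lin V h (p t) * aug (p t) j - delta k j"
  let ?m = "\<lambda>l. 1/2 * (f l + g l)"
  have b: "\<bar>?a h - delta k j\<bar> \<le> pen n V * ?z h" "rms n (?r h) \<le> ?z h" for h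
    using slack2_le_iff[OF assms, of p k h "?z h"] j by auto
  have l: "lin V ?m x = 1/2 * (lin V f x + lin V g x)" for x
    by (simp only: lin_cmult lin_add)
  have "?a ?m = 1/2 * (?a f + ?a g)"
    by (simp only: l flip: avg_add avg_cmult) (simp only: distrib_right mult.assoc)
  then have 1: "\<bar>?a ?m - delta k j\<bar> \<le> pen n V * ((?z f + ?z g) / 2)"
    using b(1)[of f] b(1)[of g] by (simp add: distrib_left add_divide_distrib)
  have "rms n (?r ?m) = rms n (\<lambda>t. 1/2 * (?r f t + ?r g t))"
    unfolding l by (rule rms_cong) (simp add: algebra_simps)
  also have "\<dots> \<le> (rms n (?r f) + rms n (?r g)) / 2"
    using rms_triangle[of n "?r f" "?r g"] by (simp only: rms_cmult) simp
  also have "\<dots> \<le> (?z f + ?z g) / 2" using b(2)[of f] b(2)[of g] by simp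
  finally show "\<bar>?a ?m - delta k j\<bar> \<le> pen n V * ((?z f + ?z g) / 2) \<and> rms n (?r ?m) \<le> (?z f + ?z g) / 2"
    using 1 by simp
qed

text \<open>The slack is convex, so near-minimisers of the cost nearly attain equality in Minkowski's
  inequality for the strictly convex fourth-power norm, which forces them to be nearly proportional.\<close>

lemma near_minimisers_proportional:
  assumes fin: "finite V" and pen: "0 < pen n V"
    and min: "\<And>\<psi>. cost2 n V p k \<psi>0 \<le> cost2 n V p k \<psi>"
    and near: "cost2 n V p k \<psi>1 \<le> cost2 n V p k \<psi>0 + \<epsilon>"
    and w1: "w1 = (\<lambda>t. lin V \<psi>1 (p t))" and w0: "w0 = (\<lambda>t. lin V \<psi>0 (p t))"
    and a: "a = norm4 n w1" and b: "b = norm4 n w0" and ab: "a > 0" "b > 0" "\<epsilon> \<le> a + b"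
  shows "avg n (\<lambda>t. (w1 t / a - w0 t / b) ^ 4) \<le> 16 * \<epsilon> * (1 / a + 1 / b)"
proof -
  \<comment> \<open>The minimum is compared with the cost at the midpoint. By convexity the slacks
    cancel, and what remains is Minkowski's inequality holding with equality up to
    \<open>\<epsilon>\<close>.\<close>
  have "cost2 n V p k \<psi>0 \<le> cost2 n V p k (\<lambda>l. 1/2 * (\<psi>1 l + \<psi>0 l))" by (rule min)
  also have "\<dots> \<le> (norm4 n (\<lambda>t. w1 t + w0 t) + (slack2 n V p k \<psi>1 + slack2 n V p k \<psi>0)) / 2"
  proof -
    have "norm4 n (\<lambda>t. lin V (\<lambda>l. 1/2 * (\<psi>1 l + \<psi>0 l)) (p t)) = \<bar>1/2\<bar> * norm4 n (\<lambda>t. w1 t + w0 t)"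
      unfolding lin_cmult lin_add norm4_cmult w1 w0 ..
    then show ?thesis unfolding cost2_def using slack2_midpoint[OF fin pen, of p k \<psi>1 \<psi>0] by simp
  qed
  finally have "a + b - \<epsilon> \<le> norm4 n (\<lambda>t. w1 t + w0 t)"
    using near by (simp add: cost2_def a b w1 w0)
  then have "(a + b - \<epsilon>) ^ 4 \<le> norm4 n (\<lambda>t. w1 t + w0 t) ^ 4" using ab by (intro power_mono) auto
  then have low: "(a + b - \<epsilon>) ^ 4 \<le> avg n (\<lambda>t. (w1 t + w0 t) ^ 4)" unfolding norm4_power .
  \<comment> \<open>With this weight the convex combination of the two normalised functions is
    \<open>(w1 + w0) / (a + b)\<close>, whose fourth moment is at least
    \<open>(1 - \<epsilon> / (a + b)) ^ 4\<close>, by Bernoulli at least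
    \<open>1 - 4 * \<epsilon> / (a + b)\<close>. The convexity gap turns the missing amount into a
    bound on the distance.\<close>
  define s where "s = a / (a + b)"
  have s: "0 \<le> s" "s \<le> 1" "1 - s = b / (a + b)" using ab by (auto simp: s_def field_simps)
  let ?d = "avg n (\<lambda>t. (w1 t / a - w0 t / b) ^ 4)"
  have one: "avg n (\<lambda>t. (w1 t / a) ^ 4) = 1" "avg n (\<lambda>t. (w0 t / b) ^ 4) = 1"
  proof -
    have "avg n (\<lambda>t. (f t / c) ^ 4) = 1" if "c = norm4 n f" "c > 0" for f c
    proof -
      have "avg n (\<lambda>t. (f t / c) ^ 4) = 1 / c ^ 4 * avg n (\<lambda>t. (f t) ^ 4)"
        unfolding avg_cmult[symmetric] by (rule avg_cong) (simp add: power_divide)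
      then show ?thesis using that by (simp flip: norm4_power)
    qed
    then show "avg n (\<lambda>t. (w1 t / a) ^ 4) = 1" "avg n (\<lambda>t. (w0 t / b) ^ 4) = 1"
      using ab by (auto simp: a b)
  qed
  have "avg n (\<lambda>t. (s * (w1 t / a) + (1 - s) * (w0 t / b)) ^ 4 + s * (1 - s) / 4 * (w1 t / a - w0 t / b) ^ 4)
     \<le> avg n (\<lambda>t. s * (w1 t / a) ^ 4 + (1 - s) * (w0 t / b) ^ 4)"
  proof (rule avg_mono)
    fix t
    show "(s * (w1 t / a) + (1 - s) * (w0 t / b)) ^ 4 + s * (1 - s) / 4 * (w1 t / a - w0 t / b) ^ 4
       \<le> s * (w1 t / a) ^ 4 + (1 - s) * (w0 t / b) ^ 4"
      using quartic_convexity_gap[OF s(1,2), of "w1 t / a" "w0 t / b"] by (simp only: times_divide_eq_left)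
  qed
  then have up: "avg n (\<lambda>t. (s * (w1 t / a) + (1 - s) * (w0 t / b)) ^ 4) + s * (1 - s) / 4 * ?d \<le> 1"
    unfolding avg_add avg_cmult one by simp
  have "s * (w1 t / a) + (1 - s) * (w0 t / b) = 1 / (a + b) * (w1 t + w0 t)" for t
    using ab unfolding s(3) unfolding s_def by (simp add: add_divide_distrib)
  then have "avg n (\<lambda>t. (s * (w1 t / a) + (1 - s) * (w0 t / b)) ^ 4) = (1 / (a + b)) ^ 4 * avg n (\<lambda>t. (w1 t + w0 t) ^ 4)"
    by (simp add: power_mult_distrib power_divide avg_cmult[of n "1 / (a + b) ^ 4", simplified])
  also have "\<dots> \<ge> (1 / (a + b)) ^ 4 * (a + b - \<epsilon>) ^ 4"
    using low by (intro mult_left_mono) auto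
  also have "(1 / (a + b)) ^ 4 * (a + b - \<epsilon>) ^ 4 = (1 + - (\<epsilon> / (a + b))) ^ 4"
    using ab by (simp add: field_simps flip: power_mult_distrib)
  also have "\<dots> \<ge> 1 + real 4 * (- (\<epsilon> / (a + b)))"
    using ab by (intro Bernoulli_inequality) (auto simp: field_simps)
  finally have "s * (1 - s) / 4 * ?d \<le> 4 * \<epsilon> / (a + b)" using up by simp
  moreover have "s * (1 - s) = a * b / (a + b)\<^sup>2" using s(3) by (simp add: s_def power2_eq_square)
  ultimately have scaled: "4 * (a + b)\<^sup>2 * (a * b / (a + b)\<^sup>2 / 4 * ?d) \<le> 4 * (a + b)\<^sup>2 * (4 * \<epsilon> / (a + b))"
    by (intro mult_left_mono) auto
  have cancel: "4 * c\<^sup>2 * (x / c\<^sup>2 / 4 * D) = D * x" "4 * c\<^sup>2 * (4 * \<epsilon> / c) = 16 * \<epsilon> * c" if "c > 0" for c x D :: real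
    using that by (simp_all add: power2_eq_square)
  have "0 < a + b" using ab by simp
  from scaled[unfolded cancel[OF this]] have "?d * (a * b) \<le> 16 * \<epsilon> * (a + b)" .
  then have "?d \<le> 16 * \<epsilon> * ((a + b) / (a * b))" using ab by (simp add: pos_le_divide_eq)
  also have "(a + b) / (a * b) = 1 / a + 1 / b" using ab by (simp add: field_simps)
  finally show ?thesis by simp
qed

lemma tendsto_Max:
  fixes f :: "'i \<Rightarrow> 'b \<Rightarrow> real"
  assumes "finite I" "I \<noteq> {}" "\<And>i. i \<in> I \<Longrightarrow> (f i \<longlongrightarrow> l i) F"
  shows "((\<lambda>x. MAX i\<in>I. f i x) \<longlongrightarrow> (MAX i\<in>I. l i)) F"
  using assms
proof (induction rule: finite_ne_induct)
  case (insert i I)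
  then show ?case by (simp add: tendsto_max)
qed simp

lemma tendsto_avg: "(\<And>t. t \<in> {1..n} \<Longrightarrow> (f t \<longlongrightarrow> l t) F) \<Longrightarrow> ((\<lambda>x. avg n (\<lambda>t. f t x)) \<longlongrightarrow> avg n l) F"
  unfolding avg_def by (cases "n = 0") (auto intro!: tendsto_intros)

lemma tendsto_cost2:
  assumes "finite V" "0 < pen n V" "\<And>l. l \<in> aug_set V \<Longrightarrow> ((\<lambda>m. \<psi> m l) \<longlongrightarrow> \<psi>0 l) F"
  shows "((\<lambda>m. cost2 n V p k (\<psi> m)) \<longlongrightarrow> cost2 n V p k \<psi>0) F"
proof -
  have l: "((\<lambda>m. lin V (\<psi> m) x) \<longlongrightarrow> lin V \<psi>0 x) F" for x
    unfolding lin_def using assms(3) by (intro tendsto_intros)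
  show ?thesis unfolding cost2_def slack2_def norm4_def rms_def
    using assms(1,2) by (intro tendsto_intros tendsto_Max tendsto_max tendsto_avg l) auto
qed

text \<open>Probability statements see the covariates only after restriction to the periods
  \<open>{1..n}\<close> and the agents in \<open>V\<close>. This lemma and
  \<open>unit_min_cong\<close> connect the restricted functions with the original ones.\<close>

lemma cost2_cong:
  assumes "\<And>t j. t \<in> {1..n} \<Longrightarrow> j \<in> V \<Longrightarrow> p t j = q t j"
  shows "cost2 n V p k \<psi> = cost2 n V q k \<psi>"
    and "t \<in> {1..n} \<Longrightarrow> lin V \<psi> (p t) = lin V \<psi> (q t)"
proof -
  have a: "aug (p t) l = aug (q t) l" if "t \<in> {1..n}" "l \<in> aug_set V" for t l
    using that assms by (cases l) auto
  then show l: "lin V \<psi> (p t) = lin V \<psi> (q t)" if "t \<in> {1..n}" for t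
    unfolding lin_def using that by (intro sum.cong) auto
  have "norm4 n (\<lambda>t. lin V \<psi> (p t)) = norm4 n (\<lambda>t. lin V \<psi> (q t))"
    unfolding norm4_def using l by (intro arg_cong[of _ _ "root 4"] avg_cong) auto
  moreover have "slack2 n V p k \<psi> = slack2 n V q k \<psi>"
    unfolding slack2_def
  proof (intro arg_cong[of _ _ Max] image_cong refl)
    fix j assume j: "j \<in> aug_set V"
    have "avg n (\<lambda>t. lin V \<psi> (p t) * aug (p t) j) = avg n (\<lambda>t. lin V \<psi> (q t) * aug (q t) j)"
      by (rule avg_cong) (simp add: l a j)
    moreover have "rms n (\<lambda>t. lin V \<psi> (p t) * aug (p t) j - delta k j) = rms n (\<lambda>t. lin V \<psi> (q t) * aug (q t) j - delta k j)"
      by (rule rms_cong) (simp add: l a j)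
    ultimately show "max (\<bar>avg n (\<lambda>t. lin V \<psi> (p t) * aug (p t) j) - delta k j\<bar> / pen n V)
          (rms n (\<lambda>t. lin V \<psi> (p t) * aug (p t) j - delta k j)) =
         max (\<bar>avg n (\<lambda>t. lin V \<psi> (q t) * aug (q t) j) - delta k j\<bar> / pen n V)
          (rms n (\<lambda>t. lin V \<psi> (q t) * aug (q t) j - delta k j))" by simp
  qed
  ultimately show "cost2 n V p k \<psi> = cost2 n V q k \<psi>" by (simp add: cost2_def)
qed

text \<open>A measurable selection of the normalised minimiser: a limit of near-minimisers
  with rational coefficients.\<close>

definition rat_rows :: "'a set \<Rightarrow> ('a option \<Rightarrow> real) set" where
  "rat_rows V = (\<Pi>\<^sub>E l\<in>aug_set V. \<rat>)"

definition rat_row :: "'a set \<Rightarrow> nat \<Rightarrow> 'a option \<Rightarrow> real" where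
  "rat_row V = from_nat_into (rat_rows V)"

definition cost2_inf :: "nat \<Rightarrow> 'a set \<Rightarrow> (nat \<Rightarrow> 'a \<Rightarrow> real) \<Rightarrow> 'a option \<Rightarrow> real" where
  "cost2_inf n V p k = (INF i. cost2 n V p k (rat_row V i))"

text \<open>Taking the least suitable index makes the selection a measurable function of the
  covariates with countably many values.\<close>

definition near_min :: "nat \<Rightarrow> 'a set \<Rightarrow> (nat \<Rightarrow> 'a \<Rightarrow> real) \<Rightarrow> 'a option \<Rightarrow> nat \<Rightarrow> nat" where
  "near_min n V p k m = (LEAST i. cost2 n V p k (rat_row V i) < cost2_inf n V p k + 1 / real (Suc m))"

definition unit_fit :: "nat \<Rightarrow> 'a set \<Rightarrow> (nat \<Rightarrow> 'a \<Rightarrow> real) \<Rightarrow> ('a option \<Rightarrow> real) \<Rightarrow> nat \<Rightarrow> real" where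
  "unit_fit n V p \<psi> t = lin V \<psi> (p t) / norm4 n (\<lambda>t. lin V \<psi> (p t))"

text \<open>Normalised fits are passed to the limit, not coefficient rows: strict convexity
  determines the fit up to a positive factor, but different rows may have the same fit. As
  \<open>lim\<close> is total, measurability holds also where the sequence diverges.\<close>

definition unit_min :: "nat \<Rightarrow> 'a set \<Rightarrow> (nat \<Rightarrow> 'a \<Rightarrow> real) \<Rightarrow> 'a option \<Rightarrow> nat \<Rightarrow> real" where
  "unit_min n V p k t = lim (\<lambda>m. unit_fit n V p (rat_row V (near_min n V p k m)) t)"

lemma rat_rows_countable:
  assumes "finite V" shows "countable (rat_rows V)" "rat_rows V \<noteq> {}" "range (rat_row V) = rat_rows V"
proof -
  show 1: "countable (rat_rows V)" unfolding rat_rows_def using assms by (intro countable_PiE countable_rat) auto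
  show 2: "rat_rows V \<noteq> {}" unfolding rat_rows_def by (auto simp: PiE_eq_empty_iff)
  show "range (rat_row V) = rat_rows V" unfolding rat_row_def by (rule range_from_nat_into[OF 2 1])
qed

lemma cost2_nonneg: "finite V \<Longrightarrow> 0 < pen n V \<Longrightarrow> 0 \<le> cost2 n V p k \<psi>"
  by (simp add: cost2_def slack2_nonneg)

text \<open>Rational rows are dense and the cost is continuous, so the countable infimum is the
  infimum over all rows.\<close>

lemma cost2_inf_le:
  assumes "finite V" "0 < pen n V" shows "cost2_inf n V p k \<le> cost2 n V p k \<psi>"
proof -
  have "\<exists>q::nat \<Rightarrow> rat. (\<lambda>m. of_rat (q m) :: real) \<longlonglongrightarrow> \<psi> l" for l
  proof -
    have "\<psi> l \<in> closure \<rat>" by (simp add: Rats_closure_real)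
    then obtain f where f: "\<And>m. f m \<in> \<rat>" "f \<longlonglongrightarrow> \<psi> l" by (auto simp: closure_sequential)
    have "\<forall>m. \<exists>r. f m = of_rat r" using f(1) by (auto elim: Rats_cases)
    then obtain q where "\<forall>m. f m = of_rat (q m)" by (rule choice[THEN exE])
    then have "f = (\<lambda>m. of_rat (q m))" by auto
    then show ?thesis using f(2) by auto
  qed
  then obtain q :: "'a option \<Rightarrow> nat \<Rightarrow> rat" where q: "\<And>l. (\<lambda>m. of_rat (q l m) :: real) \<longlonglongrightarrow> \<psi> l" by metis
  define r where "r = (\<lambda>m. \<lambda>l\<in>aug_set V. (of_rat (q l m) :: real))"
  have lim: "(\<lambda>m. cost2 n V p k (r m)) \<longlonglongrightarrow> cost2 n V p k \<psi>"
    by (rule tendsto_cost2[OF assms]) (simp add: r_def q)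
  have "cost2_inf n V p k \<le> cost2 n V p k (r m)" for m
  proof -
    have "r m \<in> range (rat_row V)" unfolding rat_rows_countable(3)[OF assms(1)] by (auto simp: r_def rat_rows_def)
    then obtain i where "r m = rat_row V i" by auto
    then show ?thesis unfolding cost2_inf_def
      by (auto intro!: cINF_lower bdd_belowI2[of _ 0] cost2_nonneg assms)
  qed
  then show ?thesis by (intro LIMSEQ_le_const[OF lim]) auto
qed

lemma near_min:
  assumes "finite V" "0 < pen n V"
  shows "cost2 n V p k (rat_row V (near_min n V p k m)) < cost2_inf n V p k + 1 / real (Suc m)"
proof -
  have "\<exists>i\<in>UNIV. cost2 n V p k (rat_row V i) < cost2_inf n V p k + 1 / real (Suc m)"
    unfolding cost2_inf_def
    by (subst cINF_less_iff[symmetric]) (auto intro!: bdd_belowI2[of _ 0] cost2_nonneg assms)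
  then show ?thesis unfolding near_min_def by (auto intro: LeastI)
qed

text \<open>All late near-minimisers have cost below \<open>L\<close>, and \<open>l0\<close> then
  keeps their norms away from 0, so dividing by the norm is stable. By
  \<open>near_minimisers_proportional\<close> their normalised fits approach that of
  \<open>\<psi>0\<close>, with fourth powers of the distances of order \<open>1 / m\<close>.\<close>

lemma unit_min_eq:
  assumes fin: "finite V" and pen: "0 < pen n V"
    and min: "\<And>\<psi>. cost2 n V p k \<psi>0 \<le> cost2 n V p k \<psi>"
    and le: "cost2 n V p k \<psi>0 < L"
    and low: "\<And>\<psi>. cost2 n V p k \<psi> \<le> L \<Longrightarrow> l0 \<le> norm4 n (\<lambda>t. lin V \<psi> (p t))" and l0: "0 < l0"
    and t: "t \<in> {1..n}"
  shows "unit_min n V p k t = unit_fit n V p \<psi>0 t"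
proof -
  define \<psi> where "\<psi> m = rat_row V (near_min n V p k m)" for m
  have inf: "cost2_inf n V p k \<le> cost2 n V p k \<psi>0" by (rule cost2_inf_le[OF fin pen])
  have c: "cost2 n V p k (\<psi> m) \<le> cost2 n V p k \<psi>0 + 1 / real (Suc m)" for m
    using near_min[OF fin pen, of p k m] inf by (simp add: \<psi>_def)
  have seq: "(\<lambda>m. 1 / real (Suc m)) \<longlonglongrightarrow> 0" by (rule LIMSEQ_Suc[OF lim_1_over_n])
  have "0 < min (L - cost2 n V p k \<psi>0) l0" using le l0 by simp
  from order_tendstoD(2)[OF seq this]
  have ev: "eventually (\<lambda>m. \<bar>unit_fit n V p (\<psi> m) t - unit_fit n V p \<psi>0 t\<bar> ^ 4
      \<le> real n * (32 / l0) * (1 / real (Suc m))) sequentially"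
  proof eventually_elim
    case (elim m)
    let ?a = "norm4 n (\<lambda>t. lin V (\<psi> m) (p t))" and ?b = "norm4 n (\<lambda>t. lin V \<psi>0 (p t))"
    let ?e = "1 / real (Suc m)"
    have a: "l0 \<le> ?a" using c[of m] elim by (intro low) auto
    have b: "l0 \<le> ?b" using le by (intro low) auto
    have "avg n (\<lambda>t. (unit_fit n V p (\<psi> m) t - unit_fit n V p \<psi>0 t) ^ 4) \<le> 16 * ?e * (1 / ?a + 1 / ?b)"
      unfolding unit_fit_def
      by (rule near_minimisers_proportional[OF fin pen min c[of m] refl refl refl refl]) (use a b l0 elim in auto)
    also have "\<dots> \<le> 16 * ?e * (1 / l0 + 1 / l0)"
      using a b l0 by (intro mult_left_mono add_mono divide_left_mono) auto
    finally have "avg n (\<lambda>t. (unit_fit n V p (\<psi> m) t - unit_fit n V p \<psi>0 t) ^ 4) \<le> (32 / l0) * ?e"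
      by (simp add: mult.commute)
    then have "(\<Sum>t=1..n. (unit_fit n V p (\<psi> m) t - unit_fit n V p \<psi>0 t) ^ 4) \<le> real n * ((32 / l0) * ?e)"
      using t by (simp add: avg_def pos_divide_le_eq mult.commute)
    moreover have "(unit_fit n V p (\<psi> m) t - unit_fit n V p \<psi>0 t) ^ 4
        \<le> (\<Sum>t=1..n. (unit_fit n V p (\<psi> m) t - unit_fit n V p \<psi>0 t) ^ 4)"
      using t by (intro member_le_sum) auto
    ultimately show ?case by simp
  qed
  have "(\<lambda>m. real n * (32 / l0) * (1 / real (Suc m))) \<longlonglongrightarrow> real n * (32 / l0) * 0"
    by (intro tendsto_mult_left seq)
  then have "(\<lambda>m. \<bar>unit_fit n V p (\<psi> m) t - unit_fit n V p \<psi>0 t\<bar> ^ 4) \<longlonglongrightarrow> 0"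
    by (intro tendsto_sandwich[OF _ ev tendsto_const[of 0]]) auto
  then have "(\<lambda>m. root 4 (\<bar>unit_fit n V p (\<psi> m) t - unit_fit n V p \<psi>0 t\<bar> ^ 4)) \<longlonglongrightarrow> root 4 0"
    by (intro tendsto_intros)
  then have "(\<lambda>m. unit_fit n V p (\<psi> m) t - unit_fit n V p \<psi>0 t) \<longlonglongrightarrow> 0"
    by (simp add: real_root_power_cancel tendsto_rabs_zero_iff del: power_abs power_even_abs_numeral)
  then have "(\<lambda>m. unit_fit n V p (\<psi> m) t) \<longlonglongrightarrow> unit_fit n V p \<psi>0 t" by (simp add: LIM_zero_iff)
  then show ?thesis unfolding unit_min_def \<psi>_def by (rule limI)
qed

lemma unit_min_cong:
  assumes "\<And>t j. t \<in> {1..n} \<Longrightarrow> j \<in> V \<Longrightarrow> p t j = q t j" and t: "t \<in> {1..n}"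
  shows "unit_min n V p k t = unit_min n V q k t"
proof -
  have c: "cost2 n V p k \<psi> = cost2 n V q k \<psi>" for \<psi> by (rule cost2_cong(1)) (rule assms)
  have l: "lin V \<psi> (p t) = lin V \<psi> (q t)" if "t \<in> {1..n}" for \<psi> t
    by (rule cost2_cong(2)[where n=n]) (use assms that in auto)
  have "norm4 n (\<lambda>t. lin V \<psi> (p t)) = norm4 n (\<lambda>t. lin V \<psi> (q t))" for \<psi>
    unfolding norm4_def using l by (intro arg_cong[of _ _ "root 4"] avg_cong) auto
  then show ?thesis using l[OF t] by (simp add: unit_min_def unit_fit_def near_min_def cost2_inf_def c)
qed

lemma measurable_unit_min:
  assumes fin: "finite V" and pen: "0 < pen n V" and t: "t \<in> {1..n}"
  shows "(\<lambda>P. unit_min n V P k t) \<in> borel_measurable (PiM {1..n} (\<lambda>_. PiM V (\<lambda>_. borel)))"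
proof -
  let ?M = "PiM {1..n} (\<lambda>_. PiM V (\<lambda>_. borel)) :: (nat \<Rightarrow> 'a \<Rightarrow> real) measure"
  have p: "(\<lambda>P. P t j) \<in> borel_measurable ?M" if "t \<in> {1..n}" "j \<in> V" for t j
    using measurable_compose[OF measurable_component_singleton[OF that(1)] measurable_component_singleton[OF that(2)]]
    by simp
  have a: "(\<lambda>P. aug (P t) l) \<in> borel_measurable ?M" if "t \<in> {1..n}" "l \<in> aug_set V" for t l
    using that p by (cases l) auto
  have l: "(\<lambda>P. lin V \<psi> (P t)) \<in> borel_measurable ?M" if "t \<in> {1..n}" for t \<psi>
    unfolding lin_def using that a by (intro borel_measurable_sum borel_measurable_times) auto
  have n4: "(\<lambda>P. norm4 n (\<lambda>t. lin V \<psi> (P t))) \<in> borel_measurable ?M" for \<psi>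
    unfolding norm4_def avg_def using l
    by (intro borel_measurable_root[THEN measurable_compose[rotated]] borel_measurable_divide borel_measurable_sum borel_measurable_power borel_measurable_abs borel_measurable_const) auto
  have c: "(\<lambda>P. cost2 n V P k \<psi>) \<in> borel_measurable ?M" for \<psi>
    unfolding cost2_def slack2_def rms_def avg_def using l a n4 fin
    by (intro borel_measurable_add borel_measurable_Max borel_measurable_max borel_measurable_divide
       borel_measurable_sum borel_measurable_power borel_measurable_abs borel_measurable_const
       borel_measurable_diff borel_measurable_times borel_measurable_sqrt[THEN measurable_compose[rotated]]) auto
  have ci: "(\<lambda>P. cost2_inf n V P k) \<in> borel_measurable ?M"
    unfolding cost2_inf_def using c
    by (intro borel_measurable_cINF) (auto intro!: bdd_belowI2[of _ 0] cost2_nonneg fin pen)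
  have nm: "(\<lambda>P. near_min n V P k m) \<in> measurable ?M (count_space UNIV)" for m
    unfolding near_min_def using c ci by measurable
  have u: "(\<lambda>P. unit_fit n V P (rat_row V i) t) \<in> borel_measurable ?M" for i
    unfolding unit_fit_def using l[OF t] n4 by (intro borel_measurable_divide) auto
  have "(\<lambda>P. unit_fit n V P (rat_row V (near_min n V P k m)) t) \<in> borel_measurable ?M" for m
    by (rule measurable_compose_countable[OF u nm])
  then show ?thesis unfolding unit_min_def by (rule borel_measurable_lim_metric)
qed

section \<open>Self-normalised tail bounds\<close>

lemma exp_tail_bound:
  assumes "prob_space M" and [measurable]: "f \<in> borel_measurable M"
    and le: "(\<integral>\<^sup>+\<omega>. ennreal (exp (f \<omega>)) \<partial>M) \<le> 1"
  shows "measure M {\<omega>\<in>space M. u \<le> f \<omega>} \<le> exp (- u)"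
proof -
  interpret prob_space M by fact
  have "emeasure M {\<omega>\<in>space M. u \<le> f \<omega>}
      \<le> emeasure M {\<omega>\<in>space M. 1 \<le> ennreal (exp (- u)) * ennreal (exp (f \<omega>))}"
  proof (intro emeasure_mono subsetI)
    fix \<omega> assume \<omega>: "\<omega> \<in> {\<omega>\<in>space M. u \<le> f \<omega>}"
    then have "1 \<le> exp (- u) * exp (f \<omega>)" by (simp flip: exp_add)
    then have "ennreal 1 \<le> ennreal (exp (- u) * exp (f \<omega>))" by (rule ennreal_leI)
    also have "\<dots> = ennreal (exp (- u)) * ennreal (exp (f \<omega>))" by (rule ennreal_mult) auto
    finally show "\<omega> \<in> {\<omega>\<in>space M. 1 \<le> ennreal (exp (- u)) * ennreal (exp (f \<omega>))}" using \<omega> by simp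
  qed simp
  also have "\<dots> \<le> ennreal (exp (- u)) * (\<integral>\<^sup>+\<omega>. ennreal (exp (f \<omega>)) * indicator (space M) \<omega> \<partial>M)"
    by (rule nn_integral_Markov_inequality) auto
  also have "\<dots> \<le> ennreal (exp (- u)) * 1"
  proof (rule mult_left_mono)
    have "(\<integral>\<^sup>+\<omega>. ennreal (exp (f \<omega>)) * indicator (space M) \<omega> \<partial>M) = (\<integral>\<^sup>+\<omega>. ennreal (exp (f \<omega>)) \<partial>M)"
      by (rule nn_integral_cong) simp
    then show "(\<integral>\<^sup>+\<omega>. ennreal (exp (f \<omega>)) * indicator (space M) \<omega> \<partial>M) \<le> 1" using le by simp
  qed simp
  finally show ?thesis by (simp add: emeasure_eq_measure)
qed

text \<open>The weights \<open>w t\<close> may depend on the covariates \<open>\<pi> (d s)\<close> of all periods \<open>s\<close>; the hypothesis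
  \<open>step\<close> bounds the conditional expectation of one factor given the covariate.\<close>

lemma iterated_conditional_bound:
  fixes F :: "real \<Rightarrow> 'x \<Rightarrow> real" and \<pi> :: "'x \<Rightarrow> 'y" and w :: "nat \<Rightarrow> (nat \<Rightarrow> 'y) \<Rightarrow> real"
  assumes mu: "prob_space \<mu>" and pi[measurable]: "\<pi> \<in> measurable \<mu> Y"
    and F[measurable]: "(\<lambda>(g, x). F g x) \<in> borel_measurable (borel \<Otimes>\<^sub>M \<mu>)"
    and Fb: "\<And>g x. \<bar>g\<bar> \<le> R \<Longrightarrow> 0 \<le> F g x \<and> F g x \<le> B"
    and step: "\<And>z g b. z \<in> borel_measurable Y \<Longrightarrow> g \<in> borel_measurable Y \<Longrightarrow> (\<And>q. 0 \<le> z q \<and> z q \<le> b) \<Longrightarrow>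
        (\<And>q. \<bar>g q\<bar> \<le> R) \<Longrightarrow> (\<integral>\<^sup>+x. ennreal (z (\<pi> x) * F (g (\<pi> x)) x) \<partial>\<mu>) \<le> (\<integral>\<^sup>+x. ennreal (z (\<pi> x)) \<partial>\<mu>)"
    and w: "\<And>t. t \<in> {1..n} \<Longrightarrow> w t \<in> borel_measurable (PiM {1..n} (\<lambda>_. Y))"
    and wb: "\<And>t P. \<bar>w t P\<bar> \<le> R"
  shows "(\<integral>\<^sup>+d. ennreal (\<Prod>t\<in>{1..n}. F (w t (\<lambda>s\<in>{1..n}. \<pi> (d s))) (d t)) \<partial>PiM {1..n} (\<lambda>_. \<mu>)) \<le> 1"
proof -
  interpret mu: prob_space \<mu> by fact
  interpret P: product_prob_space "\<lambda>_::nat. \<mu>" by standard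
  have path[measurable]: "(\<lambda>d. \<lambda>s\<in>{1..n}. \<pi> (d s)) \<in> measurable (PiM {1..n} (\<lambda>_. \<mu>)) (PiM {1..n} (\<lambda>_. Y))"
    by (intro measurable_restrict measurable_compose[OF _ pi] measurable_component_singleton) auto
  have fac: "(\<lambda>d. F (w t (\<lambda>s\<in>{1..n}. \<pi> (d s))) (d t)) \<in> borel_measurable (PiM {1..n} (\<lambda>_. \<mu>))"
    if t: "t \<in> {1..n}" for t
  proof -
    have "(\<lambda>d. (w t (\<lambda>s\<in>{1..n}. \<pi> (d s)), d t)) \<in> measurable (PiM {1..n} (\<lambda>_. \<mu>)) (borel \<Otimes>\<^sub>M \<mu>)"
      by (intro measurable_Pair measurable_compose[OF path w[OF t]] measurable_component_singleton t)
    from measurable_compose[OF this F] show ?thesis by simp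
  qed
  have "(\<integral>\<^sup>+d. ennreal (\<Prod>t\<in>{1..m}. F (w t (\<lambda>s\<in>{1..n}. \<pi> (d s))) (d t)) \<partial>PiM {1..n} (\<lambda>_. \<mu>)) \<le> 1"
    if "m \<le> n" for m using that
  proof (induction m)
    case 0
    interpret F: prob_space "PiM {1..n} (\<lambda>_. \<mu>)" by (rule prob_space_PiM) (rule mu)
    show ?case using F.emeasure_space_1 by simp
  next
    case (Suc m)
    let ?t = "Suc m" and ?I = "{1..n} - {Suc m}"
    have t: "?t \<in> {1..n}" and I: "{1..n} = insert ?t ?I" using Suc.prems by auto
    define J where "J m d = (\<Prod>t\<in>{1..m}. F (w t (\<lambda>s\<in>{1..n}. \<pi> (d s))) (d t))" for m d
    have meas: "(\<lambda>d. ennreal (J m' d)) \<in> borel_measurable (PiM (insert ?t ?I) (\<lambda>_. \<mu>))" if "m' \<le> n" for m'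
      unfolding J_def I[symmetric] using that
      by (intro measurable_compose[OF _ measurable_ennreal] borel_measurable_prod fac) auto
    have "(\<integral>\<^sup>+d. ennreal (J (Suc m) d) \<partial>PiM (insert ?t ?I) (\<lambda>_. \<mu>))
        = (\<integral>\<^sup>+x. (\<integral>\<^sup>+y. ennreal (J (Suc m) (x(?t := y))) \<partial>\<mu>) \<partial>PiM ?I (\<lambda>_. \<mu>))"
      by (rule P.product_nn_integral_insert[OF _ _ meas[OF Suc.prems]]) auto
    also have "\<dots> \<le> (\<integral>\<^sup>+x. (\<integral>\<^sup>+y. ennreal (J m (x(?t := y))) \<partial>\<mu>) \<partial>PiM ?I (\<lambda>_. \<mu>))"
    proof (rule nn_integral_mono)
      fix x assume x: "x \<in> space (PiM ?I (\<lambda>_. \<mu>))"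
      define Q where "Q q = (\<lambda>s\<in>{1..n}. if s = ?t then q else \<pi> (x s))" for q
      have xs: "x s \<in> space \<mu>" if "s \<in> ?I" for s
        using x that by (simp only: space_PiM PiE_iff)
      have Q: "Q \<in> measurable Y (PiM {1..n} (\<lambda>_. Y))" unfolding Q_def
      proof (intro measurable_restrict)
        fix s assume "s \<in> {1..n}"
        then show "(\<lambda>q. if s = ?t then q else \<pi> (x s)) \<in> measurable Y Y"
          using xs[of s] measurable_space[OF pi] by (cases "s = ?t") auto
      qed
      have path_eq: "(\<lambda>s\<in>{1..n}. \<pi> ((x(?t := y)) s)) = Q (\<pi> y)" for y
        by (auto simp: Q_def restrict_def fun_eq_iff)
      \<comment> \<open>The earlier factors see coordinate \<open>?t\<close> only through its
        covariate, by way of their weights. They form a bounded nonnegative function of that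
        covariate, which is what the factor \<open>z\<close> in \<open>step\<close> is for; the new
        factor can then be integrated out although all weights depend on the whole path.\<close>
      define z where "z q = (\<Prod>s\<in>{1..m}. F (w s (Q q)) (x s))" for q
      have zm: "z \<in> borel_measurable Y" unfolding z_def
      proof (intro borel_measurable_prod)
        fix s assume s: "s \<in> {1..m}"
        then have sI: "s \<in> ?I" "s \<in> {1..n}" using Suc.prems by auto
        have "(\<lambda>q. (w s (Q q), x s)) \<in> measurable Y (borel \<Otimes>\<^sub>M \<mu>)"
          by (intro measurable_Pair measurable_compose[OF Q w[OF sI(2)]] measurable_const xs[OF sI(1)])
        from measurable_compose[OF this F] show "(\<lambda>q. F (w s (Q q)) (x s)) \<in> borel_measurable Y" by simp
      qed
      have zb: "0 \<le> z q \<and> z q \<le> B ^ m" for q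
      proof
        show "0 \<le> z q" unfolding z_def using Fb wb by (intro prod_nonneg) auto
        have "z q \<le> (\<Prod>s\<in>{1..m}. B)" unfolding z_def using Fb wb by (intro prod_mono) auto
        then show "z q \<le> B ^ m" by simp
      qed
      have Jm: "J m (x(?t := y)) = z (\<pi> y)" for y
        unfolding J_def path_eq z_def by (intro prod.cong) auto
      have JS: "J (Suc m) (x(?t := y)) = z (\<pi> y) * F (w ?t (Q (\<pi> y))) y" for y
      proof -
        have "J (Suc m) (x(?t := y)) = J m (x(?t := y)) * F (w ?t (\<lambda>s\<in>{1..n}. \<pi> ((x(?t := y)) s))) ((x(?t := y)) ?t)"
          unfolding J_def by (simp only: prod.nat_ivl_Suc') (simp only: mult.commute)
        then show ?thesis unfolding Jm path_eq by simp
      qed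
      show "(\<integral>\<^sup>+y. ennreal (J (Suc m) (x(?t := y))) \<partial>\<mu>) \<le> (\<integral>\<^sup>+y. ennreal (J m (x(?t := y))) \<partial>\<mu>)"
        unfolding Jm JS
        by (rule step[OF zm measurable_compose[OF Q w[OF t]] zb]) (rule wb)
    qed
    also have "\<dots> = (\<integral>\<^sup>+d. ennreal (J m d) \<partial>PiM (insert ?t ?I) (\<lambda>_. \<mu>))"
      by (rule P.product_nn_integral_insert[OF _ _ meas, symmetric]) (use Suc.prems in auto)
    also have "\<dots> \<le> 1" unfolding I[symmetric] J_def by (rule Suc.IH[OF Suc_leD[OF Suc.prems]])
    finally show ?case unfolding I[symmetric] J_def .
  qed
  then show ?thesis by blast
qed

text \<open>Conditional moments are expressed by integrals against bounded functions of the
  covariate. In this form they can be used on the law of a single observation, without conditional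
  expectations.\<close>

locale cond_noise = prob_space \<mu> for \<mu> :: "'x measure" +
  fixes Y :: "'y measure" and \<pi> :: "'x \<Rightarrow> 'y" and e :: "'x \<Rightarrow> real" and c C :: real
  assumes pi[measurable]: "\<pi> \<in> measurable \<mu> Y" and e[measurable]: "e \<in> borel_measurable \<mu>"
    and int4: "integrable \<mu> (\<lambda>x. (e x) ^ 4)"
    and mean: "\<And>h b. h \<in> borel_measurable Y \<Longrightarrow> (\<And>q. \<bar>h q\<bar> \<le> b) \<Longrightarrow> (\<integral>x. h (\<pi> x) * e x \<partial>\<mu>) = 0"
    and second: "\<And>h b. h \<in> borel_measurable Y \<Longrightarrow> (\<And>q. 0 \<le> h q \<and> h q \<le> b) \<Longrightarrow>
        c * (\<integral>x. h (\<pi> x) \<partial>\<mu>) \<le> (\<integral>x. h (\<pi> x) * (e x)\<^sup>2 \<partial>\<mu>)"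
    and fourth: "\<And>h b. h \<in> borel_measurable Y \<Longrightarrow> (\<And>q. 0 \<le> h q \<and> h q \<le> b) \<Longrightarrow>
        (\<integral>x. h (\<pi> x) * (e x) ^ 4 \<partial>\<mu>) \<le> C * (\<integral>x. h (\<pi> x) \<partial>\<mu>)"
begin

lemma integrable_bounded_mult:
  assumes [measurable]: "h \<in> borel_measurable Y" "f \<in> borel_measurable \<mu>" and hb: "\<And>q. \<bar>h q\<bar> \<le> b"
    and f: "\<And>x. \<bar>f x\<bar> \<le> 1 + (e x) ^ 4"
  shows "integrable \<mu> (\<lambda>x. h (\<pi> x) * f x)"
proof (rule Bochner_Integration.integrable_bound)
  show "integrable \<mu> (\<lambda>x. b * (1 + (e x) ^ 4))" using int4 by simp
  show "AE x in \<mu>. norm (h (\<pi> x) * f x) \<le> norm (b * (1 + (e x) ^ 4))"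
  proof (rule AE_I2)
    fix x
    have "\<bar>h (\<pi> x)\<bar> * \<bar>f x\<bar> \<le> \<bar>b\<bar> * \<bar>1 + (e x) ^ 4\<bar>"
      using hb[of "\<pi> x"] f[of x] by (intro mult_mono) auto
    then show "norm (h (\<pi> x) * f x) \<le> norm (b * (1 + (e x) ^ 4))" by (simp add: abs_mult)
  qed
qed simp

lemma abs_pow_le: "\<bar>e x\<bar> \<le> 1 + (e x) ^ 4" "(e x)\<^sup>2 \<le> 1 + (e x) ^ 4" "\<bar>e x\<bar> ^ 3 \<le> 1 + (e x) ^ 4"
proof -
  have *: "u ^ m \<le> 1 + u ^ 4" if "m \<le> 4" "0 \<le> u" for u :: real and m
  proof (cases "u \<le> 1")
    case True then show ?thesis using that power_le_one[of u m] zero_le_power[of u 4] by linarith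
  next
    case False then show ?thesis using that power_increasing[of m 4 u] by linarith
  qed
  show "\<bar>e x\<bar> \<le> 1 + (e x) ^ 4" "(e x)\<^sup>2 \<le> 1 + (e x) ^ 4" "\<bar>e x\<bar> ^ 3 \<le> 1 + (e x) ^ 4"
    using *[of 1 "\<bar>e x\<bar>"] *[of 2 "\<bar>e x\<bar>"] *[of 3 "\<bar>e x\<bar>"] by auto
qed

lemma third:
  assumes h: "h \<in> borel_measurable Y" and hb: "\<And>q. 0 \<le> h q \<and> h q \<le> b"
  shows "(\<integral>x. h (\<pi> x) * \<bar>e x\<bar> ^ 3 \<partial>\<mu>) \<le> (1 + C) * (\<integral>x. h (\<pi> x) \<partial>\<mu>)"
proof -
  have hb': "\<bar>h q\<bar> \<le> b" for q using hb[of q] by simp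
  have i: "integrable \<mu> (\<lambda>x. h (\<pi> x) * \<bar>e x\<bar> ^ 3)" "integrable \<mu> (\<lambda>x. h (\<pi> x) * (e x) ^ 4)"
    using abs_pow_le by (auto intro!: integrable_bounded_mult[OF h _ hb'])
  have i1: "integrable \<mu> (\<lambda>x. h (\<pi> x))" using integrable_bounded_mult[OF h _ hb', of "\<lambda>_. 1"] by auto
  have "(\<integral>x. h (\<pi> x) * \<bar>e x\<bar> ^ 3 \<partial>\<mu>) \<le> (\<integral>x. h (\<pi> x) * 1 + h (\<pi> x) * (e x) ^ 4 \<partial>\<mu>)"
  proof (rule integral_mono)
    fix x
    have "h (\<pi> x) * \<bar>e x\<bar> ^ 3 \<le> h (\<pi> x) * (1 + (e x) ^ 4)"
      using hb abs_pow_le by (intro mult_left_mono) auto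
    then show "h (\<pi> x) * \<bar>e x\<bar> ^ 3 \<le> h (\<pi> x) * 1 + h (\<pi> x) * (e x) ^ 4" by (simp add: distrib_left)
  qed (use i i1 in auto)
  also have "\<dots> = (\<integral>x. h (\<pi> x) \<partial>\<mu>) + (\<integral>x. h (\<pi> x) * (e x) ^ 4 \<partial>\<mu>)" using i i1 by simp
  finally show ?thesis using fourth[OF h hb] by (simp add: distrib_right)
qed

text \<open>Given the covariate, \<open>F1 g\<close> and \<open>F2 \<theta> g\<close> have mean at most 1: \<open>F1\<close> controls the weighted noise
  sum, \<open>F2\<close> bounds the sum of its squares from below.\<close>

definition "F1 g x = exp (g * e x - (g * e x)\<^sup>2 / 2 - 8 * (1 + C) * \<bar>g\<bar> ^ 3)"

definition "F2 \<theta> g x = exp (- \<theta> * g\<^sup>2 * (e x)\<^sup>2 + \<theta> * c * g\<^sup>2 - \<theta>\<^sup>2 * C * g ^ 4 / 2)"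

lemma F1_measurable: "(\<lambda>(g, x). F1 g x) \<in> borel_measurable (borel \<Otimes>\<^sub>M \<mu>)"
  and F2_measurable: "(\<lambda>(g, x). F2 \<theta> g x) \<in> borel_measurable (borel \<Otimes>\<^sub>M \<mu>)"
  unfolding F1_def F2_def by measurable

lemma C_nonneg: "0 \<le> C"
proof -
  have "0 \<le> (\<integral>x. 1 * (e x) ^ 4 \<partial>\<mu>)" by simp
  also have "\<dots> \<le> C * (\<integral>x. 1 \<partial>\<mu>)" using fourth[of "\<lambda>_. 1" 1] by simp
  finally show ?thesis using prob_space by simp
qed

lemma F1_bounds: "0 \<le> F1 g x \<and> F1 g x \<le> 3"
proof -
  let ?u = "g * e x"
  have "0 \<le> 8 * (1 + C) * \<bar>g\<bar> ^ 3" using C_nonneg by simp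
  moreover have "?u - ?u\<^sup>2 / 2 \<le> 1" using zero_le_power2[of "?u - 1"] by (simp add: power2_eq_square algebra_simps)
  ultimately have "F1 g x \<le> exp 1" unfolding F1_def by simp
  then have "F1 g x \<le> 3" using exp_le by linarith
  then show ?thesis by (simp add: F1_def)
qed

text \<open>After \<open>exp_quadratic_le_cubic\<close> the linear term is centred and the cubic one
  has conditional mean at most \<open>8 * (1 + C) * |g|^3\<close>. The compensator in
  \<open>F1\<close> is the exponential of minus this amount and absorbs it by
  \<open>1 + x \<le> exp x\<close>.\<close>

lemma F1_step:
  assumes z[measurable]: "z \<in> borel_measurable Y" and g[measurable]: "g \<in> borel_measurable Y"
    and zb: "\<And>q. 0 \<le> z q \<and> z q \<le> b" and gb: "\<And>q. \<bar>g q\<bar> \<le> R"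
  shows "(\<integral>\<^sup>+x. ennreal (z (\<pi> x) * F1 (g (\<pi> x)) x) \<partial>\<mu>) \<le> (\<integral>\<^sup>+x. ennreal (z (\<pi> x)) \<partial>\<mu>)"
proof -
  let ?K = "8 * (1 + C)"
  define k where "k q = exp (- ?K * \<bar>g q\<bar> ^ 3)" for q
  have km[measurable]: "k \<in> borel_measurable Y" unfolding k_def by measurable
  have K0: "0 \<le> ?K * \<bar>g q\<bar> ^ 3" for q using C_nonneg by (intro mult_nonneg_nonneg) auto
  have k01: "0 \<le> k q" "k q \<le> 1" for q using K0[of q] by (simp_all add: k_def del: distrib_left_numeral)
  define h where "h q = z q * k q" for q
  have hm[measurable]: "h \<in> borel_measurable Y" unfolding h_def by measurable
  have b: "0 \<le> b" using zb[of undefined] by linarith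
  have R: "0 \<le> R" using gb[of undefined] by linarith
  have hb: "0 \<le> h q" "h q \<le> b" for q
    using zb[of q] k01[of q] mult_mono[of "z q" b "k q" 1] by (auto simp: h_def b)
  have g3: "\<bar>g q\<bar> ^ 3 \<le> R ^ 3" for q using gb by (intro power_mono) auto
  let ?h1 = "\<lambda>q. h q * g q" and ?h3 = "\<lambda>q. h q * \<bar>g q\<bar> ^ 3"
  have h1b: "\<bar>?h1 q\<bar> \<le> b * R" for q unfolding abs_mult using hb gb[of q] by (intro mult_mono) (auto simp: b)
  have h3b: "0 \<le> ?h3 q \<and> ?h3 q \<le> b * R ^ 3" for q
    using hb[of q] g3[of q] by (intro conjI mult_mono mult_nonneg_nonneg) (auto simp: b)
  have [measurable]: "?h1 \<in> borel_measurable Y" "?h3 \<in> borel_measurable Y" by measurable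
  have i0: "integrable \<mu> (\<lambda>x. h (\<pi> x))"
    using integrable_bounded_mult[of h "\<lambda>_. 1" b] hb by auto
  have i1: "integrable \<mu> (\<lambda>x. ?h1 (\<pi> x) * e x)"
    by (rule integrable_bounded_mult[OF _ _ h1b abs_pow_le(1)]) auto
  have i3: "integrable \<mu> (\<lambda>x. ?h3 (\<pi> x) * \<bar>e x\<bar> ^ 3)"
    by (rule integrable_bounded_mult[of _ _ "b * R ^ 3"]) (use h3b abs_pow_le(3) in auto)
  have i3': "integrable \<mu> (\<lambda>x. ?h3 (\<pi> x))"
    using integrable_bounded_mult[of ?h3 "\<lambda>_. 1" "b * R ^ 3"] h3b by auto
  have iz: "integrable \<mu> (\<lambda>x. z (\<pi> x))"
    using integrable_bounded_mult[of z "\<lambda>_. 1" b] zb by auto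
  have F1: "F1 (g (\<pi> x)) x \<le> k (\<pi> x) * (1 + g (\<pi> x) * e x + 8 * (\<bar>g (\<pi> x)\<bar> ^ 3 * \<bar>e x\<bar> ^ 3))" for x
  proof -
    have "F1 (g (\<pi> x)) x = k (\<pi> x) * exp (g (\<pi> x) * e x - (g (\<pi> x) * e x)\<^sup>2 / 2)"
      by (simp add: F1_def k_def algebra_simps flip: exp_add)
    also have "\<dots> \<le> k (\<pi> x) * (1 + g (\<pi> x) * e x + 8 * \<bar>g (\<pi> x) * e x\<bar> ^ 3)"
      using exp_quadratic_le_cubic k01 by (intro mult_left_mono) auto
    finally show ?thesis by (simp add: abs_mult power_mult_distrib)
  qed
  have pw: "z (\<pi> x) * F1 (g (\<pi> x)) x \<le> h (\<pi> x) + ?h1 (\<pi> x) * e x + 8 * (?h3 (\<pi> x) * \<bar>e x\<bar> ^ 3)" for x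
    using mult_left_mono[OF F1[of x], of "z (\<pi> x)"] zb[of "\<pi> x"] by (simp add: h_def algebra_simps)
  have iF: "integrable \<mu> (\<lambda>x. z (\<pi> x) * F1 (g (\<pi> x)) x)"
  proof (rule Bochner_Integration.integrable_bound)
    show "integrable \<mu> (\<lambda>x. 3 * z (\<pi> x))" using iz by simp
    show "(\<lambda>x. z (\<pi> x) * F1 (g (\<pi> x)) x) \<in> borel_measurable \<mu>" unfolding F1_def by measurable
    show "AE x in \<mu>. norm (z (\<pi> x) * F1 (g (\<pi> x)) x) \<le> norm (3 * z (\<pi> x))"
    proof (rule AE_I2)
      fix x
      show "norm (z (\<pi> x) * F1 (g (\<pi> x)) x) \<le> norm (3 * z (\<pi> x))"
        using zb[of "\<pi> x"] F1_bounds[of "g (\<pi> x)" x]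
        by (simp add: abs_mult mult.commute[of 3] mult_left_mono)
    qed
  qed
  have "(\<integral>x. z (\<pi> x) * F1 (g (\<pi> x)) x \<partial>\<mu>) \<le> (\<integral>x. h (\<pi> x) + ?h1 (\<pi> x) * e x + 8 * (?h3 (\<pi> x) * \<bar>e x\<bar> ^ 3) \<partial>\<mu>)"
    using iF i0 i1 i3 pw by (intro integral_mono) auto
  also have "\<dots> = (\<integral>x. h (\<pi> x) \<partial>\<mu>) + (\<integral>x. ?h1 (\<pi> x) * e x \<partial>\<mu>) + 8 * (\<integral>x. ?h3 (\<pi> x) * \<bar>e x\<bar> ^ 3 \<partial>\<mu>)"
    using i0 i1 i3 by simp
  also have "(\<integral>x. ?h1 (\<pi> x) * e x \<partial>\<mu>) = 0" by (rule mean[OF _ h1b]) simp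
  also have "(\<integral>x. ?h3 (\<pi> x) * \<bar>e x\<bar> ^ 3 \<partial>\<mu>) \<le> (1 + C) * (\<integral>x. ?h3 (\<pi> x) \<partial>\<mu>)"
    by (rule third[OF _ h3b]) simp
  also have "(\<integral>x. h (\<pi> x) \<partial>\<mu>) + 0 + 8 * ((1 + C) * (\<integral>x. ?h3 (\<pi> x) \<partial>\<mu>)) = (\<integral>x. h (\<pi> x) + ?K * ?h3 (\<pi> x) \<partial>\<mu>)"
    using i0 i3' by simp
  also have "\<dots> \<le> (\<integral>x. z (\<pi> x) \<partial>\<mu>)"
  proof (rule integral_mono)
    fix x
    let ?q = "\<pi> x"
    have "k ?q * (1 + ?K * \<bar>g ?q\<bar> ^ 3) \<le> k ?q * exp (?K * \<bar>g ?q\<bar> ^ 3)"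
      by (rule mult_left_mono[OF exp_ge_add_one_self k01(1)])
    also have "\<dots> = 1" unfolding k_def exp_add[symmetric] mult_minus_left by simp
    finally have "z ?q * (k ?q * (1 + ?K * \<bar>g ?q\<bar> ^ 3)) \<le> z ?q * 1" using zb[of ?q] by (intro mult_left_mono) auto
    then show "h ?q + ?K * ?h3 ?q \<le> z ?q" by (simp add: h_def algebra_simps)
  qed (use i0 i3' iz in auto)
  finally have "(\<integral>x. z (\<pi> x) * F1 (g (\<pi> x)) x \<partial>\<mu>) \<le> (\<integral>x. z (\<pi> x) \<partial>\<mu>)" by simp
  moreover have "(\<integral>\<^sup>+x. ennreal (z (\<pi> x) * F1 (g (\<pi> x)) x) \<partial>\<mu>) = ennreal (\<integral>x. z (\<pi> x) * F1 (g (\<pi> x)) x \<partial>\<mu>)"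
    by (rule nn_integral_eq_integral[OF iF]) (use zb F1_bounds in auto)
  moreover have "(\<integral>\<^sup>+x. ennreal (z (\<pi> x)) \<partial>\<mu>) = ennreal (\<integral>x. z (\<pi> x) \<partial>\<mu>)"
    by (rule nn_integral_eq_integral[OF iz]) (use zb in auto)
  ultimately show ?thesis by (simp add: ennreal_leI)
qed

lemma F2_bounds:
  assumes "0 \<le> \<theta>" "\<bar>g\<bar> \<le> R" shows "0 \<le> F2 \<theta> g x \<and> F2 \<theta> g x \<le> exp (\<theta> * \<bar>c\<bar> * R\<^sup>2)"
proof -
  have "g\<^sup>2 \<le> R\<^sup>2" using power_mono[OF assms(2) abs_ge_zero, of 2] by simp
  then have "c * g\<^sup>2 \<le> \<bar>c\<bar> * R\<^sup>2" by (intro mult_mono) auto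
  then have "\<theta> * (c * g\<^sup>2) \<le> \<theta> * (\<bar>c\<bar> * R\<^sup>2)" using assms(1) by (intro mult_left_mono) auto
  moreover have "0 \<le> \<theta> * g\<^sup>2 * (e x)\<^sup>2" "0 \<le> \<theta>\<^sup>2 * C * g ^ 4 / 2" using assms C_nonneg by auto
  ultimately show ?thesis by (simp add: F2_def mult.assoc)
qed

text \<open>The same scheme with \<open>exp (- u) \<le> 1 - u + u^2 / 2\<close>: the second
  conditional moment enters through its lower bound \<open>c\<close>, the fourth through its upper
  bound \<open>C\<close>, and the two compensating terms of \<open>F2\<close> match them.\<close>

lemma F2_step:
  assumes th: "0 \<le> \<theta>" and z[measurable]: "z \<in> borel_measurable Y" and g[measurable]: "g \<in> borel_measurable Y"
    and zb: "\<And>q. 0 \<le> z q \<and> z q \<le> b" and gb: "\<And>q. \<bar>g q\<bar> \<le> R"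
  shows "(\<integral>\<^sup>+x. ennreal (z (\<pi> x) * F2 \<theta> (g (\<pi> x)) x) \<partial>\<mu>) \<le> (\<integral>\<^sup>+x. ennreal (z (\<pi> x)) \<partial>\<mu>)"
proof -
  define k where "k q = exp (\<theta> * c * (g q)\<^sup>2 - \<theta>\<^sup>2 * C * (g q) ^ 4 / 2)" for q
  have km[measurable]: "k \<in> borel_measurable Y" unfolding k_def by measurable
  have b: "0 \<le> b" using zb[of undefined] by linarith
  let ?E = "exp (\<theta> * \<bar>c\<bar> * R\<^sup>2)"
  have g2: "(g q)\<^sup>2 \<le> R\<^sup>2" for q using power_mono[OF gb abs_ge_zero, of q 2] by simp
  have g4: "(g q) ^ 4 \<le> R ^ 4" for q using power_mono[OF g2[of q], of 2] by (simp flip: power_mult)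
  have k01: "0 \<le> k q" "k q \<le> ?E" for q
  proof -
    have "c * (g q)\<^sup>2 \<le> \<bar>c\<bar> * R\<^sup>2" using g2[of q] by (intro mult_mono) auto
    then have "\<theta> * (c * (g q)\<^sup>2) \<le> \<theta> * (\<bar>c\<bar> * R\<^sup>2)" using th by (intro mult_left_mono) auto
    moreover have "0 \<le> \<theta>\<^sup>2 * C * (g q) ^ 4 / 2" using C_nonneg by auto
    ultimately show "k q \<le> ?E" by (simp add: k_def mult.assoc)
  qed (simp add: k_def)
  define h where "h q = z q * k q" for q
  have hm[measurable]: "h \<in> borel_measurable Y" unfolding h_def by measurable
  have hb: "0 \<le> h q" "h q \<le> b * ?E" for q
    using zb[of q] k01[of q] mult_mono[of "z q" b "k q" ?E] by (auto simp: h_def b)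
  let ?h2 = "\<lambda>q. h q * (g q)\<^sup>2" and ?h4 = "\<lambda>q. h q * (g q) ^ 4"
  have h2b: "0 \<le> ?h2 q \<and> ?h2 q \<le> b * ?E * R\<^sup>2" for q
    using hb[of q] g2[of q] by (intro conjI mult_mono mult_nonneg_nonneg) (auto simp: b)
  have h4b: "0 \<le> ?h4 q \<and> ?h4 q \<le> b * ?E * R ^ 4" for q
    using hb[of q] g4[of q] by (intro conjI mult_mono mult_nonneg_nonneg) (auto simp: b)
  have [measurable]: "?h2 \<in> borel_measurable Y" "?h4 \<in> borel_measurable Y" by measurable
  have i0: "integrable \<mu> (\<lambda>x. h (\<pi> x))"
    using integrable_bounded_mult[of h "\<lambda>_. 1" "b * ?E"] hb by auto
  have i2: "integrable \<mu> (\<lambda>x. ?h2 (\<pi> x) * (e x)\<^sup>2)"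
    by (rule integrable_bounded_mult[of _ _ "b * ?E * R\<^sup>2"]) (use h2b abs_pow_le(2) in auto)
  have i2': "integrable \<mu> (\<lambda>x. ?h2 (\<pi> x))"
    using integrable_bounded_mult[of ?h2 "\<lambda>_. 1" "b * ?E * R\<^sup>2"] h2b by auto
  have i4: "integrable \<mu> (\<lambda>x. ?h4 (\<pi> x) * (e x) ^ 4)"
    by (rule integrable_bounded_mult[of _ _ "b * ?E * R ^ 4"]) (use h4b in auto)
  have i4': "integrable \<mu> (\<lambda>x. ?h4 (\<pi> x))"
    using integrable_bounded_mult[of ?h4 "\<lambda>_. 1" "b * ?E * R ^ 4"] h4b by auto
  have iz: "integrable \<mu> (\<lambda>x. z (\<pi> x))"
    using integrable_bounded_mult[of z "\<lambda>_. 1" b] zb by auto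
  have F2e: "F2 \<theta> (g (\<pi> x)) x = k (\<pi> x) * exp (- (\<theta> * (g (\<pi> x))\<^sup>2 * (e x)\<^sup>2))" for x
    by (simp add: F2_def k_def flip: exp_add)
  have pw: "z (\<pi> x) * F2 \<theta> (g (\<pi> x)) x \<le> h (\<pi> x) - \<theta> * (?h2 (\<pi> x) * (e x)\<^sup>2) + \<theta>\<^sup>2 / 2 * (?h4 (\<pi> x) * (e x) ^ 4)" for x
  proof -
    let ?u = "\<theta> * (g (\<pi> x))\<^sup>2 * (e x)\<^sup>2"
    have "exp (- ?u) \<le> 1 - ?u + ?u\<^sup>2 / 2" using th by (intro exp_neg_le_quadratic) auto
    then have "h (\<pi> x) * exp (- ?u) \<le> h (\<pi> x) * (1 - ?u + ?u\<^sup>2 / 2)"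
      by (rule mult_left_mono[OF _ hb(1)])
    also have "?u\<^sup>2 = \<theta>\<^sup>2 * ((g (\<pi> x)) ^ 4 * (e x) ^ 4)"
      by (simp add: power_mult_distrib power2_eq_square power4_eq_xxxx)
    also have "h (\<pi> x) * (1 - ?u + \<theta>\<^sup>2 * ((g (\<pi> x)) ^ 4 * (e x) ^ 4) / 2)
        = h (\<pi> x) - \<theta> * (?h2 (\<pi> x) * (e x)\<^sup>2) + \<theta>\<^sup>2 / 2 * (?h4 (\<pi> x) * (e x) ^ 4)"
      by (simp add: algebra_simps)
    finally show ?thesis by (simp add: F2e h_def mult.assoc)
  qed
  have iF: "integrable \<mu> (\<lambda>x. z (\<pi> x) * F2 \<theta> (g (\<pi> x)) x)"
  proof (rule Bochner_Integration.integrable_bound)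
    show "integrable \<mu> (\<lambda>x. ?E * z (\<pi> x))" using iz by simp
    show "(\<lambda>x. z (\<pi> x) * F2 \<theta> (g (\<pi> x)) x) \<in> borel_measurable \<mu>" unfolding F2_def by measurable
    show "AE x in \<mu>. norm (z (\<pi> x) * F2 \<theta> (g (\<pi> x)) x) \<le> norm (?E * z (\<pi> x))"
    proof (rule AE_I2)
      fix x
      show "norm (z (\<pi> x) * F2 \<theta> (g (\<pi> x)) x) \<le> norm (?E * z (\<pi> x))"
        using zb[of "\<pi> x"] F2_bounds[OF th gb[of "\<pi> x"], of x]
        by (simp add: abs_mult mult.commute[of ?E] mult_left_mono)
    qed
  qed
  have "(\<integral>x. z (\<pi> x) * F2 \<theta> (g (\<pi> x)) x \<partial>\<mu>)
      \<le> (\<integral>x. h (\<pi> x) - \<theta> * (?h2 (\<pi> x) * (e x)\<^sup>2) + \<theta>\<^sup>2 / 2 * (?h4 (\<pi> x) * (e x) ^ 4) \<partial>\<mu>)"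
    using iF i0 i2 i4 pw by (intro integral_mono) auto
  also have "\<dots> = (\<integral>x. h (\<pi> x) \<partial>\<mu>) - \<theta> * (\<integral>x. ?h2 (\<pi> x) * (e x)\<^sup>2 \<partial>\<mu>) + \<theta>\<^sup>2 / 2 * (\<integral>x. ?h4 (\<pi> x) * (e x) ^ 4 \<partial>\<mu>)"
    using i0 i2 i4 by simp
  also have "\<dots> \<le> (\<integral>x. h (\<pi> x) \<partial>\<mu>) - \<theta> * (c * (\<integral>x. ?h2 (\<pi> x) \<partial>\<mu>)) + \<theta>\<^sup>2 / 2 * (C * (\<integral>x. ?h4 (\<pi> x) \<partial>\<mu>))"
    using th by (intro add_mono diff_mono mult_left_mono second[OF _ h2b] fourth[OF _ h4b]) auto
  also have "\<dots> = (\<integral>x. h (\<pi> x) - \<theta> * c * ?h2 (\<pi> x) + \<theta>\<^sup>2 / 2 * C * ?h4 (\<pi> x) \<partial>\<mu>)"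
    using i0 i2' i4' by simp
  also have "\<dots> \<le> (\<integral>x. z (\<pi> x) \<partial>\<mu>)"
  proof (rule integral_mono)
    fix x
    let ?q = "\<pi> x"
    let ?v = "\<theta> * c * (g ?q)\<^sup>2 - \<theta>\<^sup>2 * C * (g ?q) ^ 4 / 2"
    have "1 - ?v \<le> exp (- ?v)" using exp_ge_add_one_self[of "- ?v"] by linarith
    from mult_left_mono[OF this k01(1)] have "k ?q * (1 - ?v) \<le> k ?q * exp (- ?v)" .
    also have "\<dots> = 1" by (simp add: k_def flip: exp_add)
    finally have "z ?q * (k ?q * (1 - ?v)) \<le> z ?q * 1" using zb[of ?q] by (intro mult_left_mono) auto
    then show "h ?q - \<theta> * c * ?h2 ?q + \<theta>\<^sup>2 / 2 * C * ?h4 ?q \<le> z ?q" by (simp add: h_def algebra_simps)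
  qed (use i0 i2' i4' iz in auto)
  finally have "(\<integral>x. z (\<pi> x) * F2 \<theta> (g (\<pi> x)) x \<partial>\<mu>) \<le> (\<integral>x. z (\<pi> x) \<partial>\<mu>)" .
  moreover have "(\<integral>\<^sup>+x. ennreal (z (\<pi> x) * F2 \<theta> (g (\<pi> x)) x) \<partial>\<mu>) = ennreal (\<integral>x. z (\<pi> x) * F2 \<theta> (g (\<pi> x)) x \<partial>\<mu>)"
    by (rule nn_integral_eq_integral[OF iF]) (use zb F2_bounds[OF th gb] in auto)
  moreover have "(\<integral>\<^sup>+x. ennreal (z (\<pi> x)) \<partial>\<mu>) = ennreal (\<integral>x. z (\<pi> x) \<partial>\<mu>)"
    by (rule nn_integral_eq_integral[OF iz]) (use zb in auto)
  ultimately show ?thesis by (simp add: ennreal_leI)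
qed

end

text \<open>The multiplier \<open>b = y / vi i\<close> is taken from a grid for
  \<open>sqrt (V2 \<omega>)\<close> of relative mesh \<open>\<delta>\<close>, with
  \<open>\<delta>^2 = 1 / sqrt n\<close>. Passing from \<open>x\<close> to
  \<open>y = (1 + \<eta>) * x\<close> pays for two losses: the cubic term, of relative size
  \<open>8 * K * q / v0 ^ 3 * (x / sqrt n)\<close>, and the mesh, of relative size
  \<open>\<delta>^2 \<le> x / sqrt n\<close>. These are the two summands of \<open>\<eta>\<close>;
  the grid has at most \<open>N + 1\<close> points in the relevant range.\<close>

lemma self_normalised_tail_one_sided:
  fixes S V2 Q :: "'w \<Rightarrow> real" and n :: nat
  assumes M: "prob_space M" and [measurable]: "S \<in> borel_measurable M" "V2 \<in> borel_measurable M" "Q \<in> borel_measurable M"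
    and K: "0 \<le> K" and q: "0 \<le> q"
    and mgf: "\<And>b. (\<integral>\<^sup>+\<omega>. ennreal (exp (b * S \<omega> - b\<^sup>2 * V2 \<omega> / 2 - K * \<bar>b\<bar> ^ 3 * Q \<omega>)) \<partial>M) \<le> 1"
    and n: "1 \<le> n" and x: "1 \<le> x" and v: "0 < v0" "0 \<le> v1"
    and eta: "\<eta> = (8 * K * q / v0 ^ 3 + 2) * (x / sqrt n)" "\<eta> \<le> 1"
    and N: "v1 / v0 * sqrt (sqrt n) \<le> real N"
  shows "measure M {\<omega>\<in>space M. real n * v0\<^sup>2 \<le> V2 \<omega> \<and> V2 \<omega> \<le> real n * v1\<^sup>2 \<and> Q \<omega> \<le> real n * q \<and> (1 + \<eta>) * x * sqrt (V2 \<omega>) < S \<omega>}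
    \<le> (real N + 1) * exp (- x\<^sup>2 / 2)" (is "measure M ?A \<le> _")
proof -
  interpret prob_space M by fact
  define sn where "sn = sqrt (real n)"
  have sn: "1 \<le> sn" "sn\<^sup>2 = n" using n by (auto simp: sn_def)
  define \<delta> where "\<delta> = 1 / sqrt sn"
  have d: "0 < \<delta>" "\<delta>\<^sup>2 = 1 / sn" using sn by (auto simp: \<delta>_def power_divide)
  have d1: "\<delta>\<^sup>2 \<le> 1" "\<delta>\<^sup>2 \<le> x / sn" using d(2) sn x by (auto simp: divide_right_mono)
  define k where "k = 8 * K * q / v0 ^ 3"
  have k: "0 \<le> k" using K q v by (simp add: k_def)
  define h where "h = x / sn"
  have h: "0 < h" "\<eta> = (k + 2) * h" using x sn eta(1) by (auto simp: h_def k_def sn_def)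
  have eta0: "0 \<le> \<eta>" using h k by simp
  define y where "y = (1 + \<eta>) * x"
  have y: "0 < y" "y \<le> 2 * x" using eta eta0 x by (auto simp: y_def intro!: mult_right_mono)
  define vi where "vi i = v0 * sn * (1 + real i * \<delta>)" for i :: nat
  have vi0: "0 < vi i" "v0 * sn \<le> vi i" for i
    using v sn d(1) by (auto simp: vi_def intro!: mult_pos_pos add_pos_nonneg)
  define f where "f i \<omega> = y / vi i * S \<omega> - (y / vi i)\<^sup>2 * V2 \<omega> / 2 - K * \<bar>y / vi i\<bar> ^ 3 * Q \<omega>" for i \<omega>
  have fm[measurable]: "f i \<in> borel_measurable M" for i unfolding f_def by measurable
  have "?A \<subseteq> (\<Union>i\<in>{..N}. {\<omega>\<in>space M. x\<^sup>2 / 2 \<le> f i \<omega>})"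
  proof
    fix \<omega> assume "\<omega> \<in> ?A"
    then have w: "\<omega> \<in> space M" "real n * v0\<^sup>2 \<le> V2 \<omega>" "V2 \<omega> \<le> real n * v1\<^sup>2" "Q \<omega> \<le> real n * q"
      "y * sqrt (V2 \<omega>) < S \<omega>" by (auto simp: y_def)
    define V where "V = sqrt (V2 \<omega>)"
    have V20: "0 \<le> V2 \<omega>" using w(2) by (meson mult_nonneg_nonneg of_nat_0_le_iff order_trans zero_le_power2)
    have VV: "V\<^sup>2 = V2 \<omega>" using V20 by (simp add: V_def)
    have Vl: "v0 * sn \<le> V" unfolding V_def using w(2) v sn
      by (intro real_le_rsqrt) (simp add: power_mult_distrib mult.commute)
    have Vu: "V \<le> v1 * sn" unfolding V_def using w(3) sn v
      by (intro real_le_lsqrt) (auto simp: power_mult_distrib mult.commute)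
    \<comment> \<open>The real-valued position of \<open>V\<close> on the grid; rounding it down
      selects the point \<open>vi i\<close> just below \<open>V\<close>, within a factor
      \<open>1 + \<delta>\<close>.\<close>
    define a where "a = (V / (v0 * sn) - 1) / \<delta>"
    define i where "i = nat \<lfloor>a\<rfloor>"
    have vs: "0 < v0 * sn" using v sn by simp
    have a0: "0 \<le> a" using Vl vs d(1) by (simp add: a_def)
    have ia: "real i \<le> a" "a < real i + 1" using a0 by (simp_all add: i_def)
    have "a \<le> V / (v0 * sn) / \<delta>" unfolding a_def using d(1) by (intro divide_right_mono) auto
    also have "\<dots> \<le> v1 * sn / (v0 * sn) / \<delta>" using Vu vs d(1) by (intro divide_right_mono) auto
    also have "\<dots> = v1 / v0 * sqrt (sqrt n)" using sn d(1) v by (simp add: \<delta>_def sn_def)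
    finally have iN: "i \<le> N" using ia N by linarith
    have Va: "V = v0 * sn * (1 + a * \<delta>)" using v(1) sn(1) d(1) by (simp add: a_def)
    have Vi: "vi i \<le> V" "V \<le> vi i * (1 + \<delta>)"
    proof -
      show "vi i \<le> V" unfolding Va vi_def using ia(1) vs d(1) by (intro mult_left_mono add_left_mono mult_right_mono) auto
      have "a * \<delta> \<le> (real i + 1) * \<delta>" using ia d(1) by (intro mult_right_mono) auto
      then have "V \<le> v0 * sn * (1 + (real i + 1) * \<delta>)" unfolding Va using vs by (intro mult_left_mono) auto
      also have "\<dots> = vi i + v0 * sn * \<delta>" by (simp add: vi_def algebra_simps)
      also have "\<dots> \<le> vi i + vi i * \<delta>" using vi0(2)[of i] d(1) by (intro add_left_mono mult_right_mono) auto
      finally show "V \<le> vi i * (1 + \<delta>)" by (simp add: algebra_simps)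
    qed
    define r where "r = V / vi i"
    have r: "1 \<le> r" "r \<le> 1 + \<delta>" using Vi vi0(1)[of i] by (auto simp: r_def field_simps)
    define b where "b = y / vi i"
    have b0: "0 < b" using y vi0(1)[of i] by (simp add: b_def)
    have bS: "y\<^sup>2 * r \<le> b * S \<omega>"
    proof -
      have "b * (y * V) \<le> b * S \<omega>" using w(5) b0 by (intro mult_left_mono) (auto simp: V_def)
      also have "b * (y * V) = y\<^sup>2 * r" by (simp add: b_def r_def power2_eq_square)
      finally show ?thesis .
    qed
    have bV: "b\<^sup>2 * V2 \<omega> = y\<^sup>2 * r\<^sup>2" unfolding VV[symmetric] by (simp add: b_def r_def power_divide)
    have bQ: "K * \<bar>b\<bar> ^ 3 * Q \<omega> \<le> k * (x\<^sup>2 * h)"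
    proof -
      have "b \<le> 2 * x / (v0 * sn)" unfolding b_def using y vi0[of i] vs by (intro frac_le) auto
      then have "\<bar>b\<bar> ^ 3 \<le> (2 * x / (v0 * sn)) ^ 3" using b0 by (intro power_mono) auto
      then have "\<bar>b\<bar> ^ 3 * Q \<omega> \<le> (2 * x / (v0 * sn)) ^ 3 * (real n * q)"
        using w(4) x vs q order_trans[OF mult_left_mono[OF w(4), of "\<bar>b\<bar> ^ 3"] mult_right_mono] by simp
      then have "K * (\<bar>b\<bar> ^ 3 * Q \<omega>) \<le> K * ((2 * x / (v0 * sn)) ^ 3 * (real n * q))" using K by (intro mult_left_mono)
      also have "\<dots> = k * (x\<^sup>2 * h)"
        using sn v by (simp add: k_def h_def power_divide power_mult_distrib power2_eq_square power3_eq_cube mult_ac flip: sn(2))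
      finally show ?thesis by (simp add: mult.assoc)
    qed
    \<comment> \<open>With \<open>r = V / vi i\<close> the exponent is
      \<open>y^2 * (r - r^2 / 2)\<close> up to the cubic term. This is stationary at
      \<open>r = 1\<close>, so the mesh enters through its square only.\<close>
    have "(r - 1)\<^sup>2 \<le> \<delta>\<^sup>2" using r by (intro power_mono) auto
    then have rr: "1 - \<delta>\<^sup>2 \<le> 2 * r - r\<^sup>2" by (simp add: power2_eq_square algebra_simps)
    have dh: "\<delta>\<^sup>2 \<le> h" using d1 by (simp add: h_def)
    have "1 + 2 * k * h \<le> (1 + 2 * \<eta>) * (1 - \<delta>\<^sup>2)"
    proof -
      have "\<eta> * \<delta>\<^sup>2 \<le> 1 * h" using eta(2) eta0 dh h by (intro mult_mono) auto
      moreover have "(1 + 2 * \<eta>) * (1 - \<delta>\<^sup>2) = 1 + 2 * \<eta> - \<delta>\<^sup>2 - 2 * (\<eta> * \<delta>\<^sup>2)" by (simp add: algebra_simps)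
      moreover have "\<eta> = k * h + 2 * h" using h(2) by (simp add: algebra_simps)
      ultimately show ?thesis using dh h(1) by linarith
    qed
    also have "\<dots> \<le> (1 + \<eta>)\<^sup>2 * (2 * r - r\<^sup>2)"
    proof (rule mult_mono[OF _ rr])
      show "1 + 2 * \<eta> \<le> (1 + \<eta>)\<^sup>2" by (simp add: power2_sum)
    qed (use d1(1) in auto)
    finally have "x\<^sup>2 * (1 + 2 * k * h) \<le> x\<^sup>2 * ((1 + \<eta>)\<^sup>2 * (2 * r - r\<^sup>2))" by (intro mult_left_mono) auto
    then have "x\<^sup>2 + 2 * (k * (x\<^sup>2 * h)) \<le> y\<^sup>2 * (2 * r - r\<^sup>2)"
      unfolding y_def power_mult_distrib by (simp add: algebra_simps)
    also have "\<dots> = 2 * (y\<^sup>2 * r) - y\<^sup>2 * r\<^sup>2" by (simp add: algebra_simps)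
    finally have "x\<^sup>2 / 2 \<le> y\<^sup>2 * r - y\<^sup>2 * r\<^sup>2 / 2 - k * (x\<^sup>2 * h)" by linarith
    then have "x\<^sup>2 / 2 \<le> b * S \<omega> - b\<^sup>2 * V2 \<omega> / 2 - K * \<bar>b\<bar> ^ 3 * Q \<omega>" using bS bV bQ by linarith
    then have "x\<^sup>2 / 2 \<le> f i \<omega>" by (simp only: f_def b_def)
    then show "\<omega> \<in> (\<Union>i\<in>{..N}. {\<omega>\<in>space M. x\<^sup>2 / 2 \<le> f i \<omega>})" using iN w(1) by blast
  qed
  then have "measure M ?A \<le> measure M (\<Union>i\<in>{..N}. {\<omega>\<in>space M. x\<^sup>2 / 2 \<le> f i \<omega>})"
    by (intro finite_measure_mono) auto
  also have "\<dots> \<le> (\<Sum>i\<in>{..N}. measure M {\<omega>\<in>space M. x\<^sup>2 / 2 \<le> f i \<omega>})"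
    by (intro finite_measure_subadditive_finite) auto
  also have "\<dots> \<le> (\<Sum>i\<in>{..N}. exp (- (x\<^sup>2 / 2)))"
    by (intro sum_mono exp_tail_bound[OF M fm]) (unfold f_def, rule mgf)
  finally show ?thesis by (simp add: add.commute)
qed

text \<open>Keeps the random normaliser away from 0, where the grid argument could not start. The
  chosen \<open>\<theta>\<close> maximises the exponent
  \<open>n * (\<theta> * c * m2 / 2 - \<theta>^2 * C * m4 / 2)\<close>.\<close>

lemma lower_tail:
  fixes V2 W2 W4 :: "'w \<Rightarrow> real" and n :: nat
  assumes M: "prob_space M" and [measurable]: "V2 \<in> borel_measurable M" "W2 \<in> borel_measurable M" "W4 \<in> borel_measurable M"
    and pos: "0 < c" "0 < C" "0 < m2" "0 < m4"
    and mgf: "\<And>\<theta>. 0 \<le> \<theta> \<Longrightarrow> (\<integral>\<^sup>+\<omega>. ennreal (exp (- \<theta> * V2 \<omega> + \<theta> * c * W2 \<omega> - \<theta>\<^sup>2 * C * W4 \<omega> / 2)) \<partial>M) \<le> 1"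
  shows "measure M {\<omega>\<in>space M. real n * m2 \<le> W2 \<omega> \<and> W4 \<omega> \<le> real n * m4 \<and> V2 \<omega> < real n * (c * m2 / 2)}
    \<le> exp (- (c\<^sup>2 * m2\<^sup>2 / (8 * C * m4)) * real n)" (is "measure M ?A \<le> _")
proof -
  interpret prob_space M by fact
  define \<theta> where "\<theta> = c * m2 / (2 * C * m4)"
  have th: "0 < \<theta>" using pos by (simp add: \<theta>_def)
  define f where "f \<omega> = - \<theta> * V2 \<omega> + \<theta> * c * W2 \<omega> - \<theta>\<^sup>2 * C * W4 \<omega> / 2" for \<omega>
  have fm[measurable]: "f \<in> borel_measurable M" unfolding f_def by measurable
  have "?A \<subseteq> {\<omega>\<in>space M. c\<^sup>2 * m2\<^sup>2 / (8 * C * m4) * real n \<le> f \<omega>}"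
  proof safe
    fix \<omega> assume w: "real n * m2 \<le> W2 \<omega>" "W4 \<omega> \<le> real n * m4" "V2 \<omega> < real n * (c * m2 / 2)"
    have "\<theta> * c * (real n * m2) \<le> \<theta> * c * W2 \<omega>" using w th pos by (intro mult_left_mono) auto
    moreover have "\<theta>\<^sup>2 * C * W4 \<omega> \<le> \<theta>\<^sup>2 * C * (real n * m4)" using w th pos by (intro mult_left_mono) auto
    moreover have "\<theta> * V2 \<omega> \<le> \<theta> * (real n * (c * m2 / 2))" using w th pos by (intro mult_left_mono) auto
    ultimately have "- (\<theta> * (real n * (c * m2 / 2))) + \<theta> * c * (real n * m2) - \<theta>\<^sup>2 * C * (real n * m4) / 2 \<le> f \<omega>"
      unfolding f_def by linarith
    also have "- (\<theta> * (real n * (c * m2 / 2))) + \<theta> * c * (real n * m2) - \<theta>\<^sup>2 * C * (real n * m4) / 2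
       = c\<^sup>2 * m2\<^sup>2 / (8 * C * m4) * real n"
      using pos by (simp add: \<theta>_def field_simps power2_eq_square)
    finally show "c\<^sup>2 * m2\<^sup>2 / (8 * C * m4) * real n \<le> f \<omega>" .
  qed
  then have "measure M ?A \<le> measure M {\<omega>\<in>space M. c\<^sup>2 * m2\<^sup>2 / (8 * C * m4) * real n \<le> f \<omega>}"
    by (intro finite_measure_mono) auto
  also have "\<dots> \<le> exp (- (c\<^sup>2 * m2\<^sup>2 / (8 * C * m4) * real n))"
    by (rule exp_tail_bound[OF M fm]) (use mgf[of \<theta>] th in \<open>simp add: f_def\<close>)
  finally show ?thesis by simp
qed

section \<open>Tails for averages of independent observations\<close>

lemma indep_exp_sum_le:
  fixes n :: nat
  assumes M: "prob_space M" and ind: "prob_space.indep_vars M (\<lambda>_. T) D {1..n}"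
    and h[measurable]: "h \<in> borel_measurable T"
    and le: "\<And>t. t \<in> {1..n} \<Longrightarrow> (\<integral>\<^sup>+\<omega>. ennreal (exp (h (D t \<omega>))) \<partial>M) \<le> 1"
  shows "(\<integral>\<^sup>+\<omega>. ennreal (exp (\<Sum>t=1..n. h (D t \<omega>))) \<partial>M) \<le> 1"
proof -
  interpret prob_space M by fact
  have ind': "indep_vars (\<lambda>_. borel) (\<lambda>t \<omega>. ennreal (exp (h (D t \<omega>)))) {1..n}"
    by (rule indep_vars_compose2[OF ind]) auto
  have "(\<integral>\<^sup>+\<omega>. ennreal (exp (\<Sum>t=1..n. h (D t \<omega>))) \<partial>M) = (\<integral>\<^sup>+\<omega>. (\<Prod>t\<in>{1..n}. ennreal (exp (h (D t \<omega>)))) \<partial>M)"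
  proof (rule nn_integral_cong)
    fix \<omega>
    have "exp (\<Sum>t=1..n. h (D t \<omega>)) = (\<Prod>t\<in>{1..n}. exp (h (D t \<omega>)))" by (rule exp_sum) simp
    then show "ennreal (exp (\<Sum>t=1..n. h (D t \<omega>))) = (\<Prod>t\<in>{1..n}. ennreal (exp (h (D t \<omega>))))"
      by (simp add: prod_ennreal)
  qed
  also have "\<dots> = (\<Prod>t\<in>{1..n}. \<integral>\<^sup>+\<omega>. ennreal (exp (h (D t \<omega>))) \<partial>M)"
    by (rule indep_vars_nn_integral[OF _ ind']) auto
  also have "\<dots> \<le> 1"
  proof -
    have prod_le: "(\<Prod>t\<in>A. g t) \<le> (1::ennreal)" if "finite A" "\<And>t. t \<in> A \<Longrightarrow> g t \<le> 1" for A :: "nat set" and g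
      using that
    proof (induction A rule: finite_induct)
      case (insert t A)
      then have "g t * prod g A \<le> 1 * 1" by (intro mult_mono) auto
      then show ?case using insert by simp
    qed simp
    show ?thesis by (rule prod_le[OF finite_atLeastAtMost le])
  qed
  finally show ?thesis .
qed

text \<open>For values in \<open>[0, L]\<close> the exponential of \<open>h / L\<close> is at most
  \<open>1 + 2 * h / L\<close>, so the bound on the mean alone controls the exponential moment. The
  price is the factor 2 in front of \<open>C\<close>.\<close>

lemma truncated_average_tail:
  assumes M: "prob_space M" and ind: "prob_space.indep_vars M (\<lambda>_. T) D {1..n}"
    and h[measurable]: "h \<in> borel_measurable T" and h0: "\<And>d. 0 \<le> h d"
    and int: "\<And>t. t \<in> {1..n} \<Longrightarrow> integrable M (\<lambda>\<omega>. h (D t \<omega>))"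
    and le: "\<And>t. t \<in> {1..n} \<Longrightarrow> (\<integral>\<omega>. h (D t \<omega>) \<partial>M) \<le> C" and L: "0 < L" and n: "1 \<le> n"
  shows "measure M {\<omega>\<in>space M. 2 * C + u * L / n \<le> avg n (\<lambda>t. min (h (D t \<omega>)) L)} \<le> exp (- u)"
proof -
  interpret prob_space M by fact
  have D: "D t \<in> measurable M T" if "t \<in> {1..n}" for t using ind that by (auto simp: indep_vars_def)
  define f where "f d = min (h d) L / L - 2 * C / L" for d
  have fm[measurable]: "f \<in> borel_measurable T" unfolding f_def by measurable
  have one: "(\<integral>\<^sup>+\<omega>. ennreal (exp (f (D t \<omega>))) \<partial>M) \<le> 1" if t: "t \<in> {1..n}" for t
  proof -
    note [measurable] = D[OF t]
    have pw: "exp (f d) \<le> exp (- (2 * C / L)) * (1 + 2 / L * h d)" for d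
    proof -
      have "exp (min (h d) L / L) \<le> 1 + 2 * (min (h d) L / L)"
        using h0[of d] L by (intro exp_le_affine) (auto simp: divide_le_eq)
      also have "\<dots> \<le> 1 + 2 / L * h d" using L by (simp add: divide_right_mono)
      finally have "exp (- (2 * C / L)) * exp (min (h d) L / L) \<le> exp (- (2 * C / L)) * (1 + 2 / L * h d)"
        by (intro mult_left_mono) auto
      then show ?thesis by (simp add: f_def flip: exp_add)
    qed
    have "(\<integral>\<^sup>+\<omega>. ennreal (exp (f (D t \<omega>))) \<partial>M) \<le> (\<integral>\<^sup>+\<omega>. ennreal (exp (- (2 * C / L)) * (1 + 2 / L * h (D t \<omega>))) \<partial>M)"
      by (intro nn_integral_mono ennreal_leI pw)
    also have "\<dots> = ennreal (\<integral>\<omega>. exp (- (2 * C / L)) * (1 + 2 / L * h (D t \<omega>)) \<partial>M)"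
      using int[OF t] h0 L by (intro nn_integral_eq_integral) auto
    also have "(\<integral>\<omega>. exp (- (2 * C / L)) * (1 + 2 / L * h (D t \<omega>)) \<partial>M) = exp (- (2 * C / L)) * (1 + 2 / L * (\<integral>\<omega>. h (D t \<omega>) \<partial>M))"
      using int[OF t] by (simp add: prob_space)
    also have "\<dots> \<le> exp (- (2 * C / L)) * (1 + 2 / L * C)"
      using le[OF t] L by (intro mult_left_mono add_left_mono) auto
    also have "\<dots> \<le> exp (- (2 * C / L)) * exp (2 * C / L)"
      using exp_ge_add_one_self[of "2 * C / L"] by (intro mult_left_mono) auto
    also have "\<dots> = 1" by (simp flip: exp_add)
    finally show ?thesis by (simp add: ennreal_leI)
  qed
  have sm: "(\<lambda>\<omega>. \<Sum>t=1..n. f (D t \<omega>)) \<in> borel_measurable M"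
    using D by (intro borel_measurable_sum measurable_compose[OF _ fm]) auto
  have eq: "2 * C + u * L / n \<le> avg n (\<lambda>t. min (h (D t \<omega>)) L) \<longleftrightarrow> u \<le> (\<Sum>t=1..n. f (D t \<omega>))" for \<omega>
  proof -
    have "(\<Sum>t=1..n. f (D t \<omega>)) = (\<Sum>t=1..n. min (h (D t \<omega>)) L) / L - n * (2 * C / L)"
      by (simp add: f_def sum_subtractf sum_divide_distrib)
    then have "(\<Sum>t=1..n. min (h (D t \<omega>)) L) = (\<Sum>t=1..n. f (D t \<omega>)) * L + 2 * C * n"
      using L by (simp add: field_simps)
    then have "u \<le> (\<Sum>t=1..n. f (D t \<omega>)) \<longleftrightarrow> 2 * C * n + u * L \<le> (\<Sum>t=1..n. min (h (D t \<omega>)) L)"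
      using L by (simp only:) simp
    moreover have "2 * C + u * L / n \<le> m / n \<longleftrightarrow> 2 * C * n + u * L \<le> m" for m
      using n by (simp add: pos_le_divide_eq distrib_right)
    ultimately show ?thesis by (simp add: avg_def)
  qed
  show ?thesis unfolding eq by (rule exp_tail_bound[OF M sm indep_exp_sum_le[OF M ind fm one]])
qed

text \<open>The cubic exponential inequality again, now with the deterministic multipliers
  \<open>\<rho>\<close> and \<open>- \<rho>\<close>. The empirical second moment stays in the event,
  bounded by \<open>K2\<close>; \<open>kap\<close> collects the cost of the quadratic and the cubic
  term, and its summand 4 becomes the factor in the exponent.\<close>

lemma centred_average_tail:
  assumes M: "prob_space M" and ind: "prob_space.indep_vars M (\<lambda>_. T) D {1..n}"
    and h[measurable]: "h \<in> borel_measurable T"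
    and int: "\<And>t. t \<in> {1..n} \<Longrightarrow> integrable M (\<lambda>\<omega>. h (D t \<omega>))"
    and mean: "\<And>t. t \<in> {1..n} \<Longrightarrow> (\<integral>\<omega>. h (D t \<omega>) \<partial>M) = 0"
    and int3: "\<And>t. t \<in> {1..n} \<Longrightarrow> integrable M (\<lambda>\<omega>. \<bar>h (D t \<omega>)\<bar> ^ 3)"
    and le3: "\<And>t. t \<in> {1..n} \<Longrightarrow> (\<integral>\<omega>. \<bar>h (D t \<omega>)\<bar> ^ 3 \<partial>M) \<le> K3" and K3: "0 \<le> K3"
    and n: "1 \<le> n" and r: "0 < \<rho>" "\<rho> \<le> 1" and kap: "K2 / 2 + 8 * K3 + 4 \<le> kap"
  shows "measure M {\<omega>\<in>space M. avg n (\<lambda>t. (h (D t \<omega>))\<^sup>2) \<le> K2 \<and> kap * \<rho> < \<bar>avg n (\<lambda>t. h (D t \<omega>))\<bar>}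
     \<le> 2 * exp (- (4 * (real n * \<rho>\<^sup>2)))" (is "measure M ?A \<le> _")
proof -
  interpret prob_space M by fact
  have D: "D t \<in> measurable M T" if "t \<in> {1..n}" for t using ind that by (auto simp: indep_vars_def)
  define f where "f b d = b * h d - b\<^sup>2 * (h d)\<^sup>2 / 2 - 8 * K3 * \<bar>b\<bar> ^ 3" for b d
  have fm[measurable]: "f b \<in> borel_measurable T" for b unfolding f_def by measurable
  have one: "(\<integral>\<^sup>+\<omega>. ennreal (exp (f b (D t \<omega>))) \<partial>M) \<le> 1" if t: "t \<in> {1..n}" for t b
  proof -
    let ?E = "exp (- (8 * K3 * \<bar>b\<bar> ^ 3))"
    note [measurable] = D[OF t]
    have pw: "exp (f b d) \<le> ?E * (1 + b * h d + 8 * \<bar>b\<bar> ^ 3 * \<bar>h d\<bar> ^ 3)" for d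
    proof -
      have "exp (b * h d - (b * h d)\<^sup>2 / 2) \<le> 1 + b * h d + 8 * \<bar>b\<bar> ^ 3 * \<bar>h d\<bar> ^ 3"
        using exp_quadratic_le_cubic[of "b * h d"] by (simp add: abs_mult power_mult_distrib mult.assoc)
      then have "?E * exp (b * h d - (b * h d)\<^sup>2 / 2) \<le> ?E * (1 + b * h d + 8 * \<bar>b\<bar> ^ 3 * \<bar>h d\<bar> ^ 3)"
        by (intro mult_left_mono) auto
      then show ?thesis by (simp add: f_def power_mult_distrib flip: exp_add)
    qed
    have nn: "0 \<le> ?E * (1 + b * h d + 8 * \<bar>b\<bar> ^ 3 * \<bar>h d\<bar> ^ 3)" for d
      using order_trans[OF _ pw[of d]] by simp
    have "(\<integral>\<^sup>+\<omega>. ennreal (exp (f b (D t \<omega>))) \<partial>M) \<le> (\<integral>\<^sup>+\<omega>. ennreal (?E * (1 + b * h (D t \<omega>) + 8 * \<bar>b\<bar> ^ 3 * \<bar>h (D t \<omega>)\<bar> ^ 3)) \<partial>M)"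
      by (intro nn_integral_mono ennreal_leI pw)
    also have "\<dots> = ennreal (\<integral>\<omega>. ?E * (1 + b * h (D t \<omega>) + 8 * \<bar>b\<bar> ^ 3 * \<bar>h (D t \<omega>)\<bar> ^ 3) \<partial>M)"
      using int[OF t] int3[OF t] nn by (intro nn_integral_eq_integral) auto
    also have "(\<integral>\<omega>. ?E * (1 + b * h (D t \<omega>) + 8 * \<bar>b\<bar> ^ 3 * \<bar>h (D t \<omega>)\<bar> ^ 3) \<partial>M)
        = ?E * (1 + 8 * \<bar>b\<bar> ^ 3 * (\<integral>\<omega>. \<bar>h (D t \<omega>)\<bar> ^ 3 \<partial>M))"
      using int[OF t] int3[OF t] mean[OF t] by (simp add: prob_space)
    also have "\<dots> \<le> ?E * (1 + 8 * \<bar>b\<bar> ^ 3 * K3)"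
      using le3[OF t] by (intro mult_left_mono add_left_mono) auto
    also have "\<dots> \<le> ?E * exp (8 * K3 * \<bar>b\<bar> ^ 3)"
      using exp_ge_add_one_self[of "8 * K3 * \<bar>b\<bar> ^ 3"] by (intro mult_left_mono) (auto simp: mult_ac)
    also have "\<dots> = 1" by (simp flip: exp_add)
    finally show ?thesis by (simp add: ennreal_leI)
  qed
  define g where "g b \<omega> = (\<Sum>t=1..n. f b (D t \<omega>))" for b \<omega>
  have gm[measurable]: "g b \<in> borel_measurable M" for b
    unfolding g_def using D by (intro borel_measurable_sum measurable_compose[OF _ fm]) auto
  let ?B = "\<lambda>b. {\<omega>\<in>space M. 4 * (real n * \<rho>\<^sup>2) \<le> g b \<omega>}"
  have B: "measure M (?B b) \<le> exp (- (4 * (real n * \<rho>\<^sup>2)))" for b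
    by (rule exp_tail_bound[OF M gm]) (unfold g_def, rule indep_exp_sum_le[OF M ind fm one])
  have "?A \<subseteq> ?B \<rho> \<union> ?B (- \<rho>)"
  proof safe
    fix \<omega> assume w: "\<omega> \<in> space M" "avg n (\<lambda>t. (h (D t \<omega>))\<^sup>2) \<le> K2" "kap * \<rho> < \<bar>avg n (\<lambda>t. h (D t \<omega>))\<bar>"
      and not: "\<not> 4 * (real n * \<rho>\<^sup>2) \<le> g (- \<rho>) \<omega>"
    define a a2 where "a = avg n (\<lambda>t. h (D t \<omega>))" and "a2 = avg n (\<lambda>t. (h (D t \<omega>))\<^sup>2)"
    have gb: "g b \<omega> = real n * (b * a - b\<^sup>2 * a2 / 2 - 8 * K3 * \<bar>b\<bar> ^ 3)" for b
      using n by (simp add: g_def f_def a_def a2_def avg_def sum_subtractf sum_distrib_left sum_divide_distrib right_diff_distrib)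
    have low: "4 * (real n * \<rho>\<^sup>2) \<le> real n * (\<rho> * z - \<rho>\<^sup>2 * a2 / 2 - 8 * K3 * \<rho> ^ 3)" if z: "kap * \<rho> \<le> z" for z
    proof -
      have "\<rho> * (kap * \<rho>) \<le> \<rho> * z" using z r by (intro mult_left_mono) auto
      moreover have "\<rho>\<^sup>2 * a2 \<le> \<rho>\<^sup>2 * K2" using w(2) by (intro mult_left_mono) (auto simp: a2_def)
      moreover have "K3 * \<rho> ^ 3 \<le> K3 * \<rho>\<^sup>2" using r K3 by (intro mult_left_mono power_decreasing) auto
      moreover have "\<rho>\<^sup>2 * (K2 / 2 + 8 * K3 + 4) \<le> \<rho>\<^sup>2 * kap" using kap by (intro mult_left_mono) auto
      ultimately have "4 * \<rho>\<^sup>2 \<le> \<rho> * z - \<rho>\<^sup>2 * a2 / 2 - 8 * K3 * \<rho> ^ 3"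
        by (simp add: power2_eq_square algebra_simps)
      then have "real n * (4 * \<rho>\<^sup>2) \<le> real n * (\<rho> * z - \<rho>\<^sup>2 * a2 / 2 - 8 * K3 * \<rho> ^ 3)" by (intro mult_left_mono) auto
      then show ?thesis by simp
    qed
    have "kap * \<rho> \<le> a \<or> kap * \<rho> \<le> - a" using w(3) by (auto simp: a_def)
    then show "4 * (real n * \<rho>\<^sup>2) \<le> g \<rho> \<omega>"
    proof
      assume "kap * \<rho> \<le> a"
      moreover have "g \<rho> \<omega> = real n * (\<rho> * a - \<rho>\<^sup>2 * a2 / 2 - 8 * K3 * \<rho> ^ 3)" unfolding gb using r by simp
      ultimately show ?thesis using low[of a] by linarith
    next
      assume "kap * \<rho> \<le> - a"
      moreover have "g (- \<rho>) \<omega> = real n * (\<rho> * (- a) - \<rho>\<^sup>2 * a2 / 2 - 8 * K3 * \<rho> ^ 3)" unfolding gb using r by simp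
      ultimately show ?thesis using low[of "- a"] not by linarith
    qed
  qed
  then have "measure M ?A \<le> measure M (?B \<rho> \<union> ?B (- \<rho>))" by (intro finite_measure_mono) auto
  also have "\<dots> \<le> measure M (?B \<rho>) + measure M (?B (- \<rho>))" by (intro measure_Un_le) auto
  finally show ?thesis using B[of \<rho>] B[of "- \<rho>"] by simp
qed

section \<open>The estimators on the good event\<close>

text \<open>All that the second step requires of the covariates, as deterministic inequalities;
  \<open>\<rho>\<close> stands for the rate sqrt(log|V| / n). The hypothesis \<open>small\<close>
  keeps every row of admissible cost within 1/2 of solving its equation.\<close>

locale good_cov =
  fixes n :: nat and V :: "'a set" and p :: "nat \<Rightarrow> 'a \<Rightarrow> real"
    and Psib :: "'a option \<Rightarrow> 'a option \<Rightarrow> real" and P1 K4 K5 c1 \<rho> :: real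
  assumes n: "1 \<le> n" and fin: "finite V"
    and P1: "1 \<le> P1" and K4: "1 \<le> K4" and K5: "0 \<le> K5" and c1: "0 < c1" and rho: "0 \<le> \<rho>"
    and pen: "0 < pen n V" "c1 * \<rho> \<le> pen n V"
    and pb: "\<And>t l. t \<in> {1..n} \<Longrightarrow> l \<in> aug_set V \<Longrightarrow> \<bar>aug (p t) l\<bar> \<le> P1"
    and q4: "\<And>k j. k \<in> aug_set V \<Longrightarrow> j \<in> aug_set V \<Longrightarrow> avg n (\<lambda>t. (lin V (Psib k) (p t) * aug (p t) j) ^ 4) \<le> K4"
    and q1: "\<And>k j. k \<in> aug_set V \<Longrightarrow> j \<in> aug_set V \<Longrightarrow> \<bar>avg n (\<lambda>t. lin V (Psib k) (p t) * aug (p t) j) - delta k j\<bar> \<le> K5 * \<rho>"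
    and small: "pen n V * (2 * K4 + 2 + K5 / c1) \<le> 1/2"
begin

text \<open>The population row costs at most \<open>K4\<close> in norm and
  \<open>K5 / c1 + (K4 + 1)\<close> in slack. The further 1 makes \<open>cost2_Psib\<close> strict,
  which leaves room for near-minimisers below the level \<open>L\<close>.\<close>

definition "L = 2 * K4 + 2 + K5 / c1"

lemma L1: "1 \<le> L" using K4 K5 c1 by (simp add: L_def add_increasing2)

lemma norm4_le: assumes "avg n (\<lambda>t. (f t) ^ 4) \<le> K4" shows "norm4 n f \<le> K4"
proof -
  have "norm4 n f ^ 4 \<le> K4" using assms by (simp add: norm4_power)
  also have "\<dots> \<le> K4 ^ 4" using K4 by (simp add: self_le_power)
  finally show ?thesis by (rule power_le_imp_le_base[of _ 3, simplified]) (use K4 in simp)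
qed

lemma rms_const: "rms n (\<lambda>_. a) = \<bar>a\<bar>" using n by (simp add: rms_def avg_const)

lemma rms_aug_le: "l \<in> aug_set V \<Longrightarrow> rms n (\<lambda>t. aug (p t) l) \<le> P1"
  using rms_mono[of n "\<lambda>t. aug (p t) l" "\<lambda>_. P1"] pb P1 by (simp add: rms_const)

lemma cost2_Psib: assumes k: "k \<in> aug_set V" shows "cost2 n V p k (Psib k) < L"
proof -
  have "norm4 n (\<lambda>t. lin V (Psib k) (p t)) \<le> K4" using q4[OF k None_in_aug_set] by (intro norm4_le) simp
  moreover have "slack2 n V p k (Psib k) \<le> K5 / c1 + (K4 + 1)"
    unfolding slack2_le_iff[OF fin pen(1)]
  proof (intro ballI conjI)
    fix j assume j: "j \<in> aug_set V"
    have "K5 * \<rho> = K5 / c1 * (c1 * \<rho>)" using c1 by simp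
    also have "\<dots> \<le> K5 / c1 * pen n V" using pen K5 c1 by (intro mult_left_mono) auto
    also have "\<dots> \<le> (K5 / c1 + (K4 + 1)) * pen n V" using pen(1) K4 by (intro mult_right_mono) auto
    finally show "\<bar>avg n (\<lambda>t. lin V (Psib k) (p t) * aug (p t) j) - delta k j\<bar> \<le> pen n V * (K5 / c1 + (K4 + 1))"
      using q1[OF k j] by (simp add: mult.commute)
    have "rms n (\<lambda>t. lin V (Psib k) (p t) * aug (p t) j + - delta k j)
        \<le> rms n (\<lambda>t. lin V (Psib k) (p t) * aug (p t) j) + rms n (\<lambda>t. - delta k j)" by (rule rms_triangle)
    also have "\<dots> \<le> norm4 n (\<lambda>t. lin V (Psib k) (p t) * aug (p t) j) + 1"
      using rms_le_norm4[OF n] by (intro add_mono) (auto simp: rms_const delta_def)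
    also have "\<dots> \<le> K4 + 1" using norm4_le[OF q4[OF k j]] by simp
    also have "\<dots> \<le> K5 / c1 + (K4 + 1)" using K5 c1 by simp
    finally show "rms n (\<lambda>t. lin V (Psib k) (p t) * aug (p t) j - delta k j) \<le> K5 / c1 + (K4 + 1)" by simp
  qed
  ultimately show ?thesis by (simp add: cost2_def L_def)
qed

text \<open>The lower bounds come from the diagonal constraint: the fit has correlation at least 1/2
  with regressor \<open>k\<close>, and Cauchy-Schwarz against a regressor bounded by
  \<open>P1\<close> keeps the fit away from 0. This is the nondegeneracy that
  \<open>unit_min_eq\<close> asks for.\<close>

lemma cost2_le_imp:
  assumes c: "cost2 n V p k \<psi> \<le> L" and k: "k \<in> aug_set V"
  shows "norm4 n (\<lambda>t. lin V \<psi> (p t)) \<le> L"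
    and "\<And>j. j \<in> aug_set V \<Longrightarrow> \<bar>avg n (\<lambda>t. lin V \<psi> (p t) * aug (p t) j) - delta k j\<bar> \<le> pen n V * L"
    and "1 / (2 * P1) \<le> rms n (\<lambda>t. lin V \<psi> (p t))"
    and "1 / (2 * P1) \<le> norm4 n (\<lambda>t. lin V \<psi> (p t))"
proof -
  show "norm4 n (\<lambda>t. lin V \<psi> (p t)) \<le> L" using c slack2_nonneg[OF fin pen(1), of p k \<psi>] by (simp add: cost2_def)
  have "slack2 n V p k \<psi> \<le> L" using c norm4_nonneg[of n "\<lambda>t. lin V \<psi> (p t)"] unfolding cost2_def by linarith
  then show a: "\<bar>avg n (\<lambda>t. lin V \<psi> (p t) * aug (p t) j) - delta k j\<bar> \<le> pen n V * L" if "j \<in> aug_set V" for j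
    using that slack2_le_iff[OF fin pen(1)] by blast
  have "\<bar>avg n (\<lambda>t. lin V \<psi> (p t) * aug (p t) k) - delta k k\<bar> \<le> 1/2"
    by (rule order_trans[OF a[OF k]]) (use small in \<open>simp only: L_def\<close>)
  then have "1/2 \<le> \<bar>avg n (\<lambda>t. lin V \<psi> (p t) * aug (p t) k)\<bar>"
    unfolding delta_def if_P[OF refl] by linarith
  also have "\<dots> \<le> rms n (\<lambda>t. lin V \<psi> (p t)) * rms n (\<lambda>t. aug (p t) k)" by (rule avg_cauchy_schwarz)
  also have "\<dots> \<le> rms n (\<lambda>t. lin V \<psi> (p t)) * P1" by (intro mult_left_mono rms_aug_le k) auto
  finally show r: "1 / (2 * P1) \<le> rms n (\<lambda>t. lin V \<psi> (p t))" using P1 by (simp add: field_simps)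
  then show "1 / (2 * P1) \<le> norm4 n (\<lambda>t. lin V \<psi> (p t))" using rms_le_norm4[OF n] order_trans by blast
qed

context
  fixes Psi assumes est: "step2_estimator n V p Psi"
begin

abbreviation "fit i t \<equiv> lin V (Psi i) (p t)"

lemma cost2_Psi: "i \<in> aug_set V \<Longrightarrow> cost2 n V p i (Psi i) < L"
  using step2_estimator_row[OF est fin pen(1)] cost2_Psib by (meson le_less_trans)

lemmas w_bounds = cost2_le_imp[OF less_imp_le[OF cost2_Psi]]

lemma unit_min_w:
  assumes i: "i \<in> aug_set V" and t: "t \<in> {1..n}"
  shows "unit_min n V p i t = fit i t / norm4 n (fit i)"
proof -
  have "unit_min n V p i t = unit_fit n V p (Psi i) t"
    by (rule unit_min_eq[OF fin pen(1) step2_estimator_row[OF est fin pen(1) i] cost2_Psi[OF i]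
        cost2_le_imp(4)[OF _ i] _ t]) (use P1 in auto)
  then show ?thesis by (simp add: unit_fit_def)
qed

lemma norm4_w_pos: "i \<in> aug_set V \<Longrightarrow> 0 < norm4 n (fit i)"
  using w_bounds(4)[of i] P1 by (auto intro: less_le_trans[of 0 "1 / (2 * P1)"])

lemma w_unit_min: "i \<in> aug_set V \<Longrightarrow> t \<in> {1..n} \<Longrightarrow> fit i t = norm4 n (fit i) * unit_min n V p i t"
  using unit_min_w norm4_w_pos by (simp add: less_imp_neq[symmetric])

lemma unit_min_avg4: assumes i: "i \<in> aug_set V" shows "avg n (\<lambda>t. (unit_min n V p i t) ^ 4) = 1"
proof -
  have "avg n (\<lambda>t. (fit i t) ^ 4) = avg n (\<lambda>t. norm4 n (fit i) ^ 4 * (unit_min n V p i t) ^ 4)"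
    by (rule avg_cong) (subst w_unit_min[OF i], auto simp: power_mult_distrib)
  then have "norm4 n (fit i) ^ 4 = norm4 n (fit i) ^ 4 * avg n (\<lambda>t. (unit_min n V p i t) ^ 4)"
    by (simp add: norm4_power avg_cmult)
  then show ?thesis using norm4_w_pos[OF i] by simp
qed

text \<open>The quotient of the lower bound \<open>1 / (2 * P1)\<close> for the fit and the upper
  bound \<open>L\<close> for its fourth-power norm.\<close>

lemma unit_min_avg2: assumes i: "i \<in> aug_set V" shows "1 / (2 * P1 * L)\<^sup>2 \<le> avg n (\<lambda>t. (unit_min n V p i t)\<^sup>2)"
proof -
  have "1 / (2 * P1) \<le> rms n (fit i)" by (rule w_bounds(3)[OF i i])
  also have "rms n (fit i) = rms n (\<lambda>t. norm4 n (fit i) * unit_min n V p i t)"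
    by (rule rms_cong) (rule w_unit_min[OF i])
  also have "\<dots> = norm4 n (fit i) * rms n (unit_min n V p i)" by (simp add: rms_cmult)
  also have "\<dots> \<le> L * rms n (unit_min n V p i)" by (intro mult_right_mono w_bounds(1)[OF i i]) auto
  finally have "1 / (2 * P1 * L) \<le> rms n (unit_min n V p i)" using P1 L1 by (simp add: field_simps)
  then have "(1 / (2 * P1 * L))\<^sup>2 \<le> (rms n (unit_min n V p i))\<^sup>2" using P1 L1 by (intro power_mono) auto
  then show ?thesis by (simp add: rms_sq power_divide)
qed

end
end

text \<open>The interface between probability and algebra: the error bounds below are deterministic
  consequences. \<open>sn1\<close> and \<open>sn2\<close> are the self-normalised noise bounds for
  the weights of the first and the second step, \<open>low\<close> prevents the thresholds from
  degenerating, and \<open>ray\<close> with \<open>gram\<close> transfers the eigenvalue bound to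
  the empirical quadratic form.\<close>

locale good_event = good_cov n V p Psib P1 K4 K5 c1 \<rho>
  for n :: nat and V :: "'a set" and p :: "nat \<Rightarrow> 'a \<Rightarrow> real"
    and Psib :: "'a option \<Rightarrow> 'a option \<Rightarrow> real" and P1 K4 K5 c1 \<rho> :: real +
  fixes y eps :: "nat \<Rightarrow> 'a \<Rightarrow> real" and A :: "'a \<Rightarrow> 'a \<Rightarrow> real" and v :: "'a \<Rightarrow> real"
    and W :: "'a \<Rightarrow> 'a \<Rightarrow> real" and vh :: "'a \<Rightarrow> real" and Psi :: "'a option \<Rightarrow> 'a option \<Rightarrow> real"
    and gram :: "'a option \<Rightarrow> 'a option \<Rightarrow> real" and K6 \<kappa> b0 c2 \<eta> \<sigma>0 :: real
  assumes ne: "V \<noteq> {}" and est1: "step1_estimator n V p y W vh" and est2: "step2_estimator n V p Psi"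
    and model: "\<And>t k. t \<in> {1..n} \<Longrightarrow> k \<in> V \<Longrightarrow> y t k = v k - (\<Sum>j\<in>V. A k j * p t j) + eps t k"
    and e4: "\<And>k. k \<in> V \<Longrightarrow> avg n (\<lambda>t. (eps t k) ^ 4) \<le> K4"
    and gram: "\<And>l j. l \<in> aug_set V \<Longrightarrow> j \<in> aug_set V \<Longrightarrow> \<bar>avg n (\<lambda>t. aug (p t) l * aug (p t) j) - gram l j\<bar> \<le> K6 * \<rho>"
    and ray: "\<And>x. (\<Sum>i\<in>aug_set V. (x i)\<^sup>2) \<le> \<kappa> * quad_form (aug_set V) gram x"
    and pos: "0 < \<kappa>" "0 \<le> K6" "0 < \<sigma>0"
    and b0: "\<And>k. k \<in> V \<Longrightarrow> l1 V (\<lambda>l. stack A v l k) \<le> b0"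
    and c2: "pen n V \<le> c2 * \<rho>" and eta: "0 \<le> \<eta>" "\<eta> \<le> 1"
    and sn1: "\<And>k j. k \<in> V \<Longrightarrow> j \<in> aug_set V \<Longrightarrow>
        \<bar>avg n (\<lambda>t. eps t k * aug (p t) j)\<bar> \<le> (1 + \<eta>) * pen n V * rms n (\<lambda>t. eps t k * aug (p t) j)"
    and sn2: "\<And>k j. k \<in> V \<Longrightarrow> j \<in> aug_set V \<Longrightarrow>
        \<bar>avg n (\<lambda>t. unit_min n V p j t * eps t k)\<bar> \<le> (1 + \<eta>) * pen n V * rms n (\<lambda>t. unit_min n V p j t * eps t k)"
    and low: "\<And>k j. k \<in> V \<Longrightarrow> j \<in> aug_set V \<Longrightarrow> \<sigma>0 \<le> rms n (\<lambda>t. unit_min n V p j t * eps t k)"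
begin

abbreviation "lam \<equiv> pen n V"
abbreviation "w i t \<equiv> lin V (Psi i) (p t)"
abbreviation "D k l \<equiv> stack W vh l k - stack A v l k"

definition "Z k = (MAX j\<in>aug_set V. rms n (\<lambda>t. eps t k * aug (p t) j))"

section \<open>Rates of the first step\<close>

lemma b0_nonneg: "0 \<le> b0"
  using ne b0 l1_nonneg order_trans by (metis ex_in_conv)

lemma Z_ge: "j \<in> aug_set V \<Longrightarrow> rms n (\<lambda>t. eps t k * aug (p t) j) \<le> Z k"
  unfolding Z_def using fin by (intro Max_ge) auto

lemma Z_le: assumes k: "k \<in> V" shows "Z k \<le> P1 * K4"
  unfolding Z_def
proof (rule Max.boundedI)
  fix a assume "a \<in> (\<lambda>j. rms n (\<lambda>t. eps t k * aug (p t) j)) ` aug_set V"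
  then obtain j where j: "j \<in> aug_set V" "a = rms n (\<lambda>t. eps t k * aug (p t) j)" by auto
  have "a \<le> rms n (\<lambda>t. P1 * eps t k)" unfolding j(2)
  proof (rule rms_mono)
    fix t assume t: "t \<in> {1..n}"
    have "\<bar>eps t k\<bar> * \<bar>aug (p t) j\<bar> \<le> \<bar>eps t k\<bar> * P1" using pb[OF t j(1)] by (intro mult_left_mono) auto
    then show "\<bar>eps t k * aug (p t) j\<bar> \<le> \<bar>P1 * eps t k\<bar>" using P1 by (simp add: abs_mult mult.commute)
  qed
  also have "\<dots> = P1 * rms n (\<lambda>t. eps t k)" using P1 by (simp add: rms_cmult)
  also have "\<dots> \<le> P1 * K4" using rms_le_norm4[OF n] norm4_le[OF e4[OF k]] P1
    by (intro mult_left_mono order_trans[OF rms_le_norm4[OF n]]) auto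
  finally show "a \<le> P1 * K4" .
qed (use fin in auto)

lemma row: assumes k: "k \<in> V"
  shows "\<exists>zh. step1_row n V p (\<lambda>t. eps t k) (\<lambda>l. stack A v l k) (D k) zh (Z k) \<eta> lam"
proof (rule step1_estimator_row[OF est1 n fin _ eta model Z_def _ k])
  fix k j assume kj: "k \<in> V" "j \<in> aug_set V"
  have "\<bar>avg n (\<lambda>t. eps t k * aug (p t) j)\<bar> \<le> (1 + \<eta>) * lam * rms n (\<lambda>t. eps t k * aug (p t) j)" by (rule sn1[OF kj])
  also have "\<dots> \<le> (1 + \<eta>) * lam * Z k" using eta pen Z_ge[OF kj(2)] by (intro mult_left_mono) auto
  finally show "\<bar>avg n (\<lambda>t. eps t k * aug (p t) j)\<bar> \<le> lam * ((1 + \<eta>) * Z k)" by (simp add: mult_ac)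
qed (use pen in auto)

definition "D1 = 2 * b0 + P1 * K4 / 2"

lemma D1_nonneg: "0 \<le> D1" using b0_nonneg P1 K4 by (simp add: D1_def)

lemma l1_D_le: assumes k: "k \<in> V" shows "l1 V (D k) \<le> D1"
proof -
  obtain zh where "step1_row n V p (\<lambda>t. eps t k) (\<lambda>l. stack A v l k) (D k) zh (Z k) \<eta> lam" using row[OF k] by blast
  from step1_row.l1_error_le[OF this] show ?thesis using b0[OF k] Z_le[OF k] by (simp add: D1_def)
qed

text \<open>The constant of \<open>quad_form_error\<close> after the replacements
  \<open>T4 \<le> P1^2\<close> and \<open>Z k \<le> P1 * K4\<close>.\<close>

definition "Ka = 4 * P1\<^sup>2 * b0 + 4 * (P1 * K4)"

lemma moment_bound_le: "moment_bound n V p \<le> P1\<^sup>2"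
proof -
  have "avg n (\<lambda>t. (p t k) ^ 4) \<le> P1 ^ 4" if "k \<in> V" for k
  proof (rule avg_bound_const[OF n])
    fix t assume "t \<in> {1..n}"
    then have "\<bar>p t k\<bar> ^ 4 \<le> P1 ^ 4" using pb[of t "Some k"] that by (intro power_mono) auto
    then show "(p t k) ^ 4 \<le> P1 ^ 4" by simp
  qed
  then have "max 1 (MAX k\<in>V. avg n (\<lambda>t. (p t k) ^ 4)) \<le> P1 ^ 4"
    using fin ne P1 by (auto simp: Max_le_iff)
  then show ?thesis unfolding moment_bound_def
    by (intro real_le_lsqrt) (auto simp flip: power_mult)
qed

lemma quad_form_diff:
  "quad_form (aug_set V) gram x \<le> avg n (\<lambda>t. (lin V x (p t))\<^sup>2) + K6 * \<rho> * (l1 V x)\<^sup>2"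
proof -
  let ?I = "aug_set V"
  let ?S = "\<lambda>l j. avg n (\<lambda>t. aug (p t) l * aug (p t) j)"
  have "avg n (\<lambda>t. (lin V x (p t))\<^sup>2) = avg n (\<lambda>t. \<Sum>l\<in>?I. x l * (\<Sum>j\<in>?I. x j * (aug (p t) l * aug (p t) j)))"
    by (rule avg_cong) (simp add: power2_eq_square lin_def sum_product sum_distrib_left mult_ac)
  also have "\<dots> = (\<Sum>l\<in>?I. x l * (\<Sum>j\<in>?I. x j * ?S l j))" by (simp add: avg_sum avg_cmult)
  finally have a: "avg n (\<lambda>t. (lin V x (p t))\<^sup>2) = (\<Sum>l\<in>?I. x l * (\<Sum>j\<in>?I. x j * ?S l j))" .
  have "quad_form ?I gram x - avg n (\<lambda>t. (lin V x (p t))\<^sup>2) = (\<Sum>l\<in>?I. \<Sum>j\<in>?I. x l * x j * (gram l j - ?S l j))"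
    unfolding a quad_form_def by (simp add: sum_subtractf[symmetric] sum_distrib_left right_diff_distrib mult_ac)
  also have "\<dots> \<le> (\<Sum>l\<in>?I. \<Sum>j\<in>?I. \<bar>x l\<bar> * \<bar>x j\<bar> * (K6 * \<rho>))"
  proof (intro sum_mono)
    fix l j assume lj: "l \<in> ?I" "j \<in> ?I"
    have "x l * x j * (gram l j - ?S l j) \<le> \<bar>x l * x j * (gram l j - ?S l j)\<bar>" by simp
    also have "\<dots> = \<bar>x l\<bar> * \<bar>x j\<bar> * \<bar>?S l j - gram l j\<bar>" by (simp add: abs_mult abs_minus_commute)
    also have "\<dots> \<le> \<bar>x l\<bar> * \<bar>x j\<bar> * (K6 * \<rho>)" using gram[OF lj] by (intro mult_left_mono) auto
    finally show "x l * x j * (gram l j - ?S l j) \<le> \<bar>x l\<bar> * \<bar>x j\<bar> * (K6 * \<rho>)" .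
  qed
  also have "\<dots> = K6 * \<rho> * (l1 V x)\<^sup>2"
    by (simp add: l1_def power2_eq_square sum_product sum_distrib_left sum_distrib_right mult_ac)
  finally show ?thesis by simp
qed

text \<open>If the error mass \<open>a\<close> on the support is at most \<open>E\<close>, the cone
  inequality alone gives the claim. Otherwise \<open>d \<le> 4 * a\<close>; in the bound on
  \<open>a^2\<close> from the eigenvalue, the deviation of the empirical Gram matrix takes at most
  half of \<open>a^2\<close> by \<open>sr\<close>, and the rest is linear in \<open>a\<close>, so
  one factor \<open>a\<close> can be cancelled.\<close>

lemma sparse_rate:
  assumes k: "k \<in> V" and T: "T \<subseteq> V" "card T \<le> s" and s: "1 \<le> s" and r: "(\<Sum>j\<in>V - T. \<bar>A k j\<bar>) \<le> r"
    and sr: "32 * s * \<kappa> * K6 * \<rho> \<le> 1/2"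
  shows "l1 V (D k) \<le> 4 * (3 * r + \<eta> * (P1 * K4)) + 64 * \<kappa> * Ka * s * lam"
proof -
  obtain zh where R: "step1_row n V p (\<lambda>t. eps t k) (\<lambda>l. stack A v l k) (D k) zh (Z k) \<eta> lam" using row[OF k] by blast
  \<comment> \<open>The intercept always belongs to the support; because \<open>1 \<le> s\<close>,
    this at most doubles the bound on its size.\<close>
  define U where "U = insert None (Some ` T)"
  have finT: "finite T" using T fin finite_subset by blast
  have U: "U \<subseteq> aug_set V" using T by (auto simp: U_def aug_set_def)
  have cU: "real (card U) \<le> 2 * real s"
  proof -
    have "card U \<le> Suc (card T)" unfolding U_def by (metis card_image card_insert_le_m1 card_insert_if finT finite_imageI inj_Some le_refl le_Suc_eq)
    then show ?thesis using T(2) s by linarith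
  qed
  have "aug_set V - U = Some ` (V - T)" by (auto simp: U_def aug_set_def)
  then have rb: "(\<Sum>l\<in>aug_set V - U. \<bar>stack A v l k\<bar>) \<le> r" using r by (simp add: sum.reindex stack_def)
  define E where "E = 3 * r + \<eta> * (P1 * K4)"
  define a d where "a = (\<Sum>l\<in>U. \<bar>D k l\<bar>)" and "d = l1 V (D k)"
  have r0: "0 \<le> r" using r order_trans sum_nonneg by (metis (mono_tags, lifting) abs_ge_zero)
  have E0: "0 \<le> E" using r0 eta P1 K4 by (simp add: E_def)
  have a0: "0 \<le> a" by (simp add: a_def sum_nonneg)
  have cone: "d \<le> 3 * a + E"
    using step1_row.cone[OF R U rb] mult_left_mono[OF Z_le[OF k] eta(1)] by (simp add: d_def a_def E_def)
  have Ka0: "0 \<le> Ka" using b0_nonneg P1 K4 by (simp add: Ka_def)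
  have "avg n (\<lambda>t. (lin V (D k) (p t))\<^sup>2) \<le> d * (lam * (4 * moment_bound n V p * l1 V (\<lambda>l. stack A v l k) + 4 * Z k))"
    unfolding d_def by (rule step1_row.quad_form_error[OF R])
  also have "\<dots> \<le> d * (lam * Ka)" unfolding Ka_def
    using moment_bound_le moment_bound_ge_1[of n V p] b0[OF k] Z_le[OF k] pen b0_nonneg
    by (intro mult_left_mono add_mono mult_mono) (auto simp: d_def)
  finally have Q: "avg n (\<lambda>t. (lin V (D k) (p t))\<^sup>2) \<le> d * (lam * Ka)" .
  have "a\<^sup>2 \<le> (\<Sum>l\<in>U. 1\<^sup>2) * (\<Sum>l\<in>U. \<bar>D k l\<bar>\<^sup>2)"
    unfolding a_def using Cauchy_Schwarz_ineq_sum[of "\<lambda>_. 1" "\<lambda>l. \<bar>D k l\<bar>" U] by simp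
  also have "\<dots> = real (card U) * (\<Sum>l\<in>U. (D k l)\<^sup>2)" by simp
  also have "\<dots> \<le> (2 * real s) * (\<Sum>l\<in>aug_set V. (D k l)\<^sup>2)"
    using cU U fin by (intro mult_mono sum_mono2) (auto intro: sum_nonneg)
  also have "\<dots> \<le> (2 * real s) * (\<kappa> * (d * (lam * Ka) + K6 * \<rho> * d\<^sup>2))"
    using ray[of "D k"] quad_form_diff[of "D k"] Q pos
    by (intro mult_left_mono) (auto simp: d_def intro: order_trans[OF ray] mult_left_mono)
  finally have a2: "a\<^sup>2 \<le> 2 * s * \<kappa> * lam * Ka * d + 2 * s * \<kappa> * K6 * \<rho> * d\<^sup>2" by (simp add: algebra_simps)
  have d0: "0 \<le> d" by (simp add: d_def)
  show ?thesis
  proof (cases "a \<le> E")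
    case True
    then have "d \<le> 4 * E" using cone by simp
    moreover have "0 \<le> 64 * \<kappa> * Ka * s * lam" using pos Ka0 pen by simp
    ultimately show ?thesis unfolding d_def E_def by linarith
  next
    case False
    then have d4: "d \<le> 4 * a" using cone by simp
    have "2 * s * \<kappa> * K6 * \<rho> * d\<^sup>2 \<le> 2 * s * \<kappa> * K6 * \<rho> * (4 * a)\<^sup>2"
      using d4 d0 pos rho by (intro mult_left_mono power_mono) auto
    also have "\<dots> = (32 * s * \<kappa> * K6 * \<rho>) * a\<^sup>2" by (simp add: power_mult_distrib)
    also have "\<dots> \<le> (1/2) * a\<^sup>2" using sr by (intro mult_right_mono) auto
    finally have "a\<^sup>2 \<le> 2 * (2 * s * \<kappa> * lam * Ka * d)" using a2 by linarith
    also have "\<dots> \<le> 2 * (2 * s * \<kappa> * lam * Ka * (4 * a))"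
      using d4 pos pen Ka0 by (intro mult_left_mono) auto
    finally have "a * a \<le> (16 * \<kappa> * Ka * s * lam) * a" by (simp add: power2_eq_square mult_ac)
    then have "a \<le> 16 * \<kappa> * Ka * s * lam" using False E0 a0 by simp
    then have "d \<le> 64 * \<kappa> * Ka * s * lam" using d4 by simp
    then show ?thesis using E0 by (simp add: d_def E_def)
  qed
qed

text \<open>\<open>w i\<close> is a positive multiple of \<open>unit_min\<close>, and a
  self-normalised inequality is invariant under such scaling. It therefore passes from the
  measurable weights to those of the given minimiser.\<close>

lemma rms_w_eps: assumes k: "k \<in> V" and i: "i \<in> aug_set V"
  shows "rms n (\<lambda>t. w i t * eps t k) = norm4 n (w i) * rms n (\<lambda>t. unit_min n V p i t * eps t k)"
    and "\<bar>avg n (\<lambda>t. w i t * eps t k)\<bar> \<le> (1 + \<eta>) * lam * rms n (\<lambda>t. w i t * eps t k)"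
    and "rms n (\<lambda>t. w i t * eps t k) \<le> L * K4"
    and "\<sigma>0 / (2 * P1) \<le> rms n (\<lambda>t. w i t * eps t k)"
proof -
  let ?u = "unit_min n V p i" and ?a = "norm4 n (w i)"
  have e: "w i t * eps t k = ?a * (?u t * eps t k)" if "t \<in> {1..n}" for t
    using w_unit_min[OF est2 i that] by simp
  show r: "rms n (\<lambda>t. w i t * eps t k) = ?a * rms n (\<lambda>t. ?u t * eps t k)"
    using rms_cong[of n _ "\<lambda>t. ?a * (?u t * eps t k)", OF e] by (simp add: rms_cmult)
  have "avg n (\<lambda>t. w i t * eps t k) = ?a * avg n (\<lambda>t. ?u t * eps t k)"
    unfolding avg_cmult[symmetric] by (rule avg_cong) (rule e)
  then have "\<bar>avg n (\<lambda>t. w i t * eps t k)\<bar> = ?a * \<bar>avg n (\<lambda>t. ?u t * eps t k)\<bar>" by (simp add: abs_mult)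
  also have "\<dots> \<le> ?a * ((1 + \<eta>) * lam * rms n (\<lambda>t. ?u t * eps t k))"
    by (intro mult_left_mono sn2[OF k i]) simp
  finally show "\<bar>avg n (\<lambda>t. w i t * eps t k)\<bar> \<le> (1 + \<eta>) * lam * rms n (\<lambda>t. w i t * eps t k)"
    unfolding r by (simp add: mult_ac)
  have "(avg n (\<lambda>t. (w i t)\<^sup>2 * (eps t k)\<^sup>2))\<^sup>2 \<le> norm4 n (w i) ^ 4 * K4"
    by (rule avg_prod_sq_le[OF _ e4[OF k]]) (simp add: norm4_power)
  also have "\<dots> \<le> L ^ 4 * K4 ^ 4"
    using w_bounds(1)[OF est2 i i] K4 by (intro mult_mono power_mono) (auto simp: self_le_power)
  finally have "(rms n (\<lambda>t. w i t * eps t k)) ^ 4 \<le> (L * K4) ^ 4"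
  proof -
    have "(rms n f) ^ 4 = ((rms n f)\<^sup>2)\<^sup>2" for f by (simp flip: power_mult)
    then show "(avg n (\<lambda>t. (w i t)\<^sup>2 * (eps t k)\<^sup>2))\<^sup>2 \<le> L ^ 4 * K4 ^ 4 \<Longrightarrow> ?thesis"
      by (simp add: rms_sq power_mult_distrib)
  qed
  then show "rms n (\<lambda>t. w i t * eps t k) \<le> L * K4"
    by (rule power_le_imp_le_base[of _ 3, simplified]) (use L1 K4 in simp)
  have "1 / (2 * P1) * \<sigma>0 \<le> ?a * rms n (\<lambda>t. ?u t * eps t k)"
    using w_bounds(4)[OF est2 i i] low[OF k i] pos P1 by (intro mult_mono) auto
  then show "\<sigma>0 / (2 * P1) \<le> rms n (\<lambda>t. w i t * eps t k)" unfolding r by simp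
qed

section \<open>Error of the debiased estimator and size of the thresholds\<close>

lemma resid: "t \<in> {1..n} \<Longrightarrow> k \<in> V \<Longrightarrow> resid V p y W vh t k = eps t k + lin V (D k) (p t)"
  by (rule resid_eq[OF fin model])

text \<open>Hoelder's inequality for the bias: the second step bounds one factor by
  \<open>lam * L\<close> in the maximum norm, the first step bounds the other in the l1
  norm.\<close>

lemma debiased_error:
  assumes k: "k \<in> V" and i: "i \<in> aug_set V"
  shows "\<bar>debiased_stack n V p y W vh Psi i k - stack A v i k\<bar>
    \<le> lam * L * l1 V (D k) + (1 + \<eta>) * lam * rms n (\<lambda>t. w i t * eps t k)"
proof -
  have "(\<Sum>l\<in>aug_set V. Psi i l * avg n (\<lambda>t. aug (p t) l * resid V p y W vh t k))
      = avg n (\<lambda>t. \<Sum>l\<in>aug_set V. Psi i l * (aug (p t) l * resid V p y W vh t k))"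
    by (simp add: avg_sum avg_cmult)
  also have "\<dots> = avg n (\<lambda>t. (\<Sum>l\<in>aug_set V. D k l * (w i t * aug (p t) l)) + w i t * eps t k)"
  proof (rule avg_cong)
    fix t assume t: "t \<in> {1..n}"
    have "(\<Sum>l\<in>aug_set V. Psi i l * (aug (p t) l * resid V p y W vh t k)) = w i t * (eps t k + lin V (D k) (p t))"
      unfolding resid[OF t k] by (subst (2) lin_def) (simp add: sum_distrib_right mult.assoc)
    also have "w i t * lin V (D k) (p t) = (\<Sum>l\<in>aug_set V. D k l * (w i t * aug (p t) l))"
      by (subst (2) lin_def) (simp add: sum_distrib_left mult_ac)
    ultimately show "(\<Sum>l\<in>aug_set V. Psi i l * (aug (p t) l * resid V p y W vh t k))
      = (\<Sum>l\<in>aug_set V. D k l * (w i t * aug (p t) l)) + w i t * eps t k" by (simp add: distrib_left)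
  qed
  also have "\<dots> = (\<Sum>l\<in>aug_set V. D k l * avg n (\<lambda>t. w i t * aug (p t) l)) + avg n (\<lambda>t. w i t * eps t k)"
    by (simp add: avg_add avg_sum avg_cmult)
  finally have "debiased_stack n V p y W vh Psi i k - stack A v i k
      = D k i - (\<Sum>l\<in>aug_set V. D k l * avg n (\<lambda>t. w i t * aug (p t) l)) - avg n (\<lambda>t. w i t * eps t k)"
    by (simp add: debiased_stack_def)
  also have "D k i = (\<Sum>l\<in>aug_set V. D k l * delta i l)"
    using sum_delta_left[of "aug_set V" i "D k"] fin i by (simp add: mult.commute)
  finally have e: "debiased_stack n V p y W vh Psi i k - stack A v i k
      = - (\<Sum>l\<in>aug_set V. D k l * (avg n (\<lambda>t. w i t * aug (p t) l) - delta i l)) - avg n (\<lambda>t. w i t * eps t k)"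
    by (simp add: right_diff_distrib sum_subtractf)
  have "\<bar>\<Sum>l\<in>aug_set V. D k l * (avg n (\<lambda>t. w i t * aug (p t) l) - delta i l)\<bar>
      \<le> (\<Sum>l\<in>aug_set V. \<bar>D k l\<bar> * (lam * L))"
    using w_bounds(2)[OF est2 i i]
    by (intro order_trans[OF sum_abs] sum_mono) (auto simp: abs_mult intro!: mult_left_mono)
  also have "\<dots> = lam * L * l1 V (D k)" by (simp add: l1_def sum_distrib_left mult_ac)
  finally show ?thesis unfolding e using rms_w_eps(2)[OF k i] by linarith
qed

lemma rms_w_lin: assumes k: "k \<in> V" and i: "i \<in> aug_set V"
  shows "rms n (\<lambda>t. w i t * lin V (D k) (p t)) \<le> P1 * L * l1 V (D k)"
proof -
  have "\<bar>lin V (D k) (p t)\<bar> \<le> P1 * l1 V (D k)" if t: "t \<in> {1..n}" for t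
  proof -
    have "\<bar>lin V (D k) (p t)\<bar> \<le> (\<Sum>l\<in>aug_set V. \<bar>D k l\<bar> * P1)"
      unfolding lin_def using pb[OF t]
      by (intro order_trans[OF sum_abs] sum_mono) (auto simp: abs_mult intro!: mult_left_mono)
    then show ?thesis by (simp add: l1_def sum_distrib_left mult.commute)
  qed
  then have "rms n (\<lambda>t. w i t * lin V (D k) (p t)) \<le> rms n (\<lambda>t. (P1 * l1 V (D k)) * w i t)"
    using P1 by (intro rms_mono) (auto simp: abs_mult mult.commute[of "\<bar>w i _\<bar>"] intro!: mult_right_mono)
  also have "\<dots> = P1 * l1 V (D k) * rms n (w i)" using P1 by (simp add: rms_cmult abs_mult)
  also have "\<dots> \<le> P1 * l1 V (D k) * L"
    using P1 w_bounds(1)[OF est2 i i] rms_le_norm4[OF n, of "w i"] by (intro mult_left_mono) auto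
  finally show ?thesis by (simp add: mult_ac)
qed

lemma sigma_hat_eq: "k \<in> V \<Longrightarrow> sigma_hat n V p y W vh Psi k j = rms n (\<lambda>t. w (Some j) t * eps t k + w (Some j) t * lin V (D k) (p t))"
  unfolding sigma_hat_def rms_def row_aug_eq_lin
  by (intro arg_cong[of _ _ sqrt] avg_cong) (simp add: resid distrib_left)

text \<open>For the rate alone, the crude bound \<open>D1\<close> on the first-step error is enough,
  since it is multiplied by \<open>lam\<close>.\<close>

lemma part_a:
  assumes k: "k \<in> V" and i: "i \<in> aug_set V"
  shows "\<bar>debiased_stack n V p y W vh Psi i k - stack A v i k\<bar> \<le> c2 * (L * D1 + 2 * L * K4) * \<rho>"
proof -
  have "lam * L * l1 V (D k) + (1 + \<eta>) * lam * rms n (\<lambda>t. w i t * eps t k) \<le> lam * L * D1 + 2 * lam * (L * K4)"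
    using l1_D_le[OF k] rms_w_eps(3)[OF k i] eta pen L1 by (intro add_mono mult_left_mono mult_mono) auto
  also have "\<dots> = lam * (L * D1 + 2 * L * K4)" by (simp add: algebra_simps)
  also have "\<dots> \<le> c2 * \<rho> * (L * D1 + 2 * L * K4)"
    using c2 L1 D1_nonneg K4 by (intro mult_right_mono) auto
  finally show ?thesis using debiased_error[OF k i] by (simp add: mult_ac)
qed

text \<open>\<open>x\<close> bounds the contribution of the first-step error to \<open>sg\<close>,
  which thus lies within \<open>x\<close> of its counterpart \<open>R\<close> for the true noise.
  From \<open>d\<close> and the lower bound on \<open>R\<close> follows
  \<open>6 * x \<le> g * sg\<close>. Bias and estimation of the scale cost at most
  \<open>3 * x\<close>, half of \<open>g * sg\<close>; the other half is reserved for
  \<open>\<eta>\<close>.\<close>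

lemma part_b:
  assumes k: "k \<in> V" and j: "j \<in> V" and g: "0 < g" "g \<le> 1" "\<eta> \<le> g / 2"
    and d: "12 * P1 * L * l1 V (D k) \<le> g * (\<sigma>0 / (2 * P1))"
  shows "\<bar>debiased_stack n V p y W vh Psi (Some j) k - stack A v (Some j) k\<bar> \<le> (1 + g) * sigma_hat n V p y W vh Psi k j * lam"
    and "2 * (1 + g) * sigma_hat n V p y W vh Psi k j * lam \<le> 4 * c2 * (L * K4 + P1 * L * D1) * \<rho>"
proof -
  let ?i = "Some j"
  have i: "?i \<in> aug_set V" using j by simp
  define R where "R = rms n (\<lambda>t. w ?i t * eps t k)"
  define x where "x = P1 * L * l1 V (D k)"
  define sg where "sg = sigma_hat n V p y W vh Psi k j"
  have x0: "0 \<le> x" using P1 L1 by (simp add: x_def)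
  have xl: "L * l1 V (D k) \<le> x" using P1 L1 mult_right_mono[of 1 P1 "L * l1 V (D k)"] by (simp add: x_def mult.assoc)
  have RX: "rms n (\<lambda>t. w ?i t * lin V (D k) (p t)) \<le> x" unfolding x_def by (rule rms_w_lin[OF k i])
  have s1: "R - x \<le> sg"
    using rms_diff[of n "\<lambda>t. w ?i t * eps t k" "\<lambda>t. w ?i t * lin V (D k) (p t)"] RX
    unfolding sg_def sigma_hat_eq[OF k] R_def by linarith
  have s2: "sg \<le> R + x"
    using rms_triangle[of n "\<lambda>t. w ?i t * eps t k" "\<lambda>t. w ?i t * lin V (D k) (p t)"] RX
    unfolding sg_def sigma_hat_eq[OF k] R_def by linarith
  have Rl: "\<sigma>0 / (2 * P1) \<le> R" unfolding R_def by (rule rms_w_eps(4)[OF k i])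
  have sp: "0 < \<sigma>0 / (2 * P1)" using pos P1 by simp
  have gx: "12 * x \<le> g * (\<sigma>0 / (2 * P1))" using d by (simp add: x_def mult.assoc)
  have "g * (\<sigma>0 / (2 * P1)) \<le> 1 * (\<sigma>0 / (2 * P1))"
    using g sp by (intro mult_right_mono) auto
  then have half: "\<sigma>0 / (2 * P1) \<le> 2 * sg" using s1 Rl gx x0 sp by linarith
  have "6 * x \<le> g * sg"
    using mult_left_mono[OF half, of g] gx g by simp
  have "\<bar>debiased_stack n V p y W vh Psi ?i k - stack A v ?i k\<bar> \<le> lam * L * l1 V (D k) + (1 + \<eta>) * lam * R"
    unfolding R_def by (rule debiased_error[OF k i])
  also have "\<dots> \<le> lam * x + (1 + \<eta>) * lam * (sg + x)"
    using xl s1 pen eta by (intro add_mono mult_left_mono) (auto simp: mult.assoc)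
  also have "\<dots> = lam * ((1 + \<eta>) * sg + x + (1 + \<eta>) * x)" by (simp add: algebra_simps)
  also have "\<dots> \<le> lam * ((1 + g) * sg)"
  proof (rule mult_left_mono)
    have "(1 + \<eta>) * x \<le> 2 * x" using eta x0 by (intro mult_right_mono) auto
    moreover have "(1 + \<eta>) * sg \<le> (1 + g / 2) * sg" using g half sp by (intro mult_right_mono) auto
    ultimately show "(1 + \<eta>) * sg + x + (1 + \<eta>) * x \<le> (1 + g) * sg"
      using \<open>6 * x \<le> g * sg\<close> by (simp add: algebra_simps)
  qed (use pen in simp)
  finally show "\<bar>debiased_stack n V p y W vh Psi ?i k - stack A v ?i k\<bar> \<le> (1 + g) * sigma_hat n V p y W vh Psi k j * lam"
    by (simp add: sg_def mult_ac)
  have "sg \<le> L * K4 + P1 * L * D1"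
    using s2 rms_w_eps(3)[OF k i] l1_D_le[OF k] P1 L1
    by (simp add: R_def x_def) (smt (verit) mult_left_mono mult_nonneg_nonneg)
  then have "2 * (1 + g) * sg * lam \<le> 4 * (L * K4 + P1 * L * D1) * (c2 * \<rho>)"
    using g half sp c2 pen by (intro mult_mono) auto
  then show "2 * (1 + g) * sigma_hat n V p y W vh Psi k j * lam \<le> 4 * c2 * (L * K4 + P1 * L * D1) * \<rho>"
    by (simp add: sg_def mult_ac)
qed

end

text \<open>The entries kept outside the sparsity pattern are at least half the threshold in the
  approximation error, so each of them costs no more than that error.\<close>

lemma thresholded_entry:
  fixes h wc m R :: real
  assumes "2 * \<bar>wc - h\<bar> \<le> m"
  shows "\<bar>(if \<bar>wc\<bar> > m then wc else 0) - h\<bar> \<le> 2 * m" "\<bar>(if \<bar>wc\<bar> > m then wc else 0) - h\<bar> \<le> \<bar>h\<bar>"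
  using assms by (auto simp: abs_if split: if_splits)

text \<open>In the application \<open>R\<close> is a row or column of the approximation error, which
  agrees with the true entry wherever \<open>Wb\<close> vanishes. The at most \<open>s\<close>
  entries of the pattern cost \<open>b\<close> each, all others together at most
  \<open>r\<close>.\<close>

lemma thresholded_sum:
  fixes f R :: "'a \<Rightarrow> real"
  assumes fin: "finite V" and s: "card {j\<in>V. Wb j \<noteq> (0::real)} \<le> s"
    and T: "\<And>j. j \<in> V \<Longrightarrow> \<bar>f j\<bar> \<le> b" and out: "\<And>j. j \<in> V \<Longrightarrow> Wb j = 0 \<Longrightarrow> \<bar>f j\<bar> \<le> \<bar>R j\<bar>"
    and b: "0 \<le> b" and r: "(\<Sum>j\<in>V. \<bar>R j\<bar>) \<le> r"
  shows "(\<Sum>j\<in>V. \<bar>f j\<bar>) \<le> s * b + r"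
proof -
  let ?T = "{j\<in>V. Wb j \<noteq> 0}"
  have "(\<Sum>j\<in>V. \<bar>f j\<bar>) = (\<Sum>j\<in>V - ?T. \<bar>f j\<bar>) + (\<Sum>j\<in>?T. \<bar>f j\<bar>)"
    by (rule sum.subset_diff) (use fin in auto)
  also have "(\<Sum>j\<in>?T. \<bar>f j\<bar>) \<le> card ?T * b" using T by (intro sum_bounded_above) auto
  also have "\<dots> \<le> s * b" using s b by (intro mult_right_mono) auto
  also have "(\<Sum>j\<in>V - ?T. \<bar>f j\<bar>) \<le> (\<Sum>j\<in>V - ?T. \<bar>R j\<bar>)" using out by (intro sum_mono) auto
  also have "\<dots> \<le> (\<Sum>j\<in>V. \<bar>R j\<bar>)" using fin by (intro sum_mono2) auto
  finally show ?thesis using r by linarith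
qed

section \<open>A single design\<close>

locale design =
  fixes N :: "('a, 'w) network" and n :: nat and B abar lbar pbar c C kappa Me MP :: real
  assumes n: "1 \<le> n" and standing: "standing_assms B abar lbar pbar n N" and data: "regular_data n N"
    and noise: "regular_noise c C Me n N" and covs: "regular_covariates c C kappa MP n N"
    and c: "0 < c" "c < C"
begin

abbreviation "M \<equiv> sample N"
abbreviation "V \<equiv> obs N"
abbreviation "I \<equiv> aug_set V"
abbreviation "PV \<equiv> (PiM V (\<lambda>_. borel) :: ('a \<Rightarrow> real) measure)"
abbreviation "T \<equiv> data_space N"
abbreviation "Dt t \<omega> \<equiv> obs_data N t \<omega>"

lemma fin: "finite V" and ne: "V \<noteq> {}" and prob: "prob_space M"
  using standing by (auto simp: standing_assms_def)

sublocale prob_space M by (rule prob)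

lemma cov_measurable: "t \<in> {1..n} \<Longrightarrow> i \<in> V \<Longrightarrow> (\<lambda>\<omega>. cov N t \<omega> i) \<in> borel_measurable M"
  and cov_bounded: "t \<in> {1..n} \<Longrightarrow> i \<in> V \<Longrightarrow> AE \<omega> in M. \<bar>cov N t \<omega> i\<bar> \<le> pbar"
  using standing by (auto simp: standing_assms_def agents_def)

lemma eps_measurable: "t \<in> {1..n} \<Longrightarrow> (\<lambda>\<omega>. red_eps N t \<omega> k) \<in> borel_measurable M"
proof -
  assume t: "t \<in> {1..n}"
  have "(\<lambda>\<omega>. shock N t \<omega> i) \<in> borel_measurable M" if "i \<in> agents N" for i
  proof (rule borel_measurable_integrable)
    show "integrable M (\<lambda>\<omega>. shock N t \<omega> i)" using standing t that by (simp add: standing_assms_def)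
  qed
  then show ?thesis unfolding red_eps_def
    by (intro borel_measurable_diff borel_measurable_sum borel_measurable_times borel_measurable_const) (auto simp: agents_def)
qed

lemma indep: "indep_vars (\<lambda>_. T) (obs_data N) {1..n}"
  and same_law: "t \<in> {1..n} \<Longrightarrow> distr M T (obs_data N t) = distr M T (obs_data N 1)"
  using data unfolding regular_data_def by blast+

lemma data_measurable: "t \<in> {1..n} \<Longrightarrow> obs_data N t \<in> measurable M T"
  using indep by (auto simp: indep_vars_def)

text \<open>Solves the reduced form for the noise, as a function of one observation, so that
  statements about the noise can be moved to the common law of the observations.\<close>

definition noise_of :: "'a \<Rightarrow> ('a \<Rightarrow> real) \<times> ('a \<Rightarrow> real) \<Rightarrow> real" where
  "noise_of k d = snd d k - red_v N k + (\<Sum>j\<in>V. netHinv N k j * fst d j)"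

lemma outcome_eq: "t \<in> {1..n} \<Longrightarrow> \<omega> \<in> space M \<Longrightarrow> k \<in> V \<Longrightarrow>
    outcome N t \<omega> k = red_v N k - (\<Sum>j\<in>V. netHinv N k j * cov N t \<omega> j) + red_eps N t \<omega> k"
  using data by (auto simp: regular_data_def)

lemma noise_of_data: "t \<in> {1..n} \<Longrightarrow> \<omega> \<in> space M \<Longrightarrow> k \<in> V \<Longrightarrow> noise_of k (Dt t \<omega>) = red_eps N t \<omega> k"
  using outcome_eq[of t \<omega> k] by (simp add: noise_of_def obs_data_def)

lemma fst_data: "fst (Dt t \<omega>) = obs_cov N t \<omega>"
  by (simp add: obs_data_def obs_cov_def)

lemma noise_of_measurable: "k \<in> V \<Longrightarrow> noise_of k \<in> borel_measurable T"
  unfolding noise_of_def[abs_def] data_space_def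
  by (intro borel_measurable_add borel_measurable_diff borel_measurable_sum borel_measurable_times borel_measurable_const
     measurable_compose[OF measurable_snd measurable_component_singleton] measurable_compose[OF measurable_fst measurable_component_singleton])

lemma fst_measurable: "fst \<in> measurable T PV" unfolding data_space_def by measurable

lemma obs_cov_measurable: "t \<in> {1..n} \<Longrightarrow> obs_cov N t \<in> measurable M PV"
  using measurable_compose[OF data_measurable fst_measurable] by (simp add: fst_data)

lemma sub_cov: "t \<in> {1..n} \<Longrightarrow> finite_measure_subalgebra M (sigma_cov N t)"
  using sets_image_in_sets[OF refl obs_cov_measurable]
  by unfold_locales (auto simp: subalgebra_def sigma_cov_def)

lemma sub_cov_all: "finite_measure_subalgebra M (sigma_cov_all n N)"
proof -
  have "(\<lambda>\<omega>. \<lambda>t\<in>{1..n}. obs_cov N t \<omega>) \<in> measurable M (PiM {1..n} (\<lambda>_. PV))"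
    by (intro measurable_restrict obs_cov_measurable)
  from sets_image_in_sets[OF refl this] show ?thesis
    by unfold_locales (auto simp: subalgebra_def sigma_cov_all_def)
qed

lemma eps4_integrable: "t \<in> {1..n} \<Longrightarrow> k \<in> V \<Longrightarrow> integrable M (\<lambda>\<omega>. (red_eps N t \<omega> k) ^ 4)"
  using noise by (auto simp: regular_noise_def)

lemma pow_le_fourth: "\<bar>u::real\<bar> ^ m \<le> 1 + u ^ 4" if "m \<le> 4"
proof -
  have "v ^ m \<le> 1 + v ^ 4" if "0 \<le> v" for v :: real
  proof (cases "v \<le> 1")
    case True then show ?thesis using that power_le_one[of v m] zero_le_power[of v 4] by linarith
  next
    case False then show ?thesis using \<open>m \<le> 4\<close> power_increasing[of m 4 v] by linarith
  qed
  from this[of "\<bar>u\<bar>"] show ?thesis by simp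
qed

lemma bounded_mult_pow_integrable:
  assumes t: "t \<in> {1..n}" and k: "k \<in> V" and h[measurable]: "h \<in> borel_measurable PV" and hb: "\<And>q. \<bar>h q\<bar> \<le> b" and m: "m \<le> 4"
  shows "integrable M (\<lambda>\<omega>. h (obs_cov N t \<omega>) * (red_eps N t \<omega> k) ^ m)"
proof (rule Bochner_Integration.integrable_bound)
  note [measurable] = obs_cov_measurable[OF t] eps_measurable[OF t]
  show "integrable M (\<lambda>\<omega>. b * (1 + (red_eps N t \<omega> k) ^ 4))" using eps4_integrable[OF t k] by simp
  show "(\<lambda>\<omega>. h (obs_cov N t \<omega>) * (red_eps N t \<omega> k) ^ m) \<in> borel_measurable M" by measurable
  show "AE \<omega> in M. norm (h (obs_cov N t \<omega>) * (red_eps N t \<omega> k) ^ m) \<le> norm (b * (1 + (red_eps N t \<omega> k) ^ 4))"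
  proof (rule AE_I2)
    fix \<omega>
    have "\<bar>h (obs_cov N t \<omega>)\<bar> * \<bar>red_eps N t \<omega> k\<bar> ^ m \<le> \<bar>b\<bar> * \<bar>1 + (red_eps N t \<omega> k) ^ 4\<bar>"
      using hb[of "obs_cov N t \<omega>"] pow_le_fourth[OF m, of "red_eps N t \<omega> k"] by (intro mult_mono) auto
    then show "norm (h (obs_cov N t \<omega>) * (red_eps N t \<omega> k) ^ m) \<le> norm (b * (1 + (red_eps N t \<omega> k) ^ 4))"
      by (simp add: abs_mult power_abs)
  qed
qed

text \<open>A function of the observed covariates is measurable for \<open>sigma_cov\<close> and may
  be taken out of the conditional expectation. This converts the assumptions on conditional moments
  into the integrated form of \<open>cond_noise\<close>.\<close>

lemma cond_exp_mult:
  assumes t: "t \<in> {1..n}" and k: "k \<in> V" and h[measurable]: "h \<in> borel_measurable PV" and hb: "\<And>q. \<bar>h q\<bar> \<le> b" and m: "m \<le> 4"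
  shows "integrable M (\<lambda>\<omega>. h (obs_cov N t \<omega>) * real_cond_exp M (sigma_cov N t) (\<lambda>\<omega>. (red_eps N t \<omega> k) ^ m) \<omega>)"
    and "(\<integral>\<omega>. h (obs_cov N t \<omega>) * (red_eps N t \<omega> k) ^ m \<partial>M)
      = (\<integral>\<omega>. h (obs_cov N t \<omega>) * real_cond_exp M (sigma_cov N t) (\<lambda>\<omega>. (red_eps N t \<omega> k) ^ m) \<omega> \<partial>M)"
proof -
  interpret F: finite_measure_subalgebra M "sigma_cov N t" by (rule sub_cov[OF t])
  have "obs_cov N t \<in> measurable (sigma_cov N t) PV"
    unfolding sigma_cov_def using measurable_space[OF obs_cov_measurable[OF t]]
    by (intro measurable_vimage_algebra1) auto
  then have hm: "(\<lambda>\<omega>. h (obs_cov N t \<omega>)) \<in> borel_measurable (sigma_cov N t)" by (rule measurable_compose[OF _ h])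
  have em: "(\<lambda>\<omega>. (red_eps N t \<omega> k) ^ m) \<in> borel_measurable M"
    using eps_measurable[OF t] by (intro borel_measurable_power)
  note * = F.real_cond_exp_intg[OF bounded_mult_pow_integrable[OF t k h hb m] hm em]
  show "integrable M (\<lambda>\<omega>. h (obs_cov N t \<omega>) * real_cond_exp M (sigma_cov N t) (\<lambda>\<omega>. (red_eps N t \<omega> k) ^ m) \<omega>)" by (rule *(1))
  show "(\<integral>\<omega>. h (obs_cov N t \<omega>) * (red_eps N t \<omega> k) ^ m \<partial>M)
      = (\<integral>\<omega>. h (obs_cov N t \<omega>) * real_cond_exp M (sigma_cov N t) (\<lambda>\<omega>. (red_eps N t \<omega> k) ^ m) \<omega> \<partial>M)" by (rule *(2)[symmetric])
qed

definition law where "law = distr M T (obs_data N 1)"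

lemma law_prob: "prob_space law"
  unfolding law_def using n by (intro prob_space_distr data_measurable) auto

lemma one_in: "1 \<in> {1..n}" using n by simp

lemma integral_law:
  fixes f :: "_ \<Rightarrow> real"
  assumes "f \<in> borel_measurable T" and t: "t \<in> {1..n}"
  shows "(\<integral>x. f x \<partial>law) = (\<integral>\<omega>. f (Dt t \<omega>) \<partial>M)"
  unfolding law_def same_law[OF t, symmetric] by (rule integral_distr[OF data_measurable[OF t] assms(1)])

lemma integrable_law:
  fixes f :: "_ \<Rightarrow> real"
  assumes "f \<in> borel_measurable T" and t: "t \<in> {1..n}"
  shows "integrable law f \<longleftrightarrow> integrable M (\<lambda>\<omega>. f (Dt t \<omega>))"
  unfolding law_def same_law[OF t, symmetric] by (rule integrable_distr_eq[OF data_measurable[OF t] assms(1)])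

lemma integral_law_noise:
  assumes k: "k \<in> V" and h[measurable]: "h \<in> borel_measurable PV"
  shows "(\<integral>x. h (fst x) * (noise_of k x) ^ m \<partial>law) = (\<integral>\<omega>. h (obs_cov N 1 \<omega>) * (red_eps N 1 \<omega> k) ^ m \<partial>M)"
proof -
  note [measurable] = noise_of_measurable[OF k] fst_measurable
  have "(\<integral>x. h (fst x) * (noise_of k x) ^ m \<partial>law) = (\<integral>\<omega>. h (fst (Dt 1 \<omega>)) * (noise_of k (Dt 1 \<omega>)) ^ m \<partial>M)"
    by (rule integral_law[OF _ one_in]) measurable
  also have "\<dots> = (\<integral>\<omega>. h (obs_cov N 1 \<omega>) * (red_eps N 1 \<omega> k) ^ m \<partial>M)"
    using noise_of_data[OF one_in _ k] by (intro Bochner_Integration.integral_cong refl) (simp add: fst_data)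
  finally show ?thesis .
qed

lemma cond_noise_law: assumes k: "k \<in> V" shows "cond_noise law PV fst (noise_of k) c C"
proof -
  interpret L: prob_space law by (rule law_prob)
  have sl: "sets law = sets T" by (simp add: law_def)
  note km = noise_of_measurable[OF k]
  let ?E = "\<lambda>m. real_cond_exp M (sigma_cov N 1) (\<lambda>\<omega>. (red_eps N 1 \<omega> k) ^ m)"
  show ?thesis
  proof
    show "fst \<in> measurable law PV" using fst_measurable by (simp add: measurable_cong_sets[OF sl refl])
    show "noise_of k \<in> borel_measurable law" using km by (simp add: measurable_cong_sets[OF sl refl])
    have "integrable M (\<lambda>\<omega>. (noise_of k (Dt 1 \<omega>)) ^ 4) \<longleftrightarrow> integrable M (\<lambda>\<omega>. (red_eps N 1 \<omega> k) ^ 4)"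
      using noise_of_data[OF one_in _ k] by (intro Bochner_Integration.integrable_cong) auto
    then show "integrable law (\<lambda>x. (noise_of k x) ^ 4)"
      using eps4_integrable[OF one_in k] integrable_law[OF borel_measurable_power[OF km] one_in] by simp
  next
    fix h b assume h[measurable]: "h \<in> borel_measurable PV" and hb: "\<And>q. \<bar>h q\<bar> \<le> (b::real)"
    have "AE \<omega> in M. h (obs_cov N 1 \<omega>) * ?E 1 \<omega> = 0"
    proof -
      have "AE \<omega> in M. real_cond_exp M (sigma_cov N 1) (\<lambda>\<omega>. red_eps N 1 \<omega> k) \<omega> = 0"
        using data one_in k unfolding regular_data_def by blast
      then show ?thesis by eventually_elim simp
    qed
    then have "(\<integral>\<omega>. h (obs_cov N 1 \<omega>) * ?E 1 \<omega> \<partial>M) = 0" by (rule integral_eq_zero_AE)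
    then show "(\<integral>x. h (fst x) * noise_of k x \<partial>law) = 0"
      using integral_law_noise[OF k h, of 1] cond_exp_mult(2)[OF one_in k h hb, of 1] by simp
  next
    fix h b assume h[measurable]: "h \<in> borel_measurable PV" and hb: "\<And>q. 0 \<le> h q \<and> h q \<le> (b::real)"
    have hb': "\<bar>h q\<bar> \<le> b" for q using hb[of q] by simp
    have ih: "integrable M (\<lambda>\<omega>. h (obs_cov N 1 \<omega>))"
      using bounded_mult_pow_integrable[OF one_in k h hb', of 0] by simp
    have hl: "(\<integral>x. h (fst x) \<partial>law) = (\<integral>\<omega>. h (obs_cov N 1 \<omega>) \<partial>M)"
      using integral_law_noise[OF k h, of 0] by simp
    have "AE \<omega> in M. (MIN j\<in>V. real_cond_exp M (sigma_cov N 1) (\<lambda>\<omega>. (red_eps N 1 \<omega> j)\<^sup>2) \<omega>) \<ge> c"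
      using noise one_in unfolding regular_noise_def by blast
    then have "AE \<omega> in M. c * h (obs_cov N 1 \<omega>) \<le> h (obs_cov N 1 \<omega>) * ?E 2 \<omega>"
    proof eventually_elim
      case (elim \<omega>)
      then have "c \<le> ?E 2 \<omega>" using k fin by (subst (asm) Min_ge_iff) auto
      from mult_left_mono[OF this, of "h (obs_cov N 1 \<omega>)"] show ?case using hb by (simp add: mult.commute)
    qed
    then have "(\<integral>\<omega>. c * h (obs_cov N 1 \<omega>) \<partial>M) \<le> (\<integral>\<omega>. h (obs_cov N 1 \<omega>) * ?E 2 \<omega> \<partial>M)"
      using ih cond_exp_mult(1)[OF one_in k h hb', of 2] by (intro integral_mono_AE) auto
    then show "c * (\<integral>x. h (fst x) \<partial>law) \<le> (\<integral>x. h (fst x) * (noise_of k x)\<^sup>2 \<partial>law)"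
      using integral_law_noise[OF k h, of 2] cond_exp_mult(2)[OF one_in k h hb', of 2] by (simp add: hl)
    have "AE \<omega> in M. (MAX j\<in>V. real_cond_exp M (sigma_cov N 1) (\<lambda>\<omega>. \<bar>red_eps N 1 \<omega> j\<bar> ^ 4) \<omega>) \<le> C"
      using noise one_in unfolding regular_noise_def by blast
    then have "AE \<omega> in M. h (obs_cov N 1 \<omega>) * ?E 4 \<omega> \<le> C * h (obs_cov N 1 \<omega>)"
    proof eventually_elim
      case (elim \<omega>)
      then have "?E 4 \<omega> \<le> C" using k fin by (subst (asm) Max_le_iff) auto
      from mult_left_mono[OF this, of "h (obs_cov N 1 \<omega>)"] show ?case using hb by (simp add: mult.commute)
    qed
    then have "(\<integral>\<omega>. h (obs_cov N 1 \<omega>) * ?E 4 \<omega> \<partial>M) \<le> (\<integral>\<omega>. C * h (obs_cov N 1 \<omega>) \<partial>M)"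
      using ih cond_exp_mult(1)[OF one_in k h hb', of 4] by (intro integral_mono_AE) auto
    then show "(\<integral>x. h (fst x) * (noise_of k x) ^ 4 \<partial>law) \<le> C * (\<integral>x. h (fst x) \<partial>law)"
      using integral_law_noise[OF k h, of 4] cond_exp_mult(2)[OF one_in k h hb', of 4] by (simp add: hl)
  qed
qed

lemma noise4_mean:
  assumes t: "t \<in> {1..n}" and k: "k \<in> V"
  shows "integrable M (\<lambda>\<omega>. (noise_of k (Dt t \<omega>)) ^ 4)" "(\<integral>\<omega>. (noise_of k (Dt t \<omega>)) ^ 4 \<partial>M) \<le> C"
proof -
  interpret L: cond_noise law PV fst "noise_of k" c C by (rule cond_noise_law[OF k])
  note km = borel_measurable_power[OF noise_of_measurable[OF k], of 4]
  show "integrable M (\<lambda>\<omega>. (noise_of k (Dt t \<omega>)) ^ 4)" using L.int4 integrable_law[OF km t] by simp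
  show "(\<integral>\<omega>. (noise_of k (Dt t \<omega>)) ^ 4 \<partial>M) \<le> C"
    using L.fourth[of "\<lambda>_. 1" 1] integral_law[OF km t] L.prob_space by simp
qed

text \<open>Integrating the conditional bound removes the conditioning on all covariates. The
  maximum serves as the envelope that justifies truncation in
  \<open>family_average_tail\<close>.\<close>

lemma max_eps4:
  "integrable M (\<lambda>\<omega>. MAX (t, j)\<in>{1..n} \<times> V. \<bar>red_eps N t \<omega> j\<bar> ^ 4)"
  "(\<integral>\<omega>. (MAX (t, j)\<in>{1..n} \<times> V. \<bar>red_eps N t \<omega> j\<bar> ^ 4) \<partial>M) \<le> Me"
proof -
  let ?m = "\<lambda>\<omega>. MAX (t, j)\<in>{1..n} \<times> V. \<bar>red_eps N t \<omega> j\<bar> ^ 4"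
  have ne': "{1..n} \<times> V \<noteq> {}" using ne n by auto
  have mm: "?m \<in> borel_measurable M"
    using eps_measurable fin by (intro borel_measurable_Max) auto
  show i: "integrable M ?m"
  proof (rule Bochner_Integration.integrable_bound[OF _ mm])
    show "integrable M (\<lambda>\<omega>. \<Sum>(t, j)\<in>{1..n} \<times> V. \<bar>red_eps N t \<omega> j\<bar> ^ 4)"
      using eps4_integrable by (intro Bochner_Integration.integrable_sum) auto
    show "AE \<omega> in M. norm (?m \<omega>) \<le> norm (\<Sum>(t, j)\<in>{1..n} \<times> V. \<bar>red_eps N t \<omega> j\<bar> ^ 4)"
    proof (rule AE_I2)
      fix \<omega>
      have "?m \<omega> \<in> (\<lambda>(t, j). \<bar>red_eps N t \<omega> j\<bar> ^ 4) ` ({1..n} \<times> V)"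
        using fin ne' by (intro Max_in) auto
      then obtain a where a: "a \<in> {1..n} \<times> V" "?m \<omega> = (\<lambda>(t, j). \<bar>red_eps N t \<omega> j\<bar> ^ 4) a" by (auto simp: image_iff)
      have "0 \<le> ?m \<omega>" unfolding a(2) by (auto split: prod.split)
      moreover have "?m \<omega> \<le> (\<Sum>(t, j)\<in>{1..n} \<times> V. \<bar>red_eps N t \<omega> j\<bar> ^ 4)" unfolding a(2)
        using fin by (intro member_le_sum[OF a(1)]) (auto split: prod.split)
      ultimately show "norm (?m \<omega>) \<le> norm (\<Sum>(t, j)\<in>{1..n} \<times> V. \<bar>red_eps N t \<omega> j\<bar> ^ 4)" by simp
    qed
  qed
  interpret F: finite_measure_subalgebra M "sigma_cov_all n N" by (rule sub_cov_all)
  have "(\<integral>\<omega>. ?m \<omega> \<partial>M) = (\<integral>\<omega>. real_cond_exp M (sigma_cov_all n N) ?m \<omega> \<partial>M)"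
    by (rule F.real_cond_exp_int(2)[OF i, symmetric])
  also have "\<dots> \<le> (\<integral>\<omega>. Me \<partial>M)"
    using noise F.real_cond_exp_int(1)[OF i] unfolding regular_noise_def by (intro integral_mono_AE) auto
  finally show "(\<integral>\<omega>. ?m \<omega> \<partial>M) \<le> Me" by (simp add: prob_space)
qed

section \<open>Bounded regressors and the population Gram matrix\<close>

definition "P1 = max 1 pbar"

lemma P1: "1 \<le> P1" by (simp add: P1_def)

lemma aug_measurable: "l \<in> I \<Longrightarrow> (\<lambda>d. aug (fst d) l) \<in> borel_measurable T"
  unfolding data_space_def
  by (cases l) (auto intro!: measurable_compose[OF measurable_fst measurable_component_singleton])

lemma aug_data: "l \<in> I \<Longrightarrow> aug (fst (Dt t \<omega>)) l = aug (cov N t \<omega>) l"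
  by (cases l) (auto simp: obs_data_def)

lemma aug_bounded: "AE \<omega> in M. \<forall>t\<in>{1..n}. \<forall>l\<in>I. \<bar>aug (cov N t \<omega>) l\<bar> \<le> P1"
proof -
  have "AE \<omega> in M. \<bar>aug (cov N t \<omega>) l\<bar> \<le> P1" if "t \<in> {1..n}" "l \<in> I" for t l
  proof (cases l)
    case (Some j)
    then have "j \<in> V" using that by simp
    from cov_bounded[OF that(1) this] show ?thesis by eventually_elim (simp add: P1_def Some)
  qed (simp add: P1_def)
  then show ?thesis using fin by (intro AE_finite_allI AE_ball_countable[THEN iffD2]) (auto simp: countable_finite)
qed

abbreviation "Psib \<equiv> Psi_bar N"

text \<open>One observation's contribution to the product of the population inverse with the
  empirical Gram matrix; by the choice of \<open>Psi_bar\<close> its mean is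
  \<open>delta k j\<close>.\<close>

definition q_of :: "'a option \<Rightarrow> 'a option \<Rightarrow> ('a \<Rightarrow> real) \<times> ('a \<Rightarrow> real) \<Rightarrow> real" where
  "q_of k j d = lin V (Psib k) (fst d) * aug (fst d) j"

lemma lin_data: "lin V x (fst (Dt t \<omega>)) = lin V x (cov N t \<omega>)"
  unfolding lin_def by (intro sum.cong) (auto simp: aug_data)

lemma q_of_data: "j \<in> I \<Longrightarrow> q_of k j (Dt t \<omega>) = lin V (Psib k) (cov N t \<omega>) * aug (cov N t \<omega>) j"
  by (simp add: q_of_def lin_data aug_data)

lemma lin_measurable: "(\<lambda>d. lin V x (fst d)) \<in> borel_measurable T"
  unfolding lin_def by (intro borel_measurable_sum borel_measurable_times aug_measurable) auto

lemma q_measurable: "j \<in> I \<Longrightarrow> q_of k j \<in> borel_measurable T"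
  unfolding q_of_def[abs_def] by (intro borel_measurable_times lin_measurable aug_measurable)

lemma gram_inv: "is_inverse_on I (gram N) Psib"
  and eig: "eigenvalue_on I Psib e \<Longrightarrow> e \<le> kappa"
  using covs is_inverse_on_mat_inv[of I "gram N"] by (auto simp: regular_covariates_def Let_def Psi_bar_def)

lemma AE_bounded_integrable:
  fixes f :: "_ \<Rightarrow> real"
  assumes "f \<in> borel_measurable M" "AE \<omega> in M. \<bar>f \<omega>\<bar> \<le> b" shows "integrable M f"
  using assms by (intro integrable_const_bound[of _ b]) auto

lemma aug_cov_measurable: "t \<in> {1..n} \<Longrightarrow> l \<in> I \<Longrightarrow> (\<lambda>\<omega>. aug (cov N t \<omega>) l) \<in> borel_measurable M"
  using measurable_compose[OF data_measurable aug_measurable] by (simp add: aug_data)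

lemma aug_prod_integrable:
  assumes t: "t \<in> {1..n}" and l: "l \<in> I" "j \<in> I"
  shows "integrable M (\<lambda>\<omega>. aug (cov N t \<omega>) l * aug (cov N t \<omega>) j)"
proof (rule AE_bounded_integrable)
  show "(\<lambda>\<omega>. aug (cov N t \<omega>) l * aug (cov N t \<omega>) j) \<in> borel_measurable M"
    by (intro borel_measurable_times aug_cov_measurable t l)
  show "AE \<omega> in M. \<bar>aug (cov N t \<omega>) l * aug (cov N t \<omega>) j\<bar> \<le> P1 * P1"
    using aug_bounded
  proof eventually_elim
    case (elim \<omega>) then show ?case using t l P1 by (auto simp: abs_mult intro!: mult_mono)
  qed
qed

lemma gram_eq:
  assumes t: "t \<in> {1..n}" and l: "l \<in> I" "j \<in> I"
  shows "(\<integral>\<omega>. aug (cov N t \<omega>) l * aug (cov N t \<omega>) j \<partial>M) = gram N l j"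
proof -
  have m: "(\<lambda>d. aug (fst d) l * aug (fst d) j) \<in> borel_measurable T"
    by (intro borel_measurable_times aug_measurable l)
  show ?thesis using integral_law[OF m t] integral_law[OF m one_in] l by (simp add: gram_def aug_data)
qed

lemma rayleigh: "0 < kappa" "(\<Sum>i\<in>I. (x i)\<^sup>2) \<le> kappa * quad_form I (gram N) x"
proof -
  have psd: "0 \<le> quad_form I (gram N) x" for x
  proof -
    have "quad_form I (gram N) x = (\<Sum>i\<in>I. \<Sum>j\<in>I. (\<integral>\<omega>. x i * x j * (aug (cov N 1 \<omega>) i * aug (cov N 1 \<omega>) j) \<partial>M))"
      by (simp add: quad_form_def gram_def sum_distrib_left mult_ac)
    also have "\<dots> = (\<integral>\<omega>. (\<Sum>i\<in>I. \<Sum>j\<in>I. x i * x j * (aug (cov N 1 \<omega>) i * aug (cov N 1 \<omega>) j)) \<partial>M)"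
      using aug_prod_integrable[OF one_in] by (simp add: Bochner_Integration.integral_sum Bochner_Integration.integrable_sum)
    also have "\<dots> = (\<integral>\<omega>. (lin V x (cov N 1 \<omega>))\<^sup>2 \<partial>M)"
      by (intro Bochner_Integration.integral_cong refl) (simp add: power2_eq_square lin_def sum_product mult_ac)
    also have "0 \<le> \<dots>" by simp
    finally show ?thesis .
  qed
  have sym: "gram N i j = gram N j i" for i j by (simp add: gram_def mult.commute)
  note R = rayleigh_inverse_bound[OF _ _ sym psd gram_inv eig]
  show "0 < kappa" "(\<Sum>i\<in>I. (x i)\<^sup>2) \<le> kappa * quad_form I (gram N) x"
    using R fin by auto
qed

lemma q_moments:
  assumes t: "t \<in> {1..n}" and kj: "k \<in> I" "j \<in> I"
  shows "integrable M (\<lambda>\<omega>. q_of k j (Dt t \<omega>))" "(\<integral>\<omega>. q_of k j (Dt t \<omega>) \<partial>M) = delta k j"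
    "integrable M (\<lambda>\<omega>. (q_of k j (Dt t \<omega>)) ^ 4)" "(\<integral>\<omega>. (q_of k j (Dt t \<omega>)) ^ 4 \<partial>M) \<le> C"
    "AE \<omega> in M. \<bar>q_of k j (Dt t \<omega>)\<bar> \<le> l1 V (Psib k) * P1 * P1"
proof -
  have m: "(\<lambda>\<omega>. q_of k j (Dt t \<omega>)) \<in> borel_measurable M"
    by (rule measurable_compose[OF data_measurable[OF t] q_measurable[OF kj(2)]])
  have exp: "q_of k j (Dt t \<omega>) = (\<Sum>l\<in>I. Psib k l * (aug (cov N t \<omega>) l * aug (cov N t \<omega>) j))" for \<omega>
    by (simp add: q_of_data[OF kj(2)] lin_def sum_distrib_right mult.assoc)
  show bd: "AE \<omega> in M. \<bar>q_of k j (Dt t \<omega>)\<bar> \<le> l1 V (Psib k) * P1 * P1"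
    using aug_bounded
  proof eventually_elim
    case (elim \<omega>)
    have "\<bar>q_of k j (Dt t \<omega>)\<bar> \<le> (\<Sum>l\<in>I. \<bar>Psib k l\<bar> * (P1 * P1))"
      unfolding exp using elim t kj P1
      by (intro order_trans[OF sum_abs] sum_mono) (auto simp: abs_mult intro!: mult_left_mono mult_mono)
    then show ?case by (simp add: l1_def sum_distrib_right mult.assoc)
  qed
  show "integrable M (\<lambda>\<omega>. q_of k j (Dt t \<omega>))" by (rule AE_bounded_integrable[OF m bd])
  show "integrable M (\<lambda>\<omega>. (q_of k j (Dt t \<omega>)) ^ 4)"
  proof (rule AE_bounded_integrable)
    show "(\<lambda>\<omega>. (q_of k j (Dt t \<omega>)) ^ 4) \<in> borel_measurable M" using m by (rule borel_measurable_power)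
    show "AE \<omega> in M. \<bar>(q_of k j (Dt t \<omega>)) ^ 4\<bar> \<le> (l1 V (Psib k) * P1 * P1) ^ 4"
      using bd
    proof eventually_elim
      case (elim \<omega>)
      then have "\<bar>q_of k j (Dt t \<omega>)\<bar> ^ 4 \<le> (l1 V (Psib k) * P1 * P1) ^ 4" by (intro power_mono) auto
      then show ?case by (simp add: power_abs)
    qed
  qed
  have "(\<integral>\<omega>. q_of k j (Dt t \<omega>) \<partial>M) = (\<Sum>l\<in>I. Psib k l * gram N l j)"
    unfolding exp using aug_prod_integrable[OF t _ kj(2)] gram_eq[OF t _ kj(2)]
    by (subst Bochner_Integration.integral_sum) auto
  also have "\<dots> = delta k j" by (rule is_inverse_on_right[OF gram_inv kj])
  finally show "(\<integral>\<omega>. q_of k j (Dt t \<omega>) \<partial>M) = delta k j" .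
  have "(MAX (k, j)\<in>I \<times> I. integral\<^sup>L M (\<lambda>\<omega>. \<bar>row_aug V Psib k (cov N t \<omega>) * aug (cov N t \<omega>) j\<bar> ^ 4)) \<le> C"
    using covs t unfolding regular_covariates_def Let_def by blast
  then have "integral\<^sup>L M (\<lambda>\<omega>. \<bar>row_aug V Psib k (cov N t \<omega>) * aug (cov N t \<omega>) j\<bar> ^ 4) \<le> C"
    using fin kj by (subst (asm) Max_le_iff) auto
  then show "(\<integral>\<omega>. (q_of k j (Dt t \<omega>)) ^ 4 \<partial>M) \<le> C" by (simp add: q_of_data[OF kj(2)] row_aug_eq_lin)
qed

lemma max_q4:
  "integrable M (\<lambda>\<omega>. MAX (t, k, j)\<in>{1..n} \<times> I \<times> I. \<bar>q_of k j (Dt t \<omega>)\<bar> ^ 4)"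
  "(\<integral>\<omega>. (MAX (t, k, j)\<in>{1..n} \<times> I \<times> I. \<bar>q_of k j (Dt t \<omega>)\<bar> ^ 4) \<partial>M) \<le> MP"
proof -
  let ?m = "\<lambda>\<omega>. MAX (t, k, j)\<in>{1..n} \<times> I \<times> I. \<bar>q_of k j (Dt t \<omega>)\<bar> ^ 4"
  have ne': "{1..n} \<times> I \<times> I \<noteq> {}" using n by auto
  have mq: "(\<lambda>\<omega>. q_of k j (Dt t \<omega>)) \<in> borel_measurable M" if "t \<in> {1..n}" "j \<in> I" for t k j
    by (rule measurable_compose[OF data_measurable[OF that(1)] q_measurable[OF that(2)]])
  have mm: "?m \<in> borel_measurable M"
    using mq fin by (intro borel_measurable_Max) (auto intro!: borel_measurable_power borel_measurable_abs)
  show "integrable M ?m"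
  proof (rule Bochner_Integration.integrable_bound[OF _ mm])
    show "integrable M (\<lambda>\<omega>. \<Sum>(t, k, j)\<in>{1..n} \<times> I \<times> I. \<bar>q_of k j (Dt t \<omega>)\<bar> ^ 4)"
      using q_moments(3) by (intro Bochner_Integration.integrable_sum) auto
    show "AE \<omega> in M. norm (?m \<omega>) \<le> norm (\<Sum>(t, k, j)\<in>{1..n} \<times> I \<times> I. \<bar>q_of k j (Dt t \<omega>)\<bar> ^ 4)"
    proof (rule AE_I2)
      fix \<omega>
      have "?m \<omega> \<in> (\<lambda>(t, k, j). \<bar>q_of k j (Dt t \<omega>)\<bar> ^ 4) ` ({1..n} \<times> I \<times> I)"
        using fin ne' by (intro Max_in) auto
      then obtain a where a: "a \<in> {1..n} \<times> I \<times> I" "?m \<omega> = (\<lambda>(t, k, j). \<bar>q_of k j (Dt t \<omega>)\<bar> ^ 4) a" by (auto simp: image_iff)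
      have "0 \<le> ?m \<omega>" unfolding a(2) by (auto split: prod.split)
      moreover have "?m \<omega> \<le> (\<Sum>(t, k, j)\<in>{1..n} \<times> I \<times> I. \<bar>q_of k j (Dt t \<omega>)\<bar> ^ 4)" unfolding a(2)
        using fin by (intro member_le_sum[OF a(1)]) (auto split: prod.split)
      ultimately show "norm (?m \<omega>) \<le> norm (\<Sum>(t, k, j)\<in>{1..n} \<times> I \<times> I. \<bar>q_of k j (Dt t \<omega>)\<bar> ^ 4)" by simp
    qed
  qed
  have "?m \<omega> = (MAX (t, k, j)\<in>{1..n} \<times> I \<times> I. \<bar>row_aug V Psib k (cov N t \<omega>) * aug (cov N t \<omega>) j\<bar> ^ 4)" for \<omega>
    by (intro arg_cong[of _ _ Max] image_cong refl) (auto simp: q_of_data row_aug_eq_lin)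
  then show "(\<integral>\<omega>. ?m \<omega> \<partial>M) \<le> MP"
    using covs unfolding regular_covariates_def Let_def by simp
qed

end

section \<open>Noise conditional on the covariates of all periods\<close>

context design begin

definition path :: "'w \<Rightarrow> nat \<Rightarrow> 'a \<Rightarrow> real" where
  "path \<omega> = (\<lambda>s\<in>{1..n}. obs_cov N s \<omega>)"

lemma path_measurable: "path \<in> measurable M (PiM {1..n} (\<lambda>_. PV))"
  unfolding path_def[abs_def] by (intro measurable_restrict obs_cov_measurable)

lemma joint_law: "distr M (PiM {1..n} (\<lambda>_. T)) (\<lambda>\<omega>. \<lambda>t\<in>{1..n}. Dt t \<omega>) = PiM {1..n} (\<lambda>_. law)"
proof -
  have "distr M (PiM {1..n} (\<lambda>_. T)) (\<lambda>\<omega>. \<lambda>t\<in>{1..n}. Dt t \<omega>) = PiM {1..n} (\<lambda>t. distr M T (obs_data N t))"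
    using indep_vars_iff_distr_eq_PiM'[of "{1..n}" "obs_data N" "\<lambda>_. T"] indep data_measurable n by auto
  also have "\<dots> = PiM {1..n} (\<lambda>_. law)"
    by (intro PiM_cong refl) (simp only: law_def same_law)
  finally show ?thesis .
qed

text \<open>The observations are independent with a common law, so jointly they follow a product
  measure, and \<open>iterated_conditional_bound\<close> can be pulled back to the sample
  space.\<close>

lemma iterated_noise:
  fixes F :: "real \<Rightarrow> ('a \<Rightarrow> real) \<times> ('a \<Rightarrow> real) \<Rightarrow> real"
  assumes F: "(\<lambda>(g, x). F g x) \<in> borel_measurable (borel \<Otimes>\<^sub>M law)"
    and Fb: "\<And>g x. \<bar>g\<bar> \<le> R \<Longrightarrow> 0 \<le> F g x \<and> F g x \<le> b"
    and step: "\<And>z g b. z \<in> borel_measurable PV \<Longrightarrow> g \<in> borel_measurable PV \<Longrightarrow> (\<And>q. 0 \<le> z q \<and> z q \<le> b) \<Longrightarrow>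
        (\<And>q. \<bar>g q\<bar> \<le> R) \<Longrightarrow> (\<integral>\<^sup>+x. ennreal (z (fst x) * F (g (fst x)) x) \<partial>law) \<le> (\<integral>\<^sup>+x. ennreal (z (fst x)) \<partial>law)"
    and w: "\<And>t. t \<in> {1..n} \<Longrightarrow> w t \<in> borel_measurable (PiM {1..n} (\<lambda>_. PV))"
    and wb: "\<And>t P. \<bar>w t P\<bar> \<le> R"
  shows "(\<integral>\<^sup>+\<omega>. ennreal (\<Prod>t\<in>{1..n}. F (w t (path \<omega>)) (Dt t \<omega>)) \<partial>M) \<le> 1"
proof -
  have sl: "sets law = sets T" by (simp add: law_def)
  have fl: "fst \<in> measurable law PV" using fst_measurable by (simp add: measurable_cong_sets[OF sl refl])
  define G where "G d = ennreal (\<Prod>t\<in>{1..n}. F (w t (\<lambda>s\<in>{1..n}. fst (d s))) (d t))" for d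
  have sP: "sets (PiM {1..n} (\<lambda>_. T)) = sets (PiM {1..n} (\<lambda>_. law))" by (intro sets_PiM_cong refl) (simp add: sl)
  have Gm: "G \<in> borel_measurable (PiM {1..n} (\<lambda>_. T))"
    unfolding measurable_cong_sets[OF sP refl] G_def
  proof (intro measurable_compose[OF _ measurable_ennreal] borel_measurable_prod)
    fix t assume t: "t \<in> {1..n}"
    have pth: "(\<lambda>d. \<lambda>s\<in>{1..n}. fst (d s)) \<in> measurable (PiM {1..n} (\<lambda>_. law)) (PiM {1..n} (\<lambda>_. PV))"
      by (intro measurable_restrict measurable_compose[OF _ fl] measurable_component_singleton)
    have "(\<lambda>d. (w t (\<lambda>s\<in>{1..n}. fst (d s)), d t)) \<in> measurable (PiM {1..n} (\<lambda>_. law)) (borel \<Otimes>\<^sub>M law)"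
      by (intro measurable_Pair measurable_compose[OF pth w[OF t]] measurable_component_singleton t)
    from measurable_compose[OF this F]
    show "(\<lambda>d. F (w t (\<lambda>s\<in>{1..n}. fst (d s))) (d t)) \<in> borel_measurable (PiM {1..n} (\<lambda>_. law))" by simp
  qed
  have Dm: "(\<lambda>\<omega>. \<lambda>t\<in>{1..n}. Dt t \<omega>) \<in> measurable M (PiM {1..n} (\<lambda>_. T))"
    by (intro measurable_restrict data_measurable)
  have "(\<integral>\<^sup>+\<omega>. ennreal (\<Prod>t\<in>{1..n}. F (w t (path \<omega>)) (Dt t \<omega>)) \<partial>M) = (\<integral>\<^sup>+\<omega>. G (\<lambda>t\<in>{1..n}. Dt t \<omega>) \<partial>M)"
  proof (rule nn_integral_cong)
    fix \<omega>
    have "(\<lambda>s\<in>{1..n}. fst ((\<lambda>t\<in>{1..n}. Dt t \<omega>) s)) = path \<omega>"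
      unfolding path_def by (intro restrict_ext) (simp add: fst_data)
    moreover have "(\<Prod>t\<in>{1..n}. F (w t (path \<omega>)) ((\<lambda>t\<in>{1..n}. Dt t \<omega>) t)) = (\<Prod>t\<in>{1..n}. F (w t (path \<omega>)) (Dt t \<omega>))"
      by (intro prod.cong) auto
    ultimately show "ennreal (\<Prod>t\<in>{1..n}. F (w t (path \<omega>)) (Dt t \<omega>)) = G (\<lambda>t\<in>{1..n}. Dt t \<omega>)"
      unfolding G_def by (simp only:)
  qed
  also have "\<dots> = (\<integral>\<^sup>+d. G d \<partial>PiM {1..n} (\<lambda>_. law))"
    unfolding joint_law[symmetric] by (rule nn_integral_distr[symmetric, OF Dm]) (simp add: Gm del: One_nat_def)
  also have "\<dots> \<le> 1"
    unfolding G_def by (rule iterated_conditional_bound[OF law_prob fl F Fb step w wb])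
  finally show ?thesis .
qed

context
  fixes w :: "nat \<Rightarrow> (nat \<Rightarrow> 'a \<Rightarrow> real) \<Rightarrow> real" and k :: 'a and R :: real
  assumes k: "k \<in> V" and w: "\<And>t. t \<in> {1..n} \<Longrightarrow> w t \<in> borel_measurable (PiM {1..n} (\<lambda>_. PV))"
    and wb: "\<And>t P. \<bar>w t P\<bar> \<le> R"
begin

lemma w_measurable: "t \<in> {1..n} \<Longrightarrow> (\<lambda>\<omega>. w t (path \<omega>)) \<in> borel_measurable M"
  by (rule measurable_compose[OF path_measurable w])

lemma weighted_exp_moment:
  "(\<integral>\<^sup>+\<omega>. ennreal (exp (b * (\<Sum>t=1..n. w t (path \<omega>) * red_eps N t \<omega> k)
      - b\<^sup>2 * (\<Sum>t=1..n. (w t (path \<omega>) * red_eps N t \<omega> k)\<^sup>2) / 2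
      - 8 * (1 + C) * \<bar>b\<bar> ^ 3 * (\<Sum>t=1..n. \<bar>w t (path \<omega>)\<bar> ^ 3))) \<partial>M) \<le> 1"
proof -
  interpret L: cond_noise law PV fst "noise_of k" c C by (rule cond_noise_law[OF k])
  have "(\<integral>\<^sup>+\<omega>. ennreal (\<Prod>t\<in>{1..n}. L.F1 (b * w t (path \<omega>)) (Dt t \<omega>)) \<partial>M) \<le> 1"
  proof (rule iterated_noise[where R="\<bar>b\<bar> * R" and b=3 and w="\<lambda>t P. b * w t P"])
    show "(\<lambda>(g, x). L.F1 g x) \<in> borel_measurable (borel \<Otimes>\<^sub>M law)" by (rule L.F1_measurable)
    show "\<bar>b * w t P\<bar> \<le> \<bar>b\<bar> * R" for t P using wb by (simp add: abs_mult mult_left_mono)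
    show "(\<lambda>P. b * w t P) \<in> borel_measurable (PiM {1..n} (\<lambda>_. PV))" if "t \<in> {1..n}" for t
      using w[OF that] by (intro borel_measurable_times borel_measurable_const)
  qed (use L.F1_bounds L.F1_step in blast)+
  moreover have "(\<Prod>t\<in>{1..n}. L.F1 (b * w t (path \<omega>)) (Dt t \<omega>)) = exp (b * (\<Sum>t=1..n. w t (path \<omega>) * red_eps N t \<omega> k)
      - b\<^sup>2 * (\<Sum>t=1..n. (w t (path \<omega>) * red_eps N t \<omega> k)\<^sup>2) / 2
      - 8 * (1 + C) * \<bar>b\<bar> ^ 3 * (\<Sum>t=1..n. \<bar>w t (path \<omega>)\<bar> ^ 3))" if "\<omega> \<in> space M" for \<omega>
  proof -
    have "(\<Prod>t\<in>{1..n}. L.F1 (b * w t (path \<omega>)) (Dt t \<omega>)) = (\<Prod>t\<in>{1..n}. exp (b * (w t (path \<omega>) * red_eps N t \<omega> k)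
      - b\<^sup>2 / 2 * (w t (path \<omega>) * red_eps N t \<omega> k)\<^sup>2 - 8 * (1 + C) * \<bar>b\<bar> ^ 3 * \<bar>w t (path \<omega>)\<bar> ^ 3))"
      using noise_of_data[OF _ that k]
      by (intro prod.cong refl) (simp add: L.F1_def power_mult_distrib abs_mult mult_ac)
    also have "\<dots> = exp (\<Sum>t\<in>{1..n}. b * (w t (path \<omega>) * red_eps N t \<omega> k)
      - b\<^sup>2 / 2 * (w t (path \<omega>) * red_eps N t \<omega> k)\<^sup>2 - 8 * (1 + C) * \<bar>b\<bar> ^ 3 * \<bar>w t (path \<omega>)\<bar> ^ 3)"
      by (rule exp_sum[symmetric]) simp
    finally show ?thesis by (simp only: sum_subtractf sum_distrib_left[symmetric]) simp
  qed
  ultimately show ?thesis by (simp cong: nn_integral_cong_simp)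
qed

lemma weighted_lower_moment:
  assumes th: "0 \<le> \<theta>"
  shows "(\<integral>\<^sup>+\<omega>. ennreal (exp (- \<theta> * (\<Sum>t=1..n. (w t (path \<omega>) * red_eps N t \<omega> k)\<^sup>2)
      + \<theta> * c * (\<Sum>t=1..n. (w t (path \<omega>))\<^sup>2) - \<theta>\<^sup>2 * C * (\<Sum>t=1..n. (w t (path \<omega>)) ^ 4) / 2)) \<partial>M) \<le> 1"
proof -
  interpret L: cond_noise law PV fst "noise_of k" c C by (rule cond_noise_law[OF k])
  have "(\<integral>\<^sup>+\<omega>. ennreal (\<Prod>t\<in>{1..n}. L.F2 \<theta> (w t (path \<omega>)) (Dt t \<omega>)) \<partial>M) \<le> 1"
  proof (rule iterated_noise[where R=R and b="exp (\<theta> * \<bar>c\<bar> * R\<^sup>2)"])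
    show "(\<lambda>(g, x). L.F2 \<theta> g x) \<in> borel_measurable (borel \<Otimes>\<^sub>M law)" by (rule L.F2_measurable)
    show "0 \<le> L.F2 \<theta> g x \<and> L.F2 \<theta> g x \<le> exp (\<theta> * \<bar>c\<bar> * R\<^sup>2)" if "\<bar>g\<bar> \<le> R" for g x by (rule L.F2_bounds[OF th that])
    show "(\<integral>\<^sup>+x. ennreal (z (fst x) * L.F2 \<theta> (g (fst x)) x) \<partial>law) \<le> (\<integral>\<^sup>+x. ennreal (z (fst x)) \<partial>law)"
      if "z \<in> borel_measurable PV" "g \<in> borel_measurable PV" "\<And>q. 0 \<le> z q \<and> z q \<le> b" "\<And>q. \<bar>g q\<bar> \<le> R" for z g b
      by (rule L.F2_step[OF th that])
  qed (use w wb in blast)+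
  moreover have "(\<Prod>t\<in>{1..n}. L.F2 \<theta> (w t (path \<omega>)) (Dt t \<omega>)) = exp (- \<theta> * (\<Sum>t=1..n. (w t (path \<omega>) * red_eps N t \<omega> k)\<^sup>2)
      + \<theta> * c * (\<Sum>t=1..n. (w t (path \<omega>))\<^sup>2) - \<theta>\<^sup>2 * C * (\<Sum>t=1..n. (w t (path \<omega>)) ^ 4) / 2)" if "\<omega> \<in> space M" for \<omega>
  proof -
    have "(\<Prod>t\<in>{1..n}. L.F2 \<theta> (w t (path \<omega>)) (Dt t \<omega>)) = (\<Prod>t\<in>{1..n}. exp (- \<theta> * (w t (path \<omega>) * red_eps N t \<omega> k)\<^sup>2
      + \<theta> * c * (w t (path \<omega>))\<^sup>2 - \<theta>\<^sup>2 * C / 2 * (w t (path \<omega>)) ^ 4))"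
      using noise_of_data[OF _ that k]
      by (intro prod.cong refl) (simp add: L.F2_def power_mult_distrib mult_ac)
    also have "\<dots> = exp (\<Sum>t\<in>{1..n}. - \<theta> * (w t (path \<omega>) * red_eps N t \<omega> k)\<^sup>2
      + \<theta> * c * (w t (path \<omega>))\<^sup>2 - \<theta>\<^sup>2 * C / 2 * (w t (path \<omega>)) ^ 4)"
      by (rule exp_sum[symmetric]) simp
    finally show ?thesis by (simp only: sum_subtractf sum.distrib sum_distrib_left[symmetric]) simp
  qed
  ultimately show ?thesis by (simp cong: nn_integral_cong_simp)
qed

end

text \<open>The weights enter only where their fourth powers average to at most \<open>m4\<close>, so truncating them
  at a large level does not change the event.\<close>

lemma weighted_noise_tail:
  assumes k: "k \<in> V" and w: "\<And>t. t \<in> {1..n} \<Longrightarrow> w t \<in> borel_measurable (PiM {1..n} (\<lambda>_. PV))"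
    and m: "0 < m2" "1 \<le> m4" "1 \<le> K4" and x: "1 \<le> x"
    and v0: "v0 = sqrt (c * m2 / 2)"
    and eta: "\<eta> = (8 * (8 * (1 + C)) * (1 + m4) / v0 ^ 3 + 2) * (x / sqrt n)" "\<eta> \<le> 1"
    and Nn: "(m4 + K4) / v0 * sqrt (sqrt n) \<le> real Nn"
  shows "measure M {\<omega>\<in>space M. m2 \<le> avg n (\<lambda>t. (w t (path \<omega>))\<^sup>2) \<and> avg n (\<lambda>t. (w t (path \<omega>)) ^ 4) \<le> m4 \<and>
      avg n (\<lambda>t. (red_eps N t \<omega> k) ^ 4) \<le> K4 \<and>
      \<not> (v0 \<le> rms n (\<lambda>t. w t (path \<omega>) * red_eps N t \<omega> k) \<and>
         \<bar>avg n (\<lambda>t. w t (path \<omega>) * red_eps N t \<omega> k)\<bar> \<le> (1 + \<eta>) * (x / sqrt n) * rms n (\<lambda>t. w t (path \<omega>) * red_eps N t \<omega> k))}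
    \<le> exp (- (c\<^sup>2 * m2\<^sup>2 / (8 * C * m4)) * real n) + 2 * ((real Nn + 1) * exp (- x\<^sup>2 / 2))" (is "measure M ?A \<le> _")
proof -
  \<comment> \<open>If the fourth powers average to at most \<open>m4\<close>, each is at most
    \<open>n * m4\<close>, and \<open>|w| \<le> 1 + w^4\<close>. The truncation supplies the
    boundedness required for the exponential moments.\<close>
  define R where "R = n * m4 + 1"
  define w' where "w' t P = max (- R) (min R (w t P))" for t P
  have R1: "1 \<le> R" using m n by (simp add: R_def)
  have w'm: "w' t \<in> borel_measurable (PiM {1..n} (\<lambda>_. PV))" if "t \<in> {1..n}" for t
    unfolding w'_def using w[OF that] by (intro borel_measurable_max borel_measurable_min borel_measurable_const)
  have w'b: "\<bar>w' t P\<bar> \<le> R" for t P using R1 by (auto simp: w'_def)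
  define S where "S \<omega> = (\<Sum>t=1..n. w' t (path \<omega>) * red_eps N t \<omega> k)" for \<omega>
  define V2 where "V2 \<omega> = (\<Sum>t=1..n. (w' t (path \<omega>) * red_eps N t \<omega> k)\<^sup>2)" for \<omega>
  define Q where "Q \<omega> = (\<Sum>t=1..n. \<bar>w' t (path \<omega>)\<bar> ^ 3)" for \<omega>
  define W2 where "W2 \<omega> = (\<Sum>t=1..n. (w' t (path \<omega>))\<^sup>2)" for \<omega>
  define W4 where "W4 \<omega> = (\<Sum>t=1..n. (w' t (path \<omega>)) ^ 4)" for \<omega>
  have wpm: "(\<lambda>\<omega>. w' t (path \<omega>)) \<in> borel_measurable M" if "t \<in> {1..n}" for t
    by (rule w_measurable[OF k w'm w'b that])
  have ms: "S \<in> borel_measurable M" "V2 \<in> borel_measurable M" "Q \<in> borel_measurable M" "W2 \<in> borel_measurable M" "W4 \<in> borel_measurable M"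
    unfolding S_def V2_def Q_def W2_def W4_def using wpm eps_measurable
    by (auto intro!: borel_measurable_sum borel_measurable_times borel_measurable_power borel_measurable_abs)
  have K: "0 \<le> 8 * (1 + C)" using c by simp
  have v0p: "0 < v0" using v0 c m by simp
  have v02: "v0\<^sup>2 = c * m2 / 2" using v0 c m by simp
  have q0: "0 \<le> 1 + m4" and v1: "0 \<le> m4 + K4" using m by auto
  have mgf: "(\<integral>\<^sup>+\<omega>. ennreal (exp (b * S \<omega> - b\<^sup>2 * V2 \<omega> / 2 - 8 * (1 + C) * \<bar>b\<bar> ^ 3 * Q \<omega>)) \<partial>M) \<le> 1" for b
    unfolding S_def V2_def Q_def by (rule weighted_exp_moment[OF k w'm w'b])
  \<comment> \<open>The compensators are even in \<open>b\<close>, so \<open>- S\<close> satisfies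
    the same bound and the lower tail needs no separate argument.\<close>
  have mgf': "(\<integral>\<^sup>+\<omega>. ennreal (exp (b * (- S \<omega>) - b\<^sup>2 * V2 \<omega> / 2 - 8 * (1 + C) * \<bar>b\<bar> ^ 3 * Q \<omega>)) \<partial>M) \<le> 1" for b
    using mgf[of "- b"] by simp
  let ?E = "\<lambda>S. {\<omega>\<in>space M. real n * v0\<^sup>2 \<le> V2 \<omega> \<and> V2 \<omega> \<le> real n * (m4 + K4)\<^sup>2 \<and> Q \<omega> \<le> real n * (1 + m4) \<and> (1 + \<eta>) * x * sqrt (V2 \<omega>) < S \<omega>}"
  let ?L = "{\<omega>\<in>space M. real n * m2 \<le> W2 \<omega> \<and> W4 \<omega> \<le> real n * m4 \<and> V2 \<omega> < real n * (c * m2 / 2)}"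
  have m'': "(\<lambda>\<omega>. - S \<omega>) \<in> borel_measurable M" using ms(1) by simp
  have E1: "measure M (?E S) \<le> (real Nn + 1) * exp (- x\<^sup>2 / 2)"
    by (rule self_normalised_tail_one_sided[OF prob ms(1-3) K q0 mgf n x v0p v1 eta Nn])
  have E2: "measure M (?E (\<lambda>\<omega>. - S \<omega>)) \<le> (real Nn + 1) * exp (- x\<^sup>2 / 2)"
    by (rule self_normalised_tail_one_sided[OF prob m'' ms(2,3) K q0 mgf' n x v0p v1 eta Nn])
  have C0: "0 < C" and m40: "0 < m4" using c m by auto
  have E3: "measure M ?L \<le> exp (- (c\<^sup>2 * m2\<^sup>2 / (8 * C * m4)) * real n)"
  proof (rule lower_tail[OF prob ms(2,4,5) c(1) C0 m(1) m40])
    fix \<theta> :: real assume "0 \<le> \<theta>"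
    then show "(\<integral>\<^sup>+\<omega>. ennreal (exp (- \<theta> * V2 \<omega> + \<theta> * c * W2 \<omega> - \<theta>\<^sup>2 * C * W4 \<omega> / 2)) \<partial>M) \<le> 1"
      unfolding V2_def W2_def W4_def using weighted_lower_moment[where w=w' and \<theta>=\<theta>, OF k w'm w'b] by simp
  qed
  have sub: "?A \<subseteq> ?L \<union> (?E S \<union> ?E (\<lambda>\<omega>. - S \<omega>))"
  proof
    fix \<omega> assume "\<omega> \<in> ?A"
    then have a: "\<omega> \<in> space M" "m2 \<le> avg n (\<lambda>t. (w t (path \<omega>))\<^sup>2)" "avg n (\<lambda>t. (w t (path \<omega>)) ^ 4) \<le> m4"
      "avg n (\<lambda>t. (red_eps N t \<omega> k) ^ 4) \<le> K4"
      and no: "\<not> (v0 \<le> rms n (\<lambda>t. w t (path \<omega>) * red_eps N t \<omega> k) \<and>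
         \<bar>avg n (\<lambda>t. w t (path \<omega>) * red_eps N t \<omega> k)\<bar> \<le> (1 + \<eta>) * (x / sqrt n) * rms n (\<lambda>t. w t (path \<omega>) * red_eps N t \<omega> k))"
      by auto
    have nn: "0 < real n" using n by simp
    have wR: "\<bar>w t (path \<omega>)\<bar> \<le> R" if t: "t \<in> {1..n}" for t
    proof -
      have "(w t (path \<omega>)) ^ 4 \<le> (\<Sum>t=1..n. (w t (path \<omega>)) ^ 4)" using t by (intro member_le_sum) auto
      also have "\<dots> \<le> n * m4" using a(3) nn by (simp add: avg_def pos_divide_le_eq mult.commute)
      finally have "(w t (path \<omega>)) ^ 4 \<le> n * m4" .
      moreover have "\<bar>w t (path \<omega>)\<bar> ^ 1 \<le> 1 + (w t (path \<omega>)) ^ 4" by (rule pow_le_fourth) simp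
      ultimately show ?thesis by (simp add: R_def)
    qed
    have ww: "w' t (path \<omega>) = w t (path \<omega>)" if "t \<in> {1..n}" for t
      using wR[OF that] by (auto simp: w'_def)
    define r where "r = rms n (\<lambda>t. w t (path \<omega>) * red_eps N t \<omega> k)"
    define a1 where "a1 = avg n (\<lambda>t. w t (path \<omega>) * red_eps N t \<omega> k)"
    have S: "S \<omega> = real n * a1" using nn ww by (simp add: S_def a1_def avg_def)
    have V2: "V2 \<omega> = real n * r\<^sup>2" using nn ww by (simp add: V2_def r_def rms_sq avg_def)
    have W2: "real n * m2 \<le> W2 \<omega>" using a(2) nn ww by (simp add: W2_def avg_def pos_le_divide_eq mult.commute)
    have W4: "W4 \<omega> \<le> real n * m4" using a(3) nn ww by (simp add: W4_def avg_def pos_divide_le_eq mult.commute)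
    have Q: "Q \<omega> \<le> real n * (1 + m4)"
    proof -
      have "Q \<omega> \<le> (\<Sum>t=1..n. 1 + (w' t (path \<omega>)) ^ 4)" unfolding Q_def by (intro sum_mono pow_le_fourth) auto
      also have "\<dots> = real n + W4 \<omega>" by (simp add: sum.distrib W4_def)
      finally show ?thesis using W4 by (simp add: distrib_left)
    qed
    \<comment> \<open>Cauchy-Schwarz bounds \<open>r^4\<close> by \<open>m4 * K4\<close>. The upper
      end \<open>m4 + K4\<close> of the grid is crude; being at least 1, it lies below its own
      square.\<close>
    have Vu: "V2 \<omega> \<le> real n * (m4 + K4)\<^sup>2"
    proof -
      have "(r\<^sup>2)\<^sup>2 \<le> m4 * K4" unfolding r_def rms_sq power_mult_distrib by (rule avg_prod_sq_le[OF a(3,4)])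
      also have "\<dots> \<le> (m4 + K4)\<^sup>2" using m by (simp add: power2_sum)
      finally have "r\<^sup>2 \<le> m4 + K4" by (rule power2_le_imp_le) (rule v1)
      also have "\<dots> \<le> (m4 + K4)\<^sup>2" using m by (simp add: self_le_power)
      finally show ?thesis using nn by (simp add: V2)
    qed
    show "\<omega> \<in> ?L \<union> (?E S \<union> ?E (\<lambda>\<omega>. - S \<omega>))"
    proof (cases "v0 \<le> r")
      case False
      have "r\<^sup>2 < v0\<^sup>2" using False by (intro power_strict_mono) (auto simp: r_def)
      then have "V2 \<omega> < real n * (c * m2 / 2)" unfolding V2 v02 using nn by (intro mult_strict_left_mono)
      then show ?thesis using a(1) W2 W4 by blast
    next
      case True
      then have lo: "real n * v0\<^sup>2 \<le> V2 \<omega>" unfolding V2 using v0p by (intro mult_left_mono power_mono) auto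
      have r0: "0 \<le> r" by (simp add: r_def)
      have "(1 + \<eta>) * (x / sqrt n) * r < \<bar>a1\<bar>" using no True by (simp add: r_def a1_def)
      then have "real n * ((1 + \<eta>) * (x / sqrt n) * r) < real n * \<bar>a1\<bar>" using nn by (intro mult_strict_left_mono)
      moreover have "real n * ((1 + \<eta>) * (x / sqrt n) * r) = (1 + \<eta>) * x * sqrt (V2 \<omega>)"
      proof -
        have "real n * ((1 + \<eta>) * (x / sqrt n) * r) = (1 + \<eta>) * r * (real n * (x / sqrt n))" by (simp only: mult_ac)
        also have "real n * (x / sqrt n) = x * sqrt n" using nn by (simp add: field_simps)
        finally show ?thesis using r0 by (simp add: V2 real_sqrt_mult mult_ac)
      qed
      ultimately have "(1 + \<eta>) * x * sqrt (V2 \<omega>) < \<bar>S \<omega>\<bar>" using nn by (simp add: S abs_mult)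
      then have "(1 + \<eta>) * x * sqrt (V2 \<omega>) < S \<omega> \<or> (1 + \<eta>) * x * sqrt (V2 \<omega>) < - S \<omega>" by linarith
      then show ?thesis using a(1) lo Vu Q by blast
    qed
  qed
  have L_sets: "?L \<in> sets M" and E_sets: "?E S \<in> sets M" "?E (\<lambda>\<omega>. - S \<omega>) \<in> sets M"
    using ms by measurable
  have "measure M ?A \<le> measure M (?L \<union> (?E S \<union> ?E (\<lambda>\<omega>. - S \<omega>)))"
    using L_sets E_sets by (intro finite_measure_mono sub) auto
  also have "\<dots> \<le> measure M ?L + measure M (?E S \<union> ?E (\<lambda>\<omega>. - S \<omega>))"
    using L_sets E_sets by (intro measure_Un_le) auto
  also have "\<dots> \<le> measure M ?L + (measure M (?E S) + measure M (?E (\<lambda>\<omega>. - S \<omega>)))"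
    using E_sets by (intro add_left_mono measure_Un_le) auto
  finally show ?thesis using E1 E2 E3 by simp
qed

section \<open>Bounds holding uniformly over families of averages\<close>

definition "ell = ln (real (card V))"
text \<open>The target rate. It is chosen such that \<open>n * rho^2 = ell\<close>: an exponent
  \<open>4 * n * rho^2\<close> means probability |V|^(-4), which survives a union over pairs of
  indices.\<close>

definition "rho = sqrt (ell / n)"

text \<open>Truncation takes place at \<open>n / ell\<close>. By Markov's inequality for the
  envelope \<open>G\<close>, nothing is cut off except with probability \<open>m * ell / n\<close>,
  which is the origin of the growth condition on \<open>Me\<close> and \<open>MP\<close>; the
  truncated averages have tails \<open>exp (- (4 * ell))\<close>, and the level exceeds
  \<open>2 * C\<close> by \<open>4 * ell * (n / ell) / n = 4\<close>.\<close>

lemma family_average_tail: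
  assumes J: "finite J" and h: "\<And>i. i \<in> J \<Longrightarrow> h i \<in> borel_measurable T" and h0: "\<And>i d. 0 \<le> h i d"
    and int: "\<And>i t. i \<in> J \<Longrightarrow> t \<in> {1..n} \<Longrightarrow> integrable M (\<lambda>\<omega>. h i (Dt t \<omega>))"
    and le: "\<And>i t. i \<in> J \<Longrightarrow> t \<in> {1..n} \<Longrightarrow> (\<integral>\<omega>. h i (Dt t \<omega>) \<partial>M) \<le> C"
    and G: "integrable M G" "(\<integral>\<omega>. G \<omega> \<partial>M) \<le> m" "\<And>\<omega>. \<omega> \<in> space M \<Longrightarrow> 0 \<le> G \<omega>"
    and hG: "\<And>i t \<omega>. i \<in> J \<Longrightarrow> t \<in> {1..n} \<Longrightarrow> \<omega> \<in> space M \<Longrightarrow> h i (Dt t \<omega>) \<le> G \<omega>"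
    and ell: "0 < ell"
  shows "measure M {\<omega>\<in>space M. \<exists>i\<in>J. 2 * C + 4 < avg n (\<lambda>t. h i (Dt t \<omega>))} \<le> m * ell / n + card J * exp (- (4 * ell))"
    (is "measure M ?A \<le> _")
proof -
  define Lv where "Lv = n / ell"
  have L: "0 < Lv" using ell n by (simp add: Lv_def)
  let ?G = "{\<omega>\<in>space M. Lv \<le> G \<omega>}"
  let ?B = "\<lambda>i. {\<omega>\<in>space M. 2 * C + (4 * ell) * Lv / n \<le> avg n (\<lambda>t. min (h i (Dt t \<omega>)) Lv)}"
  have aux: "(4 * ell) * Lv / n = 4" using ell n by (simp add: Lv_def)
  have hm: "(\<lambda>\<omega>. h i (Dt t \<omega>)) \<in> borel_measurable M" if "i \<in> J" "t \<in> {1..n}" for i t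
    by (rule measurable_compose[OF data_measurable[OF that(2)] h[OF that(1)]])
  have Bs: "?B i \<in> sets M" if "i \<in> J" for i
  proof -
    have "(\<lambda>\<omega>. avg n (\<lambda>t. min (h i (Dt t \<omega>)) Lv)) \<in> borel_measurable M"
      unfolding avg_def using hm[OF that] by (intro borel_measurable_divide borel_measurable_sum borel_measurable_min borel_measurable_const)
    then show ?thesis by measurable
  qed
  have Gs: "?G \<in> sets M" using G(1) by measurable
  have "?A \<subseteq> ?G \<union> (\<Union>i\<in>J. ?B i)"
  proof
    fix \<omega> assume "\<omega> \<in> ?A"
    then obtain i where i: "\<omega> \<in> space M" "i \<in> J" "2 * C + 4 < avg n (\<lambda>t. h i (Dt t \<omega>))" by auto
    show "\<omega> \<in> ?G \<union> (\<Union>i\<in>J. ?B i)"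
    proof (cases "Lv \<le> G \<omega>")
      case False
      have "avg n (\<lambda>t. min (h i (Dt t \<omega>)) Lv) = avg n (\<lambda>t. h i (Dt t \<omega>))"
      proof (rule avg_cong)
        fix t assume "t \<in> {1..n}"
        from hG[OF i(2) this i(1)] False show "min (h i (Dt t \<omega>)) Lv = h i (Dt t \<omega>)" by simp
      qed
      then have "\<omega> \<in> ?B i" using i aux by simp
      then show ?thesis using i(2) by blast
    qed (use i in auto)
  qed
  then have "measure M ?A \<le> measure M (?G \<union> (\<Union>i\<in>J. ?B i))"
    by (intro finite_measure_mono sets.Un sets.finite_UN Gs Bs J)
  also have "\<dots> \<le> measure M ?G + measure M (\<Union>i\<in>J. ?B i)"
    by (intro measure_Un_le sets.finite_UN Gs Bs J)
  also have "measure M (\<Union>i\<in>J. ?B i) \<le> (\<Sum>i\<in>J. measure M (?B i))"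
    using Bs J by (intro finite_measure_subadditive_finite) auto
  also have "\<dots> \<le> (\<Sum>i\<in>J. exp (- (4 * ell)))"
    by (intro sum_mono truncated_average_tail[OF prob indep h h0 int le L n]) auto
  also have "measure M ?G \<le> (\<integral>\<omega>. G \<omega> \<partial>M) / Lv"
    using G L by (intro integral_Markov_inequality_measure[where A="{}"]) auto
  also have "\<dots> \<le> m / Lv" using G(2) L by (intro divide_right_mono) auto
  finally show ?thesis by (simp add: Lv_def)
qed

text \<open>\<open>kap\<close> is the constant of \<open>centred_average_tail\<close> for the
  centred variables, with second-moment bound \<open>2 * K4 + 2 * mb^2\<close> and third absolute
  moment at most \<open>1 + 8 * (mf + mb ^ 4)\<close>. The empirical fourth moment remains a
  condition inside the event, to be verified separately.\<close>

lemma family_centred_tail: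
  assumes J: "finite J" and h: "\<And>i. i \<in> J \<Longrightarrow> h i \<in> borel_measurable T"
    and int: "\<And>i t. i \<in> J \<Longrightarrow> t \<in> {1..n} \<Longrightarrow> integrable M (\<lambda>\<omega>. h i (Dt t \<omega>))"
    and mean: "\<And>i t. i \<in> J \<Longrightarrow> t \<in> {1..n} \<Longrightarrow> (\<integral>\<omega>. h i (Dt t \<omega>) \<partial>M) = \<mu> i"
    and int4: "\<And>i t. i \<in> J \<Longrightarrow> t \<in> {1..n} \<Longrightarrow> integrable M (\<lambda>\<omega>. (h i (Dt t \<omega>)) ^ 4)"
    and le: "\<And>i t. i \<in> J \<Longrightarrow> t \<in> {1..n} \<Longrightarrow> (\<integral>\<omega>. (h i (Dt t \<omega>)) ^ 4 \<partial>M) \<le> mf"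
    and mu: "\<And>i. i \<in> J \<Longrightarrow> \<bar>\<mu> i\<bar> \<le> mb" and K: "1 \<le> K4" and ell: "0 < ell" and r1: "rho \<le> 1"
    and kap: "K4 + mb\<^sup>2 + 8 * (1 + 8 * (mf + mb ^ 4)) + 4 \<le> kap"
  shows "measure M {\<omega>\<in>space M. \<exists>i\<in>J. avg n (\<lambda>t. (h i (Dt t \<omega>)) ^ 4) \<le> K4 \<and> kap * rho < \<bar>avg n (\<lambda>t. h i (Dt t \<omega>)) - \<mu> i\<bar>}
    \<le> card J * (2 * exp (- (4 * ell)))" (is "measure M ?A \<le> _")
proof (cases "J = {}")
  case False
  then obtain i0 where i0: "i0 \<in> J" by auto
  have mf0: "0 \<le> mf" using order_trans[OF _ le[OF i0 one_in]] by simp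
  have r: "0 < rho" "real n * rho\<^sup>2 = ell" using ell n by (auto simp: rho_def)
  let ?X = "\<lambda>i d. h i d - \<mu> i"
  let ?K3 = "1 + 8 * (mf + mb ^ 4)"
  let ?B = "\<lambda>i. {\<omega>\<in>space M. avg n (\<lambda>t. (?X i (Dt t \<omega>))\<^sup>2) \<le> 2 * K4 + 2 * mb\<^sup>2 \<and> kap * rho < \<bar>avg n (\<lambda>t. ?X i (Dt t \<omega>))\<bar>}"
  have quart: "\<bar>a - b\<bar> ^ 4 \<le> 8 * (a ^ 4 + b ^ 4)" for a b :: real
  proof -
    have sq: "(u + v)\<^sup>2 \<le> 2 * (u\<^sup>2 + v\<^sup>2)" for u v :: real
      using zero_le_power2[of "u - v"] by (simp add: power2_eq_square algebra_simps)
    have "(a - b)\<^sup>2 \<le> 2 * (a\<^sup>2 + b\<^sup>2)" using sq[of a "- b"] by simp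
    then have "((a - b)\<^sup>2)\<^sup>2 \<le> (2 * (a\<^sup>2 + b\<^sup>2))\<^sup>2" by (intro power_mono) auto
    also have "\<dots> \<le> 4 * (2 * ((a\<^sup>2)\<^sup>2 + (b\<^sup>2)\<^sup>2))" unfolding power_mult_distrib using sq[of "a\<^sup>2" "b\<^sup>2"] by simp
    finally show ?thesis by (simp flip: power_mult)
  qed
  have mu4: "(\<mu> i) ^ 4 \<le> mb ^ 4" if "i \<in> J" for i
    using power_mono[OF mu[OF that], of 4] by simp
  have B: "measure M (?B i) \<le> 2 * exp (- (4 * ell))" if i: "i \<in> J" for i
  proof -
    have Xm: "?X i \<in> borel_measurable T" using h[OF i] by (intro borel_measurable_diff borel_measurable_const)
    have X3: "\<bar>?X i d\<bar> ^ 3 \<le> 1 + 8 * ((h i d) ^ 4 + mb ^ 4)" for d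
    proof -
      have "\<bar>?X i d\<bar> ^ 3 \<le> 1 + (?X i d) ^ 4" by (rule pow_le_fourth) simp
      also have "(?X i d) ^ 4 \<le> 8 * ((h i d) ^ 4 + (\<mu> i) ^ 4)" using quart[of "h i d" "\<mu> i"] by simp
      finally show ?thesis using mu4[OF i] by simp
    qed
    have ib: "integrable M (\<lambda>\<omega>. 1 + 8 * ((h i (Dt t \<omega>)) ^ 4 + mb ^ 4))" if "t \<in> {1..n}" for t
      using int4[OF i that] by simp
    have i3: "integrable M (\<lambda>\<omega>. \<bar>?X i (Dt t \<omega>)\<bar> ^ 3)" if t: "t \<in> {1..n}" for t
    proof (rule Bochner_Integration.integrable_bound[OF ib[OF t]])
      show "(\<lambda>\<omega>. \<bar>?X i (Dt t \<omega>)\<bar> ^ 3) \<in> borel_measurable M"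
        using measurable_compose[OF data_measurable[OF t] Xm] by (intro borel_measurable_power borel_measurable_abs)
      show "AE \<omega> in M. norm (\<bar>?X i (Dt t \<omega>)\<bar> ^ 3) \<le> norm (1 + 8 * ((h i (Dt t \<omega>)) ^ 4 + mb ^ 4))"
        using X3 by (intro AE_I2) (auto simp: order_trans[OF _ abs_ge_self])
    qed
    have l3: "(\<integral>\<omega>. \<bar>?X i (Dt t \<omega>)\<bar> ^ 3 \<partial>M) \<le> ?K3" if t: "t \<in> {1..n}" for t
    proof -
      have "(\<integral>\<omega>. \<bar>?X i (Dt t \<omega>)\<bar> ^ 3 \<partial>M) \<le> (\<integral>\<omega>. 1 + 8 * ((h i (Dt t \<omega>)) ^ 4 + mb ^ 4) \<partial>M)"
        by (intro integral_mono i3 ib t X3)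
      also have "\<dots> = 1 + 8 * ((\<integral>\<omega>. (h i (Dt t \<omega>)) ^ 4 \<partial>M) + mb ^ 4)" using int4[OF i t] by (simp add: prob_space)
      also have "\<dots> \<le> ?K3" using le[OF i t] by simp
      finally show ?thesis .
    qed
    have K3: "0 \<le> ?K3" using mf0 by simp
    have kk: "(2 * K4 + 2 * mb\<^sup>2) / 2 + 8 * ?K3 + 4 \<le> kap"
    proof -
      have "(2 * K4 + 2 * mb\<^sup>2) / 2 = K4 + mb\<^sup>2" by (simp add: add_divide_distrib)
      then show ?thesis using kap by (simp only:)
    qed
    have "measure M (?B i) \<le> 2 * exp (- (4 * (real n * rho\<^sup>2)))"
      by (rule centred_average_tail[OF prob indep Xm _ _ i3 l3 K3 n r(1) r1 kk])
         (use int[OF i] mean[OF i] in \<open>auto simp: prob_space\<close>)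
    then show ?thesis unfolding r(2) .
  qed
  have Bs: "?B i \<in> sets M" if i: "i \<in> J" for i
  proof -
    have Xm: "(\<lambda>\<omega>. ?X i (Dt t \<omega>)) \<in> borel_measurable M" if "t \<in> {1..n}" for t
      using measurable_compose[OF data_measurable[OF that] h[OF i]] by (intro borel_measurable_diff borel_measurable_const)
    have "(\<lambda>\<omega>. avg n (\<lambda>t. (?X i (Dt t \<omega>))\<^sup>2)) \<in> borel_measurable M" "(\<lambda>\<omega>. avg n (\<lambda>t. ?X i (Dt t \<omega>))) \<in> borel_measurable M"
      unfolding avg_def using Xm by (intro borel_measurable_divide borel_measurable_sum borel_measurable_power borel_measurable_const; simp)+
    then show ?thesis by measurable
  qed
  have "?A \<subseteq> (\<Union>i\<in>J. ?B i)"
  proof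
    fix \<omega> assume "\<omega> \<in> ?A"
    then obtain i where i: "\<omega> \<in> space M" "i \<in> J" "avg n (\<lambda>t. (h i (Dt t \<omega>)) ^ 4) \<le> K4"
      "kap * rho < \<bar>avg n (\<lambda>t. h i (Dt t \<omega>)) - \<mu> i\<bar>" by auto
    have "avg n (\<lambda>t. (?X i (Dt t \<omega>))\<^sup>2) \<le> avg n (\<lambda>t. 2 * (h i (Dt t \<omega>))\<^sup>2 + 2 * mb\<^sup>2)"
    proof (rule avg_mono)
      fix t
      have "(?X i (Dt t \<omega>))\<^sup>2 \<le> 2 * (h i (Dt t \<omega>))\<^sup>2 + 2 * (\<mu> i)\<^sup>2"
        using zero_le_power2[of "h i (Dt t \<omega>) + \<mu> i"] by (simp add: power2_eq_square algebra_simps)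
      moreover have "(\<mu> i)\<^sup>2 \<le> mb\<^sup>2" using power_mono[OF mu[OF i(2)], of 2] by simp
      ultimately show "(?X i (Dt t \<omega>))\<^sup>2 \<le> 2 * (h i (Dt t \<omega>))\<^sup>2 + 2 * mb\<^sup>2" by simp
    qed
    also have "\<dots> = 2 * avg n (\<lambda>t. (h i (Dt t \<omega>))\<^sup>2) + 2 * mb\<^sup>2" using n by (simp add: avg_add avg_cmult avg_const)
    also have "avg n (\<lambda>t. (h i (Dt t \<omega>))\<^sup>2) \<le> K4"
    proof (rule power2_le_imp_le)
      show "(avg n (\<lambda>t. (h i (Dt t \<omega>))\<^sup>2))\<^sup>2 \<le> K4\<^sup>2"
        using rms_le_avg4[OF n i(3)] K by (rule order_trans[OF _ self_le_power]) auto
    qed (use K in simp)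
    finally have "avg n (\<lambda>t. (?X i (Dt t \<omega>))\<^sup>2) \<le> 2 * K4 + 2 * mb\<^sup>2" by simp
    moreover have "avg n (\<lambda>t. ?X i (Dt t \<omega>)) = avg n (\<lambda>t. h i (Dt t \<omega>)) - \<mu> i" using n by (simp add: avg_diff avg_const)
    ultimately show "\<omega> \<in> (\<Union>i\<in>J. ?B i)" using i by auto
  qed
  then have "measure M ?A \<le> measure M (\<Union>i\<in>J. ?B i)" using Bs J by (intro finite_measure_mono) auto
  also have "\<dots> \<le> (\<Sum>i\<in>J. measure M (?B i))" using Bs J by (intro finite_measure_subadditive_finite) auto
  also have "\<dots> \<le> (\<Sum>i\<in>J. 2 * exp (- (4 * ell)))" by (intro sum_mono B)
  finally show ?thesis by simp
qed simp

end

text \<open>Gaussian tail bounds at the quantile \<open>x\<close>. The lower tail bound makes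
  \<open>exp (- x^2 / 2)\<close> of order x / (n |V|^2): this absorbs a union over pairs and still
  leaves x / n for the grid. The upper one gives \<open>x^2 \<le> 2 * ln (1 / q)\<close>, and
  \<open>ln n \<le> C' * ln (card V)\<close> makes every logarithm comparable with that of |V|,
  which yields \<open>2 * (C' + 4)\<close>.\<close>

lemma pen_bounds:
  fixes V :: "'a set"
  assumes n: "3 \<le> n" and cV: "2 \<le> card V" and C': "0 < C'" "ln n \<le> C' * ln (card V)"
  defines "x \<equiv> inv Phi (1 - 1 / (3 * real n * (real (card V))\<^sup>2))"
  shows "1 \<le> x" "pen n V = x / sqrt n" "exp (- x\<^sup>2 / 2) \<le> 4 * x / (n * (real (card V))\<^sup>2)"
    "1/2 * sqrt (ln (card V) / n) \<le> pen n V" "pen n V \<le> sqrt (2 * (C' + 4)) * sqrt (ln (card V) / n)"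
proof -
  define q where "q = 1 / (3 * real n * (real (card V))\<^sup>2)"
  define l where "l = ln (real (card V))"
  have c4: "4 \<le> (real (card V))\<^sup>2" using power_mono[of 2 "real (card V)" 2] cV by simp
  have nc: "36 \<le> 3 * real n * (real (card V))\<^sup>2"
    using mult_mono[of 9 "3 * real n" 4 "(real (card V))\<^sup>2"] n c4 by simp
  have q: "0 < q" "q \<le> 1/36" using nc by (auto simp: q_def field_simps)
  have Phix: "1 - Phi x = q" unfolding x_def q_def[symmetric] using Phi_inv[of "1 - q"] q by simp
  \<comment> \<open>The size conditions put the level \<open>q\<close> at or below 1/36, whereas the
    Gaussian tail beyond 1 is at least \<open>exp (- 1/2) / 12\<close>, hence at least 1/24.\<close>
  show x1: "1 \<le> x"
  proof (rule ccontr)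
    assume "\<not> 1 \<le> x"
    then have "Phi x \<le> Phi 1" unfolding Phi_def by (intro std_normal.cdf_nondecreasing) simp
    then have "12 * 1 * (1 - Phi 1) \<le> 12 * q" using Phix by simp
    moreover have "exp (- 1\<^sup>2 / 2) \<le> 12 * 1 * (1 - Phi 1)" by (rule one_minus_Phi_ge) simp
    moreover have "1 + (- 1 / 2) \<le> exp (- 1 / 2 :: real)" by (rule exp_ge_add_one_self)
    ultimately show False using q by simp
  qed
  show pen: "pen n V = x / sqrt n" by (simp add: pen_def x_def)
  have "exp (- x\<^sup>2 / 2) \<le> 12 * x * q" using one_minus_Phi_ge[OF x1] Phix by simp
  also have "\<dots> = 4 * x / (n * (real (card V))\<^sup>2)" by (simp add: q_def)
  finally show ex: "exp (- x\<^sup>2 / 2) \<le> 4 * x / (n * (real (card V))\<^sup>2)" .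
  have l0: "ln 2 \<le> l" "0 < l" using cV by (auto simp: l_def intro: less_le_trans[of 0 "ln 2"])
  have lq: "ln (1 / q) = ln 3 + ln n + 2 * l"
    using n cV by (simp add: q_def l_def ln_mult ln_realpow)
  have "12 * x * q = exp (ln (12 * x) + ln q)" using x1 q by (simp add: exp_add)
  then have "- x\<^sup>2 / 2 \<le> ln (12 * x) + ln q" using one_minus_Phi_ge[OF x1] Phix by simp
  moreover have "ln (12 * x) \<le> 3 * x\<^sup>2"
  proof -
    have "12 = 2 ^ 3 * (3/2 :: real)" by simp
    then have "ln (12 * x) = 3 * ln 2 + ln (3/2) + ln x" using x1 by (simp only: ln_mult ln_realpow) (simp add: ln_mult ln_realpow)
    also have "\<dots> \<le> 3 * ln 2 + 1/2 + (x - 1)" using x1 ln_le_minus_one[of "3/2"] ln_le_minus_one[of x] by simp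
    also have "\<dots> \<le> 3 * (25/36) + 1/2 + (x - 1)" using ln2_le_25_over_36 by simp
    also have "\<dots> \<le> 3 * x\<^sup>2" using x1 self_le_power[of x 2] by simp
    finally show ?thesis .
  qed
  moreover have "ln (1 / q) = - ln q" using q by (simp add: ln_div)
  ultimately have up: "ln (1 / q) \<le> 7/2 * x\<^sup>2" by simp
  have n0: "0 \<le> ln (real n)" "0 \<le> ln (3::real)" using n by auto
  have "l / 4 \<le> x\<^sup>2" using up lq n0 l0 by linarith
  then have "sqrt (l / 4) \<le> x" using x1 by (intro real_le_lsqrt) auto
  then have "sqrt l / 2 \<le> x" by (simp add: real_sqrt_divide)
  then have "sqrt l / 2 / sqrt n \<le> x / sqrt n" by (intro divide_right_mono) auto
  then show "1/2 * sqrt (ln (card V) / n) \<le> pen n V" by (simp add: pen l_def real_sqrt_divide)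
  have "q \<le> exp (- x\<^sup>2 / 2)" using one_minus_Phi_le[of x] x1 Phix by simp
  then have "ln q \<le> ln (exp (- x\<^sup>2 / 2))" using q by (subst ln_le_cancel_iff) auto
  then have "x\<^sup>2 \<le> 2 * ln (1 / q)" using q by (simp add: ln_div)
  also have "2 * ln (1 / q) \<le> 2 * (C' + 4) * l"
  proof -
    have "ln 3 \<le> ln (2 ^ 2 :: real)" by (subst ln_le_cancel_iff) auto
    also have "\<dots> = 2 * ln 2" by (subst ln_realpow) auto
    finally have "ln 3 \<le> 2 * l" using l0 by linarith
    then show ?thesis unfolding lq using C'(2) by (simp add: l_def algebra_simps)
  qed
  finally have "x \<le> sqrt (2 * (C' + 4) * l)" by (rule real_le_rsqrt)
  then have "x / sqrt n \<le> sqrt (2 * (C' + 4) * l) / sqrt n" by (intro divide_right_mono) auto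
  then show "pen n V \<le> sqrt (2 * (C' + 4)) * sqrt (ln (card V) / n)"
    by (simp add: pen l_def real_sqrt_mult real_sqrt_divide)
qed

section \<open>Constants and the good event of a single design\<close>

context design begin

text \<open>By the block formulas, \<open>red_v N k\<close> is row \<open>k\<close> of the full
  inverse applied to the intercepts, reduced by the latent covariate on the latent agents. The row
  sum bound \<open>B\<close> therefore controls it together with row \<open>k\<close> of
  \<open>netHinv\<close>.\<close>

lemma reduced_form_bound:
  assumes k: "k \<in> V"
  shows "l1 V (\<lambda>l. stack (netHinv N) (red_v N) l k) \<le> \<bar>B\<bar> * (1 + \<bar>abar\<bar> + \<bar>pbar\<bar>)"
proof -
  let ?Mi = "netMinv N"
  have st: "finite (lat N)" "V \<inter> lat N = {}" "invertible_on (agents N) (netM N)" "invertible_on (lat N) (netM N)"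
    "invertible_on V (netH N)" "norm_inf (agents N) ?Mi \<le> B" "\<And>i. i \<in> agents N \<Longrightarrow> \<bar>icpt N i\<bar> \<le> abar"
    using standing by (auto simp: standing_assms_def)
  have N: "is_inverse_on (V \<union> lat N) (netM N) ?Mi"
    using is_inverse_on_mat_inv[OF st(3)] by (simp add: agents_def netMinv_def)
  note Li = is_inverse_on_mat_inv[OF st(4)]
  have Hi: "is_inverse_on V (netH N) (netHinv N)" unfolding netHinv_def by (rule is_inverse_on_mat_inv[OF st(5)])
  have H: "netH N i j = netM N i j - mat_mult (lat N) (netS N) (netM N) i j" for i j by (simp add: netH_def)
  note blk = schur_inverse_eq_block[OF fin st(1,2) N Li netS_def H Hi k]
    and blk2 = schur_inverse_mult_eq_block[OF fin st(1,2) N Li netS_def H Hi k]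
  have ag: "agents N = V \<union> lat N" by (simp add: agents_def)
  have "(\<Sum>j\<in>agents N. \<bar>?Mi k j\<bar>) \<le> norm_inf (agents N) ?Mi"
    unfolding norm_inf_def using k fin st(1) by (intro Max_ge) (auto simp: ag)
  then have row: "(\<Sum>j\<in>agents N. \<bar>?Mi k j\<bar>) \<le> B" using st(6) by simp
  have split: "(\<Sum>j\<in>agents N. f j) = (\<Sum>j\<in>V. f j) + (\<Sum>j\<in>lat N. f j)" for f :: "'a \<Rightarrow> real"
    unfolding ag by (rule sum.union_disjoint[OF fin st(1,2)])
  have p0: "\<bar>lat_cov N\<bar> \<le> \<bar>pbar\<bar>" if l: "l \<in> lat N" for l
  proof -
    have cov1: "AE \<omega> in M. \<bar>cov N 1 \<omega> l\<bar> \<le> pbar" and cov2: "\<forall>\<omega>\<in>space M. cov N 1 \<omega> l = lat_cov N"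
      using standing one_in l unfolding standing_assms_def agents_def by blast+
    have "AE \<omega> in M. \<bar>lat_cov N\<bar> \<le> pbar"
      using cov1 AE_space by eventually_elim (use cov2 in auto)
    then show ?thesis by simp
  qed
  have "red_v N k = (\<Sum>j\<in>V. netHinv N k j * icpt N j) - (\<Sum>l\<in>lat N. (\<Sum>j\<in>V. netHinv N k j * netS N j l) * (icpt N l - lat_cov N))"
    unfolding red_v_def sum_mult_swap ..
  also have "\<dots> = (\<Sum>j\<in>V. ?Mi k j * icpt N j) + (\<Sum>l\<in>lat N. ?Mi k l * (icpt N l - lat_cov N))"
    using blk blk2 by (simp add: sum_negf)
  finally have "\<bar>red_v N k\<bar> \<le> (\<Sum>j\<in>V. \<bar>?Mi k j * icpt N j\<bar>) + (\<Sum>l\<in>lat N. \<bar>?Mi k l * (icpt N l - lat_cov N)\<bar>)"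
    using sum_abs[of "\<lambda>j. ?Mi k j * icpt N j" V] sum_abs[of "\<lambda>l. ?Mi k l * (icpt N l - lat_cov N)" "lat N"] by linarith
  also have "\<dots> \<le> (\<Sum>j\<in>V. \<bar>?Mi k j\<bar> * (\<bar>abar\<bar> + \<bar>pbar\<bar>)) + (\<Sum>l\<in>lat N. \<bar>?Mi k l\<bar> * (\<bar>abar\<bar> + \<bar>pbar\<bar>))"
  proof (intro add_mono sum_mono)
    fix j assume "j \<in> V"
    then have "\<bar>icpt N j\<bar> \<le> abar" using st(7) by (simp add: ag)
    then show "\<bar>?Mi k j * icpt N j\<bar> \<le> \<bar>?Mi k j\<bar> * (\<bar>abar\<bar> + \<bar>pbar\<bar>)" unfolding abs_mult by (intro mult_left_mono) auto
  next
    fix l assume l: "l \<in> lat N"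
    then have "\<bar>icpt N l\<bar> \<le> abar" using st(7) by (simp add: ag)
    then show "\<bar>?Mi k l * (icpt N l - lat_cov N)\<bar> \<le> \<bar>?Mi k l\<bar> * (\<bar>abar\<bar> + \<bar>pbar\<bar>)"
      unfolding abs_mult using p0[OF l] by (intro mult_left_mono) auto
  qed
  also have "\<dots> = (\<Sum>j\<in>agents N. \<bar>?Mi k j\<bar>) * (\<bar>abar\<bar> + \<bar>pbar\<bar>)" by (simp add: split sum_distrib_right distrib_right)
  also have "\<dots> \<le> \<bar>B\<bar> * (\<bar>abar\<bar> + \<bar>pbar\<bar>)" using row by (intro mult_right_mono) auto
  finally have v: "\<bar>red_v N k\<bar> \<le> \<bar>B\<bar> * (\<bar>abar\<bar> + \<bar>pbar\<bar>)" .
  have "(\<Sum>j\<in>V. \<bar>netHinv N k j\<bar>) = (\<Sum>j\<in>V. \<bar>?Mi k j\<bar>)" using blk by simp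
  also have "\<dots> \<le> (\<Sum>j\<in>agents N. \<bar>?Mi k j\<bar>)" unfolding split by (simp add: sum_nonneg)
  also have "\<dots> \<le> \<bar>B\<bar>" using row by simp
  finally show ?thesis using v unfolding l1_stack[OF fin] by (simp add: algebra_simps)
qed

text \<open>\<open>K4\<close> exceeds the level \<open>2 * C + 4\<close> of
  \<open>family_average_tail\<close>. \<open>K5\<close> and \<open>K6\<close> are the
  \<open>kap\<close> of \<open>family_centred_tail\<close> for the scores \<open>q_of\<close> and
  for products of regressors; \<open>Lc\<close> is the level \<open>L\<close> for
  \<open>c1 = 1/2\<close>, the lower constant in \<open>pen_bounds\<close>. In \<open>m2\<close> the
  first term belongs to the regressors as weights, the second to \<open>unit_min\<close>;
  \<open>m4\<close> serves both. \<open>Ke * pen\<close> is the \<open>\<eta>\<close> of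
  \<open>weighted_noise_tail\<close>. Of all these, only \<open>Nn\<close>, \<open>xq\<close> and
  \<open>fail\<close> vary with the number of periods.\<close>

definition "K4 = 2 * C + 5"
definition "K5 = K4 + 1\<^sup>2 + 8 * (1 + 8 * (C + 1 ^ 4)) + 4"
definition "K6 = P1 ^ 8 + (P1\<^sup>2)\<^sup>2 + 8 * (1 + 8 * (P1 ^ 8 + (P1\<^sup>2) ^ 4)) + 4"
definition "Lc = 2 * K4 + 2 + K5 / (1/2)"
definition "m2 = min (1 / (2 * kappa)) (1 / (2 * P1 * Lc)\<^sup>2)"
definition "m4 = P1 ^ 4"
definition "v0 = sqrt (c * m2 / 2)"
definition "Ke = 8 * (8 * (1 + C)) * (1 + m4) / v0 ^ 3 + 2"
definition "kap1 = c\<^sup>2 * m2\<^sup>2 / (8 * C * m4)"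
definition "Nn = nat \<lceil>(m4 + K4) / v0 * sqrt (sqrt n)\<rceil>"
definition "xq = inv Phi (1 - 1 / (3 * real n * (real (card V))\<^sup>2))"
definition "b0 = \<bar>B\<bar> * (1 + \<bar>abar\<bar> + \<bar>pbar\<bar>)"
definition "fail = (Me + MP) * ell / n + 21 / card V + 4 * (real (card V))\<^sup>2 * exp (- kap1 * n)
    + 64 * (real Nn + 1) * xq / n"

lemma const_pos: "1 \<le> K4" "0 \<le> K5" "0 \<le> K6" "1 \<le> Lc" "0 < m2" "1 \<le> m4" "0 < v0" "0 \<le> Ke" "0 < kap1"
proof -
  show K4: "1 \<le> K4" using c by (simp add: K4_def)
  show K5: "0 \<le> K5" using c K4 by (simp add: K5_def)
  show "0 \<le> K6" using P1 by (simp add: K6_def)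
  show L: "1 \<le> Lc" using K4 K5 by (simp add: Lc_def)
  show m2: "0 < m2" using rayleigh(1) P1 L by (auto simp: m2_def)
  show m4: "1 \<le> m4" using P1 by (simp add: m4_def)
  show v0: "0 < v0" using m2 c by (simp add: v0_def)
  show "0 \<le> Ke" using m4 v0 c by (simp add: Ke_def)
  show "0 < kap1" using m2 m4 c by (simp add: kap1_def)
qed

text \<open>The weights are random, so the conditions on their moments belong to the event. On the
  good event they are verified pointwise, and the negated conclusion is what has been
  excluded.\<close>

definition noise_failure :: "'a \<Rightarrow> (nat \<Rightarrow> (nat \<Rightarrow> 'a \<Rightarrow> real) \<Rightarrow> real) \<Rightarrow> 'w set" where
  "noise_failure k w = {\<omega>\<in>space M. m2 \<le> avg n (\<lambda>t. (w t (path \<omega>))\<^sup>2) \<and> avg n (\<lambda>t. (w t (path \<omega>)) ^ 4) \<le> m4 \<and>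
      avg n (\<lambda>t. (red_eps N t \<omega> k) ^ 4) \<le> K4 \<and>
      \<not> (v0 \<le> rms n (\<lambda>t. w t (path \<omega>) * red_eps N t \<omega> k) \<and>
         \<bar>avg n (\<lambda>t. w t (path \<omega>) * red_eps N t \<omega> k)\<bar> \<le> (1 + Ke * pen n V) * pen n V * rms n (\<lambda>t. w t (path \<omega>) * red_eps N t \<omega> k))}"

abbreviation "w1 j t P \<equiv> aug (P t) j"
abbreviation "w2 j t P \<equiv> unit_min n V P j t"

lemma path_component: "t \<in> {1..n} \<Longrightarrow> j \<in> V \<Longrightarrow> path \<omega> t j = cov N t \<omega> j"
  by (simp add: path_def obs_cov_def)

lemma w1_path: "t \<in> {1..n} \<Longrightarrow> j \<in> I \<Longrightarrow> w1 j t (path \<omega>) = aug (cov N t \<omega>) j"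
  by (cases j) (auto simp: path_component)

lemma w2_path: "t \<in> {1..n} \<Longrightarrow> w2 j t (path \<omega>) = unit_min n V (\<lambda>t. cov N t \<omega>) j t"
  by (rule unit_min_cong) (auto simp: path_component)

lemma w1_measurable:
  assumes t: "t \<in> {1..n}" and j: "j \<in> I"
  shows "w1 j t \<in> borel_measurable (PiM {1..n} (\<lambda>_. PV))"
proof (cases j)
  case (Some i)
  then have i: "i \<in> V" using j by simp
  have "(\<lambda>P. P t i) \<in> borel_measurable (PiM {1..n} (\<lambda>_. PV))"
    by (rule measurable_compose[OF measurable_component_singleton[OF t] measurable_component_singleton[OF i]])
  then show ?thesis by (simp add: Some)
qed simp

lemma avg_measurable:
  "(\<And>t. t \<in> {1..n} \<Longrightarrow> f t \<in> borel_measurable M) \<Longrightarrow> (\<lambda>\<omega>. avg n (\<lambda>t. f t \<omega>)) \<in> borel_measurable M"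
  unfolding avg_def by (intro borel_measurable_divide borel_measurable_sum borel_measurable_const)

lemma noise_failure_sets:
  assumes w: "\<And>t. t \<in> {1..n} \<Longrightarrow> w t \<in> borel_measurable (PiM {1..n} (\<lambda>_. PV))"
  shows "noise_failure k w \<in> events"
proof -
  have wm: "(\<lambda>\<omega>. w t (path \<omega>)) \<in> borel_measurable M" if "t \<in> {1..n}" for t
    by (rule measurable_compose[OF path_measurable w[OF that]])
  have [measurable]: "(\<lambda>\<omega>. avg n (\<lambda>t. (w t (path \<omega>))\<^sup>2)) \<in> borel_measurable M"
    "(\<lambda>\<omega>. avg n (\<lambda>t. (w t (path \<omega>)) ^ 4)) \<in> borel_measurable M"
    "(\<lambda>\<omega>. avg n (\<lambda>t. (red_eps N t \<omega> k) ^ 4)) \<in> borel_measurable M"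
    "(\<lambda>\<omega>. avg n (\<lambda>t. w t (path \<omega>) * red_eps N t \<omega> k)) \<in> borel_measurable M"
    "(\<lambda>\<omega>. avg n (\<lambda>t. (w t (path \<omega>) * red_eps N t \<omega> k)\<^sup>2)) \<in> borel_measurable M"
    by (intro avg_measurable borel_measurable_power borel_measurable_times wm eps_measurable; assumption)+
  show ?thesis unfolding noise_failure_def rms_def by measurable
qed

lemma card_I_le: "2 \<le> card V \<Longrightarrow> real (card I) \<le> 2 * real (card V)"
  using card_aug_set[OF fin] by simp

text \<open>The set \<open>A\<close> is chosen before the estimators are quantified: it speaks of
  covariates and noise only and serves all minimisers at once, whatever their dependence on the
  sample point.\<close>

lemma good_set:
  assumes n3: "3 \<le> n" and cV: "2 \<le> card V" and C': "0 < C'" "ln n \<le> C' * ln (card V)"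
    and r1: "rho \<le> 1" and small: "pen n V * Lc \<le> 1/2" and r6: "K6 * rho \<le> 1 / (2 * kappa)" and e1: "Ke * pen n V \<le> 1"
  shows "\<exists>A\<in>events. 1 - fail \<le> prob A \<and> (\<forall>\<omega>\<in>A. \<forall>W vh Psi.
     step1_estimator n V (\<lambda>t. cov N t \<omega>) (\<lambda>t. outcome N t \<omega>) W vh \<longrightarrow> step2_estimator n V (\<lambda>t. cov N t \<omega>) Psi \<longrightarrow>
     good_event n V (\<lambda>t. cov N t \<omega>) Psib P1 K4 K5 (1/2) rho (\<lambda>t. outcome N t \<omega>) (\<lambda>t. red_eps N t \<omega>)
       (netHinv N) (red_v N) W vh Psi (gram N) K6 kappa b0 (sqrt (2 * (C' + 4))) (Ke * pen n V) v0)"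
proof -
  note pb = pen_bounds[OF n3 cV C', folded xq_def]
  have ell: "0 < ell" using cV by (simp add: ell_def)
  have r0: "0 < rho" using ell n by (simp add: rho_def)
  define e4 where "e4 = exp (- (4 * ell))"
  have e4: "e4 = 1 / (real (card V)) ^ 4"
  proof -
    have "exp (4 * ell) = exp ell ^ 4" by (simp flip: exp_of_nat_mult)
    also have "exp ell = real (card V)" using cV by (simp add: ell_def)
    finally show ?thesis by (simp add: e4_def exp_minus inverse_eq_divide)
  qed
  let ?q = "\<lambda>(k, j). q_of k j" and ?a = "\<lambda>(l, j) d. aug (fst d) l * aug (fst d) j"
  \<comment> \<open>\<open>F0\<close> is a null set. \<open>F1\<close> and \<open>F2\<close> concern
    empirical fourth moments of the noise and of the scores, \<open>F3\<close> and \<open>F4\<close>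
    the deviations of the scores and of the Gram matrix, \<open>F5\<close> and \<open>F6\<close> the
    noise weighted by regressors and by normalised minimisers. The moment conditions inside the
    later sets hold off the earlier ones or follow from the nondegeneracy of the weights.\<close>
  define F0 where "F0 = {\<omega>\<in>space M. \<not> (\<forall>t\<in>{1..n}. \<forall>l\<in>I. \<bar>aug (cov N t \<omega>) l\<bar> \<le> P1)}"
  define F1 where "F1 = {\<omega>\<in>space M. \<exists>k\<in>V. 2 * C + 4 < avg n (\<lambda>t. (noise_of k (Dt t \<omega>)) ^ 4)}"
  define F2 where "F2 = {\<omega>\<in>space M. \<exists>i\<in>I \<times> I. 2 * C + 4 < avg n (\<lambda>t. (?q i (Dt t \<omega>)) ^ 4)}"
  define F3 where "F3 = {\<omega>\<in>space M. \<exists>i\<in>I \<times> I. avg n (\<lambda>t. (?q i (Dt t \<omega>)) ^ 4) \<le> K4 \<and> K5 * rho < \<bar>avg n (\<lambda>t. ?q i (Dt t \<omega>)) - (case i of (k, j) \<Rightarrow> delta k j)\<bar>}"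
  define F4 where "F4 = {\<omega>\<in>space M. \<exists>i\<in>I \<times> I. avg n (\<lambda>t. (?a i (Dt t \<omega>)) ^ 4) \<le> P1 ^ 8 \<and> K6 * rho < \<bar>avg n (\<lambda>t. ?a i (Dt t \<omega>)) - (case i of (l, j) \<Rightarrow> gram N l j)\<bar>}"
  define F5 where "F5 = (\<Union>(k, j)\<in>V \<times> I. noise_failure k (w1 j))"
  define F6 where "F6 = (\<Union>(k, j)\<in>V \<times> I. noise_failure k (w2 j))"
  have fI: "finite (I \<times> I)" "finite (V \<times> I)" using fin by auto
  have qm: "?q i \<in> borel_measurable T" if "i \<in> I \<times> I" for i
    using that q_measurable by (cases i) auto
  have am: "?a i \<in> borel_measurable T" if "i \<in> I \<times> I" for i
    using that by (cases i) (auto intro!: borel_measurable_times aug_measurable)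
  have nm: "noise_of k \<in> borel_measurable T" if "k \<in> V" for k using that by (rule noise_of_measurable)
  have comp: "(\<lambda>\<omega>. h (Dt t \<omega>)) \<in> borel_measurable M" if "h \<in> borel_measurable T" "t \<in> {1..n}" for h :: "_ \<Rightarrow> real" and t
    by (rule measurable_compose[OF data_measurable[OF that(2)] that(1)])
  have avgm: "(\<lambda>\<omega>. avg n (\<lambda>t. (h (Dt t \<omega>)) ^ 4)) \<in> borel_measurable M" "(\<lambda>\<omega>. avg n (\<lambda>t. h (Dt t \<omega>))) \<in> borel_measurable M"
    if h: "h \<in> borel_measurable T" for h :: "_ \<Rightarrow> real"
    by (intro avg_measurable borel_measurable_power comp[OF h]; assumption)+
  have S0: "F0 \<in> events"
  proof -
    have "{\<omega>\<in>space M. \<bar>aug (cov N t \<omega>) l\<bar> \<le> P1} \<in> events" if "t \<in> {1..n}" "l \<in> I" for t l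
      using aug_cov_measurable[OF that] by measurable
    then have "{\<omega>\<in>space M. \<forall>t\<in>{1..n}. \<forall>l\<in>I. \<bar>aug (cov N t \<omega>) l\<bar> \<le> P1} \<in> events"
      using fin by (intro sets.sets_Collect_finite_All) auto
    then show ?thesis unfolding F0_def by (rule sets.sets_Collect_neg)
  qed
  have S1: "F1 \<in> events" unfolding F1_def
  proof (intro sets.sets_Collect_finite_Ex fin)
    fix k assume "k \<in> V"
    note [measurable] = avgm[OF nm[OF this]]
    show "{\<omega>\<in>space M. 2 * C + 4 < avg n (\<lambda>t. (noise_of k (Dt t \<omega>)) ^ 4)} \<in> events" by measurable
  qed
  have S2: "F2 \<in> events" unfolding F2_def
  proof (intro sets.sets_Collect_finite_Ex fI)
    fix i assume "i \<in> I \<times> I"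
    note [measurable] = avgm[OF qm[OF this]]
    show "{\<omega>\<in>space M. 2 * C + 4 < avg n (\<lambda>t. (?q i (Dt t \<omega>)) ^ 4)} \<in> events" by measurable
  qed
  have S3: "F3 \<in> events" unfolding F3_def
  proof (intro sets.sets_Collect_finite_Ex fI)
    fix i assume "i \<in> I \<times> I"
    note [measurable] = avgm[OF qm[OF this]]
    show "{\<omega>\<in>space M. avg n (\<lambda>t. (?q i (Dt t \<omega>)) ^ 4) \<le> K4 \<and> K5 * rho < \<bar>avg n (\<lambda>t. ?q i (Dt t \<omega>)) - (case i of (k, j) \<Rightarrow> delta k j)\<bar>} \<in> events" by measurable
  qed
  have S4: "F4 \<in> events" unfolding F4_def
  proof (intro sets.sets_Collect_finite_Ex fI)
    fix i assume "i \<in> I \<times> I"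
    note [measurable] = avgm[OF am[OF this]]
    show "{\<omega>\<in>space M. avg n (\<lambda>t. (?a i (Dt t \<omega>)) ^ 4) \<le> P1 ^ 8 \<and> K6 * rho < \<bar>avg n (\<lambda>t. ?a i (Dt t \<omega>)) - (case i of (l, j) \<Rightarrow> gram N l j)\<bar>} \<in> events" by measurable
  qed
  have p0: "0 < pen n V" using pb(1,2) n by simp
  have w2m: "w2 j t \<in> borel_measurable (PiM {1..n} (\<lambda>_. PV))" if "t \<in> {1..n}" for j t
    using measurable_unit_min[OF fin p0 that] by simp
  have NF1: "noise_failure k (w1 j) \<in> events" and NF2: "noise_failure k (w2 j) \<in> events" if "j \<in> I" for k j
    using that by (auto intro!: noise_failure_sets w1_measurable w2m simp del: One_nat_def)
  have S5: "F5 \<in> events" and S6: "F6 \<in> events"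
    unfolding F5_def F6_def using NF1 NF2 fI(2) by (auto intro!: sets.finite_UN)
  have Pr0: "prob F0 = 0"
  proof -
    have "AE \<omega> in M. \<not> \<not> (\<forall>t\<in>{1..n}. \<forall>l\<in>I. \<bar>aug (cov N t \<omega>) l\<bar> \<le> P1)" using aug_bounded by simp
    from emeasure_eq_0_AE[OF this] show ?thesis by (simp add: F0_def measure_def)
  qed
  have Pr1: "prob F1 \<le> Me * ell / n + card V * e4" unfolding F1_def e4_def
  proof (rule family_average_tail[OF fin, where h="\<lambda>k d. (noise_of k d) ^ 4" and G="\<lambda>\<omega>. MAX (t, j)\<in>{1..n} \<times> V. \<bar>red_eps N t \<omega> j\<bar> ^ 4"])
    have ub: "\<bar>red_eps N t \<omega> k\<bar> ^ 4 \<le> (MAX (t, j)\<in>{1..n} \<times> V. \<bar>red_eps N t \<omega> j\<bar> ^ 4)" if "k \<in> V" "t \<in> {1..n}" for k t \<omega>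
      using that fin by (intro Max_ge) (auto intro!: rev_image_eqI[of "(t, k)"])
    show "(noise_of k (Dt t \<omega>)) ^ 4 \<le> (MAX (t, j)\<in>{1..n} \<times> V. \<bar>red_eps N t \<omega> j\<bar> ^ 4)"
      if "k \<in> V" "t \<in> {1..n}" "\<omega> \<in> space M" for k t \<omega>
      using ub[OF that(1,2), of \<omega>] noise_of_data[OF that(2,3,1)] by simp
    obtain k0 where k0: "k0 \<in> V" using ne by auto
    show "0 \<le> (MAX (t, j)\<in>{1..n} \<times> V. \<bar>red_eps N t \<omega> j\<bar> ^ 4)" for \<omega>
      by (rule order_trans[OF _ ub[OF k0 one_in]]) simp
  qed (use nm noise4_mean max_eps4 ell in \<open>auto intro: borel_measurable_power\<close>)
  have Pr2: "prob F2 \<le> MP * ell / n + card (I \<times> I) * e4" unfolding F2_def e4_def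
  proof (rule family_average_tail[OF fI(1), where h="\<lambda>i d. (?q i d) ^ 4" and G="\<lambda>\<omega>. MAX (t, k, j)\<in>{1..n} \<times> I \<times> I. \<bar>q_of k j (Dt t \<omega>)\<bar> ^ 4"])
    have ub: "\<bar>q_of k j (Dt t \<omega>)\<bar> ^ 4 \<le> (MAX (t, k, j)\<in>{1..n} \<times> I \<times> I. \<bar>q_of k j (Dt t \<omega>)\<bar> ^ 4)"
      if "k \<in> I" "j \<in> I" "t \<in> {1..n}" for k j t \<omega>
      using that fin by (intro Max_ge) (auto intro!: rev_image_eqI[of "(t, k, j)"])
    show "(?q i (Dt t \<omega>)) ^ 4 \<le> (MAX (t, k, j)\<in>{1..n} \<times> I \<times> I. \<bar>q_of k j (Dt t \<omega>)\<bar> ^ 4)"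
      if "i \<in> I \<times> I" "t \<in> {1..n}" for i t \<omega>
      using that ub[of "fst i" "snd i" t \<omega>] by (cases i) auto
    show "0 \<le> (MAX (t, k, j)\<in>{1..n} \<times> I \<times> I. \<bar>q_of k j (Dt t \<omega>)\<bar> ^ 4)" for \<omega>
      by (rule order_trans[OF _ ub[OF None_in_aug_set None_in_aug_set one_in]]) simp
    show "integrable M (\<lambda>\<omega>. (?q i (Dt t \<omega>)) ^ 4)" "(\<integral>\<omega>. (?q i (Dt t \<omega>)) ^ 4 \<partial>M) \<le> C"
      if "i \<in> I \<times> I" "t \<in> {1..n}" for i t
      using that q_moments(3,4)[OF that(2), of "fst i" "snd i"] by (cases i; auto)+
    show "(\<lambda>d. (?q i d) ^ 4) \<in> borel_measurable T" if "i \<in> I \<times> I" for i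
      using qm[OF that] by (rule borel_measurable_power)
  qed (use max_q4 ell in auto)
  have Pr3: "prob F3 \<le> card (I \<times> I) * (2 * e4)" unfolding F3_def e4_def
  proof (rule family_centred_tail[OF fI(1), where h="?q" and \<mu>="\<lambda>(k, j). delta k j" and mf=C and mb=1])
    show "integrable M (\<lambda>\<omega>. ?q i (Dt t \<omega>))" "(\<integral>\<omega>. ?q i (Dt t \<omega>) \<partial>M) = (case i of (k, j) \<Rightarrow> delta k j)"
      "integrable M (\<lambda>\<omega>. (?q i (Dt t \<omega>)) ^ 4)" "(\<integral>\<omega>. (?q i (Dt t \<omega>)) ^ 4 \<partial>M) \<le> C"
      if "i \<in> I \<times> I" "t \<in> {1..n}" for i t
      using that q_moments(1-4)[OF that(2), of "fst i" "snd i"] by (cases i; auto)+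
  qed (use qm const_pos ell r1 in \<open>auto simp: delta_def K5_def\<close>)
  have a_bd: "AE \<omega> in M. \<bar>?a i (Dt t \<omega>)\<bar> \<le> P1\<^sup>2" if "i \<in> I \<times> I" "t \<in> {1..n}" for i t
    using aug_bounded
  proof eventually_elim
    case (elim \<omega>)
    obtain l j where i: "i = (l, j)" "l \<in> I" "j \<in> I" using \<open>i \<in> I \<times> I\<close> by auto
    have "\<bar>aug (cov N t \<omega>) l\<bar> * \<bar>aug (cov N t \<omega>) j\<bar> \<le> P1 * P1"
      using elim that(2) i P1 by (intro mult_mono) auto
    then show ?case using i by (simp add: aug_data abs_mult power2_eq_square)
  qed
  have p8: "(z::real) ^ 4 \<le> P1 ^ 8" if "\<bar>z\<bar> \<le> P1\<^sup>2" for z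
    using power_mono[OF that abs_ge_zero, of 4] by (simp flip: power_mult)
  have Pr4: "prob F4 \<le> card (I \<times> I) * (2 * e4)" unfolding F4_def e4_def
  proof (rule family_centred_tail[OF fI(1), where h="?a" and \<mu>="\<lambda>(l, j). gram N l j" and mf="P1 ^ 8" and mb="P1\<^sup>2"])
    fix i assume i: "i \<in> I \<times> I"
    show "?a i \<in> borel_measurable T" by (rule am[OF i])
    {
      fix t assume t: "t \<in> {1..n}"
      show 1: "integrable M (\<lambda>\<omega>. ?a i (Dt t \<omega>))" by (rule AE_bounded_integrable[OF comp[OF am[OF i] t] a_bd[OF i t]])
      show 2: "(\<integral>\<omega>. ?a i (Dt t \<omega>) \<partial>M) = (case i of (l, j) \<Rightarrow> gram N l j)"
        using i gram_eq[OF t] by (auto simp: aug_data)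
      have ae: "AE \<omega> in M. (?a i (Dt t \<omega>)) ^ 4 \<le> P1 ^ 8"
        using a_bd[OF i t] by eventually_elim (rule p8)
      show 3: "integrable M (\<lambda>\<omega>. (?a i (Dt t \<omega>)) ^ 4)"
        by (rule AE_bounded_integrable[of _ "P1 ^ 8"], intro borel_measurable_power comp[OF am[OF i] t]) (use ae in simp)
      have "(\<integral>\<omega>. (?a i (Dt t \<omega>)) ^ 4 \<partial>M) \<le> (\<integral>\<omega>. P1 ^ 8 \<partial>M)" using 3 ae by (intro integral_mono_AE) auto
      then show "(\<integral>\<omega>. (?a i (Dt t \<omega>)) ^ 4 \<partial>M) \<le> P1 ^ 8" by (simp add: prob_space)
    }
    have "AE \<omega> in M. ?a i (Dt 1 \<omega>) \<le> P1\<^sup>2" "AE \<omega> in M. - (P1\<^sup>2) \<le> ?a i (Dt 1 \<omega>)"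
      using a_bd[OF i one_in] by (eventually_elim, simp add: abs_le_iff)+
    moreover have i1: "integrable M (\<lambda>\<omega>. ?a i (Dt 1 \<omega>))" by (rule AE_bounded_integrable[OF comp[OF am[OF i] one_in] a_bd[OF i one_in]])
    ultimately have "(\<integral>\<omega>. ?a i (Dt 1 \<omega>) \<partial>M) \<le> (\<integral>\<omega>. P1\<^sup>2 \<partial>M)" "(\<integral>\<omega>. - (P1\<^sup>2) \<partial>M) \<le> (\<integral>\<omega>. ?a i (Dt 1 \<omega>) \<partial>M)"
      by (intro integral_mono_AE; simp)+
    moreover have "(\<integral>\<omega>. ?a i (Dt 1 \<omega>) \<partial>M) = (case i of (l, j) \<Rightarrow> gram N l j)"
      using i gram_eq[OF one_in] by (auto simp: aug_data)
    ultimately show "\<bar>case i of (l, j) \<Rightarrow> gram N l j\<bar> \<le> P1\<^sup>2" by (simp add: prob_space abs_le_iff)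
  qed (use P1 ell r1 in \<open>auto simp: K6_def\<close>)
  define fb where "fb = exp (- kap1 * real n) + 2 * ((real Nn + 1) * exp (- xq\<^sup>2 / 2))"
  have NFb: "prob (noise_failure k w) \<le> fb" if k: "k \<in> V" and w: "\<And>t. t \<in> {1..n} \<Longrightarrow> w t \<in> borel_measurable (PiM {1..n} (\<lambda>_. PV))" for k w
    unfolding noise_failure_def fb_def pb(2) kap1_def
  proof (rule weighted_noise_tail[OF k w const_pos(5,6,1) pb(1) v0_def])
    show "Ke * (xq / sqrt n) = (8 * (8 * (1 + C)) * (1 + m4) / v0 ^ 3 + 2) * (xq / sqrt n)" by (simp add: Ke_def)
    show "Ke * (xq / sqrt n) \<le> 1" using e1 by (simp add: pb(2))
    show "(m4 + K4) / v0 * sqrt (sqrt n) \<le> real Nn" unfolding Nn_def by (rule real_nat_ceiling_ge)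
  qed
  have Pr5: "prob F5 \<le> card (V \<times> I) * fb" and Pr6: "prob F6 \<le> card (V \<times> I) * fb"
  proof -
    have union: "prob (\<Union>i\<in>V \<times> I. g i) \<le> card (V \<times> I) * fb"
      if g: "\<And>i. i \<in> V \<times> I \<Longrightarrow> g i \<in> events \<and> prob (g i) \<le> fb" for g
    proof -
      have "prob (\<Union>i\<in>V \<times> I. g i) \<le> (\<Sum>i\<in>V \<times> I. prob (g i))"
        using g by (intro finite_measure_subadditive_finite fI) auto
      also have "\<dots> \<le> card (V \<times> I) * fb" using g by (intro sum_bounded_above) auto
      finally show ?thesis .
    qed
    show "prob F5 \<le> card (V \<times> I) * fb" unfolding F5_def
    proof (rule union)
      fix i assume "i \<in> V \<times> I"
      then show "(case i of (k, j) \<Rightarrow> noise_failure k (w1 j)) \<in> events \<and> prob (case i of (k, j) \<Rightarrow> noise_failure k (w1 j)) \<le> fb"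
        using NF1 NFb[OF _ w1_measurable] by (cases i) auto
    qed
    show "prob F6 \<le> card (V \<times> I) * fb" unfolding F6_def
    proof (rule union)
      fix i assume "i \<in> V \<times> I"
      then show "(case i of (k, j) \<Rightarrow> noise_failure k (w2 j)) \<in> events \<and> prob (case i of (k, j) \<Rightarrow> noise_failure k (w2 j)) \<le> fb"
        using NF2 NFb[OF _ w2m] by (cases i) auto
    qed
  qed
  define U where "U = F0 \<union> (F1 \<union> (F2 \<union> (F3 \<union> (F4 \<union> (F5 \<union> F6)))))"
  have SU: "U \<in> events" unfolding U_def by (intro sets.Un S0 S1 S2 S3 S4 S5 S6)
  have un: "prob (X \<union> Y) \<le> prob X + b" if "prob Y \<le> b" "X \<in> events" "Y \<in> events" for X Y b
    using measure_Un_le[OF that(2,3)] that(1) by linarith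
  have "prob U \<le> prob F0 + (prob F1 + (prob F2 + (prob F3 + (prob F4 + (prob F5 + prob F6)))))"
    unfolding U_def by (intro un order_refl sets.Un S0 S1 S2 S3 S4 S5 S6)
  also have "\<dots> \<le> fail"
  proof -
    define m where "m = real (card V)"
    have m2': "2 \<le> m" using cV by (simp add: m_def)
    have cI: "real (card (I \<times> I)) \<le> 4 * m\<^sup>2"
      using mult_mono[OF card_I_le[OF cV] card_I_le[OF cV]] by (simp add: card_cartesian_product m_def power2_eq_square)
    have cVI: "real (card (V \<times> I)) \<le> 2 * m\<^sup>2"
      using mult_left_mono[OF card_I_le[OF cV], of "real (card V)"] by (simp add: card_cartesian_product m_def power2_eq_square)
    have fb0: "0 \<le> fb" by (simp add: fb_def)
    have e40: "0 \<le> e4" by (simp add: e4_def)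
    \<comment> \<open>\<open>F1\<close> contributes |V| terms; over pairs, \<open>F2\<close>
      contributes one term and \<open>F3\<close> and \<open>F4\<close> two each. As there are at
      most \<open>4 * m^2\<close> pairs, the total constant is 1 + 5 * 4.\<close>
    have "real (card V) * e4 + 5 * (real (card (I \<times> I)) * e4) \<le> m\<^sup>2 * e4 + 5 * (4 * m\<^sup>2 * e4)"
      using cI e40 m2' self_le_power[of m 2] by (intro add_mono mult_left_mono mult_right_mono) (auto simp: m_def)
    also have "\<dots> = 21 * (m\<^sup>2 * e4)" by simp
    also have "m\<^sup>2 * e4 = 1 / m\<^sup>2" using m2' by (simp add: e4 m_def power2_eq_square power4_eq_xxxx)
    also have "21 * (1 / m\<^sup>2) \<le> 21 / m" using m2' self_le_power[of m 2] by (simp add: frac_le)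
    finally have t1: "real (card V) * e4 + 5 * (real (card (I \<times> I)) * e4) \<le> 21 / m" .
    have "2 * (real (card (V \<times> I)) * fb) \<le> 2 * (2 * m\<^sup>2 * fb)" using cVI fb0 by (intro mult_left_mono mult_right_mono) auto
    also have "\<dots> = 4 * m\<^sup>2 * exp (- kap1 * n) + 8 * m\<^sup>2 * (real Nn + 1) * exp (- xq\<^sup>2 / 2)"
      by (simp add: fb_def algebra_simps)
    \<comment> \<open>The lower Gaussian tail bound exchanges the exponential for
      \<open>4 * xq / (n * m^2)\<close> and so cancels the number of pairs.\<close>
    also have "8 * m\<^sup>2 * (real Nn + 1) * exp (- xq\<^sup>2 / 2) \<le> 8 * m\<^sup>2 * (real Nn + 1) * (4 * xq / (n * m\<^sup>2))"
      using pb(3) by (intro mult_left_mono) (auto simp: m_def)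
    also have "\<dots> = 32 * (real Nn + 1) * xq / n" using m2' by simp
    also have "\<dots> \<le> 64 * (real Nn + 1) * xq / n" using pb(1) by (intro divide_right_mono mult_right_mono) auto
    finally have t2: "2 * (real (card (V \<times> I)) * fb) \<le> 4 * m\<^sup>2 * exp (- kap1 * n) + 64 * (real Nn + 1) * xq / n" by simp
    have t3: "(Me + MP) * ell / n = Me * ell / n + MP * ell / n" by (simp add: add_divide_distrib distrib_right)
    show ?thesis
      using Pr0 Pr1 Pr2 Pr3 Pr4 Pr5 Pr6 t1 t2 unfolding fail_def t3 m_def[symmetric] by linarith
  qed
  finally have PU: "prob U \<le> fail" .
  let ?A = "space M - U"
  have "?A \<in> events" using SU by auto
  moreover have "1 - fail \<le> prob ?A" using PU prob_compl[OF SU] by simp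
  moreover have "good_event n V (\<lambda>t. cov N t \<omega>) Psib P1 K4 K5 (1/2) rho (\<lambda>t. outcome N t \<omega>) (\<lambda>t. red_eps N t \<omega>)
       (netHinv N) (red_v N) W vh Psi (gram N) K6 kappa b0 (sqrt (2 * (C' + 4))) (Ke * pen n V) v0"
    if \<omega>: "\<omega> \<in> ?A" and est1: "step1_estimator n V (\<lambda>t. cov N t \<omega>) (\<lambda>t. outcome N t \<omega>) W vh"
      and est2: "step2_estimator n V (\<lambda>t. cov N t \<omega>) Psi" for \<omega> W vh Psi
  proof -
    let ?p = "\<lambda>t. cov N t \<omega>"
    have sp: "\<omega> \<in> space M" and nF: "\<omega> \<notin> F0" "\<omega> \<notin> F1" "\<omega> \<notin> F2" "\<omega> \<notin> F3" "\<omega> \<notin> F4" "\<omega> \<notin> F5" "\<omega> \<notin> F6"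
      using \<omega> by (auto simp: U_def)
    have b: "\<bar>aug (?p t) l\<bar> \<le> P1" if "t \<in> {1..n}" "l \<in> I" for t l
      using nF(1) sp that unfolding F0_def by blast
    have e4: "avg n (\<lambda>t. (red_eps N t \<omega> k) ^ 4) \<le> K4" if k: "k \<in> V" for k
    proof -
      have "avg n (\<lambda>t. (noise_of k (Dt t \<omega>)) ^ 4) \<le> 2 * C + 4" using nF(2) sp k unfolding F1_def by force
      moreover have "avg n (\<lambda>t. (noise_of k (Dt t \<omega>)) ^ 4) = avg n (\<lambda>t. (red_eps N t \<omega> k) ^ 4)"
        by (rule avg_cong) (simp add: noise_of_data[OF _ sp k])
      ultimately show ?thesis by (simp add: K4_def)
    qed
    have q4: "avg n (\<lambda>t. (lin V (Psib k) (?p t) * aug (?p t) j) ^ 4) \<le> K4" if kj: "k \<in> I" "j \<in> I" for k j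
    proof -
      have "avg n (\<lambda>t. (q_of k j (Dt t \<omega>)) ^ 4) \<le> 2 * C + 4" using nF(3) sp kj unfolding F2_def by force
      then show ?thesis by (simp add: q_of_data[OF kj(2)] K4_def)
    qed
    have q1: "\<bar>avg n (\<lambda>t. lin V (Psib k) (?p t) * aug (?p t) j) - delta k j\<bar> \<le> K5 * rho" if kj: "k \<in> I" "j \<in> I" for k j
    proof -
      have "avg n (\<lambda>t. (q_of k j (Dt t \<omega>)) ^ 4) \<le> K4" using q4[OF kj] by (simp add: q_of_data[OF kj(2)])
      then have "\<bar>avg n (\<lambda>t. q_of k j (Dt t \<omega>)) - delta k j\<bar> \<le> K5 * rho" using nF(4) sp kj unfolding F3_def by force
      then show ?thesis by (simp add: q_of_data[OF kj(2)])
    qed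
    have gr: "\<bar>avg n (\<lambda>t. aug (?p t) l * aug (?p t) j) - gram N l j\<bar> \<le> K6 * rho" if lj: "l \<in> I" "j \<in> I" for l j
    proof -
      have "avg n (\<lambda>t. (aug (?p t) l * aug (?p t) j) ^ 4) \<le> P1 ^ 8"
      proof (rule avg_bound_const[OF n])
        fix t assume t: "t \<in> {1..n}"
        have "\<bar>aug (?p t) l\<bar> * \<bar>aug (?p t) j\<bar> \<le> P1 * P1" using b[OF t lj(1)] b[OF t lj(2)] P1 by (intro mult_mono) auto
        then show "(aug (?p t) l * aug (?p t) j) ^ 4 \<le> P1 ^ 8" by (intro p8) (simp add: abs_mult power2_eq_square)
      qed
      then have "avg n (\<lambda>t. (?a (l, j) (Dt t \<omega>)) ^ 4) \<le> P1 ^ 8" using lj by (simp add: aug_data)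
      then have "\<bar>avg n (\<lambda>t. ?a (l, j) (Dt t \<omega>)) - gram N l j\<bar> \<le> K6 * rho" using nF(5) sp lj unfolding F4_def by force
      then show ?thesis using lj by (simp add: aug_data)
    qed
    interpret G: good_cov n V ?p Psib P1 K4 K5 "1/2" rho
      by unfold_locales
         (use n fin P1 const_pos r0 p0 pb(4) b q4 q1 small in \<open>auto simp: Lc_def ell_def rho_def\<close>)
    have GL: "G.L = Lc" by (simp add: G.L_def Lc_def)
    have noise: "v0 \<le> rms n (\<lambda>t. w t (path \<omega>) * red_eps N t \<omega> k) \<and>
         \<bar>avg n (\<lambda>t. w t (path \<omega>) * red_eps N t \<omega> k)\<bar> \<le> (1 + Ke * pen n V) * pen n V * rms n (\<lambda>t. w t (path \<omega>) * red_eps N t \<omega> k)"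
      if "\<omega> \<notin> noise_failure k w" "m2 \<le> avg n (\<lambda>t. (w t (path \<omega>))\<^sup>2)" "avg n (\<lambda>t. (w t (path \<omega>)) ^ 4) \<le> m4" "k \<in> V" for k w
      using that sp e4[OF that(4)] unfolding noise_failure_def by blast
    have sn1: "\<bar>avg n (\<lambda>t. red_eps N t \<omega> k * aug (?p t) j)\<bar>
        \<le> (1 + Ke * pen n V) * pen n V * rms n (\<lambda>t. red_eps N t \<omega> k * aug (?p t) j)" if kj: "k \<in> V" "j \<in> I" for k j
    proof -
      have e: "avg n (\<lambda>t. f t (w1 j t (path \<omega>))) = avg n (\<lambda>t. f t (aug (?p t) j))" for f
        by (rule avg_cong) (simp add: w1_path kj(2) del: One_nat_def)
      \<comment> \<open>The Rayleigh bound at a unit vector: each diagonal entry of the Gram matrix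
        is at least \<open>1 / kappa\<close>, and by \<open>r6\<close> its empirical version loses
        at most half of this. Hence the regressors are admissible weights.\<close>
      have "(\<Sum>i\<in>I. (delta j i)\<^sup>2) = 1"
        using sum_delta_left[of I j "\<lambda>i. delta j i"] kj(2) fin by (simp add: power2_eq_square) (simp add: delta_def)
      moreover have "quad_form I (gram N) (delta j) = gram N j j"
        using sum_delta_left[of I j "\<lambda>i. \<Sum>l\<in>I. gram N i l * delta j l"] sum_delta_left[of I j "\<lambda>l. gram N j l"] kj(2) fin
        by (simp add: quad_form_def mult.commute)
      ultimately have "1 / kappa \<le> gram N j j" using rayleigh(2)[of "delta j"] rayleigh(1) by (simp add: field_simps)
      then have "1 / (2 * kappa) \<le> avg n (\<lambda>t. aug (?p t) j * aug (?p t) j)"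
        using gr[OF kj(2,2)] r6 by (simp add: field_simps)
      then have 1: "m2 \<le> avg n (\<lambda>t. (w1 j t (path \<omega>))\<^sup>2)" unfolding e[of "\<lambda>_ z. z\<^sup>2"] by (simp add: m2_def power2_eq_square)
      have 2: "avg n (\<lambda>t. (w1 j t (path \<omega>)) ^ 4) \<le> m4" unfolding e[of "\<lambda>_ z. z ^ 4"]
      proof (rule avg_bound_const[OF n])
        fix t assume t: "t \<in> {1..n}"
        show "(aug (?p t) j) ^ 4 \<le> m4" using power_mono[OF b[OF t kj(2)] abs_ge_zero, of 4] by (simp add: m4_def)
      qed
      have "\<omega> \<notin> noise_failure k (w1 j)" using nF(6) kj unfolding F5_def by blast
      from noise[OF this 1 2 kj(1)] show ?thesis
        unfolding e[of "\<lambda>t z. z * red_eps N t \<omega> k"] rms_def e[of "\<lambda>t z. (z * red_eps N t \<omega> k)\<^sup>2"] by (simp add: mult.commute)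
    qed
    have sn2: "v0 \<le> rms n (\<lambda>t. unit_min n V ?p j t * red_eps N t \<omega> k) \<and>
        \<bar>avg n (\<lambda>t. unit_min n V ?p j t * red_eps N t \<omega> k)\<bar>
        \<le> (1 + Ke * pen n V) * pen n V * rms n (\<lambda>t. unit_min n V ?p j t * red_eps N t \<omega> k)" if kj: "k \<in> V" "j \<in> I" for k j
    proof -
      have e: "avg n (\<lambda>t. f t (w2 j t (path \<omega>))) = avg n (\<lambda>t. f t (unit_min n V ?p j t))" for f
        by (rule avg_cong) (simp add: w2_path del: One_nat_def)
      have 1: "m2 \<le> avg n (\<lambda>t. (w2 j t (path \<omega>))\<^sup>2)"
        unfolding e[of "\<lambda>_ z. z\<^sup>2"] using G.unit_min_avg2[OF est2 kj(2)] by (simp add: m2_def GL)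
      have 2: "avg n (\<lambda>t. (w2 j t (path \<omega>)) ^ 4) \<le> m4"
        unfolding e[of "\<lambda>_ z. z ^ 4"] using G.unit_min_avg4[OF est2 kj(2)] const_pos(6) by simp
      have "\<omega> \<notin> noise_failure k (w2 j)" using nF(7) kj unfolding F6_def by blast
      from noise[OF this 1 2 kj(1)] show ?thesis
        unfolding e[of "\<lambda>t z. z * red_eps N t \<omega> k"] rms_def e[of "\<lambda>t z. (z * red_eps N t \<omega> k)\<^sup>2"] .
    qed
    show ?thesis
    proof
      show "V \<noteq> {}" by (rule ne)
      show "step1_estimator n V ?p (\<lambda>t. outcome N t \<omega>) W vh" by (rule est1)
      show "step2_estimator n V ?p Psi" by (rule est2)
      show "outcome N t \<omega> k = red_v N k - (\<Sum>j\<in>V. netHinv N k j * cov N t \<omega> j) + red_eps N t \<omega> k"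
        if "t \<in> {1..n}" "k \<in> V" for t k by (rule outcome_eq[OF that(1) sp that(2)])
      show "pen n V \<le> sqrt (2 * (C' + 4)) * rho" using pb(5) by (simp add: ell_def rho_def)
      show "l1 V (\<lambda>l. stack (netHinv N) (red_v N) l k) \<le> b0" if "k \<in> V" for k
        using reduced_form_bound[OF that] by (simp add: b0_def)
    qed (use e4 gr rayleigh const_pos e1 p0 sn1 sn2 in auto)
  qed
  ultimately show ?thesis by blast
qed

end

section \<open>Asymptotics\<close>

text \<open>Below the index from which the bounds hold, the witness is the empty set; this also
  covers \<open>n = 0\<close>, about which nothing is assumed.\<close>

lemma whpI:
  assumes prob: "\<And>n. 1 \<le> n \<Longrightarrow> prob_space (P n)" and f: "f \<longlonglongrightarrow> 0"
    and ev: "eventually (\<lambda>n. \<exists>A\<in>sets (P n). 1 - f n \<le> measure (P n) A \<and> (\<forall>\<omega>\<in>A. E n \<omega>)) sequentially"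
  shows "whp P E"
proof -
  obtain n0 where n0: "\<And>n. n0 \<le> n \<Longrightarrow> \<exists>A\<in>sets (P n). 1 - f n \<le> measure (P n) A \<and> (\<forall>\<omega>\<in>A. E n \<omega>)"
    using ev by (auto simp: eventually_sequentially)
  have "\<forall>n. \<exists>A. n0 \<le> n \<longrightarrow> A \<in> sets (P n) \<and> 1 - f n \<le> measure (P n) A \<and> (\<forall>\<omega>\<in>A. E n \<omega>)"
    using n0 by blast
  then obtain A where A: "\<And>n. n0 \<le> n \<Longrightarrow> A n \<in> sets (P n) \<and> 1 - f n \<le> measure (P n) (A n) \<and> (\<forall>\<omega>\<in>A n. E n \<omega>)"
    by metis
  define A' where "A' n = (if n0 \<le> n then A n else {})" for n
  have "(\<lambda>n. measure (P n) (A' n)) \<longlonglongrightarrow> 1"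
  proof (rule tendsto_sandwich)
    show "(\<lambda>n. 1 - f n) \<longlonglongrightarrow> 1" using tendsto_diff[OF tendsto_const f, of 1] by simp
    show "eventually (\<lambda>n. 1 - f n \<le> measure (P n) (A' n)) sequentially"
      using eventually_ge_at_top[of n0] by eventually_elim (simp add: A A'_def)
    show "eventually (\<lambda>n. measure (P n) (A' n) \<le> 1) sequentially"
      using eventually_ge_at_top[of 1] by eventually_elim (auto intro: prob_space.prob_le_1[OF prob])
    show "(\<lambda>_. 1::real) \<longlonglongrightarrow> 1" by simp
  qed
  then show ?thesis unfolding whp_def using A by (intro exI[of _ A']) (auto simp: A'_def)
qed

lemma sparse_approx_rows:
  assumes fin: "finite V" and sp: "sparse_approx_on V s r A"
  obtains Wb where "\<And>k. k \<in> V \<Longrightarrow> card {j\<in>V. Wb k j \<noteq> 0} \<le> s" "\<And>j. j \<in> V \<Longrightarrow> card {k\<in>V. Wb k j \<noteq> 0} \<le> s"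
    "\<And>k. k \<in> V \<Longrightarrow> (\<Sum>j\<in>V. \<bar>A k j - Wb k j\<bar>) \<le> r" "\<And>j. j \<in> V \<Longrightarrow> (\<Sum>k\<in>V. \<bar>A k j - Wb k j\<bar>) \<le> r"
proof -
  obtain Wb where W: "sparse_on V s Wb" "max (norm_one V (\<lambda>i j. A i j - Wb i j)) (norm_inf V (\<lambda>i j. A i j - Wb i j)) \<le> r"
    using sp by (auto simp: sparse_approx_on_def)
  show thesis
  proof
    show "card {j\<in>V. Wb k j \<noteq> 0} \<le> s" if "k \<in> V" for k using W(1) that by (simp add: sparse_on_def)
    show "card {k\<in>V. Wb k j \<noteq> 0} \<le> s" if "j \<in> V" for j using W(1) that by (simp add: sparse_on_def)
    show "(\<Sum>j\<in>V. \<bar>A k j - Wb k j\<bar>) \<le> r" if "k \<in> V" for k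
    proof -
      have "(\<Sum>j\<in>V. \<bar>A k j - Wb k j\<bar>) \<le> norm_inf V (\<lambda>i j. A i j - Wb i j)"
        unfolding norm_inf_def using fin that by (intro Max_ge) auto
      then show ?thesis using W(2) by simp
    qed
    show "(\<Sum>k\<in>V. \<bar>A k j - Wb k j\<bar>) \<le> r" if "j \<in> V" for j
    proof -
      have "(\<Sum>k\<in>V. \<bar>A k j - Wb k j\<bar>) \<le> norm_one V (\<lambda>i j. A i j - Wb i j)"
        unfolding norm_one_def using fin that by (intro Max_ge) auto
      then show ?thesis using W(2) by simp
    qed
  qed
qed

lemma thresholded_bounds:
  assumes fin: "finite V" and ne: "V \<noteq> {}" and sp: "sparse_approx_on V s r A"
    and mu: "\<And>k j. k \<in> V \<Longrightarrow> j \<in> V \<Longrightarrow> 2 * \<bar>W k j - A k j\<bar> \<le> mu k j \<and> mu k j \<le> b"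
  shows "(MAX (k, j)\<in>V \<times> V. \<bar>thresholded mu W k j - A k j\<bar>) \<le> 2 * b"
    "norm_inf V (\<lambda>k j. thresholded mu W k j - A k j) \<le> s * (2 * b) + 3 * r"
    "norm_one V (\<lambda>k j. thresholded mu W k j - A k j) \<le> s * (2 * b) + 3 * r"
proof -
  let ?F = "\<lambda>k j. thresholded mu W k j - A k j"
  have e1: "\<bar>?F k j\<bar> \<le> 2 * b" and e2: "\<bar>?F k j\<bar> \<le> \<bar>A k j\<bar>" if "k \<in> V" "j \<in> V" for k j
    using thresholded_entry[of "W k j" "A k j" "mu k j"] mu[OF that] by (auto simp: thresholded_def)
  obtain k0 where k0: "k0 \<in> V" using ne by auto
  have b: "0 \<le> 2 * b" using e1[OF k0 k0] by (meson abs_ge_zero order_trans)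
  show "(MAX (k, j)\<in>V \<times> V. \<bar>?F k j\<bar>) \<le> 2 * b"
    using fin ne e1 by (intro Max.boundedI) auto
  obtain Wb where Wb: "\<And>k. k \<in> V \<Longrightarrow> card {j\<in>V. Wb k j \<noteq> 0} \<le> s" "\<And>j. j \<in> V \<Longrightarrow> card {k\<in>V. Wb k j \<noteq> 0} \<le> s"
    "\<And>k. k \<in> V \<Longrightarrow> (\<Sum>j\<in>V. \<bar>A k j - Wb k j\<bar>) \<le> r" "\<And>j. j \<in> V \<Longrightarrow> (\<Sum>k\<in>V. \<bar>A k j - Wb k j\<bar>) \<le> r"
    using sparse_approx_rows[OF fin sp] by blast
  have r: "0 \<le> r" using Wb(3)[OF k0] by (meson abs_ge_zero order_trans sum_nonneg)
  have "(\<Sum>j\<in>V. \<bar>?F k j\<bar>) \<le> s * (2 * b) + r" if k: "k \<in> V" for k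
    by (rule thresholded_sum[OF fin Wb(1)[OF k] e1[OF k] _ b Wb(3)[OF k]]) (use e2[OF k] in auto)
  then show "norm_inf V ?F \<le> s * (2 * b) + 3 * r"
    unfolding norm_inf_def using fin ne r by (intro Max.boundedI) force+
  have "(\<Sum>k\<in>V. \<bar>?F k j\<bar>) \<le> s * (2 * b) + r" if j: "j \<in> V" for j
    by (rule thresholded_sum[OF fin Wb(2)[OF j] e1[OF _ j] _ b Wb(4)[OF j]]) (use e2[OF _ j] in auto)
  then show "norm_one V ?F \<le> s * (2 * b) + 3 * r"
    unfolding norm_one_def using fin ne r by (intro Max.boundedI) force+
qed

context good_event begin

text \<open>\<open>T\<close> is the support of row \<open>k\<close> of the sparse approximation; off
  it the true entries coincide with approximation errors and sum to at most
  \<open>r\<close>.\<close>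

lemma sparse_row_rate:
  assumes sp: "sparse_approx_on V s r A" and s: "1 \<le> s" and sr: "32 * s * \<kappa> * K6 * \<rho> \<le> 1/2" and k: "k \<in> V"
  shows "l1 V (D k) \<le> 4 * (3 * r + \<eta> * (P1 * K4)) + 64 * \<kappa> * Ka * s * lam"
proof -
  obtain Wb where Wb: "card {j\<in>V. Wb k j \<noteq> 0} \<le> s" "(\<Sum>j\<in>V. \<bar>A k j - Wb k j\<bar>) \<le> r"
    by (rule sparse_approx_rows[OF fin sp]) (use k in blast)
  let ?T = "{j\<in>V. Wb k j \<noteq> 0}"
  have "(\<Sum>j\<in>V - ?T. \<bar>A k j\<bar>) = (\<Sum>j\<in>V - ?T. \<bar>A k j - Wb k j\<bar>)" by (intro sum.cong) auto
  also have "\<dots> \<le> (\<Sum>j\<in>V. \<bar>A k j - Wb k j\<bar>)" using fin by (intro sum_mono2) auto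
  finally have "(\<Sum>j\<in>V - ?T. \<bar>A k j\<bar>) \<le> r" using Wb(2) by simp
  then show ?thesis by (intro sparse_rate[OF k _ Wb(1) s _ sr]) auto
qed

lemma debiased_bounds:
  assumes R: "c2 * (L * D1 + 2 * L * K4) \<le> R"
  shows "(MAX (k, j)\<in>V \<times> V. \<bar>debiased_W n V p y W vh Psi k j - A k j\<bar>) \<le> R * \<rho>"
    "(MAX k\<in>V. \<bar>debiased_v n V p y W vh Psi k - v k\<bar>) \<le> R * \<rho>"
proof -
  have a: "\<bar>debiased_stack n V p y W vh Psi i k - stack A v i k\<bar> \<le> R * \<rho>" if "k \<in> V" "i \<in> aug_set V" for k i
    using part_a[OF that] mult_right_mono[OF R rho] by linarith
  have "\<bar>debiased_W n V p y W vh Psi k j - A k j\<bar> \<le> R * \<rho>" if "k \<in> V" "j \<in> V" for k j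
    using a[of k "Some j"] that by (simp add: debiased_W_def stack_def)
  then show "(MAX (k, j)\<in>V \<times> V. \<bar>debiased_W n V p y W vh Psi k j - A k j\<bar>) \<le> R * \<rho>"
    using fin ne by (intro Max.boundedI) auto
  have "\<bar>debiased_v n V p y W vh Psi k - v k\<bar> \<le> R * \<rho>" if "k \<in> V" for k
    using a[of k None] that by (simp add: debiased_v_def stack_def abs_minus_commute) 
  then show "(MAX k\<in>V. \<bar>debiased_v n V p y W vh Psi k - v k\<bar>) \<le> R * \<rho>"
    using fin ne by (intro Max.boundedI) auto
qed

text \<open>\<open>part_b\<close> with \<open>g = 1 / ln n\<close>, the inflation built into the
  thresholds.\<close>

lemma threshold_bounds:
  assumes k: "k \<in> V" and j: "j \<in> V" and g: "1 \<le> ln n" "\<eta> \<le> 1 / ln n / 2"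
    and d: "12 * P1 * L * l1 V (D k) \<le> 1 / ln n * (\<sigma>0 / (2 * P1))" and R: "4 * c2 * (L * K4 + P1 * L * D1) \<le> R"
  shows "2 * \<bar>debiased_W n V p y W vh Psi k j - A k j\<bar> \<le> threshold_level n V p y W vh Psi k j"
    "threshold_level n V p y W vh Psi k j \<le> R * \<rho>"
proof -
  have g': "0 < 1 / ln (real n)" "1 / ln (real n) \<le> 1" using g(1) by auto
  note b = part_b[OF k j g' g(2) d]
  show "2 * \<bar>debiased_W n V p y W vh Psi k j - A k j\<bar> \<le> threshold_level n V p y W vh Psi k j"
    using mult_left_mono[OF b(1), of 2, OF zero_le_numeral]
    unfolding debiased_W_def threshold_level_def by (simp only: stack_def option.case mult.assoc)
  show "threshold_level n V p y W vh Psi k j \<le> R * \<rho>"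
    using b(2) mult_right_mono[OF R rho] by (simp add: threshold_level_def)
qed

end

text \<open>Once \<open>ln n \<ge> 1\<close>, the sequences with a square root are dominated by the
  square root of the first growth condition, since \<open>(ln n)^2 \<le> (ln n)^3\<close> and
  \<open>1 \<le> s n\<close>. Further, \<open>Me + MP \<le> 2 * Me * MP\<close> for numbers at least
  1, and \<open>Cl\<close> forces |V| to grow at least like a fixed power of n.\<close>

lemma regular_design_asymptotics:
  fixes card_V s :: "nat \<Rightarrow> nat" and l :: "nat \<Rightarrow> real"
  defines "l \<equiv> (\<lambda>n. ln (real (card_V n)))"
  assumes C': "0 < C'" and s: "\<And>n. 1 \<le> n \<Longrightarrow> 1 \<le> s n" and Cl: "\<And>n. 1 \<le> n \<Longrightarrow> ln (real n) \<le> C' * l n"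
    and M: "\<And>n. 1 \<le> n \<Longrightarrow> 1 \<le> Me n \<and> 1 \<le> MP n"
    and o1: "(\<lambda>n. (real (s n))\<^sup>2 * l n * (ln (real n)) ^ 3) \<in> o(\<lambda>n. real n)"
    and o2: "(\<lambda>n. Me n * MP n * l n) \<in> o(\<lambda>n. real n)"
  shows "eventually (\<lambda>n. 2 \<le> card_V n) sequentially"
    and "(\<lambda>n. real (s n) * sqrt (l n / n) * ln n) \<longlonglongrightarrow> 0"
    and "(\<lambda>n. sqrt (l n / n) * ln n) \<longlonglongrightarrow> 0" and "(\<lambda>n. real (s n) * sqrt (l n / n)) \<longlonglongrightarrow> 0"
    and "(\<lambda>n. sqrt (l n / n)) \<longlonglongrightarrow> 0" and "(\<lambda>n. l n / n) \<longlonglongrightarrow> 0"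
    and "(\<lambda>n. (Me n + MP n) * l n / n) \<longlonglongrightarrow> 0" and "(\<lambda>n. 1 / real (card_V n)) \<longlonglongrightarrow> 0"
proof -
  have big: "eventually (\<lambda>n. 3 \<le> n \<and> 1 \<le> ln (real n)) sequentially"
  proof -
    have "eventually (\<lambda>n. 1 \<le> ln (real n)) sequentially"
      using filterlim_compose[OF ln_at_top filterlim_real_sequentially] by (simp add: filterlim_at_top)
    then show ?thesis using eventually_ge_at_top[of 3] by eventually_elim simp
  qed
  have card: "2 \<le> card_V n" "0 < l n" if "3 \<le> n" "1 \<le> ln (real n)" for n
  proof -
    have "0 < C' * l n" using Cl[of n] that by linarith
    then show "0 < l n" using C' by (simp add: zero_less_mult_iff)
    then have "1 < real (card_V n)" unfolding l_def by (cases "card_V n = 0") (auto simp: ln_gt_zero_iff)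
    then show "2 \<le> card_V n" by simp
  qed
  show "eventually (\<lambda>n. 2 \<le> card_V n) sequentially" using big by eventually_elim (auto intro: card)
  have t1: "(\<lambda>n. (real (s n))\<^sup>2 * l n * (ln (real n)) ^ 3 / n) \<longlonglongrightarrow> 0" using smalloD_tendsto[OF o1] .
  have t2: "(\<lambda>n. Me n * MP n * l n / n) \<longlonglongrightarrow> 0" using smalloD_tendsto[OF o2] .
  have sq: "(\<lambda>n. sqrt ((real (s n))\<^sup>2 * l n * (ln (real n)) ^ 3 / n)) \<longlonglongrightarrow> 0"
    using tendsto_real_sqrt[OF t1] by simp
  have dom: "f \<longlonglongrightarrow> 0" if ev: "eventually (\<lambda>n. 0 \<le> f n \<and> f n \<le> g n) sequentially" and g: "g \<longlonglongrightarrow> 0" for f g :: "nat \<Rightarrow> real"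
    by (rule tendsto_sandwich[OF _ _ tendsto_const g]) (use ev in \<open>auto elim: eventually_mono\<close>)
  show a: "(\<lambda>n. real (s n) * sqrt (l n / n) * ln n) \<longlonglongrightarrow> 0"
  proof (rule dom[OF _ sq])
    show "eventually (\<lambda>n. 0 \<le> real (s n) * sqrt (l n / n) * ln n \<and>
        real (s n) * sqrt (l n / n) * ln n \<le> sqrt ((real (s n))\<^sup>2 * l n * (ln (real n)) ^ 3 / n)) sequentially"
      using big
    proof eventually_elim
      case (elim n)
      have l0: "0 < l n" using card elim by blast
      have "(real (s n) * sqrt (l n / n) * ln n)\<^sup>2 = (real (s n))\<^sup>2 * (l n / n) * (ln n)\<^sup>2"
        using l0 by (simp add: power_mult_distrib)
      also have "\<dots> \<le> (real (s n))\<^sup>2 * (l n / n) * (ln n) ^ 3"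
        using elim l0 by (intro mult_left_mono power_increasing) auto
      finally have "real (s n) * sqrt (l n / n) * ln n \<le> sqrt ((real (s n))\<^sup>2 * (l n / n) * (ln n) ^ 3)"
        by (rule real_le_rsqrt)
      then show ?case using l0 elim by simp
    qed
  qed
  show b: "(\<lambda>n. sqrt (l n / n) * ln n) \<longlonglongrightarrow> 0"
  proof (rule dom[OF _ a])
    show "eventually (\<lambda>n. 0 \<le> sqrt (l n / n) * ln n \<and> sqrt (l n / n) * ln n \<le> real (s n) * sqrt (l n / n) * ln n) sequentially"
      using big
    proof eventually_elim
      case (elim n)
      then have l0: "0 < l n" and s1: "1 \<le> real (s n)" using card s[of n] by auto
      have "1 * (sqrt (l n / n) * ln n) \<le> real (s n) * (sqrt (l n / n) * ln n)"
        using s1 l0 elim by (intro mult_right_mono) auto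
      then show ?case using l0 elim by (simp add: mult.assoc)
    qed
  qed
  show "(\<lambda>n. real (s n) * sqrt (l n / n)) \<longlonglongrightarrow> 0"
  proof (rule dom[OF _ a])
    show "eventually (\<lambda>n. 0 \<le> real (s n) * sqrt (l n / n) \<and> real (s n) * sqrt (l n / n) \<le> real (s n) * sqrt (l n / n) * ln n) sequentially"
      using big
    proof eventually_elim
      case (elim n)
      then have l0: "0 < l n" using card by auto
      have "real (s n) * sqrt (l n / n) * 1 \<le> real (s n) * sqrt (l n / n) * ln n"
        using l0 elim by (intro mult_left_mono) auto
      then show ?case using l0 by simp
    qed
  qed
  show c: "(\<lambda>n. sqrt (l n / n)) \<longlonglongrightarrow> 0"
  proof (rule dom[OF _ b])
    show "eventually (\<lambda>n. 0 \<le> sqrt (l n / n) \<and> sqrt (l n / n) \<le> sqrt (l n / n) * ln n) sequentially"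
      using big
    proof eventually_elim
      case (elim n)
      then have l0: "0 < l n" using card by auto
      have "sqrt (l n / n) * 1 \<le> sqrt (l n / n) * ln n"
        using l0 elim by (intro mult_left_mono) auto
      then show ?case using l0 by simp
    qed
  qed
  show "(\<lambda>n. l n / n) \<longlonglongrightarrow> 0"
  proof (rule dom[of _ "\<lambda>n. (sqrt (l n / n))\<^sup>2"])
    show "eventually (\<lambda>n. 0 \<le> l n / n \<and> l n / n \<le> (sqrt (l n / n))\<^sup>2) sequentially"
      using big
    proof eventually_elim
      case (elim n)
      then have "0 < l n" using card by auto
      then show ?case by simp
    qed
    show "(\<lambda>n. (sqrt (l n / n))\<^sup>2) \<longlonglongrightarrow> 0" using tendsto_power[OF c, of 2] by simp
  qed
  show "(\<lambda>n. (Me n + MP n) * l n / n) \<longlonglongrightarrow> 0"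
  proof (rule dom[of _ "\<lambda>n. 2 * (Me n * MP n * l n / n)"])
    show "eventually (\<lambda>n. 0 \<le> (Me n + MP n) * l n / n \<and> (Me n + MP n) * l n / n \<le> 2 * (Me n * MP n * l n / n)) sequentially"
      using big
    proof eventually_elim
      case (elim n)
      then have l0: "0 < l n" and m: "1 \<le> Me n" "1 \<le> MP n" using card M[of n] by auto
      have "Me n * 1 \<le> Me n * MP n" "1 * MP n \<le> Me n * MP n" using m by (intro mult_left_mono mult_right_mono; simp)+
      then have "(Me n + MP n) * (l n / n) \<le> (2 * (Me n * MP n)) * (l n / n)" using l0 by (intro mult_right_mono) auto
      then show ?case using l0 m by simp
    qed
    show "(\<lambda>n. 2 * (Me n * MP n * l n / n)) \<longlonglongrightarrow> 0" using tendsto_mult_left[OF t2, of 2] by simp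
  qed
  show "(\<lambda>n. 1 / real (card_V n)) \<longlonglongrightarrow> 0"
  proof (rule dom[of _ "\<lambda>n. exp (- (ln (real n) / C'))"])
    show "eventually (\<lambda>n. 0 \<le> 1 / real (card_V n) \<and> 1 / real (card_V n) \<le> exp (- (ln (real n) / C'))) sequentially"
      using big
    proof eventually_elim
      case (elim n)
      have c2: "2 \<le> card_V n" using card elim by blast
      have "1 / real (card_V n) = exp (- l n)" using c2 by (simp add: l_def exp_minus inverse_eq_divide)
      also have "\<dots> \<le> exp (- (ln (real n) / C'))" using Cl[of n] elim C' by (simp add: field_simps)
      finally show ?case by simp
    qed
    have "filterlim (\<lambda>n. ln (real n) / C') at_top sequentially"
      using filterlim_tendsto_pos_mult_at_top[OF tendsto_const[of "1 / C'"] _ filterlim_compose[OF ln_at_top filterlim_real_sequentially]] C'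
      by simp
    then show "(\<lambda>n. exp (- (ln (real n) / C'))) \<longlonglongrightarrow> 0"
      by (intro filterlim_compose[OF exp_at_bot]) (simp add: filterlim_uminus_at_top[symmetric])
  qed
qed

section \<open>Sequences of designs and uniform constants\<close>

locale design_sequence =
  fixes B abar lbar pbar c C C' kappa :: real
    and N :: "nat \<Rightarrow> ('a, 'w) network" and s :: "nat \<Rightarrow> nat" and r1 Me MP :: "nat \<Rightarrow> real"
    and What :: "nat \<Rightarrow> 'w \<Rightarrow> 'a \<Rightarrow> 'a \<Rightarrow> real" and vhat :: "nat \<Rightarrow> 'w \<Rightarrow> 'a \<Rightarrow> real"
    and Psihat :: "nat \<Rightarrow> 'w \<Rightarrow> 'a option \<Rightarrow> 'a option \<Rightarrow> real"
  assumes c: "0 < c" "c < C" and C': "0 < C'"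
    and reg: "regular_design B abar lbar pbar c C C' kappa N s r1 Me MP"
    and est: "\<And>n \<omega>. 1 \<le> n \<Longrightarrow> \<omega> \<in> space (sample (N n)) \<Longrightarrow>
      step1_estimator n (obs (N n)) (\<lambda>t. cov (N n) t \<omega>) (\<lambda>t. outcome (N n) t \<omega>) (What n \<omega>) (vhat n \<omega>) \<and>
      step2_estimator n (obs (N n)) (\<lambda>t. cov (N n) t \<omega>) (Psihat n \<omega>)"
begin

lemma design: "1 \<le> n \<Longrightarrow> design (N n) n B abar lbar pbar c C kappa (Me n) (MP n)"
  using reg c by (simp add: regular_design_def design_def)

text \<open>The instance for one period names the constants and provides their signs. Outside the
  locale they depend only on parameters shared by all \<open>n\<close>, so the constants of every
  \<open>N n\<close> are literally the same terms.\<close>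

sublocale D1: design "N 1" 1 B abar lbar pbar c C kappa "Me 1" "MP 1"
  by (rule design) simp

abbreviation "V n \<equiv> obs (N n)"
abbreviation "P n \<equiv> sample (N n)"
abbreviation "l n \<equiv> ln (real (card (V n)))"
abbreviation "rate n \<equiv> sqrt (l n / real n)"
abbreviation "c2 \<equiv> sqrt (2 * (C' + 4))"
abbreviation "p n \<omega> \<equiv> \<lambda>t. cov (N n) t \<omega>"
abbreviation "y n \<omega> \<equiv> \<lambda>t. outcome (N n) t \<omega>"
abbreviation "Wc n \<omega> \<equiv> debiased_W n (V n) (p n \<omega>) (y n \<omega>) (What n \<omega>) (vhat n \<omega>) (Psihat n \<omega>)"
abbreviation "vc n \<omega> \<equiv> debiased_v n (V n) (p n \<omega>) (y n \<omega>) (What n \<omega>) (vhat n \<omega>) (Psihat n \<omega>)"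
abbreviation "mu n \<omega> \<equiv> threshold_level n (V n) (p n \<omega>) (y n \<omega>) (What n \<omega>) (vhat n \<omega>) (Psihat n \<omega>)"
abbreviation "good n \<omega> \<equiv> good_event n (V n) (p n \<omega>) (Psi_bar (N n)) D1.P1 D1.K4 D1.K5 (1/2) (rate n) (y n \<omega>)
  (\<lambda>t. red_eps (N n) t \<omega>) (netHinv (N n)) (red_v (N n)) (What n \<omega>) (vhat n \<omega>) (Psihat n \<omega>)
  (gram (N n)) D1.K6 kappa D1.b0 c2 (D1.Ke * pen n (V n)) D1.v0"

lemma prob: "1 \<le> n \<Longrightarrow> prob_space (P n)"
  using design.prob[OF design] .

lemma limits:
  "eventually (\<lambda>n. 2 \<le> card (V n)) sequentially"
  "(\<lambda>n. real (s n) * rate n * ln n) \<longlonglongrightarrow> 0" "(\<lambda>n. rate n * ln n) \<longlonglongrightarrow> 0" "(\<lambda>n. real (s n) * rate n) \<longlonglongrightarrow> 0"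
  "(\<lambda>n. rate n) \<longlonglongrightarrow> 0" "(\<lambda>n. l n / n) \<longlonglongrightarrow> 0"
  "(\<lambda>n. (Me n + MP n) * l n / n) \<longlonglongrightarrow> 0" "(\<lambda>n. 1 / real (card (V n))) \<longlonglongrightarrow> 0"
proof -
  have s: "1 \<le> s n" and Cl: "ln (real n) \<le> C' * l n" and M: "1 \<le> Me n \<and> 1 \<le> MP n" if "1 \<le> n" for n
    using reg that by (simp_all add: regular_design_def)
  have o1: "(\<lambda>n. (real (s n))\<^sup>2 * l n * (ln (real n)) ^ 3) \<in> o(\<lambda>n. real n)" and o2: "(\<lambda>n. Me n * MP n * l n) \<in> o(\<lambda>n. real n)"
    using reg by (simp_all add: regular_design_def)
  note A = regular_design_asymptotics[of C' s "\<lambda>n. card (V n)" Me MP, OF C' s Cl M o1 o2]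
  show "eventually (\<lambda>n. 2 \<le> card (V n)) sequentially"
    "(\<lambda>n. real (s n) * rate n * ln n) \<longlonglongrightarrow> 0" "(\<lambda>n. rate n * ln n) \<longlonglongrightarrow> 0" "(\<lambda>n. real (s n) * rate n) \<longlonglongrightarrow> 0"
    "(\<lambda>n. rate n) \<longlonglongrightarrow> 0" "(\<lambda>n. l n / n) \<longlonglongrightarrow> 0"
    "(\<lambda>n. (Me n + MP n) * l n / n) \<longlonglongrightarrow> 0" "(\<lambda>n. 1 / real (card (V n))) \<longlonglongrightarrow> 0"
    by (rule A; assumption)+
qed

lemma Cl: "1 \<le> n \<Longrightarrow> ln (real n) \<le> C' * l n"
  using reg by (simp add: regular_design_def)

lemma eventually_small:
  fixes f :: "nat \<Rightarrow> real"
  assumes "f \<longlonglongrightarrow> 0" "0 < b" shows "eventually (\<lambda>n. a * f n \<le> b) sequentially"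
proof -
  have "(\<lambda>n. a * f n) \<longlonglongrightarrow> 0" using tendsto_mult_left[OF assms(1), of a] by simp
  from order_tendstoD(2)[OF this assms(2)] show ?thesis by (rule eventually_mono) simp
qed

lemma pen_le: "3 \<le> n \<Longrightarrow> 2 \<le> card (V n) \<Longrightarrow> 0 < pen n (V n) \<and> pen n (V n) \<le> c2 * rate n"
  using pen_bounds(1,2,5)[of n "V n" C'] C' Cl[of n] by simp

text \<open>A majorant of \<open>fail\<close> whose limit is visible: the factor |V|^2 is absorbed
  by half of the exponent once \<open>l n / n \<le> kap1 / 4\<close>, and \<open>xq\<close> and
  \<open>Nn\<close> are replaced by multiples of sqrt n and n^(1/4), up to additive
  constants.\<close>

definition "bound n = (Me n + MP n) * l n / n + 21 * (1 / real (card (V n))) + 4 * exp (- (D1.kap1 / 2) * n)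
   + 64 * c2 * ((D1.m4 + D1.K4) / D1.v0 * (sqrt (sqrt n) * sqrt n / n) + 2 * (sqrt n / n))"

lemma bound_tendsto: "bound \<longlonglongrightarrow> 0"
proof -
  have e: "(\<lambda>n. exp (- (D1.kap1 / 2) * real n)) \<longlonglongrightarrow> 0"
  proof -
    have "filterlim (\<lambda>n. D1.kap1 / 2 * real n) at_top sequentially"
      using filterlim_tendsto_pos_mult_at_top[OF tendsto_const[of "D1.kap1 / 2"] _ filterlim_real_sequentially] D1.const_pos(9) by simp
    then have "filterlim (\<lambda>n. - (D1.kap1 / 2 * real n)) at_bot sequentially" by (simp add: filterlim_uminus_at_top[symmetric])
    from filterlim_compose[OF exp_at_bot this] show ?thesis by simp
  qed
  have inv: "(\<lambda>n. 1 / real n) \<longlonglongrightarrow> 0" by (rule lim_1_over_n)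
  have q: "sqrt x / x = 1 / sqrt x" if "0 \<le> x" for x :: real
  proof -
    have "r / (r * r) = 1 / r" for r :: real by simp
    from this[of "sqrt x"] show ?thesis using that by simp
  qed
  have s1: "(\<lambda>n. sqrt (real n) / n) \<longlonglongrightarrow> 0"
  proof -
    have "(\<lambda>n. sqrt (1 / real n)) \<longlonglongrightarrow> sqrt 0" by (rule tendsto_real_sqrt[OF inv])
    moreover have "sqrt (1 / real n) = sqrt (real n) / n" for n
      by (subst q) (simp_all add: real_sqrt_divide)
    ultimately show ?thesis by (simp only: real_sqrt_zero)
  qed
  have s2: "(\<lambda>n. sqrt (sqrt (real n)) * sqrt (real n) / n) \<longlonglongrightarrow> 0"
  proof -
    have "(\<lambda>n. sqrt (sqrt (real n) / n)) \<longlonglongrightarrow> sqrt 0" by (rule tendsto_real_sqrt[OF s1])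
    moreover have "sqrt (sqrt (real n) / n) = sqrt (sqrt (real n)) * sqrt (real n) / n" for n
    proof -
      have "sqrt (sqrt (real n)) * sqrt (real n) / n = sqrt (sqrt (real n)) * (1 / sqrt (real n))"
        unfolding times_divide_eq_right[symmetric] by (subst q) simp_all
      also have "\<dots> = 1 / sqrt (sqrt (real n))" using q[of "sqrt (real n)"] by simp
      finally have F: "sqrt (sqrt (real n)) * sqrt (real n) / n = 1 / sqrt (sqrt (real n))" .
      show ?thesis unfolding F by (subst q) (simp_all add: real_sqrt_divide)
    qed
    ultimately show ?thesis by (simp only: real_sqrt_zero)
  qed
  have "bound \<longlonglongrightarrow> 0 + 21 * 0 + 4 * 0 + 64 * c2 * ((D1.m4 + D1.K4) / D1.v0 * 0 + 2 * 0)"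
    unfolding bound_def[abs_def] by (intro tendsto_intros limits e s1 s2)
  then show ?thesis by simp
qed

lemma eventually_good:
  "eventually (\<lambda>n. \<exists>A\<in>sets (P n). 1 - bound n \<le> measure (P n) A \<and> (\<forall>\<omega>\<in>A. good n \<omega>)) sequentially"
proof -
  note cp = D1.const_pos
  have c2: "0 < c2" using C' by simp
  have k: "0 < kappa" by (rule D1.rayleigh(1))
  have pos: "0 < (1::real)" "0 < (1/2::real)" "0 < 1 / (2 * kappa)" "0 < D1.kap1 / 4" using k cp(9) by auto
  show ?thesis
    using eventually_ge_at_top[of 3] limits(1)
      eventually_small[OF limits(5) pos(1), of 1] eventually_small[OF limits(5) pos(2), of "c2 * D1.Lc"]
      eventually_small[OF limits(5) pos(3), of D1.K6] eventually_small[OF limits(5) pos(1), of "D1.Ke * c2"]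
      eventually_small[OF limits(6) pos(4), of 1]
  proof eventually_elim
    case (elim n)
    have e: "rate n \<le> 1" "c2 * D1.Lc * rate n \<le> 1/2" "D1.K6 * rate n \<le> 1 / (2 * kappa)" "D1.Ke * c2 * rate n \<le> 1" "l n / n \<le> D1.kap1 / 4"
      using elim by simp_all
    have n1: "1 \<le> n" using elim(1) by simp
    interpret D: design "N n" n B abar lbar pbar c C kappa "Me n" "MP n" by (rule design[OF n1])
    have rho: "D.rho = rate n" by (simp add: D.rho_def D.ell_def)
    have pl: "0 < pen n (V n)" "pen n (V n) \<le> c2 * rate n" using pen_le[OF elim(1,2)] by auto
    note pb = pen_bounds[OF elim(1,2) C' Cl[OF n1], folded D.xq_def]
    have "pen n (V n) * D1.Lc \<le> c2 * rate n * D1.Lc" using pl cp(4) by (intro mult_right_mono) auto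
    then have h1: "pen n (V n) * D1.Lc \<le> 1/2" using e(2) by (simp add: mult_ac)
    have "D1.Ke * pen n (V n) \<le> D1.Ke * (c2 * rate n)" using pl cp(8) by (intro mult_left_mono) auto
    then have h2: "D1.Ke * pen n (V n) \<le> 1" using e(4) by (simp add: mult_ac)
    obtain A where A: "A \<in> sets (P n)" "1 - D.fail \<le> measure (P n) A"
      "\<forall>\<omega>\<in>A. \<forall>W vh Psi. step1_estimator n (V n) (p n \<omega>) (y n \<omega>) W vh \<longrightarrow> step2_estimator n (V n) (p n \<omega>) Psi \<longrightarrow>
         good_event n (V n) (p n \<omega>) (Psi_bar (N n)) D1.P1 D1.K4 D1.K5 (1/2) (rate n) (y n \<omega>) (\<lambda>t. red_eps (N n) t \<omega>)
         (netHinv (N n)) (red_v (N n)) W vh Psi (gram (N n)) D1.K6 kappa D1.b0 c2 (D1.Ke * pen n (V n)) D1.v0"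
      using D.good_set[OF elim(1,2) C' Cl[OF n1]] e(1,3) h1 h2 unfolding rho by blast
    have "D.fail \<le> bound n"
    proof -
      have l0: "0 \<le> l n" using elim(2) by simp
      have r0: "0 < real n" using n1 by simp
      have "(real (card (V n)))\<^sup>2 = exp (2 * l n)"
      proof -
        have "exp (2 * l n) = exp (l n) ^ 2" by (simp flip: exp_of_nat_mult)
        then show ?thesis using elim(2) by simp
      qed
      then have "4 * (real (card (V n)))\<^sup>2 * exp (- D1.kap1 * n) = 4 * exp (2 * l n - D1.kap1 * n)"
        by (simp add: exp_diff exp_minus field_simps)
      also have "\<dots> \<le> 4 * exp (- (D1.kap1 / 2) * n)"
      proof -
        have "l n \<le> D1.kap1 / 4 * n" using e(5) r0 by (simp add: pos_divide_le_eq)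
        then show ?thesis by simp
      qed
      finally have f1: "4 * (real (card (V n)))\<^sup>2 * exp (- D1.kap1 * n) \<le> 4 * exp (- (D1.kap1 / 2) * n)" .
      let ?a = "(D1.m4 + D1.K4) / D1.v0"
      have "0 \<le> ?a * sqrt (sqrt n)" using cp by simp
      then have nn: "real D.Nn \<le> ?a * sqrt (sqrt n) + 1" unfolding D.Nn_def by linarith
      have "D.xq = pen n (V n) * sqrt n" using pb(2) r0 by simp
      also have "\<dots> \<le> c2 * rate n * sqrt n" using pl by (intro mult_right_mono) auto
      also have "\<dots> \<le> c2 * 1 * sqrt n" using e(1) c2 by (intro mult_right_mono mult_left_mono) auto
      finally have x: "D.xq \<le> c2 * sqrt n" by simp
      have "64 * (real D.Nn + 1) * D.xq / n \<le> 64 * (?a * sqrt (sqrt n) + 2) * (c2 * sqrt n) / n"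
        using nn x pb(1) by (intro divide_right_mono mult_mono) auto
      also have "\<dots> = 64 * c2 * (?a * (sqrt (sqrt n) * sqrt n / n) + 2 * (sqrt n / n))"
      proof -
        have "64 * (a * q + 2) * (z * r) / m = 64 * z * (a * (q * r / m) + 2 * (r / m))" for a q z r m :: real
          by (simp add: distrib_left distrib_right add_divide_distrib mult_ac)
        then show ?thesis .
      qed
      finally have f2: "64 * (real D.Nn + 1) * D.xq / n \<le> 64 * c2 * (?a * (sqrt (sqrt n) * sqrt n / n) + 2 * (sqrt n / n))" .
      show ?thesis unfolding D.fail_def bound_def D.ell_def using f1 f2 by simp
    qed
    then have "1 - bound n \<le> measure (P n) A" using A(2) by simp
    moreover have "good n \<omega>" if "\<omega> \<in> A" for \<omega>
      using A(3) est[OF n1] sets.sets_into_space[OF A(1)] that by blast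
    ultimately show "\<exists>A\<in>sets (P n). 1 - bound n \<le> measure (P n) A \<and> (\<forall>\<omega>\<in>A. good n \<omega>)" using A(1) by blast
  qed
qed

lemma whp_of_good:
  assumes "eventually (\<lambda>n. \<forall>\<omega>. good n \<omega> \<longrightarrow> E n \<omega>) sequentially" shows "whp P E"
proof (rule whpI[OF prob bound_tendsto])
  show "eventually (\<lambda>n. \<exists>A\<in>sets (P n). 1 - bound n \<le> measure (P n) A \<and> (\<forall>\<omega>\<in>A. E n \<omega>)) sequentially"
    using eventually_good assms by eventually_elim blast
qed

text \<open>In exported form \<open>L\<close>, \<open>D1\<close> and \<open>Ka\<close> depend only
  on the constants, so one value serves all good events, whatever \<open>n\<close> and the sample
  point.\<close>

definition "Lq = good_cov.L D1.K4 D1.K5 (1/2)"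
definition "Dq = good_event.D1 D1.P1 D1.K4 D1.b0"
definition "Kq = good_event.Ka D1.P1 D1.K4 D1.b0"

lemma whp_debiased:
  assumes R: "c2 * (Lq * Dq + 2 * Lq * D1.K4) \<le> R"
  shows "whp P (\<lambda>n \<omega>. (MAX (k, j)\<in>V n \<times> V n. \<bar>Wc n \<omega> k j - netHinv (N n) k j\<bar>) \<le> R * rate n \<and>
    (MAX k\<in>V n. \<bar>vc n \<omega> k - red_v (N n) k\<bar>) \<le> R * rate n)"
proof (rule whp_of_good, rule always_eventually, intro allI impI)
  fix n \<omega> assume "good n \<omega>"
  then interpret G: good_event n "V n" "p n \<omega>" "Psi_bar (N n)" D1.P1 D1.K4 D1.K5 "1/2" "rate n" "y n \<omega>"
    "\<lambda>t. red_eps (N n) t \<omega>" "netHinv (N n)" "red_v (N n)" "What n \<omega>" "vhat n \<omega>" "Psihat n \<omega>" "gram (N n)" D1.K6 kappa D1.b0 c2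
    "D1.Ke * pen n (V n)" D1.v0 .
  show "(MAX (k, j)\<in>V n \<times> V n. \<bar>Wc n \<omega> k j - netHinv (N n) k j\<bar>) \<le> R * rate n \<and>
    (MAX k\<in>V n. \<bar>vc n \<omega> k - red_v (N n) k\<bar>) \<le> R * rate n"
    using G.debiased_bounds[OF R[unfolded Lq_def Dq_def]] by blast
qed

lemma eventually_threshold:
  assumes r1: "r1 \<in> o(\<lambda>n. 1 / ln (real n))" and R: "4 * c2 * (Lq * D1.K4 + D1.P1 * Lq * Dq) \<le> R"
  shows "eventually (\<lambda>n. \<forall>\<omega>. good n \<omega> \<longrightarrow> (\<forall>k\<in>V n. \<forall>j\<in>V n.
    2 * \<bar>Wc n \<omega> k j - netHinv (N n) k j\<bar> \<le> mu n \<omega> k j \<and> mu n \<omega> k j \<le> R * rate n)) sequentially"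
proof -
  note cp = D1.const_pos
  have k: "0 < kappa" by (rule D1.rayleigh(1))
  have P1: "1 \<le> D1.P1" by (rule D1.P1)
  have c2: "0 < c2" using C' by simp
  have r1l: "(\<lambda>n. r1 n * ln n) \<longlonglongrightarrow> 0" using smalloD_tendsto[OF r1] by simp
  have ln1: "eventually (\<lambda>n. 1 \<le> ln (real n)) sequentially"
    using filterlim_compose[OF ln_at_top filterlim_real_sequentially] by (simp add: filterlim_at_top)
  \<comment> \<open>\<open>ln n\<close> times the bound of \<open>sparse_row_rate\<close>, scaled as
    hypothesis \<open>d\<close> of \<open>part_b\<close> demands for \<open>g = 1 / ln n\<close>.
    Its three terms vanish because of \<open>r1 = o(1 / ln n)\<close>, of the rate times
    \<open>ln n\<close>, and of the sparsity condition.\<close>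
  define X where "X n = 12 * D1.P1 * Lq * (12 * (r1 n * ln n) + 4 * D1.Ke * c2 * D1.P1 * D1.K4 * (rate n * ln n)
      + 64 * kappa * Kq * c2 * (real (s n) * rate n * ln n))" for n
  have "X \<longlonglongrightarrow> 12 * D1.P1 * Lq * (12 * 0 + 4 * D1.Ke * c2 * D1.P1 * D1.K4 * 0 + 64 * kappa * Kq * c2 * 0)"
    unfolding X_def[abs_def] by (intro tendsto_intros limits r1l)
  then have X: "X \<longlonglongrightarrow> 0" by simp
  have v0: "0 < D1.v0 / (2 * D1.P1)" using cp P1 by simp
  have half: "0 < (1/2::real)" by simp
  show ?thesis
    using eventually_ge_at_top[of 3] limits(1) ln1 eventually_small[OF limits(3) half, of "D1.Ke * c2"]
      eventually_small[OF X v0, of 1] eventually_small[OF limits(4) half, of "32 * kappa * D1.K6"]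
  proof (eventually_elim, intro allI impI ballI)
    fix n \<omega> k j
    assume n3: "3 \<le> n" and cV: "2 \<le> card (V n)" and ln1: "1 \<le> ln (real n)"
      and e1: "D1.Ke * c2 * (rate n * ln n) \<le> 1/2" and e2: "1 * X n \<le> D1.v0 / (2 * D1.P1)"
      and e3: "32 * kappa * D1.K6 * (real (s n) * rate n) \<le> 1/2"
      and good: "good n \<omega>" and kj: "k \<in> V n" "j \<in> V n"
    interpret G: good_event n "V n" "p n \<omega>" "Psi_bar (N n)" D1.P1 D1.K4 D1.K5 "1/2" "rate n" "y n \<omega>"
      "\<lambda>t. red_eps (N n) t \<omega>" "netHinv (N n)" "red_v (N n)" "What n \<omega>" "vhat n \<omega>" "Psihat n \<omega>" "gram (N n)" D1.K6 kappa D1.b0 c2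
      "D1.Ke * pen n (V n)" D1.v0 by (rule good)
    have n1: "1 \<le> n" using n3 by simp
    have sp: "sparse_approx_on (V n) (s n) (r1 n) (netHinv (N n))" "1 \<le> s n"
      using reg n1 by (auto simp: regular_design_def)
    have pl: "0 < pen n (V n)" "pen n (V n) \<le> c2 * rate n" using pen_le[OF n3 cV] by auto
    have L: "G.L = Lq" and D: "G.D1 = Dq" and Ka: "G.Ka = Kq" by (simp_all add: Lq_def Dq_def Kq_def)
    have L0: "0 \<le> Lq" using G.L1 L by simp
    have K0: "0 \<le> Kq" unfolding Ka[symmetric] G.Ka_def using G.b0_nonneg P1 cp by simp
    have lnp: "0 < ln (real n)" using ln1 by simp
    have eta: "D1.Ke * pen n (V n) \<le> 1 / ln n / 2"
    proof -
      have "D1.Ke * pen n (V n) * ln n \<le> D1.Ke * (c2 * rate n) * ln n"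
        using pl cp(8) lnp by (intro mult_right_mono mult_left_mono) auto
      also have "\<dots> \<le> 1/2" using e1 by (simp add: mult_ac)
      finally show ?thesis using lnp by (simp add: field_simps)
    qed
    have sr: "32 * real (s n) * kappa * D1.K6 * rate n \<le> 1/2" using e3 by (simp add: mult_ac)
    have "12 * D1.P1 * Lq * l1 (V n) (G.D k) * ln n \<le> X n"
    proof -
      have "l1 (V n) (G.D k) \<le> 4 * (3 * r1 n + D1.Ke * pen n (V n) * (D1.P1 * D1.K4)) + 64 * kappa * Kq * s n * pen n (V n)"
        unfolding Ka[symmetric] by (rule G.sparse_row_rate[OF sp sr kj(1)])
      also have "\<dots> \<le> 4 * (3 * r1 n + D1.Ke * (c2 * rate n) * (D1.P1 * D1.K4)) + 64 * kappa * Kq * s n * (c2 * rate n)"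
        using pl cp P1 K0 k by (intro add_mono mult_left_mono mult_right_mono) auto
      finally have "12 * D1.P1 * Lq * ln n * l1 (V n) (G.D k)
          \<le> 12 * D1.P1 * Lq * ln n * (4 * (3 * r1 n + D1.Ke * (c2 * rate n) * (D1.P1 * D1.K4)) + 64 * kappa * Kq * s n * (c2 * rate n))"
        using P1 L0 lnp by (intro mult_left_mono) auto
      also have "\<dots> = X n" by (simp add: X_def algebra_simps)
      finally show ?thesis by (simp add: mult_ac)
    qed
    then have "12 * D1.P1 * Lq * l1 (V n) (G.D k) * ln n \<le> D1.v0 / (2 * D1.P1)" using e2 by simp
    then have "12 * D1.P1 * G.L * l1 (V n) (G.D k) \<le> (D1.v0 / (2 * D1.P1)) / ln n"
      unfolding L by (simp only: pos_le_divide_eq[OF lnp])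
    then have d: "12 * D1.P1 * G.L * l1 (V n) (G.D k) \<le> 1 / ln n * (D1.v0 / (2 * D1.P1))"
      by (simp only: times_divide_eq_left mult_1)
    show "2 * \<bar>Wc n \<omega> k j - netHinv (N n) k j\<bar> \<le> mu n \<omega> k j \<and> mu n \<omega> k j \<le> R * rate n"
      using G.threshold_bounds[OF kj ln1 eta d] R unfolding L D by blast
  qed
qed

lemma whp_threshold:
  assumes "r1 \<in> o(\<lambda>n. 1 / ln (real n))" and "4 * c2 * (Lq * D1.K4 + D1.P1 * Lq * Dq) \<le> R"
  shows "whp P (\<lambda>n \<omega>. \<forall>k\<in>V n. \<forall>j\<in>V n. R * rate n \<ge> mu n \<omega> k j \<and> mu n \<omega> k j \<ge> 2 * \<bar>Wc n \<omega> k j - netHinv (N n) k j\<bar>)"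
  by (rule whp_of_good) (use eventually_threshold[OF assms] in \<open>auto elim!: eventually_mono\<close>)

lemma whp_thresholded:
  assumes "r1 \<in> o(\<lambda>n. 1 / ln (real n))" and "4 * c2 * (Lq * D1.K4 + D1.P1 * Lq * Dq) \<le> R"
  shows "whp P (\<lambda>n \<omega>.
    (MAX (k, j)\<in>V n \<times> V n. \<bar>thresholded (mu n \<omega>) (Wc n \<omega>) k j - netHinv (N n) k j\<bar>) \<le> 2 * R * rate n \<and>
    norm_inf (V n) (\<lambda>k j. thresholded (mu n \<omega>) (Wc n \<omega>) k j - netHinv (N n) k j) \<le> real (s n) * (2 * R) * rate n + 3 * r1 n \<and>
    norm_one (V n) (\<lambda>k j. thresholded (mu n \<omega>) (Wc n \<omega>) k j - netHinv (N n) k j) \<le> real (s n) * (2 * R) * rate n + 3 * r1 n)"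
proof (rule whp_of_good)
  show "eventually (\<lambda>n. \<forall>\<omega>. good n \<omega> \<longrightarrow>
    (MAX (k, j)\<in>V n \<times> V n. \<bar>thresholded (mu n \<omega>) (Wc n \<omega>) k j - netHinv (N n) k j\<bar>) \<le> 2 * R * rate n \<and>
    norm_inf (V n) (\<lambda>k j. thresholded (mu n \<omega>) (Wc n \<omega>) k j - netHinv (N n) k j) \<le> real (s n) * (2 * R) * rate n + 3 * r1 n \<and>
    norm_one (V n) (\<lambda>k j. thresholded (mu n \<omega>) (Wc n \<omega>) k j - netHinv (N n) k j) \<le> real (s n) * (2 * R) * rate n + 3 * r1 n) sequentially"
    using eventually_threshold[OF assms] eventually_ge_at_top[of 1]
  proof (eventually_elim, intro allI impI)
    fix n \<omega>
    assume th: "\<forall>\<omega>. good n \<omega> \<longrightarrow> (\<forall>k\<in>V n. \<forall>j\<in>V n.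
      2 * \<bar>Wc n \<omega> k j - netHinv (N n) k j\<bar> \<le> mu n \<omega> k j \<and> mu n \<omega> k j \<le> R * rate n)" and n1: "1 \<le> n" and g: "good n \<omega>"
    interpret D: design "N n" n B abar lbar pbar c C kappa "Me n" "MP n" by (rule design[OF n1])
    have sp: "sparse_approx_on (V n) (s n) (r1 n) (netHinv (N n))"
      using reg n1 by (auto simp: regular_design_def)
    have "2 * \<bar>Wc n \<omega> k j - netHinv (N n) k j\<bar> \<le> mu n \<omega> k j \<and> mu n \<omega> k j \<le> R * rate n" if "k \<in> V n" "j \<in> V n" for k j
      using th g that by blast
    from thresholded_bounds[OF D.fin D.ne sp this]
    show "(MAX (k, j)\<in>V n \<times> V n. \<bar>thresholded (mu n \<omega>) (Wc n \<omega>) k j - netHinv (N n) k j\<bar>) \<le> 2 * R * rate n \<and>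
      norm_inf (V n) (\<lambda>k j. thresholded (mu n \<omega>) (Wc n \<omega>) k j - netHinv (N n) k j) \<le> real (s n) * (2 * R) * rate n + 3 * r1 n \<and>
      norm_one (V n) (\<lambda>k j. thresholded (mu n \<omega>) (Wc n \<omega>) k j - netHinv (N n) k j) \<le> real (s n) * (2 * R) * rate n + 3 * r1 n"
      by (simp only: mult.assoc)
  qed
qed

end

theorem theorem2:
  fixes B abar lbar pbar c C C' kappa :: real
  assumes "0 < c" and "c < C" and "0 < C'"
  shows "\<exists>C1>0. \<exists>C2>0. \<exists>C3>0.
    \<forall>(N :: nat \<Rightarrow> ('a, 'w) network) (s :: nat \<Rightarrow> nat) (r1 :: nat \<Rightarrow> real)
      (Meps :: nat \<Rightarrow> real) (MPsi :: nat \<Rightarrow> real)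
      (What :: nat \<Rightarrow> 'w \<Rightarrow> 'a \<Rightarrow> 'a \<Rightarrow> real) (vhat :: nat \<Rightarrow> 'w \<Rightarrow> 'a \<Rightarrow> real)
      (Psihat :: nat \<Rightarrow> 'w \<Rightarrow> 'a option \<Rightarrow> 'a option \<Rightarrow> real).
    regular_design B abar lbar pbar c C C' kappa N s r1 Meps MPsi \<longrightarrow>
    (\<forall>n\<ge>1. \<forall>\<omega>\<in>space (sample (N n)).
       step1_estimator n (obs (N n)) (\<lambda>t. cov (N n) t \<omega>) (\<lambda>t. outcome (N n) t \<omega>)
         (What n \<omega>) (vhat n \<omega>) \<and>
       step2_estimator n (obs (N n)) (\<lambda>t. cov (N n) t \<omega>) (Psihat n \<omega>)) \<longrightarrow>
    (let V = (\<lambda>n. obs (N n));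
         P = (\<lambda>n. sample (N n));
         Hinv = (\<lambda>n. netHinv (N n));
         rate = (\<lambda>n. sqrt (ln (card (V n)) / real n));
         Wc = (\<lambda>n \<omega>. debiased_W n (V n) (\<lambda>t. cov (N n) t \<omega>) (\<lambda>t. outcome (N n) t \<omega>)
                 (What n \<omega>) (vhat n \<omega>) (Psihat n \<omega>));
         vc = (\<lambda>n \<omega>. debiased_v n (V n) (\<lambda>t. cov (N n) t \<omega>) (\<lambda>t. outcome (N n) t \<omega>)
                 (What n \<omega>) (vhat n \<omega>) (Psihat n \<omega>));
         mu = (\<lambda>n \<omega>. threshold_level n (V n) (\<lambda>t. cov (N n) t \<omega>) (\<lambda>t. outcome (N n) t \<omega>)
                 (What n \<omega>) (vhat n \<omega>) (Psihat n \<omega>));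
         Wmu = (\<lambda>n \<omega>. thresholded (mu n \<omega>) (Wc n \<omega>))
     in
       whp P (\<lambda>n \<omega>.
         (MAX (k, j)\<in>V n \<times> V n. \<bar>Wc n \<omega> k j - Hinv n k j\<bar>) \<le> C1 * rate n \<and>
         (MAX k\<in>V n. \<bar>vc n \<omega> k - red_v (N n) k\<bar>) \<le> C1 * rate n)
       \<and>
       (r1 \<in> o(\<lambda>n. 1 / ln (real n)) \<longrightarrow>
         whp P (\<lambda>n \<omega>. \<forall>k\<in>V n. \<forall>j\<in>V n.
           C2 * rate n \<ge> mu n \<omega> k j \<and> mu n \<omega> k j \<ge> 2 * \<bar>Wc n \<omega> k j - Hinv n k j\<bar>)
         \<and>
         whp P (\<lambda>n \<omega>.
           (MAX (k, j)\<in>V n \<times> V n. \<bar>Wmu n \<omega> k j - Hinv n k j\<bar>) \<le> C3 * rate n \<and>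
           norm_inf (V n) (\<lambda>k j. Wmu n \<omega> k j - Hinv n k j) \<le> real (s n) * C3 * rate n + 3 * r1 n \<and>
           norm_one (V n) (\<lambda>k j. Wmu n \<omega> k j - Hinv n k j) \<le> real (s n) * C3 * rate n + 3 * r1 n)))"
proof -
  \<comment> \<open>The final constants must precede the quantification over networks, so the locale
    constants are written here with explicit parameters and identified with those of the
    interpretation later. The absolute value and the added 1 in \<open>C1\<close> and
    \<open>C2\<close> secure positivity.\<close>
  define P1 K4 K5 b0 c2 where "P1 = design.P1 pbar" and "K4 = design.K4 C" and "K5 = design.K5 C"
    and "b0 = design.b0 B abar pbar" and "c2 = sqrt (2 * (C' + 4))"
  define L D where "L = good_cov.L K4 K5 (1/2)" and "D = good_event.D1 P1 K4 b0"
  define C1 C2 where "C1 = \<bar>c2 * (L * D + 2 * L * K4)\<bar> + 1" and "C2 = \<bar>4 * c2 * (L * K4 + P1 * L * D)\<bar> + 1"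
  have pos: "0 < C1" "0 < C2" "0 < 2 * C2" by (auto simp: C1_def C2_def intro: add_nonneg_pos)
  show ?thesis
  \<comment> \<open>The third constant is twice the second: thresholding moves an entry by at most
    one threshold, so the error stays below twice the threshold.\<close>
  proof (rule exI[of _ C1], intro conjI pos(1), rule exI[of _ C2], intro conjI pos(2), rule exI[of _ "2 * C2"], intro conjI pos(3) allI impI)
    fix N :: "nat \<Rightarrow> ('a, 'w) network" and s :: "nat \<Rightarrow> nat" and r1 Meps MPsi :: "nat \<Rightarrow> real"
      and What :: "nat \<Rightarrow> 'w \<Rightarrow> 'a \<Rightarrow> 'a \<Rightarrow> real" and vhat :: "nat \<Rightarrow> 'w \<Rightarrow> 'a \<Rightarrow> real"
      and Psihat :: "nat \<Rightarrow> 'w \<Rightarrow> 'a option \<Rightarrow> 'a option \<Rightarrow> real"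
    assume reg: "regular_design B abar lbar pbar c C C' kappa N s r1 Meps MPsi"
      and est: "\<forall>n\<ge>1. \<forall>\<omega>\<in>space (sample (N n)).
         step1_estimator n (obs (N n)) (\<lambda>t. cov (N n) t \<omega>) (\<lambda>t. outcome (N n) t \<omega>) (What n \<omega>) (vhat n \<omega>) \<and>
         step2_estimator n (obs (N n)) (\<lambda>t. cov (N n) t \<omega>) (Psihat n \<omega>)"
    interpret S: design_sequence B abar lbar pbar c C C' kappa N s r1 Meps MPsi What vhat Psihat
      by unfold_locales (use assms reg est in auto)
    have L: "L = S.Lq" and D: "D = S.Dq"
      by (simp_all add: L_def D_def S.Lq_def S.Dq_def P1_def K4_def K5_def b0_def)
    have R1: "c2 * (S.Lq * S.Dq + 2 * S.Lq * S.D1.K4) \<le> C1"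
      unfolding C1_def L D K4_def by simp
    have R2: "4 * c2 * (S.Lq * S.D1.K4 + S.D1.P1 * S.Lq * S.Dq) \<le> C2"
      unfolding C2_def L D K4_def P1_def by simp
    note a = S.whp_debiased[OF R1[unfolded c2_def]]
      and b = S.whp_threshold[OF _ R2[unfolded c2_def]] and c = S.whp_thresholded[OF _ R2[unfolded c2_def]]
    show "(let V = (\<lambda>n. obs (N n));
         P = (\<lambda>n. sample (N n));
         Hinv = (\<lambda>n. netHinv (N n));
         rate = (\<lambda>n. sqrt (ln (card (V n)) / real n));
         Wc = (\<lambda>n \<omega>. debiased_W n (V n) (\<lambda>t. cov (N n) t \<omega>) (\<lambda>t. outcome (N n) t \<omega>)
                 (What n \<omega>) (vhat n \<omega>) (Psihat n \<omega>));
         vc = (\<lambda>n \<omega>. debiased_v n (V n) (\<lambda>t. cov (N n) t \<omega>) (\<lambda>t. outcome (N n) t \<omega>)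
                 (What n \<omega>) (vhat n \<omega>) (Psihat n \<omega>));
         mu = (\<lambda>n \<omega>. threshold_level n (V n) (\<lambda>t. cov (N n) t \<omega>) (\<lambda>t. outcome (N n) t \<omega>)
                 (What n \<omega>) (vhat n \<omega>) (Psihat n \<omega>));
         Wmu = (\<lambda>n \<omega>. thresholded (mu n \<omega>) (Wc n \<omega>))
     in
       whp P (\<lambda>n \<omega>.
         (MAX (k, j)\<in>V n \<times> V n. \<bar>Wc n \<omega> k j - Hinv n k j\<bar>) \<le> C1 * rate n \<and>
         (MAX k\<in>V n. \<bar>vc n \<omega> k - red_v (N n) k\<bar>) \<le> C1 * rate n)
       \<and>
       (r1 \<in> o(\<lambda>n. 1 / ln (real n)) \<longrightarrow>
         whp P (\<lambda>n \<omega>. \<forall>k\<in>V n. \<forall>j\<in>V n.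
           C2 * rate n \<ge> mu n \<omega> k j \<and> mu n \<omega> k j \<ge> 2 * \<bar>Wc n \<omega> k j - Hinv n k j\<bar>)
         \<and>
         whp P (\<lambda>n \<omega>.
           (MAX (k, j)\<in>V n \<times> V n. \<bar>Wmu n \<omega> k j - Hinv n k j\<bar>) \<le> 2 * C2 * rate n \<and>
           norm_inf (V n) (\<lambda>k j. Wmu n \<omega> k j - Hinv n k j) \<le> real (s n) * (2 * C2) * rate n + 3 * r1 n \<and>
           norm_one (V n) (\<lambda>k j. Wmu n \<omega> k j - Hinv n k j) \<le> real (s n) * (2 * C2) * rate n + 3 * r1 n)))"
      unfolding Let_def by (intro conjI impI a b c)
  qed
qed

end
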